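(* Let $n=2m$ be an even positive integer and let $1\le k\le m$ be such that either $k=m$ or $k$ is odd. The morphism of algebraic varieties $\pi_m\colon Y_m\to Y_{m-1}$, $(F_1,\dots,F_m)\mapsto(F_1,\dots,F_{m-1})$, restricts to a homeomorphism (even an isomorphism of algebraic varieties) $$\mathcal Fl^{n-k,k}_{D,\mathrm{odd}}\xrightarrow{\ \cong\ }\mathcal Fl^{n-k-1,k-1}_C,$$ i.e. $\mathcal Fl^{n-k-1,k-1}_C\subseteq Y_{m-1}$ is isomorphic to one of the two (isomorphic) connected components of $\mathcal Fl^{n-k,k}_D\subseteq Y_m$. In particular, there is a homeomorphism $\mathcal S^{n-k,k}_{D,\mathrm{odd}}\cong\mathcal Fl^{n-k-1,k-1}_C$.
   Context: Cup diagrams: take a rectangle in the plane with $m$ vertices labelled $1,\dots,m$ from left to right on its upper horizontal edge. A cup diagram is a non-intersecting diagram inside the rectangle obtained by attaching lower semicircles (cups), each joining two vertices, and vertical line segments (rays), each joining a vertex to the lower horizontal edge, so that every vertex is joined to exactly one endpoint of a cup or ray. In addition, any cup or ray which can be connected to the right edge of the rectangle by a path inside the rectangle not intersecting any other part of the diagram may (but need not) be decorated with a single dot. Diagrams are equal if their cups and rays are incident with the same vertices and the dots are distributed in the same way. $\mathbb B^{n-k,k}$ is the set of cup diagrams on $m$ vertices with exactly $\lfloor k/2\rfloor$ cups, and $\mathbb B^{n-k,k}_{\mathrm{odd}}$ the subset of those with an odd number of dots. Topological model: let $\mathbb S^2\subseteq\mathbb R^3$ be the unit sphere, $p=(0,0,1)$,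 $q=(1,0,0)$. For $a\in\mathbb B^{n-k,k}$, $S_a\subseteq(\mathbb S^2)^m$ is the set of all $(x_1,\dots,x_m)$ with $x_i=-x_j$ (resp. $x_i=x_j$) if $i,j$ are connected by an undotted (resp. dotted) cup, $x_i=p$ if $i$ is connected to a dotted ray, $x_i=-p$ if $i$ is connected to an undotted ray which is the rightmost ray of $a$, and $x_i=q$ if $i$ is connected to an undotted ray which is not the rightmost. Set $\mathcal S^{n-k,k}_{D,\mathrm{odd}}=\bigcup_{a\in\mathbb B^{n-k,k}_{\mathrm{odd}}}S_a$. The variety $Y_m$: let $N$ be a large integer ($N\ge n$ suffices), $\mathbb C^{2N}$ the hermitian space with orthonormal basis $e_1,\dots,e_N,f_1,\dots,f_N$, and $z$ the nilpotent endomorphism with $ze_i=e_{i-1}$, $zf_i=f_{i-1}$ for $i\ge2$ and $ze_1=zf_1=0$. $Y_m$ is the smooth projective variety of all $(F_1,\dots,F_m)$ with $F_1\subseteq\dots\subseteq F_m\subseteq\mathbb C^{2N}$, $\dim F_i=i$, $zF_i\subseteq F_{i-1}$ (where $F_0=0$). Let $e,f$ be the standard basis of $\mathbb C^2$ and $C\colon\mathbb C^{2N}\to\mathbb C^2$ the linear map with $C(e_i)=e$, $C(f_i)=f$. The map $\phi_m\colon Y_m\to(\mathbb P^1)^m$, $(F_1,\dots,F_m)\mapsto(C(F_1),C(F_2\cap F_1^\perp),\dots,C(F_m\cap F_{m-1}^\perp))$ ($\perp$ with respect to the hermitian form, $\mathbb P^1$ the space of lines in $\mathbb C^2$) is a diffeomorphism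 (known result of Cautis–Kamnitzer). Forms: $E_{r,s}=\mathrm{span}(e_1,\dots,e_r,f_1,\dots,f_s)$. The symmetric form $\beta^{n-k,k}_D$ on $E_{n-k,k}$ is: if $k=m$, $\beta(e_{j'},f_j)=\beta(f_j,e_{j'})=(-1)^{j-1}\delta_{j+j',k+1}$ and $\beta(e_j,e_{j'})=\beta(f_j,f_{j'})=0$; if $k<m$, $\beta(e_i,f_j)=\beta(f_j,e_i)=0$, $\beta(e_i,e_{i'})=(-1)^{i-1}\delta_{i+i',n-k+1}$, $\beta(f_j,f_{j'})=(-1)^j\delta_{j+j',k+1}$. The symplectic form $\beta^{n-k-1,k-1}_C$ on $E_{n-k-1,k-1}$ is: if $k=m$, $-\beta(e_{j'},f_j)=\beta(f_j,e_{j'})=(-1)^{j-1}\delta_{j+j',k}$ and $\beta(e_j,e_{j'})=\beta(f_j,f_{j'})=0$; if $k<m$, $\beta(e_i,f_j)=\beta(f_j,e_i)=0$, $\beta(e_i,e_{i'})=(-1)^{i-1}\delta_{i+i',n-k}$, $\beta(f_j,f_{j'})=(-1)^{j}\delta_{j+j',k}$. Embedded Springer fibers: $\mathcal Fl^{n-k,k}_D\subseteq Y_m$ consists of all $(F_1,\dots,F_m)\in Y_m$ with $F_m\subseteq E_{n-k,k}$ isotropic for $\beta_D^{n-k,k}$; $\mathcal Fl^{n-k-1,k-1}_C\subseteq Y_{m-1}$ consists of all $(F_1,\dots,F_{m-1})\in Y_{m-1}$ with $F_{m-1}\subseteq E_{n-k-1,k-1}$ isotropic for $\beta_C^{n-k-1,k-1}$.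 The sets $T_a$: for $a\in\mathbb B^{n-k,k}$, $T_a\subset(\mathbb P^1)^m$ is the set of $(l_1,\dots,l_m)$ with $l_j=l_i^\perp$ if $i,j$ are connected by an undotted cup, $l_i=l_j$ if $i,j$ are connected by a dotted cup, and the following ray conditions. If $k=m$: $l_i=\mathrm{span}(f)$ (resp. $\mathrm{span}(e)$) if $i$ is connected to an undotted (resp. dotted) ray. If $k<m$: $l_i=\mathrm{span}(e)$ if $i$ is connected to a ray that is not the rightmost ray, and for the vertex $\rho$ connected to the rightmost ray, $l_\rho=\mathrm{span}(e+(-1)^\epsilon f)$ if $m-k$ is even and $l_\rho=\mathrm{span}(\mathbf i e+(-1)^\epsilon f)$ if $m-k$ is odd, where $\mathbf i=\sqrt{-1}$, $\epsilon=0$ if the rightmost ray is dotted and $\epsilon=1$ if it is undotted. Finally $\mathcal Fl^{n-k,k}_{D,\mathrm{odd}}:=\bigcup_{a\in\mathbb B^{n-k,k}_{\mathrm{odd}}}\phi_m^{-1}(T_a)$, which is a connected component of $\mathcal Fl^{n-k,k}_D$. Homeomorphisms refer to the classical (Euclidean) topology. *)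

theory Defs
  imports "HOL-Analysis.Analysis"
begin

section \<open>Cup diagrams\<close>

text \<open>A diagram on the vertices \<open>1, \<dots>, m\<close> is a pair \<open>(A, D)\<close>: its set of arcs (cups and rays)
  and the subset of those carrying a dot. Vertex \<open>i\<close> is drawn at the point \<open>(i, 0)\<close> on the upper edge
  of the rectangle \<open>[0, m + 1] \<times> [-m, 0]\<close>, which is deep enough to contain every semicircle.\<close>

datatype arc = Cup nat nat | Ray nat

type_synonym diagram = "arc set \<times> arc set"

fun ends :: "arc \<Rightarrow> nat set" where
  "ends (Cup i j) = {i, j}"
| "ends (Ray i) = {i}"

fun wf_arc :: "nat \<Rightarrow> arc \<Rightarrow> bool" where
  "wf_arc m (Cup i j) \<longleftrightarrow> 1 \<le> i \<and> i < j \<and> j \<le> m"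
| "wf_arc m (Ray i) \<longleftrightarrow> 1 \<le> i \<and> i \<le> m"

definition rectangle :: "nat \<Rightarrow> (real \<times> real) set" where
  "rectangle m = {0..real m + 1} \<times> {- real m..0}"

definition right_edge :: "nat \<Rightarrow> (real \<times> real) set" where
  "right_edge m = {real m + 1} \<times> {- real m..0}"

fun drawing :: "nat \<Rightarrow> arc \<Rightarrow> (real \<times> real) set" where
  "drawing m (Cup i j) =
     {(x, y). y \<le> 0 \<and> (x - (real i + real j) / 2)\<^sup>2 + y\<^sup>2 = ((real j - real i) / 2)\<^sup>2}"
| "drawing m (Ray i) = {real i} \<times> {- real m..0}"

definition accessible :: "nat \<Rightarrow> arc set \<Rightarrow> arc \<Rightarrow> bool" where
  "accessible m A a \<longleftrightarrow>
     (\<exists>g. path g \<and> path_image g \<subseteq> rectangle m \<and> pathstart g \<in> drawing m a \<and>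
          pathfinish g \<in> right_edge m \<and> (\<forall>b\<in>A - {a}. path_image g \<inter> drawing m b = {}))"

definition cup_diagram :: "nat \<Rightarrow> diagram \<Rightarrow> bool" where
  "cup_diagram m = (\<lambda>(A, D).
     (\<forall>a\<in>A. wf_arc m a) \<and>
     (\<forall>v\<in>{1..m}. \<exists>!a. a \<in> A \<and> v \<in> ends a) \<and>
     (\<forall>a\<in>A. \<forall>b\<in>A. a \<noteq> b \<longrightarrow> drawing m a \<inter> drawing m b = {}) \<and>
     D \<subseteq> A \<and> (\<forall>a\<in>D. accessible m A a))"

text \<open>Throughout, \<open>n = 2 * m\<close>: the diagrams, forms and flag varieties indexed by \<open>m\<close> and \<open>k\<close> below
  are those usually indexed by \<open>n - k, k\<close> (type D) and \<open>n - k - 1, k - 1\<close> (type C).\<close>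

definition cup_diagrams :: "nat \<Rightarrow> nat \<Rightarrow> diagram set" where
  "cup_diagrams m k =
     {(A, D). cup_diagram m (A, D) \<and> card {a \<in> A. \<exists>i j. a = Cup i j} = k div 2}"

definition cup_diagrams_odd :: "nat \<Rightarrow> nat \<Rightarrow> diagram set" where
  "cup_diagrams_odd m k = {(A, D). (A, D) \<in> cup_diagrams m k \<and> odd (card D)}"

definition rightmost_ray :: "arc set \<Rightarrow> nat \<Rightarrow> bool" where
  "rightmost_ray A i \<longleftrightarrow> Ray i \<in> A \<and> (\<forall>i'. Ray i' \<in> A \<longrightarrow> i' \<le> i)"

section \<open>The topological model\<close>

definition p_pt :: "real ^ 3" where "p_pt = vector [0, 0, 1]"

definition q_pt :: "real ^ 3" where "q_pt = vector [1, 0, 0]"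

definition S_cup :: "nat \<Rightarrow> diagram \<Rightarrow> (nat \<Rightarrow> real ^ 3) set" where
  "S_cup m = (\<lambda>(A, D).
     {x \<in> {1..m} \<rightarrow>\<^sub>E sphere 0 1.
        (\<forall>i j. Cup i j \<in> A \<longrightarrow> x i = (if Cup i j \<in> D then x j else - x j)) \<and>
        (\<forall>i. Ray i \<in> A \<longrightarrow> x i =
           (if Ray i \<in> D then p_pt else if rightmost_ray A i then - p_pt else q_pt))})"

definition S_D_odd :: "nat \<Rightarrow> nat \<Rightarrow> (nat \<Rightarrow> real ^ 3) set" where
  "S_D_odd m k = (\<Union>a\<in>cup_diagrams_odd m k. S_cup m a)"

definition S_topology :: "nat \<Rightarrow> (nat \<Rightarrow> real ^ 3) topology" where
  "S_topology m = product_topology (\<lambda>_. top_of_set (sphere 0 1)) {1..m}"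

section \<open>The hermitian space and the variety \<open>Y\<close>\<close>

text \<open>With \<open>N = CARD('d)\<close>, the space \<open>complex ^ ('d + 'd)\<close> is the hermitian space of dimension
  \<open>2 * N\<close>; \<open>idx\<close> enumerates \<open>'d\<close> by \<open>1, \<dots>, N\<close>, the coordinates at \<open>Inl\<close> belong to the \<open>e\<close>'s and
  those at \<open>Inr\<close> to the \<open>f\<close>'s. A vector-space notion prefixed with \<open>vec\<close> is over the complex numbers.\<close>

definition idx :: "nat \<Rightarrow> 'd::finite" where
  "idx i = from_nat_into UNIV (i - 1)"

definition e_vec :: "nat \<Rightarrow> complex ^ ('d::finite + 'd)" where
  "e_vec i = axis (Inl (idx i)) 1"

definition f_vec :: "nat \<Rightarrow> complex ^ ('d::finite + 'd)" where
  "f_vec i = axis (Inr (idx i)) 1"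

definition nilp :: "complex ^ ('d::finite + 'd) \<Rightarrow> complex ^ ('d + 'd)" where
  "nilp v = (\<Sum>i=2..CARD('d). v $ Inl (idx i) *s e_vec (i - 1) + v $ Inr (idx i) *s f_vec (i - 1))"

definition herm :: "complex ^ 'b::finite \<Rightarrow> complex ^ 'b \<Rightarrow> complex" where
  "herm v w = (\<Sum>i\<in>UNIV. v $ i * cnj (w $ i))"

definition herm_comp :: "(complex ^ 'b::finite) set \<Rightarrow> (complex ^ 'b) set" where
  "herm_comp F = {v. \<forall>w\<in>F. herm v w = 0}"

type_synonym 'b flag = "nat \<Rightarrow> (complex ^ 'b) set"

definition flag_at :: "'b::finite flag \<Rightarrow> nat \<Rightarrow> (complex ^ 'b) set" where
  "flag_at F i = (if i = 0 then {0} else F i)"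

definition Y :: "nat \<Rightarrow> ('d::finite + 'd) flag set" where
  "Y m = {F \<in> extensional {1..m}. \<forall>i\<in>{1..m}.
            vec.subspace (F i) \<and> vec.dim (F i) = i \<and> flag_at F (i - 1) \<subseteq> F i \<and>
            nilp ` F i \<subseteq> flag_at F (i - 1)}"

definition flag_proj :: "nat \<Rightarrow> 'b::finite flag \<Rightarrow> 'b flag" where
  "flag_proj m F = restrict F {1..m - 1}"

text \<open>The classical topology on the disjoint union of the Grassmannians: a subspace is identified
  with the orthogonal projection onto it (the map to the closest point), and for linear maps on a
  finite-dimensional space the topology of pointwise convergence is the Euclidean one.\<close>

definition subspace_topology :: "(complex ^ 'b::finite) set topology" where
  "subspace_topology = pullback_topology {F. vec.subspace F} closest_point euclidean"

definition flag_topology :: "nat \<Rightarrow> 'b::finite flag topology" where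
  "flag_topology m = product_topology (\<lambda>_. subspace_topology) {1..m}"

section \<open>Morphisms between subvarieties of flag varieties\<close>

text \<open>Frames are the homogeneous coordinates of flags: the variety of flags is the quotient of the
  variety of frames (a Zariski open subset of an affine space) by the group of invertible upper
  triangular matrices, and the quotient map is a Zariski locally trivial principal bundle. Hence a
  map between subvarieties of flag varieties is a morphism iff, locally in the Zariski topology, it
  is given by polynomials in these coordinates. Denominators are not needed, since rescaling the
  members of a frame does not change the flag. The Zariski neighbourhood is given by \<open>Q \<noteq> 0\<close>; that
  \<open>P\<close> descends from frames to flags is part of the requirement on all \<open>y\<close> and \<open>w\<close>.\<close>

definition is_frame :: "nat \<Rightarrow> 'b::finite flag \<Rightarrow> (nat \<Rightarrow> complex ^ 'b) \<Rightarrow> bool" where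
  "is_frame m F w \<longleftrightarrow> (\<forall>i\<in>{1..m}. F i = vec.span (w ` {1..i}))"

inductive polynomial_fun :: "nat \<Rightarrow> ((nat \<Rightarrow> complex ^ 'b::finite) \<Rightarrow> complex) \<Rightarrow> bool" for m where
  const: "polynomial_fun m (\<lambda>_. c)"
| coord: "i \<in> {1..m} \<Longrightarrow> polynomial_fun m (\<lambda>w. w i $ b)"
| add: "polynomial_fun m P \<Longrightarrow> polynomial_fun m Q \<Longrightarrow> polynomial_fun m (\<lambda>w. P w + Q w)"
| mult: "polynomial_fun m P \<Longrightarrow> polynomial_fun m Q \<Longrightarrow> polynomial_fun m (\<lambda>w. P w * Q w)"

definition variety_morphism ::
  "nat \<Rightarrow> 'b::finite flag set \<Rightarrow> nat \<Rightarrow> 'c::finite flag set \<Rightarrow> ('b flag \<Rightarrow> 'c flag) \<Rightarrow> bool" where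
  "variety_morphism m X m' X' \<phi> \<longleftrightarrow> \<phi> ` X \<subseteq> X' \<and>
     (\<forall>x\<in>X. \<exists>Q P. polynomial_fun m Q \<and>
        (\<forall>i\<in>{1..m'}. \<forall>c. polynomial_fun m (\<lambda>w. P w i $ c)) \<and>
        (\<exists>w. is_frame m x w \<and> Q w \<noteq> 0) \<and>
        (\<forall>y\<in>X. \<forall>w. is_frame m y w \<and> Q w \<noteq> 0 \<longrightarrow> is_frame m' (\<phi> y) (P w)))"

definition variety_isomorphism ::
  "nat \<Rightarrow> 'b::finite flag set \<Rightarrow> nat \<Rightarrow> 'c::finite flag set \<Rightarrow> ('b flag \<Rightarrow> 'c flag) \<Rightarrow> bool" where
  "variety_isomorphism m X m' X' \<phi> \<longleftrightarrow> bij_betw \<phi> X X' \<and>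
     variety_morphism m X m' X' \<phi> \<and> variety_morphism m' X' m X (the_inv_into X \<phi>)"

section \<open>Bilinear forms and embedded Springer fibers\<close>

definition E_space :: "nat \<Rightarrow> nat \<Rightarrow> (complex ^ ('d::finite + 'd)) set" where
  "E_space r s = vec.span (e_vec ` {1..r} \<union> f_vec ` {1..s})"

text \<open>\<open>Inl i\<close> and \<open>Inr j\<close> of type \<open>nat + nat\<close> label the basis vectors \<open>e_vec i\<close> and \<open>f_vec j\<close>;
  \<open>bilin r s G\<close> is the bilinear form on \<open>E_space r s\<close> with Gram matrix \<open>G\<close>.\<close>

definition coordinate :: "complex ^ ('d::finite + 'd) \<Rightarrow> nat + nat \<Rightarrow> complex" where
  "coordinate v a = v $ map_sum idx idx a"

definition bilin :: "nat \<Rightarrow> nat \<Rightarrow> (nat + nat \<Rightarrow> nat + nat \<Rightarrow> complex) \<Rightarrow>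
    complex ^ ('d::finite + 'd) \<Rightarrow> complex ^ ('d + 'd) \<Rightarrow> complex" where
  "bilin r s G v w =
     (\<Sum>a\<in>{1..r} <+> {1..s}. \<Sum>b\<in>{1..r} <+> {1..s}. coordinate v a * coordinate w b * G a b)"

fun gram_D :: "nat \<Rightarrow> nat \<Rightarrow> nat + nat \<Rightarrow> nat + nat \<Rightarrow> complex" where
  "gram_D m k (Inl i) (Inl i') =
     (if k < m \<and> i + i' = 2 * m - k + 1 then (- 1) ^ (i - 1) else 0)"
| "gram_D m k (Inr j) (Inr j') =
     (if k < m \<and> j + j' = k + 1 then (- 1) ^ j else 0)"
| "gram_D m k (Inl j') (Inr j) =
     (if k = m \<and> j + j' = k + 1 then (- 1) ^ (j - 1) else 0)"
| "gram_D m k (Inr j) (Inl j') =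
     (if k = m \<and> j + j' = k + 1 then (- 1) ^ (j - 1) else 0)"

fun gram_C :: "nat \<Rightarrow> nat \<Rightarrow> nat + nat \<Rightarrow> nat + nat \<Rightarrow> complex" where
  "gram_C m k (Inl i) (Inl i') =
     (if k < m \<and> i + i' = 2 * m - k then (- 1) ^ (i - 1) else 0)"
| "gram_C m k (Inr j) (Inr j') =
     (if k < m \<and> j + j' = k then (- 1) ^ j else 0)"
| "gram_C m k (Inl j') (Inr j) =
     (if k = m \<and> j + j' = k then - ((- 1) ^ (j - 1)) else 0)"
| "gram_C m k (Inr j) (Inl j') =
     (if k = m \<and> j + j' = k then (- 1) ^ (j - 1) else 0)"

definition beta_D :: "nat \<Rightarrow> nat \<Rightarrow> complex ^ ('d::finite + 'd) \<Rightarrow> complex ^ ('d + 'd) \<Rightarrow> complex" where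
  "beta_D m k = bilin (2 * m - k) k (gram_D m k)"

definition beta_C :: "nat \<Rightarrow> nat \<Rightarrow> complex ^ ('d::finite + 'd) \<Rightarrow> complex ^ ('d + 'd) \<Rightarrow> complex" where
  "beta_C m k = bilin (2 * m - k - 1) (k - 1) (gram_C m k)"

definition isotropic :: "('v \<Rightarrow> 'v \<Rightarrow> complex) \<Rightarrow> 'v set \<Rightarrow> bool" where
  "isotropic \<beta> F \<longleftrightarrow> (\<forall>v\<in>F. \<forall>w\<in>F. \<beta> v w = 0)"

definition Fl_D :: "nat \<Rightarrow> nat \<Rightarrow> ('d::finite + 'd) flag set" where
  "Fl_D m k = {F \<in> Y m. flag_at F m \<subseteq> E_space (2 * m - k) k \<and> isotropic (beta_D m k) (flag_at F m)}"

definition Fl_C :: "nat \<Rightarrow> nat \<Rightarrow> ('d::finite + 'd) flag set" where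
  "Fl_C m k = {F \<in> Y (m - 1). flag_at F (m - 1) \<subseteq> E_space (2 * m - k - 1) (k - 1) \<and>
                 isotropic (beta_C m k) (flag_at F (m - 1))}"

section \<open>The odd part of the Springer fiber of type D\<close>

definition e2 :: "complex ^ 2" where "e2 = axis 1 1"

definition f2 :: "complex ^ 2" where "f2 = axis 2 1"

definition P1 :: "(complex ^ 2) set set" where
  "P1 = {l. vec.subspace l \<and> vec.dim l = 1}"

definition C_map :: "complex ^ ('d::finite + 'd) \<Rightarrow> complex ^ 2" where
  "C_map v = (\<Sum>i=1..CARD('d). v $ Inl (idx i) *s e2 + v $ Inr (idx i) *s f2)"

definition phi :: "nat \<Rightarrow> ('d::finite + 'd) flag \<Rightarrow> nat \<Rightarrow> (complex ^ 2) set" where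
  "phi m F = (\<lambda>i\<in>{1..m}. C_map ` (F i \<inter> herm_comp (flag_at F (i - 1))))"

definition ray_line :: "nat \<Rightarrow> nat \<Rightarrow> diagram \<Rightarrow> nat \<Rightarrow> (complex ^ 2) set" where
  "ray_line m k = (\<lambda>(A, D) i.
     if k = m then vec.span {if Ray i \<in> D then e2 else f2}
     else if rightmost_ray A i then
       (let \<epsilon> = (if Ray i \<in> D then 0 else 1) :: nat
        in vec.span {(if even (m - k) then 1 else \<i>) *s e2 + (- 1) ^ \<epsilon> *s f2})
     else vec.span {e2})"

definition T_cup :: "nat \<Rightarrow> nat \<Rightarrow> diagram \<Rightarrow> (nat \<Rightarrow> (complex ^ 2) set) set" where
  "T_cup m k = (\<lambda>(A, D).
     {l \<in> {1..m} \<rightarrow>\<^sub>E P1.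
        (\<forall>i j. Cup i j \<in> A \<longrightarrow> l j = (if Cup i j \<in> D then l i else herm_comp (l i))) \<and>
        (\<forall>i. Ray i \<in> A \<longrightarrow> l i = ray_line m k (A, D) i)})"

definition Fl_D_odd :: "nat \<Rightarrow> nat \<Rightarrow> ('d::finite + 'd) flag set" where
  "Fl_D_odd m k = (\<Union>a\<in>cup_diagrams_odd m k. {F \<in> Y m. phi m F \<in> T_cup m k a})"

end

theory Submission
  imports Defs
begin

text \<open>The lines \<open>C (F\<^sub>i \<inter> F\<^sub>i\<^sub>-\<^sub>1\<^sup>\<bottom>)\<close>, read as points of the sphere with antipodal points for orthogonal lines,
  identify \<open>Y m\<close> with a product of spheres. If two consecutive lines \<open>i, i + 1\<close> are orthogonal, then
  \<open>F\<^sub>i\<^sub>+\<^sub>1\<close> is the preimage of \<open>F\<^sub>i\<^sub>-\<^sub>1\<close> under the nilpotent map, and deleting the pair leads from the type D fiber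
  for \<open>(m, k)\<close> to the one for \<open>(m - 2, k - 2)\<close>. For \<open>k \<ge> 2\<close> an isotropic flag has such a pair, possibly only after
  replacing the last line by its orthogonal complement, which preserves isotropy. The products of
  spheres \<open>S\<^sub>a\<close> satisfy the same recursion: an undotted cup joining neighbours can be removed, and replacing
  the last coordinate by its antipode exchanges the two parities of the number of dots. So the fiber is
  the disjoint union of an odd and an even part, and the same recursion shows that both are connected.

  A flag in the type C fiber has exactly two isotropic extensions \<open>F\<^sub>m\<close>, given by the two isotropic lines
  in the plane \<open>F\<^sub>m\<^sub>-\<^sub>1\<^sup>\<bottom> / F\<^sub>m\<^sub>-\<^sub>1\<close>; these lines are orthogonal for the hermitian form, so one
  extension is odd and the other even. The parity is that of \<open>dim (N \<inter> F\<^sub>m)\<close>, up to a constant, for any fixed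
  Lagrangian \<open>N\<close>. For the inverse morphism choose \<open>N\<close> transversal to a given \<open>F\<^sub>m\<^sub>-\<^sub>1\<close> and meeting \<open>F\<^sub>m\<close> in a line;
  nearby, the extension of the right parity is \<open>F\<^sub>m\<^sub>-\<^sub>1 + (N \<inter> F\<^sub>m\<^sub>-\<^sub>1\<^sup>\<bottom>)\<close>, which Cramer's rule computes.\<close>

subsection \<open>Cup diagrams\<close>

text \<open>The coordinates carry the proof: for unit vectors \<open>a\<close>,
  \<open>Bm a i\<close> is an isometry of the plane onto the orthogonal complement of
  \<open>Fs a i\<close> in its preimage under \<open>nilp\<close>. So a flag is a sequence of lines,
  and adding one subspace is a choice of one vector in the plane. The two types meet in
  \<open>beta_C v (nilp w) = beta_D v w\<close>, which turns isotropy of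
  \<open>F\<^sub>m\<^sub>-\<^sub>1\<close> for \<open>beta_C\<close> into the statement that its
  preimage under \<open>nilp\<close> is its complement for \<open>beta_D\<close>. That an isotropic
  \<open>F\<^sub>m\<close> forces the same rests on skewness of \<open>nilp\<close>: a skew
  endomorphism of a nondegenerate quadratic plane that kills an isotropic line is zero. The lines
  prescribed for rays change with \<open>m - k\<close>, so the identification of the sphere with the
  projective line is turned accordingly (\<open>axes\<close>); the reduction keeps
  \<open>m - k\<close>, so one identification serves a whole induction. Unit vectors cannot be
  chosen continuously over the sphere, hence continuity and equality of lines are stated for
  projections. Homeomorphisms are continuous bijections from compact to Hausdorff spaces, so no
  inverse has to be shown continuous.\<close>

lemma mem_cup_drawing:
  "(x, y) \<in> drawing m (Cup i j) \<longleftrightarrow> y \<le> 0 \<and> y\<^sup>2 = (x - real i) * (real j - x)"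
proof -
  have "(x - (real i + real j) / 2)\<^sup>2 + y\<^sup>2 - ((real j - real i) / 2)\<^sup>2 = y\<^sup>2 - (x - real i) * (real j - x)"
    by (simp add: power2_eq_square field_simps)
  then show ?thesis by auto
qed

lemma mem_ray_drawing: "(x, y) \<in> drawing m (Ray i) \<longleftrightarrow> x = real i \<and> - real m \<le> y \<and> y \<le> 0"
  by auto

lemma cup_drawing_range:
  assumes "(x, y) \<in> drawing m (Cup i j)" "i < j"
  shows "real i \<le> x" "x \<le> real j"
proof -
  have "(x - real i) * (real j - x) \<ge> 0" using assms(1) mem_cup_drawing by (metis zero_le_power2)
  with \<open>i < j\<close> show "real i \<le> x" "x \<le> real j"
    by (auto simp: zero_le_mult_iff)
qed

text \<open>The two sides are the squared depths at abscissa \<open>x\<close> of an inner and an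
  outer semicircle: the outer one is strictly deeper.\<close>

lemma nested_product_less:
  fixes x i j i' j' :: real
  assumes "i < i'" "j' < j" "i' \<le> x" "x \<le> j'"
  shows "(x - i') * (j' - x) < (x - i) * (j - x)"
proof -
  have "(x - i') * (j' - x) \<le> (x - i') * (j - x)" using assms by (intro mult_left_mono) auto
  also have "\<dots> < (x - i) * (j - x)" using assms by (intro mult_strict_right_mono) auto
  finally show ?thesis .
qed

section \<open>Combinatorial form of the geometric conditions\<close>

definition is_cup :: "arc \<Rightarrow> bool" where "is_cup a \<longleftrightarrow> (\<exists>i j. a = Cup i j)"

lemma is_cup_simps [simp]: "is_cup (Cup i j)" "\<not> is_cup (Ray i)"
  by (auto simp: is_cup_def)

text \<open>The third case demands \<open>is_cup b\<close> because a ray starting under a cup runs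
  down to the bottom edge and crosses it.\<close>

definition noncrossing :: "arc set \<Rightarrow> bool" where
  "noncrossing A \<longleftrightarrow> (\<forall>i j b. Cup i j \<in> A \<longrightarrow> b \<in> A \<longrightarrow> b \<noteq> Cup i j \<longrightarrow>
     (\<forall>v\<in>ends b. v < i) \<or> (\<forall>v\<in>ends b. j < v) \<or> (is_cup b \<and> (\<forall>v\<in>ends b. i < v \<and> v < j))
     \<or> (\<exists>i' j'. b = Cup i' j' \<and> i' < i \<and> j < j'))"

text \<open>What can separate an arc from the right edge is a ray to its right or a cup around it.
  The inequality \<open>r \<le> v\<close> is not strict, so that a ray passes the comparison with
  itself.\<close>

definition outer :: "arc set \<Rightarrow> arc \<Rightarrow> bool" where
  "outer A a \<longleftrightarrow> (\<forall>r. Ray r \<in> A \<longrightarrow> (\<forall>v\<in>ends a. r \<le> v)) \<and>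
     (\<forall>i j. Cup i j \<in> A \<longrightarrow> \<not> (\<forall>v\<in>ends a. i < v \<and> v < j))"

text \<open>The drawing-free form of \<open>cup_diagram\<close>. Existence of an arc at each vertex
  suffices, since two arcs sharing a vertex violate \<open>noncrossing\<close>.\<close>

definition good_diagram :: "nat \<Rightarrow> arc set \<Rightarrow> arc set \<Rightarrow> bool" where
  "good_diagram m A D \<longleftrightarrow> (\<forall>a\<in>A. wf_arc m a) \<and> (\<forall>v\<in>{1..m}. \<exists>a\<in>A. v \<in> ends a) \<and>
     noncrossing A \<and> D \<subseteq> A \<and> (\<forall>a\<in>D. outer A a)"

lemma cup_ray_disjoint_iff:
  assumes "wf_arc m (Cup i j)" "wf_arc m (Ray r)"
  shows "drawing m (Cup i j) \<inter> drawing m (Ray r) = {} \<longleftrightarrow> r < i \<or> j < r"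
proof
  assume *: "drawing m (Cup i j) \<inter> drawing m (Ray r) = {}"
  show "r < i \<or> j < r"
  proof (rule ccontr)
    assume "\<not> (r < i \<or> j < r)"
    then have r: "i \<le> r" "r \<le> j" by auto
    define s where "s = (real r - real i) * (real j - real r)"
    have s0: "s \<ge> 0" using r by (simp add: s_def)
    \<comment> \<open>The depth of the rectangle enters here: the point of the semicircle below
      \<open>r\<close> is at most \<open>m\<close> deep, so the ray, which ends at depth
      \<open>m\<close>, reaches it.\<close>
    have "s \<le> (real m)\<^sup>2"
      unfolding s_def power2_eq_square using assms r by (intro mult_mono) auto
    then have "sqrt s \<le> real m" by (simp add: real_le_lsqrt)
    then have "(real r, - sqrt s) \<in> drawing m (Cup i j) \<inter> drawing m (Ray r)"
      using s0 by (simp add: mem_cup_drawing mem_ray_drawing s_def del: drawing.simps)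
    with * show False by blast
  qed
next
  assume "r < i \<or> j < r"
  then show "drawing m (Cup i j) \<inter> drawing m (Ray r) = {}"
    using cup_drawing_range[of _ _ m i j] assms by (fastforce simp del: drawing.simps simp: mem_ray_drawing)
qed

lemma cups_cross:
  assumes "i \<le> i'" "i' \<le> j" "j \<le> j'" "i < j" "i' < j'"
  shows "drawing m (Cup i j) \<inter> drawing m (Cup i' j') \<noteq> {}"
proof (cases "i = i' \<and> j = j'")
  case True
  have "(real i, 0) \<in> drawing m (Cup i j)" by (simp add: mem_cup_drawing del: drawing.simps)
  with True show ?thesis by blast
next
  case False
  define s where "s = real i' + real j' - real i - real j"
  have s: "s > 0" using False assms by (auto simp: s_def)
  \<comment> \<open>The radical axis of the two circles, where both products agree. The next two
    computations place it between \<open>i'\<close> and \<open>j\<close>, so that the common value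
    is a squared depth.\<close>
  define x where "x = (real i' * real j' - real i * real j) / s"
  have xs: "x * s = real i' * real j' - real i * real j" using s by (simp add: x_def)
  have "(x - real i') * s = (real i' - real i) * (real j - real i')"
    unfolding left_diff_distrib xs by (simp add: s_def algebra_simps)
  moreover have "\<dots> \<ge> 0" using assms by simp
  ultimately have x1: "x \<ge> real i'" using s by (smt (verit) zero_le_mult_iff)
  have "(real j - x) * s = (real j - real i') * (real j' - real j)"
    unfolding left_diff_distrib xs by (simp add: s_def algebra_simps)
  moreover have "\<dots> \<ge> 0" using assms by simp
  ultimately have x2: "x \<le> real j" using s by (smt (verit) zero_le_mult_iff)
  define t where "t = (x - real i) * (real j - x)"
  have t0: "t \<ge> 0" using x1 x2 assms by (simp add: t_def)
  have "t = (x - real i') * (real j' - x)"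
    using xs by (simp add: t_def s_def algebra_simps)
  then have "(x, - sqrt t) \<in> drawing m (Cup i j) \<inter> drawing m (Cup i' j')"
    using t0 by (simp add: mem_cup_drawing t_def del: drawing.simps)
  then show ?thesis by blast
qed

lemma cups_nested_disjoint:
  assumes "i < i'" "j' < j" "i' < j'"
  shows "drawing m (Cup i j) \<inter> drawing m (Cup i' j') = {}"
proof -
  have False if "(x, y) \<in> drawing m (Cup i j)" "(x, y) \<in> drawing m (Cup i' j')" for x y
    using nested_product_less[of i i' j' j x] cup_drawing_range[OF that(2) assms(3)] that assms
    by (simp add: mem_cup_drawing del: drawing.simps)
  then show ?thesis by (auto simp del: drawing.simps)
qed

lemma cups_separate_disjoint:
  assumes "j < i'" "i < j" "i' < j'"
  shows "drawing m (Cup i j) \<inter> drawing m (Cup i' j') = {}"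
proof -
  have False if "(x, y) \<in> drawing m (Cup i j)" "(x, y) \<in> drawing m (Cup i' j')" for x y
    using cup_drawing_range[OF that(1)] cup_drawing_range[OF that(2)] assms by linarith
  then show ?thesis by (auto simp del: drawing.simps)
qed

lemma cups_disjoint_iff:
  assumes "i < j" "i' < j'"
  shows "drawing m (Cup i j) \<inter> drawing m (Cup i' j') = {} \<longleftrightarrow>
     j' < i \<or> j < i' \<or> (i < i' \<and> j' < j) \<or> (i' < i \<and> j < j')" (is "?L \<longleftrightarrow> ?R")
proof
  assume ?R
  then show ?L
    using cups_separate_disjoint assms cups_nested_disjoint by (metis inf_commute)
next
  assume ?L
  show ?R
  proof (rule ccontr)
    assume "\<not> ?R"
    then consider "i \<le> i'" "i' \<le> j" "j \<le> j'" | "i' \<le> i" "i \<le> j'" "j' \<le> j" by linarith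
    then show False
      using cups_cross[of i i' j j' m] cups_cross[of i' i j' j m] assms \<open>?L\<close> by cases auto
  qed
qed

lemma disjoint_drawings_iff_noncrossing:
  assumes wf: "\<forall>a\<in>A. wf_arc m a"
  shows "(\<forall>a\<in>A. \<forall>b\<in>A. a \<noteq> b \<longrightarrow> drawing m a \<inter> drawing m b = {}) \<longleftrightarrow> noncrossing A"
    (is "?L \<longleftrightarrow> _")
proof
  assume L: ?L
  show "noncrossing A"
    unfolding noncrossing_def
  proof (intro allI impI)
    fix i j b
    assume ij: "Cup i j \<in> A" and b: "b \<in> A" "b \<noteq> Cup i j"
    then have d: "drawing m (Cup i j) \<inter> drawing m b = {}" using L by blast
    show "(\<forall>v\<in>ends b. v < i) \<or> (\<forall>v\<in>ends b. j < v) \<or> (is_cup b \<and> (\<forall>v\<in>ends b. i < v \<and> v < j))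
      \<or> (\<exists>i' j'. b = Cup i' j' \<and> i' < i \<and> j < j')"
    proof (cases b)
      case (Ray r)
      then have "r < i \<or> j < r" using cup_ray_disjoint_iff[of m i j r] wf ij b d by blast
      then show ?thesis using Ray by auto
    next
      case (Cup i' j')
      have "i < j" "i' < j'" using wf ij b Cup by fastforce+
      then show ?thesis using cups_disjoint_iff[of i j i' j' m] d Cup by auto
    qed
  qed
next
  assume nc: "noncrossing A"
  have cup: "drawing m (Cup i j) \<inter> drawing m b = {}"
    if ij: "Cup i j \<in> A" and b: "b \<in> A" "b \<noteq> Cup i j" for i j b
  proof (cases b)
    case (Ray r)
    then have "r < i \<or> j < r" using nc ij b unfolding noncrossing_def by fastforce
    then show ?thesis using cup_ray_disjoint_iff[of m i j r] wf ij b Ray by blast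
  next
    case (Cup i' j')
    have lt: "i < j" "i' < j'" using wf ij b Cup by fastforce+
    have "j' < i \<or> j < i' \<or> (i < i' \<and> j' < j) \<or> (i' < i \<and> j < j')"
      using nc ij b unfolding noncrossing_def Cup by fastforce
    then show ?thesis using cups_disjoint_iff[OF lt, of m] Cup by blast
  qed
  show ?L
  proof (intro ballI impI)
    fix a b assume ab: "a \<in> A" "b \<in> A" "a \<noteq> b"
    show "drawing m a \<inter> drawing m b = {}"
    proof (cases a)
      case (Cup i j) then show ?thesis using cup ab by blast
    next
      case R: (Ray r)
      show ?thesis
      proof (cases b)
        case (Cup i j) then show ?thesis using cup ab by blast
      next
        case (Ray r') then show ?thesis using R ab by auto
      qed
    qed
  qed
qed

lemma unique_arc_iff:
  assumes wf: "\<forall>a\<in>A. wf_arc m a" and nc: "noncrossing A"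
  shows "(\<forall>v\<in>{1..m}. \<exists>!a. a \<in> A \<and> v \<in> ends a) \<longleftrightarrow> (\<forall>v\<in>{1..m}. \<exists>a\<in>A. v \<in> ends a)"
proof -
  have "a = b" if "a \<in> A" "b \<in> A" "v \<in> ends a" "v \<in> ends b" for a b v
  proof -
    have cup: "b = Cup i j" if "Cup i j \<in> A" "b \<in> A" "v \<in> ends (Cup i j)" "v \<in> ends b" for i j b
    proof (rule ccontr)
      assume ne: "b \<noteq> Cup i j"
      have "i < j" using that(1) wf by fastforce
      then show False using that ne nc unfolding noncrossing_def by fastforce
    qed
    show ?thesis
    proof (cases a)
      case (Cup i j) then show ?thesis using cup that by blast
    next
      case R: (Ray r)
      show ?thesis
      proof (cases b)
        case (Cup i j) then show ?thesis using cup that by blast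
      next
        case (Ray r') then show ?thesis using R that by auto
      qed
    qed
  qed
  then show ?thesis by blast
qed

lemma noncrossing_ray:
  assumes "noncrossing A" "Cup i j \<in> A" "Ray r \<in> A"
  shows "r < i \<or> j < r"
  using assms unfolding noncrossing_def by fastforce

lemma path_crosses_level:
  fixes g :: "real \<Rightarrow> real \<times> real"
  assumes g: "path g" and f: "continuous_on UNIV f" and lo: "f (pathstart g) \<le> (c::real)" and hi: "c \<le> f (pathfinish g)"
  obtains z where "z \<in> path_image g" "f z = c"
proof -
  have "continuous_on {0..1} (\<lambda>t. f (g t))"
    using g by (auto simp: path_def intro: continuous_on_compose2[OF f])
  then obtain t where "0 \<le> t" "t \<le> 1" "f (g t) = c"
    using IVT'[of "\<lambda>t. f (g t)" 0 c 1] lo hi by (auto simp: pathstart_def pathfinish_def)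
  then show ?thesis using that[of "g t"] by (auto simp: path_image_def)
qed

text \<open>Inside the rectangle a blocking ray or cup is a level set of a continuous function, the
  abscissa for a ray and the circle equation for a cup. Its values at \<open>a\<close> and at the
  right edge lie on different sides of that level, so the path meets the blocking arc.\<close>

lemma accessible_imp_outer:
  assumes wf: "\<forall>a\<in>A. wf_arc m a" and nc: "noncrossing A" and a: "a \<in> A" and acc: "accessible m A a"
  shows "outer A a"
proof -
  obtain g where g: "path g" "path_image g \<subseteq> rectangle m" "pathstart g \<in> drawing m a"
    "pathfinish g \<in> right_edge m" and av: "\<forall>b\<in>A - {a}. path_image g \<inter> drawing m b = {}"
    using acc unfolding accessible_def by blast
  have fin: "fst (pathfinish g) = real m + 1" using g(4) by (auto simp: right_edge_def)
  obtain x y where xy: "pathstart g = (x, y)" by fastforce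
  have 1: "r \<le> v" if r: "Ray r \<in> A" and v: "v \<in> ends a" for r v
  proof (rule ccontr)
    assume "\<not> r \<le> v"
    then have vr: "v < r" by simp
    then have ne: "Ray r \<noteq> a" using v by auto
    have "x < real r"
    proof (cases a)
      case (Ray s) then show ?thesis using g(3) xy v vr by auto
    next
      case (Cup i j)
      have ij: "i < j" using wf a Cup by fastforce
      have "j < r" using noncrossing_ray[OF nc _ r, of i j] a Cup v vr ij by auto
      moreover have "x \<le> real j" using cup_drawing_range[of x y m i j] g(3) xy Cup ij by simp
      ultimately show ?thesis by linarith
    qed
    moreover have "real r \<le> real m + 1" using wf r by fastforce
    ultimately obtain z where z: "z \<in> path_image g" "fst z = real r"
      using path_crosses_level[OF g(1) continuous_on_fst[OF continuous_on_id], of "real r"] xy fin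
      by (auto simp: id_def)
    then have "z \<in> drawing m (Ray r)"
      using g(2) by (cases z) (auto simp: rectangle_def)
    then show False using av r ne z by blast
  qed
  have 2: False if ij: "Cup i j \<in> A" and v: "\<forall>v\<in>ends a. i < v \<and> v < j" for i j
  proof -
    have lt: "i < j" "j \<le> m" using wf ij by fastforce+
    have ne: "Cup i j \<noteq> a" using v by auto
    define f where "f z = snd z ^ 2 - (fst z - real i) * (real j - fst z)" for z :: "real \<times> real"
    have cf: "continuous_on UNIV f" unfolding f_def by (intro continuous_intros)
    have "f (pathstart g) \<le> 0"
    proof (cases a)
      case (Ray r)
      then show ?thesis using noncrossing_ray[OF nc ij, of r] a v by auto
    next
      case (Cup i' j')
      have l: "i' < j'" using wf a Cup by fastforce
      have "(x, y) \<in> drawing m (Cup i' j')" using g(3) xy Cup by simp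
      then have "y\<^sup>2 = (x - real i') * (real j' - x)" "real i' \<le> x" "x \<le> real j'"
        using cup_drawing_range[OF _ l] by (auto simp: mem_cup_drawing simp del: drawing.simps)
      then show ?thesis
        using nested_product_less[of i i' j' j x] v Cup xy by (simp add: f_def)
    qed
    moreover have "0 \<le> f (pathfinish g)"
      using fin lt by (auto simp: f_def mult_nonneg_nonpos intro: order_trans[of _ 0])
    ultimately obtain z where z: "z \<in> path_image g" "f z = 0"
      using path_crosses_level[OF g(1) cf] by blast
    have "snd z \<le> 0" using g(2) z by (auto simp: rectangle_def)
    then have "z \<in> drawing m (Cup i j)"
      using z(2) by (cases z) (simp add: mem_cup_drawing f_def del: drawing.simps)
    then show False using av ij ne z by blast
  qed
  show ?thesis unfolding outer_def using 1 2 by blast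
qed

text \<open>Semicircles have radius below \<open>m\<close>, so only rays touch the bottom edge; the
  accessibility paths run along it.\<close>

lemma bottom_avoids_cup:
  assumes "wf_arc m (Cup i j)"
  shows "(x, - real m) \<notin> drawing m (Cup i j)"
proof
  assume *: "(x, - real m) \<in> drawing m (Cup i j)"
  then have "i < j" "real i \<le> x" "x \<le> real j" using assms cup_drawing_range[OF *] by auto
  then have "(x - real i) * (real j - x) < real m * real m"
    using assms by (intro mult_strict_mono') auto
  then show False using * by (simp add: mem_cup_drawing power2_eq_square del: drawing.simps)
qed

text \<open>The path leaves a ray at its foot and a cup at its lowest point, drops to the bottom
  edge and follows it to the right, where \<open>outer\<close> excludes any further ray.\<close>

lemma outer_imp_accessible:
  assumes wf: "\<forall>a\<in>A. wf_arc m a" and nc: "noncrossing A" and a: "a \<in> A" and out: "outer A a"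
  shows "accessible m A a"
proof (cases a)
  case (Ray r)
  define g where "g = linepath (real r, - real m) (real m + 1, - real m)"
  have r: "1 \<le> r" "r \<le> m" using wf a Ray by fastforce+
  have im: "path_image g \<subseteq> {real r..real m + 1} \<times> {- real m..- real m}"
    unfolding g_def path_image_linepath using r
    by (intro closed_segment_subset convex_Times) auto
  have "path_image g \<inter> drawing m b = {}" if b: "b \<in> A" "b \<noteq> a" for b
  proof (cases b)
    case (Ray s)
    then have "s < r" using out b \<open>a = Ray r\<close> unfolding outer_def by fastforce
    then show ?thesis using im Ray by auto
  next
    case (Cup i j)
    then show ?thesis using bottom_avoids_cup[of m i j] wf b im by (fastforce simp del: drawing.simps)
  qed
  moreover have "path_image g \<subseteq> rectangle m" using im by (fastforce simp: rectangle_def)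
  ultimately show ?thesis
    unfolding accessible_def using Ray
    by (intro exI[of _ g]) (auto simp: g_def right_edge_def)
next
  case (Cup i j)
  define c where "c = (real i + real j) / 2"
  define h where "h = (real j - real i) / 2"
  have ij: "1 \<le> i" "i < j" "j \<le> m" using wf a Cup by fastforce+
  have h: "0 < h" "h \<le> real m" "real i < c" "c < real j" using ij by (auto simp: h_def c_def field_simps)
  define g1 where "g1 = linepath (c, - h) (c, - real m)"
  define g2 where "g2 = linepath (c, - real m) (real m + 1, - real m)"
  have im1: "path_image g1 \<subseteq> {c..c} \<times> {- real m..- h}"
    unfolding g1_def path_image_linepath using h
    by (intro closed_segment_subset convex_Times) auto
  have im2: "path_image g2 \<subseteq> {c..real m + 1} \<times> {- real m..- real m}"
    unfolding g2_def path_image_linepath using h ij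
    by (intro closed_segment_subset convex_Times) auto
  have im: "path_image (g1 +++ g2) = path_image g1 \<union> path_image g2"
    by (rule path_image_join) (simp add: g1_def g2_def)
  have av: "path_image (g1 +++ g2) \<inter> drawing m b = {}" if b: "b \<in> A" "b \<noteq> a" for b
  proof (cases b)
    case (Ray s)
    then have "s \<le> i" using out b \<open>a = Cup i j\<close> unfolding outer_def by fastforce
    then show ?thesis using im im1 im2 Ray h by fastforce
  next
    case C: (Cup i' j')
    have ij': "i' < j'" using wf b C by fastforce
    \<comment> \<open>A cup that is this deep under the centre \<open>c\<close> of \<open>a\<close>
      would have to enclose \<open>a\<close>, which \<open>outer\<close> excludes; cups nested
      inside \<open>a\<close> are too shallow.\<close>
    have "(c, y) \<notin> drawing m b" if y: "y \<le> - h" for y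
    proof
      assume *: "(c, y) \<in> drawing m b"
      then have r: "real i' \<le> c" "c \<le> real j'" using cup_drawing_range[of c y m i' j'] ij' C by simp_all
      have "y\<^sup>2 = (c - real i') * (real j' - c)" using * C by (simp add: mem_cup_drawing del: drawing.simps)
      moreover have "h * h \<le> y\<^sup>2" using power_mono[of h "- y" 2] y h by (simp add: power2_eq_square)
      moreover have "(c - real i) * (real j - c) = h * h" by (simp add: c_def h_def field_simps)
      moreover have "(\<forall>v\<in>ends b. v < i) \<or> (\<forall>v\<in>ends b. j < v) \<or> (is_cup b \<and> (\<forall>v\<in>ends b. i < v \<and> v < j))
        \<or> (\<exists>i' j'. b = Cup i' j' \<and> i' < i \<and> j < j')"
        using nc a b Cup unfolding noncrossing_def by blast
      moreover have "\<not> (i' < i \<and> j < j')" using out b C Cup ij unfolding outer_def by fastforce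
      ultimately show False
        using nested_product_less[of i i' j' j c] r h C by auto
    qed
    moreover have "(x, - real m) \<notin> drawing m b" for x
      using bottom_avoids_cup[of m i' j'] wf b C by blast
    ultimately show ?thesis
      unfolding im using im1 im2 by (fastforce simp del: drawing.simps)
  qed
  have "path_image (g1 +++ g2) \<subseteq> rectangle m"
    unfolding im using im1 im2 h ij by (fastforce simp: rectangle_def)
  moreover have "(c, - h) \<in> drawing m a"
    unfolding Cup using h by (simp add: c_def h_def)
  moreover have "path (g1 +++ g2)" by (simp add: g1_def g2_def)
  ultimately show ?thesis
    unfolding accessible_def using av
    by (intro exI[of _ "g1 +++ g2"]) (auto simp: g1_def g2_def right_edge_def)
qed

lemma cup_diagram_iff_good: "cup_diagram m (A, D) \<longleftrightarrow> good_diagram m A D"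
proof (cases "(\<forall>a\<in>A. wf_arc m a) \<and> noncrossing A")
  case True
  then have "(\<forall>a\<in>D. accessible m A a) \<longleftrightarrow> (\<forall>a\<in>D. outer A a)" if "D \<subseteq> A"
    using that accessible_imp_outer outer_imp_accessible by blast
  then show ?thesis
    unfolding cup_diagram_def good_diagram_def
    using True disjoint_drawings_iff_noncrossing[of A m] unique_arc_iff[of A m] by auto
next
  case False
  then show ?thesis
    unfolding cup_diagram_def good_diagram_def
    using disjoint_drawings_iff_noncrossing[of A m] by auto
qed

lemma finite_wf_arcs: "finite {a. wf_arc m a}"
proof -
  have "a \<in> (\<lambda>(i, j). Cup i j) ` ({..m} \<times> {..m}) \<union> Ray ` {..m}" if "wf_arc m a" for a
    using that by (cases a) auto
  then show ?thesis by (auto intro!: finite_subset[of "{a. wf_arc m a}" "(\<lambda>(i, j). Cup i j) ` ({..m} \<times> {..m}) \<union> Ray ` {..m}"])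
qed

lemma good_diagram_finite:
  assumes "good_diagram m A D"
  shows "finite A" "finite D"
proof -
  have "A \<subseteq> {a. wf_arc m a}" using assms unfolding good_diagram_def by auto
  then show "finite A" using finite_wf_arcs by (rule finite_subset)
  then show "finite D" using assms unfolding good_diagram_def by (auto intro: finite_subset)
qed

section \<open>Inserting and removing a cup between neighbouring vertices \<open>i\<close> and
  \<open>Suc i\<close>\<close>

definition skip :: "nat \<Rightarrow> nat \<Rightarrow> nat" where "skip i v = (if v < i then v else v + 2)"

primrec skip_arc :: "nat \<Rightarrow> arc \<Rightarrow> arc" where
  "skip_arc i (Cup u v) = Cup (skip i u) (skip i v)"
| "skip_arc i (Ray u) = Ray (skip i u)"

lemma skip_less_iff [simp]: "skip i u < skip i v \<longleftrightarrow> u < v"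
  by (auto simp: skip_def)

lemma skip_le_iff [simp]: "skip i u \<le> skip i v \<longleftrightarrow> u \<le> v"
  by (auto simp: skip_def)

lemma skip_eq_iff [simp]: "skip i u = skip i v \<longleftrightarrow> u = v"
  by (auto simp: skip_def)

lemma skip_neq [simp]: "skip i v \<noteq> i" "skip i v \<noteq> Suc i" "i \<noteq> skip i v" "Suc i \<noteq> skip i v"
  by (auto simp: skip_def)

lemma skip_surj:
  assumes "w \<noteq> i" "w \<noteq> Suc i"
  obtains v where "w = skip i v"
proof (cases "w < i")
  case True
  then show ?thesis using that[of w] by (simp add: skip_def)
next
  case False
  then have "\<not> w - 2 < i" "w - 2 + 2 = w" using assms by linarith+
  then show ?thesis using that[of "w - 2"] by (simp add: skip_def)
qed

lemma skip_bounds [simp]: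
  assumes "1 \<le> i" "i < m"
  shows "skip i v \<le> m \<longleftrightarrow> v \<le> m - 2" "Suc 0 \<le> skip i v \<longleftrightarrow> Suc 0 \<le> v"
  using assms by (auto simp: skip_def)

lemma ends_skip_arc [simp]: "ends (skip_arc i a) = skip i ` ends a"
  by (cases a) auto

lemma skip_arc_inj [simp]: "skip_arc i a = skip_arc i b \<longleftrightarrow> a = b"
  by (cases a; cases b) auto

lemma is_cup_skip_arc [simp]: "is_cup (skip_arc i a) \<longleftrightarrow> is_cup a"
  by (cases a) auto

lemma skip_arc_neq [simp]: "skip_arc i a \<noteq> Cup i (Suc i)" "Cup i (Suc i) \<noteq> skip_arc i a"
  by (cases a; simp)+

lemma wf_skip_arc [simp]:
  assumes "1 \<le> i" "i < m"
  shows "wf_arc m (skip_arc i a) \<longleftrightarrow> wf_arc (m - 2) a"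
  using assms by (cases a) simp_all

lemma Cup_in_skip_image: "Cup u v \<in> skip_arc i ` A \<longleftrightarrow> (\<exists>u' v'. u = skip i u' \<and> v = skip i v' \<and> Cup u' v' \<in> A)"
proof
  assume "Cup u v \<in> skip_arc i ` A"
  then obtain a where a: "Cup u v = skip_arc i a" "a \<in> A" by blast
  then show "\<exists>u' v'. u = skip i u' \<and> v = skip i v' \<and> Cup u' v' \<in> A" by (cases a) auto
next
  assume "\<exists>u' v'. u = skip i u' \<and> v = skip i v' \<and> Cup u' v' \<in> A"
  then show "Cup u v \<in> skip_arc i ` A" by (metis imageI skip_arc.simps(1))
qed

lemma Ray_in_skip_image: "Ray u \<in> skip_arc i ` A \<longleftrightarrow> (\<exists>u'. u = skip i u' \<and> Ray u' \<in> A)"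
proof
  assume "Ray u \<in> skip_arc i ` A"
  then obtain a where a: "Ray u = skip_arc i a" "a \<in> A" by blast
  then show "\<exists>u'. u = skip i u' \<and> Ray u' \<in> A" by (cases a) auto
next
  assume "\<exists>u'. u = skip i u' \<and> Ray u' \<in> A"
  then show "Ray u \<in> skip_arc i ` A" by (metis imageI skip_arc.simps(2))
qed

definition insert_cup :: "nat \<Rightarrow> arc set \<Rightarrow> arc set" where
  "insert_cup i A = insert (Cup i (Suc i)) (skip_arc i ` A)"

lemma Cup_in_insert_cup:
  "Cup u v \<in> insert_cup i A \<longleftrightarrow> u = i \<and> v = Suc i \<or> (\<exists>u' v'. u = skip i u' \<and> v = skip i v' \<and> Cup u' v' \<in> A)"
  by (auto simp: insert_cup_def Cup_in_skip_image)

lemma Ray_in_insert_cup: "Ray u \<in> insert_cup i A \<longleftrightarrow> (\<exists>u'. u = skip i u' \<and> Ray u' \<in> A)"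
  by (auto simp: insert_cup_def Ray_in_skip_image)

lemma skip_arc_in_insert_cup [simp]: "skip_arc i a \<in> insert_cup i A \<longleftrightarrow> a \<in> A"
  by (auto simp: insert_cup_def)

lemma noncrossing_insert_cup:
  assumes wf: "\<forall>a\<in>A. wf_arc m a"
  shows "noncrossing (insert_cup i A) \<longleftrightarrow> noncrossing A"
proof
  assume nc: "noncrossing (insert_cup i A)"
  show "noncrossing A"
    unfolding noncrossing_def
  proof (intro allI impI)
    fix u v b assume *: "Cup u v \<in> A" "b \<in> A" "b \<noteq> Cup u v"
    then have "Cup (skip i u) (skip i v) \<in> insert_cup i A" "skip_arc i b \<in> insert_cup i A"
      "skip_arc i b \<noteq> Cup (skip i u) (skip i v)"
      using skip_arc_inj[of i b "Cup u v"] by (auto simp: Cup_in_insert_cup simp del: skip_arc_inj)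
    then have "(\<forall>w\<in>ends (skip_arc i b). w < skip i u) \<or> (\<forall>w\<in>ends (skip_arc i b). skip i v < w) \<or>
       (is_cup (skip_arc i b) \<and> (\<forall>w\<in>ends (skip_arc i b). skip i u < w \<and> w < skip i v)) \<or>
       (\<exists>u' v'. skip_arc i b = Cup u' v' \<and> u' < skip i u \<and> skip i v < v')"
      using nc unfolding noncrossing_def by blast
    then show "(\<forall>w\<in>ends b. w < u) \<or> (\<forall>w\<in>ends b. v < w) \<or> (is_cup b \<and> (\<forall>w\<in>ends b. u < w \<and> w < v)) \<or>
       (\<exists>u' v'. b = Cup u' v' \<and> u' < u \<and> v < v')"
      by (cases b) auto
  qed
next
  assume nc: "noncrossing A"
  show "noncrossing (insert_cup i A)"
    unfolding noncrossing_def
  proof (intro allI impI)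
    fix u v b assume *: "Cup u v \<in> insert_cup i A" "b \<in> insert_cup i A" "b \<noteq> Cup u v"
    show "(\<forall>w\<in>ends b. w < u) \<or> (\<forall>w\<in>ends b. v < w) \<or> (is_cup b \<and> (\<forall>w\<in>ends b. u < w \<and> w < v)) \<or>
       (\<exists>u' v'. b = Cup u' v' \<and> u' < u \<and> v < v')"
    proof (cases "u = i \<and> v = Suc i")
      case True
      then obtain b' where b': "b = skip_arc i b'" "b' \<in> A" using * by (auto simp: insert_cup_def)
      then have "wf_arc m b'" using wf by blast
      then show ?thesis using b' True by (cases b') (auto simp: skip_def)
    next
      case False
      then obtain u' v' where uv: "u = skip i u'" "v = skip i v'" "Cup u' v' \<in> A"
        using * by (auto simp: Cup_in_insert_cup)
      have uv': "u' < v'" using wf uv(3) by fastforce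
      show ?thesis
      proof (cases "b = Cup i (Suc i)")
        case True
        then show ?thesis using uv uv' by (auto simp: skip_def)
      next
        case False
        then obtain b' where b': "b = skip_arc i b'" "b' \<in> A" using * by (auto simp: insert_cup_def)
        then have "b' \<noteq> Cup u' v'" using * uv by auto
        then have "(\<forall>w\<in>ends b'. w < u') \<or> (\<forall>w\<in>ends b'. v' < w) \<or> (is_cup b' \<and> (\<forall>w\<in>ends b'. u' < w \<and> w < v')) \<or>
          (\<exists>u'' v''. b' = Cup u'' v'' \<and> u'' < u' \<and> v' < v'')"
          using nc b' uv unfolding noncrossing_def by blast
        then show ?thesis unfolding b' uv by (cases b') auto
      qed
    qed
  qed
qed

text \<open>A cup joining neighbours encloses no vertex and is no ray, so it blocks no other
  arc.\<close>

lemma outer_insert_cup: "outer (insert_cup i A) (skip_arc i a) \<longleftrightarrow> outer A a"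
proof -
  have ne: "ends a \<noteq> {}" by (cases a) auto
  have "(\<forall>u v. Cup u v \<in> insert_cup i A \<longrightarrow> \<not> (\<forall>w\<in>skip i ` ends a. u < w \<and> w < v)) \<longleftrightarrow>
    (\<forall>u v. Cup u v \<in> A \<longrightarrow> \<not> (\<forall>w\<in>ends a. u < w \<and> w < v))" (is "?L \<longleftrightarrow> ?R")
  proof
    assume L: ?L
    show ?R
    proof (intro allI impI)
      fix u v assume "Cup u v \<in> A"
      then have "Cup (skip i u) (skip i v) \<in> insert_cup i A" by (auto simp: Cup_in_insert_cup)
      then show "\<not> (\<forall>w\<in>ends a. u < w \<and> w < v)" using L by fastforce
    qed
  next
    assume ?R
    then show ?L using ne by (auto simp: Cup_in_insert_cup)
  qed
  moreover have "(\<forall>r. Ray r \<in> insert_cup i A \<longrightarrow> (\<forall>v\<in>skip i ` ends a. r \<le> v)) \<longleftrightarrow>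
    (\<forall>r. Ray r \<in> A \<longrightarrow> (\<forall>v\<in>ends a. r \<le> v))"
    by (auto simp: Ray_in_insert_cup)
  ultimately show ?thesis unfolding outer_def by simp
qed

text \<open>\<open>T\<close> holds the dot, if any, of the new cup. At the right end
  \<open>Suc i = m\<close> the dot is legitimate, because no ray lies further right and no cup fits
  around.\<close>

lemma good_insert_cup:
  assumes i: "1 \<le> i" "i < m" and T: "T = {} \<or> T = {Cup i (Suc i)} \<and> Suc i = m"
  shows "good_diagram m (insert_cup i A) (skip_arc i ` D \<union> T) \<longleftrightarrow> good_diagram (m - 2) A D"
proof -
  have wf: "(\<forall>a\<in>insert_cup i A. wf_arc m a) \<longleftrightarrow> (\<forall>a\<in>A. wf_arc (m - 2) a)"
    using i by (auto simp: insert_cup_def)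
  have cov: "(\<forall>v\<in>{1..m}. \<exists>a\<in>insert_cup i A. v \<in> ends a) \<longleftrightarrow> (\<forall>v\<in>{1..m - 2}. \<exists>a\<in>A. v \<in> ends a)" (is "?L \<longleftrightarrow> ?R")
  proof
    assume L: ?L
    show ?R
    proof
      fix v assume "v \<in> {1..m - 2}"
      then have "skip i v \<in> {1..m}" using i by simp
      then obtain a where a: "a \<in> insert_cup i A" "skip i v \<in> ends a" using L by blast
      then show "\<exists>a\<in>A. v \<in> ends a" by (fastforce simp: insert_cup_def)
    qed
  next
    assume R: ?R
    show ?L
    proof
      fix w assume w: "w \<in> {1..m}"
      show "\<exists>a\<in>insert_cup i A. w \<in> ends a"
      proof (cases "w = i \<or> w = Suc i")
        case True then show ?thesis by (auto simp: insert_cup_def)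
      next
        case False
        then obtain v where v: "w = skip i v" using skip_surj by metis
        then have "v \<in> {1..m - 2}" using w i by simp
        then obtain a where "a \<in> A" "v \<in> ends a" using R by blast
        then show ?thesis using v by (intro bexI[of _ "skip_arc i a"]) auto
      qed
    qed
  qed
  have DA: "skip_arc i ` D \<union> T \<subseteq> insert_cup i A \<longleftrightarrow> D \<subseteq> A"
    using T by (auto simp: insert_cup_def)
  have T_out: "\<forall>a\<in>T. outer (insert_cup i A) a" if "\<forall>a\<in>insert_cup i A. wf_arc m a"
  proof -
    have "outer (insert_cup i A) (Cup i (Suc i))" if "Suc i = m"
    proof -
      have "r \<le> i" if r: "Ray r \<in> insert_cup i A" for r
      proof -
        have "r \<noteq> i" "r \<noteq> Suc i" using r by (auto simp: Ray_in_insert_cup)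
        moreover have "r \<le> m" using r \<open>\<forall>a\<in>insert_cup i A. wf_arc m a\<close> by fastforce
        ultimately show ?thesis using \<open>Suc i = m\<close> by linarith
      qed
      moreover have "v \<le> Suc i" if "Cup u v \<in> insert_cup i A" for u v
        using that \<open>\<forall>a\<in>insert_cup i A. wf_arc m a\<close> \<open>Suc i = m\<close> by fastforce
      ultimately show ?thesis unfolding outer_def by (fastforce simp: le_SucI)
    qed
    then show ?thesis using T by auto
  qed
  show ?thesis
    unfolding good_diagram_def wf cov DA
    using noncrossing_insert_cup[of A "m - 2" i] outer_insert_cup[of i A] T_out wf
    by (auto simp: ball_Un)
qed

text \<open>\<open>b\<close> stands for an undotted cup, whose ends carry antipodal points; the ends
  of a dotted cup carry equal points.\<close>

definition insert_pair :: "nat \<Rightarrow> nat \<Rightarrow> bool \<Rightarrow> real ^ 3 \<Rightarrow> (nat \<Rightarrow> real ^ 3) \<Rightarrow> nat \<Rightarrow> real ^ 3" where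
  "insert_pair m i b y x = (\<lambda>j\<in>{1..m}. if j < i then x j else if j = i then y
     else if j = Suc i then (if b then - y else y) else x (j - 2))"

definition delete_pair :: "nat \<Rightarrow> nat \<Rightarrow> (nat \<Rightarrow> 'p) \<Rightarrow> nat \<Rightarrow> 'p" where
  "delete_pair m i x = (\<lambda>j\<in>{1..m - 2}. x (skip i j))"

lemma delete_insert_pair:
  assumes "1 \<le> i" "i < m" "x \<in> extensional {1..m - 2}"
  shows "delete_pair m i (insert_pair m i b y x) = x"
proof
  fix j
  show "delete_pair m i (insert_pair m i b y x) j = x j"
  proof (cases "j \<in> {1..m - 2}")
    case True
    then have "skip i j \<in> {1..m}" using assms by simp
    then show ?thesis using True by (auto simp: delete_pair_def insert_pair_def skip_def)
  next
    case False
    then show ?thesis using assms(3) by (auto simp: delete_pair_def extensional_def)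
  qed
qed

lemma insert_delete_pair:
  assumes "1 \<le> i" "i < m" "x \<in> extensional {1..m}" "x (Suc i) = (if b then - x i else x i)"
  shows "insert_pair m i b (x i) (delete_pair m i x) = x"
proof
  fix j
  have "Suc (Suc (j - 2)) = j" if "\<not> j < i" "j \<noteq> i" "j \<noteq> Suc i" using that assms by linarith
  then show "insert_pair m i b (x i) (delete_pair m i x) j = x j"
    using assms by (auto simp: delete_pair_def insert_pair_def skip_def extensional_def)
qed

lemma insert_pair_sphere:
  assumes "1 \<le> i" "i < m" "x \<in> {1..m - 2} \<rightarrow>\<^sub>E sphere 0 1" "y \<in> sphere 0 1"
  shows "insert_pair m i b y x \<in> {1..m} \<rightarrow>\<^sub>E sphere 0 1"
proof -
  have "j - 2 \<in> {1..m - 2}" if "\<not> j < i" "j \<noteq> i" "j \<noteq> Suc i" "j \<le> m" for j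
    using that assms(1) by auto
  then show ?thesis using assms by (auto simp: insert_pair_def PiE_iff extensional_def)
qed

text \<open>The conditions split into the one for the new cup and those for the shifted arcs.
  Shifting preserves the order, so the rightmost ray stays rightmost and the latter are the
  conditions of the smaller diagram.\<close>

lemma S_cup_insert:
  assumes i: "1 \<le> i" "i < m"
    and b: "T = (if b then {} else {Cup i (Suc i)})"
    and wf: "\<forall>a\<in>A. wf_arc (m - 2) a"
  shows "x \<in> S_cup m (insert_cup i A, skip_arc i ` D \<union> T) \<longleftrightarrow>
    x \<in> {1..m} \<rightarrow>\<^sub>E sphere 0 1 \<and> x (Suc i) = (if b then - x i else x i) \<and>
    delete_pair m i x \<in> S_cup (m - 2) (A, D)"
proof (cases "x \<in> {1..m} \<rightarrow>\<^sub>E sphere 0 1")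
  case False
  then show ?thesis by (simp add: S_cup_def)
next
  case x: True
  have rm: "rightmost_ray (insert_cup i A) (skip i r) \<longleftrightarrow> rightmost_ray A r" for r
    unfolding rightmost_ray_def by (auto simp: Ray_in_insert_cup)
  have dp: "delete_pair m i x \<in> {1..m - 2} \<rightarrow>\<^sub>E sphere 0 1"
    using x i by (auto simp: delete_pair_def PiE_iff)
  have CD: "Cup (skip i u) (skip i v) \<in> skip_arc i ` D \<union> T \<longleftrightarrow> Cup u v \<in> D"
    "Ray (skip i u) \<in> skip_arc i ` D \<union> T \<longleftrightarrow> Ray u \<in> D" for u v
    using b by (auto simp: Cup_in_skip_image Ray_in_skip_image)
  have C0: "Cup i (Suc i) \<in> skip_arc i ` D \<union> T \<longleftrightarrow> \<not> b"
    using b by (auto simp: Cup_in_skip_image)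
  have dpv: "delete_pair m i x v = x (skip i v)" if "v \<in> ends a" "a \<in> A" for a v
    using wf that by (cases a) (fastforce simp: delete_pair_def)+
  have cups: "(\<forall>u v. Cup u v \<in> insert_cup i A \<longrightarrow> x u = (if Cup u v \<in> skip_arc i ` D \<union> T then x v else - x v)) \<longleftrightarrow>
    x i = (if b then - x (Suc i) else x (Suc i)) \<and>
    (\<forall>u v. Cup u v \<in> A \<longrightarrow> x (skip i u) = (if Cup u v \<in> D then x (skip i v) else - x (skip i v)))"
  proof -
    have "(\<forall>u v. Cup u v \<in> insert_cup i A \<longrightarrow> P u v) \<longleftrightarrow>
      P i (Suc i) \<and> (\<forall>u v. Cup u v \<in> A \<longrightarrow> P (skip i u) (skip i v))" for P
      unfolding Cup_in_insert_cup by blast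
    from this[of "\<lambda>u v. x u = (if Cup u v \<in> skip_arc i ` D \<union> T then x v else - x v)"]
    show ?thesis unfolding CD(1) using C0 by simp
  qed
  have rays: "(\<forall>u. Ray u \<in> insert_cup i A \<longrightarrow> x u = (if Ray u \<in> skip_arc i ` D \<union> T then p_pt else
       if rightmost_ray (insert_cup i A) u then - p_pt else q_pt)) \<longleftrightarrow>
    (\<forall>u. Ray u \<in> A \<longrightarrow> x (skip i u) = (if Ray u \<in> D then p_pt else if rightmost_ray A u then - p_pt else q_pt))"
  proof -
    have "(\<forall>u. Ray u \<in> insert_cup i A \<longrightarrow> P u) \<longleftrightarrow> (\<forall>u. Ray u \<in> A \<longrightarrow> P (skip i u))" for P
      unfolding Ray_in_insert_cup by blast
    from this[of "\<lambda>u. x u = (if Ray u \<in> skip_arc i ` D \<union> T then p_pt else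
       if rightmost_ray (insert_cup i A) u then - p_pt else q_pt)"]
    show ?thesis unfolding CD(2) rm by simp
  qed
  have cups': "(\<forall>u v. Cup u v \<in> A \<longrightarrow> x (skip i u) = (if Cup u v \<in> D then x (skip i v) else - x (skip i v))) \<longleftrightarrow>
    (\<forall>u v. Cup u v \<in> A \<longrightarrow> delete_pair m i x u = (if Cup u v \<in> D then delete_pair m i x v else - delete_pair m i x v))"
    using dpv by (metis ends.simps(1) insertI1 insertI2)
  have rays': "(\<forall>u. Ray u \<in> A \<longrightarrow> x (skip i u) = (if Ray u \<in> D then p_pt else if rightmost_ray A u then - p_pt else q_pt)) \<longleftrightarrow>
    (\<forall>u. Ray u \<in> A \<longrightarrow> delete_pair m i x u = (if Ray u \<in> D then p_pt else if rightmost_ray A u then - p_pt else q_pt))"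
  proof -
    have "delete_pair m i x u = x (skip i u)" if "Ray u \<in> A" for u using dpv[OF _ that] by simp
    then show ?thesis by (intro iff_allI imp_cong refl) simp
  qed
  have "x i = (if b then - x (Suc i) else x (Suc i)) \<longleftrightarrow> x (Suc i) = (if b then - x i else x i)"
    by auto
  then show ?thesis
    unfolding S_cup_def using x dp cups rays cups' rays' by auto
qed

subsection \<open>The union of products of spheres of one parity\<close>

text \<open>Both parities have to be treated together, since removing a dotted cup exchanges
  them.\<close>

definition S_par :: "bool \<Rightarrow> nat \<Rightarrow> nat \<Rightarrow> (nat \<Rightarrow> real ^ 3) set" where
  "S_par b m k = (\<Union>a\<in>{(A, D) \<in> cup_diagrams m k. odd (card D) = b}. S_cup m a)"

lemma S_D_odd_eq: "S_D_odd m k = S_par True m k"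
  unfolding S_D_odd_def S_par_def cup_diagrams_odd_def by auto

lemma S_par_iff:
  "x \<in> S_par b m k \<longleftrightarrow> (\<exists>A D. good_diagram m A D \<and> card {a \<in> A. is_cup a} = k div 2 \<and> odd (card D) = b \<and> x \<in> S_cup m (A, D))"
  unfolding S_par_def cup_diagrams_def cup_diagram_iff_good is_cup_def by blast

lemma S_par_sphere: "S_par b m k \<subseteq> {1..m} \<rightarrow>\<^sub>E sphere 0 1"
  by (auto simp: S_par_def S_cup_def)

lemma card_insert_cup:
  assumes "good_diagram m A D"
  shows "card {a \<in> insert_cup i A. is_cup a} = Suc (card {a \<in> A. is_cup a})"
    and "card (skip_arc i ` D) = card D"
    and "card (skip_arc i ` D \<union> {Cup i (Suc i)}) = Suc (card D)"
proof -
  have inj: "inj_on (skip_arc i) B" for B by (auto simp: inj_on_def)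
  have eq: "{a \<in> insert_cup i A. is_cup a} = insert (Cup i (Suc i)) (skip_arc i ` {a \<in> A. is_cup a})"
    by (auto simp: insert_cup_def)
  have "Cup i (Suc i) \<notin> skip_arc i ` B" for B by auto
  then show "card {a \<in> insert_cup i A. is_cup a} = Suc (card {a \<in> A. is_cup a})"
    "card (skip_arc i ` D \<union> {Cup i (Suc i)}) = Suc (card D)"
    using good_diagram_finite[OF assms] unfolding eq by (simp_all add: card_image[OF inj])
  show "card (skip_arc i ` D) = card D" by (rule card_image[OF inj])
qed

text \<open>A dotted new cup contributes one dot. Hence the parity of the smaller diagram is
  \<open>c = b\<close>: it is \<open>c\<close> for an undotted cup and its negation for a dotted
  one.\<close>

lemma S_par_insert:
  assumes i: "1 \<le> i" "i < m" and k: "2 \<le> k" and b: "b \<or> Suc i = m"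
    and x: "x \<in> S_par (c = b) (m - 2) (k - 2)" and y: "y \<in> sphere 0 1"
  shows "insert_pair m i b y x \<in> S_par c m k"
proof -
  obtain A D where AD: "good_diagram (m - 2) A D" "card {a \<in> A. is_cup a} = (k - 2) div 2"
    "odd (card D) = (c = b)" "x \<in> S_cup (m - 2) (A, D)"
    using x unfolding S_par_iff by blast
  define T where "T = (if b then {} else {Cup i (Suc i)})"
  have xs: "x \<in> {1..m - 2} \<rightarrow>\<^sub>E sphere 0 1" using S_par_sphere x by blast
  have "good_diagram m (insert_cup i A) (skip_arc i ` D \<union> T)"
    using good_insert_cup[OF i, of T A D] AD(1) b by (auto simp: T_def)
  moreover have "card {a \<in> insert_cup i A. is_cup a} = k div 2"
    using card_insert_cup(1)[OF AD(1)] AD(2) k by (metis Suc_eq_plus1 add_2_eq_Suc' div2_Suc_Suc le_add_diff_inverse2)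
  moreover have "odd (card (skip_arc i ` D \<union> T)) = c"
    using card_insert_cup(2,3)[OF AD(1), of i] AD(3) by (cases b) (auto simp: T_def)
  moreover have "insert_pair m i b y x \<in> S_cup m (insert_cup i A, skip_arc i ` D \<union> T)"
  proof -
    have "\<forall>a\<in>A. wf_arc (m - 2) a" using AD(1) by (simp add: good_diagram_def)
    moreover have "insert_pair m i b y x (Suc i) = (if b then - insert_pair m i b y x i else insert_pair m i b y x i)"
      using i by (simp add: insert_pair_def)
    moreover have "delete_pair m i (insert_pair m i b y x) = x"
      using delete_insert_pair[OF i] xs by (simp add: PiE_def)
    ultimately show ?thesis
      using S_cup_insert[OF i T_def] insert_pair_sphere[OF i xs y] AD(4) by simp
  qed
  ultimately show ?thesis unfolding S_par_iff by blast
qed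

lemma S_par_remove:
  assumes g: "good_diagram m A D" and C: "Cup i (Suc i) \<in> A" and b: "b \<longleftrightarrow> Cup i (Suc i) \<notin> D"
    and bi: "b \<or> Suc i = m"
    and k: "2 \<le> k" "card {a \<in> A. is_cup a} = k div 2" and c: "odd (card D) = c"
    and x: "x \<in> S_cup m (A, D)"
  shows "x (Suc i) = (if b then - x i else x i)" "delete_pair m i x \<in> S_par (c = b) (m - 2) (k - 2)"
proof -
  have wf: "\<forall>a\<in>A. wf_arc m a" and nc: "noncrossing A" and DA: "D \<subseteq> A"
    using g by (auto simp: good_diagram_def)
  have i: "1 \<le> i" "i < m" using wf C by fastforce+
  define T where "T = (if b then {} else {Cup i (Suc i)})"
  define A' where "A' = {a. skip_arc i a \<in> A}"
  define D' where "D' = {a. skip_arc i a \<in> D}"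
  have rep: "\<exists>a'. a = skip_arc i a'" if a: "a \<in> A" "a \<noteq> Cup i (Suc i)" for a
  proof -
    have "\<forall>v\<in>ends a. v \<noteq> i \<and> v \<noteq> Suc i"
      using nc C a unfolding noncrossing_def by fastforce
    then show ?thesis
    proof (cases a)
      case (Cup u v)
      then show ?thesis using \<open>\<forall>v\<in>ends a. _\<close> skip_surj[of u i] skip_surj[of v i]
        by (metis ends.simps(1) insertI1 insertI2 skip_arc.simps(1))
    next
      case (Ray u)
      then show ?thesis using \<open>\<forall>v\<in>ends a. _\<close> skip_surj[of u i]
        by (metis ends.simps(2) insertI1 skip_arc.simps(2))
    qed
  qed
  have A: "A = insert_cup i A'" using rep C by (auto simp: insert_cup_def A'_def)
  have D: "D = skip_arc i ` D' \<union> T" using rep DA b by (auto simp: D'_def T_def)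
  have g': "good_diagram (m - 2) A' D'"
    using good_insert_cup[OF i, of T A' D'] g bi unfolding A[symmetric] D[symmetric] by (auto simp: T_def)
  then have wf': "\<forall>a\<in>A'. wf_arc (m - 2) a" by (simp add: good_diagram_def)
  have xx: "x (Suc i) = (if b then - x i else x i) \<and> delete_pair m i x \<in> S_cup (m - 2) (A', D')"
    using S_cup_insert[OF i T_def wf', of x D'] x unfolding A[symmetric] D[symmetric] by blast
  then show "x (Suc i) = (if b then - x i else x i)" by blast
  have "card {a \<in> A'. is_cup a} = (k - 2) div 2"
    using card_insert_cup(1)[OF g', of i] k unfolding A[symmetric] by simp
  moreover have "odd (card D') = (c = b)"
    using card_insert_cup(2,3)[OF g', of i] c D by (cases b) (auto simp: T_def)
  ultimately show "delete_pair m i x \<in> S_par (c = b) (m - 2) (k - 2)"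
    unfolding S_par_iff using g' xx by blast
qed

text \<open>Otherwise the arc at \<open>Suc i\<close> would be a cup strictly inside.\<close>

lemma adjacent_cup:
  assumes g: "good_diagram m A D" and C: "Cup i j \<in> A"
    and min: "\<And>u v. Cup u v \<in> A \<Longrightarrow> \<not> (i < u \<and> v < j)"
  shows "j = Suc i"
proof (rule ccontr)
  assume "j \<noteq> Suc i"
  moreover have ij: "1 \<le> i" "i < j" "j \<le> m" using g C by (fastforce simp: good_diagram_def)+
  ultimately have "Suc i < j" by simp
  then obtain a where a: "a \<in> A" "Suc i \<in> ends a" using g ij by (fastforce simp: good_diagram_def)
  then have "a \<noteq> Cup i j" using \<open>Suc i < j\<close> by auto
  moreover have "noncrossing A" using g by (simp add: good_diagram_def)
  ultimately have "is_cup a \<and> (\<forall>v\<in>ends a. i < v \<and> v < j)"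
    using C a \<open>Suc i < j\<close> unfolding noncrossing_def by fastforce
  then show False using min a by (auto simp: is_cup_def)
qed

text \<open>If some cup is undotted, a shortest such cup joins neighbours: every cup inside it would
  be undotted as well, being cut off from the right edge. If all cups are dotted, none is nested and
  no ray lies to the right of any, so the cup ending furthest to the right joins
  \<open>m - 1\<close> and \<open>m\<close>.\<close>

lemma S_par_cases:
  assumes k: "2 \<le> k" and x: "x \<in> S_par c m k"
  shows "(\<exists>i. 1 \<le> i \<and> i < m \<and> x (Suc i) = - x i \<and> delete_pair m i x \<in> S_par c (m - 2) (k - 2)) \<or>
    (2 \<le> m \<and> x m = x (m - 1) \<and> delete_pair m (m - 1) x \<in> S_par (\<not> c) (m - 2) (k - 2))"
proof -
  obtain A D where g: "good_diagram m A D" and cd: "card {a \<in> A. is_cup a} = k div 2"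
    "odd (card D) = c" and xS: "x \<in> S_cup m (A, D)"
    using x unfolding S_par_iff by blast
  have wf: "\<forall>a\<in>A. wf_arc m a" and nc: "noncrossing A" and DA: "D \<subseteq> A"
    and cov: "\<forall>v\<in>{1..m}. \<exists>a\<in>A. v \<in> ends a" and out: "\<forall>a\<in>D. outer A a"
    using g by (auto simp: good_diagram_def)
  show ?thesis
  proof (cases "\<exists>u v. Cup u v \<in> A - D")
    case True
    define P where "P n \<longleftrightarrow> (\<exists>u v. Cup u v \<in> A - D \<and> v - u = n)" for n
    have "\<exists>n. P n" using True by (auto simp: P_def)
    then have "P (LEAST n. P n)" by (rule LeastI_ex)
    then obtain i j where ij: "Cup i j \<in> A - D" "j - i = (LEAST n. P n)" by (auto simp: P_def)
    have "\<not> (i < u \<and> v < j)" if uv: "Cup u v \<in> A" for u v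
    proof
      assume lt: "i < u \<and> v < j"
      have "u < v" using wf uv by fastforce
      then have "Cup u v \<notin> D" using out ij lt unfolding outer_def by fastforce
      then have "P (v - u)" using uv by (auto simp: P_def)
      then have "j - i \<le> v - u" unfolding ij(2) by (rule Least_le)
      then show False using lt \<open>u < v\<close> by linarith
    qed
    then have j: "j = Suc i" using adjacent_cup[OF g, of i j] ij by blast
    then have "1 \<le> i" "i < m" using wf ij by fastforce+
    then show ?thesis
      using S_par_remove[OF g, of i True k c x] ij j k cd xS by auto
  next
    case False
    have fin: "finite A" using good_diagram_finite[OF g] by blast
    have "{a \<in> A. is_cup a} \<noteq> {}" using cd k by (metis card.empty div_eq_0_iff not_less zero_neq_numeral)
    then obtain u0 v0 where uv0: "Cup u0 v0 \<in> A" by (auto simp: is_cup_def)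
    define V where "V = {v. \<exists>u. Cup u v \<in> A}"
    have "V \<subseteq> {..m}" using wf by (fastforce simp: V_def)
    then have finV: "finite V" by (rule finite_subset) simp
    define j where "j = Max V"
    have "j \<in> V" unfolding j_def using finV uv0 by (intro Max_in) (auto simp: V_def)
    then obtain i where ij: "Cup i j \<in> A" by (auto simp: V_def)
    have jmax: "v \<le> j" if "Cup u v \<in> A" for u v
      unfolding j_def using that finV by (intro Max_ge) (auto simp: V_def)
    have allD: "Cup u v \<in> D" if "Cup u v \<in> A" for u v using False that by blast
    have ijw: "1 \<le> i" "i < j" "j \<le> m" using wf ij by fastforce+
    have "\<not> (i < u \<and> v < j)" if "Cup u v \<in> A" for u v
    proof
      assume lt: "i < u \<and> v < j"
      have "u < v" using wf that by fastforce
      then show False using out allD[OF that] ij lt unfolding outer_def by fastforce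
    qed
    then have j: "j = Suc i" using adjacent_cup[OF g ij] by blast
    have "j = m"
    proof (rule ccontr)
      assume "j \<noteq> m"
      then have jm: "j < m" using ijw by simp
      obtain a where a: "a \<in> A" "m \<in> ends a" using cov ijw by fastforce
      show False
      proof (cases a)
        case (Cup u v)
        then have "m \<le> v" using a wf by fastforce
        then show False using jmax[of u v] a Cup jm by auto
      next
        case (Ray r)
        then show False using out allD[OF ij] a jm unfolding outer_def by fastforce
      qed
    qed
    then have i: "i = m - 1" "2 \<le> m" using j ijw by auto
    show ?thesis
      using S_par_remove[OF g, of i False k c x] ij allD[OF ij] j \<open>j = m\<close> k cd xS i by auto
  qed
qed

text \<open>Written as a union of images of products with a sphere, the recursion passes compactness
  and connectedness from the smaller case.\<close>

theorem S_par_rec: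
  assumes k: "2 \<le> k" and m: "2 \<le> m"
  shows "S_par c m k =
    (\<Union>i\<in>{1..<m}. (\<lambda>(y, x). insert_pair m i True y x) ` (sphere 0 1 \<times> S_par c (m - 2) (k - 2))) \<union>
    (\<lambda>(y, x). insert_pair m (m - 1) False y x) ` (sphere 0 1 \<times> S_par (\<not> c) (m - 2) (k - 2))" (is "_ = ?R")
proof (intro equalityI subsetI)
  fix x assume x: "x \<in> S_par c m k"
  then have xs: "x \<in> extensional {1..m}" "\<And>i. i \<in> {1..m} \<Longrightarrow> x i \<in> sphere 0 1"
    using S_par_sphere by (fastforce simp: PiE_iff)+
  from S_par_cases[OF k x] show "x \<in> ?R"
  proof (elim disjE exE conjE)
    fix i assume i: "1 \<le> i" "i < m" "x (Suc i) = - x i" "delete_pair m i x \<in> S_par c (m - 2) (k - 2)"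
    then have "x = insert_pair m i True (x i) (delete_pair m i x)"
      using insert_delete_pair[of i m x True] xs by simp
    moreover have "(x i, delete_pair m i x) \<in> sphere 0 1 \<times> S_par c (m - 2) (k - 2)"
      using i xs by auto
    ultimately have "x \<in> (\<lambda>(y, x). insert_pair m i True y x) ` (sphere 0 1 \<times> S_par c (m - 2) (k - 2))"
      by (metis (no_types, lifting) case_prod_conv image_eqI)
    then show ?thesis using i by auto
  next
    assume i: "2 \<le> m" "x m = x (m - 1)" "delete_pair m (m - 1) x \<in> S_par (\<not> c) (m - 2) (k - 2)"
    then have "x = insert_pair m (m - 1) False (x (m - 1)) (delete_pair m (m - 1) x)"
      using insert_delete_pair[of "m - 1" m x False] xs by simp
    moreover have "(x (m - 1), delete_pair m (m - 1) x) \<in> sphere 0 1 \<times> S_par (\<not> c) (m - 2) (k - 2)"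
      using i xs by auto
    ultimately show ?thesis
      by (metis (no_types, lifting) UnI2 case_prod_conv image_eqI)
  qed
next
  fix x assume "x \<in> ?R"
  then show "x \<in> S_par c m k"
    using S_par_insert[where b = True, of _ m k _ c] S_par_insert[where b = False, of "m - 1" m k _ c] k m by auto
qed

lemma PiE_fixed_iff:
  assumes "\<And>i. i \<in> I \<Longrightarrow> c i \<in> S"
  shows "x \<in> I \<rightarrow>\<^sub>E S \<and> (\<forall>i\<in>I. x i = c i) \<longleftrightarrow> x = restrict c I"
proof
  assume "x \<in> I \<rightarrow>\<^sub>E S \<and> (\<forall>i\<in>I. x i = c i)"
  then show "x = restrict c I" by (intro extensionalityI[of x I]) (auto simp: PiE_def)
qed (use assms in auto)

text \<open>Without cups every vertex carries a ray, and only the ray at \<open>m\<close> can be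
  dotted. So each parity is a single point, except that the empty diagram has no dot to make it
  odd.\<close>

lemma S_par_few:
  assumes k: "k < 2"
  shows "x \<in> S_par c m k \<longleftrightarrow> x = (\<lambda>i\<in>{1..m}. if i < m then q_pt else if c then p_pt else - p_pt) \<and> (m = 0 \<longrightarrow> \<not> c)"
proof -
  define A where "A = Ray ` {1..m}"
  define Dt where "Dt = (if c then {Ray m} else {})"
  have gA: "B = A" if g: "good_diagram m B D" and c0: "card {a \<in> B. is_cup a} = k div 2" for B D
  proof -
    have "k div 2 = 0" using k by simp
    then have "{a \<in> B. is_cup a} = {}" using c0 good_diagram_finite(1)[OF g] by simp
    then have ray: "\<exists>r. a = Ray r" if "a \<in> B" for a using that by (cases a) (auto simp: is_cup_def)
    have wf: "\<forall>a\<in>B. wf_arc m a" and cov: "\<forall>v\<in>{1..m}. \<exists>a\<in>B. v \<in> ends a"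
      using g unfolding good_diagram_def by blast+
    have 1: "B \<subseteq> A"
    proof
      fix a assume a: "a \<in> B"
      then obtain r where "a = Ray r" using ray by blast
      moreover have "wf_arc m a" using wf a by blast
      ultimately show "a \<in> A" by (simp add: A_def)
    qed
    have 2: "A \<subseteq> B"
    proof
      fix a assume "a \<in> A"
      then obtain r where r: "a = Ray r" "r \<in> {1..m}" by (auto simp: A_def)
      then obtain b where b: "b \<in> B" "r \<in> ends b" using cov by blast
      then obtain s where "b = Ray s" using ray by blast
      then show "a \<in> B" using b r by simp
    qed
    show ?thesis using 1 2 by blast
  qed
  have mem: "Ray s \<in> A \<longleftrightarrow> 1 \<le> s \<and> s \<le> m" "Cup u v \<notin> A" for s u v by (auto simp: A_def)
  have out: "outer A a \<longleftrightarrow> a = Ray m" if a: "a \<in> A" for a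
  proof -
    obtain r where r: "a = Ray r" "1 \<le> r" "r \<le> m" using a unfolding A_def by auto
    show ?thesis
    proof
      assume "outer A a"
      then have "\<And>s. Ray s \<in> A \<Longrightarrow> s \<le> r" unfolding outer_def r(1) by simp
      moreover have "Ray m \<in> A" using mem(1) r by simp
      ultimately have "m \<le> r" by blast
      then show "a = Ray m" using r by simp
    next
      assume "a = Ray m"
      then show "outer A a" unfolding outer_def by (simp add: mem)
    qed
  qed
  have nc: "noncrossing A" unfolding noncrossing_def by (simp add: mem)
  have wf: "\<forall>a\<in>A. wf_arc m a" unfolding A_def by simp
  have cov: "\<forall>v\<in>{1..m}. \<exists>a\<in>A. v \<in> ends a"
  proof
    fix v assume "v \<in> {1..m}"
    then have "Ray v \<in> A" "v \<in> ends (Ray v)" unfolding A_def by simp_all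
    then show "\<exists>a\<in>A. v \<in> ends a" by blast
  qed
  have gD: "good_diagram m A D \<longleftrightarrow> D = {} \<or> (D = {Ray m} \<and> m \<noteq> 0)" for D
  proof
    assume g: "good_diagram m A D"
    then have DA: "D \<subseteq> A" "\<forall>a\<in>D. outer A a" unfolding good_diagram_def by simp_all
    then have "\<forall>a\<in>D. a = Ray m" using out by (meson subsetD)
    then have "D \<subseteq> {Ray m}" by auto
    moreover have "m \<noteq> 0" if "Ray m \<in> D" using DA(1) that mem(1)[of m] by (meson not_one_le_zero subsetD)
    ultimately show "D = {} \<or> (D = {Ray m} \<and> m \<noteq> 0)" by (metis insertI1 subset_singletonD)
  next
    assume "D = {} \<or> (D = {Ray m} \<and> m \<noteq> 0)"
    moreover have "Ray m \<in> A" if "m \<noteq> 0" using that mem(1)[of m] by simp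
    ultimately have "D \<subseteq> A" "\<forall>a\<in>D. outer A a" using out[of "Ray m"] by (metis empty_subsetI insert_subset, metis empty_iff singletonD)
    then show "good_diagram m A D" unfolding good_diagram_def using nc wf cov by simp
  qed
  have cA: "card {a \<in> A. is_cup a} = k div 2"
  proof -
    have "{a \<in> A. is_cup a} = {}" by (auto simp: A_def)
    moreover have "k div 2 = 0" using k by simp
    ultimately show ?thesis by (simp only: card.empty)
  qed
  have rm: "rightmost_ray A r \<longleftrightarrow> r = m \<and> m \<noteq> 0" for r
  proof
    assume r: "rightmost_ray A r"
    then have "1 \<le> r" "r \<le> m" using mem(1)[of r] unfolding rightmost_ray_def by simp_all
    moreover have "m \<le> r" using r mem(1)[of m] calculation unfolding rightmost_ray_def by simp
    ultimately show "r = m \<and> m \<noteq> 0" by linarith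
  next
    assume "r = m \<and> m \<noteq> 0"
    then show "rightmost_ray A r" unfolding rightmost_ray_def by (simp add: mem)
  qed
  have "x \<in> S_par c m k \<longleftrightarrow> (\<exists>D. (D = {} \<or> (D = {Ray m} \<and> m \<noteq> 0)) \<and> odd (card D) = c \<and> x \<in> S_cup m (A, D))"
  proof
    assume "x \<in> S_par c m k"
    then obtain B D where B: "good_diagram m B D" "card {a \<in> B. is_cup a} = k div 2" "odd (card D) = c" "x \<in> S_cup m (B, D)"
      unfolding S_par_iff by blast
    then show "\<exists>D. (D = {} \<or> (D = {Ray m} \<and> m \<noteq> 0)) \<and> odd (card D) = c \<and> x \<in> S_cup m (A, D)"
      using gA[OF B(1,2)] gD by blast
  next
    assume "\<exists>D. (D = {} \<or> (D = {Ray m} \<and> m \<noteq> 0)) \<and> odd (card D) = c \<and> x \<in> S_cup m (A, D)"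
    then show "x \<in> S_par c m k" unfolding S_par_iff using gD cA by blast
  qed
  then have eq: "x \<in> S_par c m k \<longleftrightarrow> (\<exists>D. ((D = {} \<or> (D = {Ray m} \<and> m \<noteq> 0)) \<and> odd (card D) = c) \<and> x \<in> S_cup m (A, D))"
    unfolding conj_assoc .
  have q: "((D = {} \<or> (D = {Ray m} \<and> m \<noteq> 0)) \<and> odd (card D) = c) = ((m = 0 \<longrightarrow> \<not> c) \<and> D = Dt)" for D
  proof (cases c)
    case True
    then show ?thesis by (auto simp: Dt_def)
  next
    case False
    then show ?thesis by (auto simp: Dt_def)
  qed
  have 1: "x \<in> S_par c m k \<longleftrightarrow> (m = 0 \<longrightarrow> \<not> c) \<and> x \<in> S_cup m (A, Dt)"
    unfolding eq q by simp
  have 2: "x \<in> S_cup m (A, Dt) \<longleftrightarrow> x = (\<lambda>i\<in>{1..m}. if i < m then q_pt else if c then p_pt else - p_pt)" if "m = 0 \<longrightarrow> \<not> c"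
  proof -
    have pq: "norm p_pt = 1" "norm q_pt = 1"
      by (simp_all add: p_pt_def q_pt_def norm_eq_1 inner_vec_def sum_3 vector_3)
    have "x \<in> S_cup m (A, Dt) \<longleftrightarrow> x \<in> {1..m} \<rightarrow>\<^sub>E sphere 0 1 \<and>
      (\<forall>i\<in>{1..m}. x i = (if Ray i \<in> Dt then p_pt else if i = m then - p_pt else q_pt))"
    proof -
      have "(\<forall>i. Ray i \<in> A \<longrightarrow> P i) \<longleftrightarrow> (\<forall>i\<in>{1..m}. P i)" for P unfolding mem(1) by auto
      moreover have "(if Ray i \<in> Dt then p_pt else if i = m \<and> m \<noteq> 0 then - p_pt else q_pt) =
        (if Ray i \<in> Dt then p_pt else if i = m then - p_pt else q_pt)" if "i \<in> {1..m}" for i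
        using that by simp
      ultimately show ?thesis
        unfolding S_cup_def prod.case mem_Collect_eq rm by (simp add: mem(2))
    qed
    moreover have "\<dots> \<longleftrightarrow> x = (\<lambda>i\<in>{1..m}. if i < m then q_pt else if c then p_pt else - p_pt)"
    proof -
      define e where "e i = (if i < m then q_pt else if c then p_pt else - p_pt)" for i
      have "(if Ray i \<in> Dt then p_pt else if i = m then - p_pt else q_pt) = e i" if "i \<in> {1..m}" for i
        using that unfolding Dt_def e_def by (cases "i = m"; cases c) simp_all
      then have "(\<forall>i\<in>{1..m}. x i = (if Ray i \<in> Dt then p_pt else if i = m then - p_pt else q_pt)) \<longleftrightarrow>
        (\<forall>i\<in>{1..m}. x i = e i)" by (intro ball_cong refl) simp
      moreover have "x \<in> {1..m} \<rightarrow>\<^sub>E sphere 0 1 \<and> (\<forall>i\<in>{1..m}. x i = e i) \<longleftrightarrow> x = restrict e {1..m}"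
        using pq by (intro PiE_fixed_iff[of "{1..m}" e "sphere 0 1" x]) (simp add: e_def)
      moreover have "restrict e {1..m} = (\<lambda>i\<in>{1..m}. if i < m then q_pt else if c then p_pt else - p_pt)"
        by (rule restrict_ext) (simp only: e_def)
      ultimately show ?thesis by (simp only:)
    qed
    ultimately show ?thesis by (rule trans)
  qed
  show ?thesis unfolding 1
  proof
    assume *: "(m = 0 \<longrightarrow> \<not> c) \<and> x \<in> S_cup m (A, Dt)"
    show "x = (\<lambda>i\<in>{1..m}. if i < m then q_pt else if c then p_pt else - p_pt) \<and> (m = 0 \<longrightarrow> \<not> c)"
      using 2[OF conjunct1[OF *]] * by (elim conjE, intro conjI) (rule iffD1)
  next
    assume *: "x = (\<lambda>i\<in>{1..m}. if i < m then q_pt else if c then p_pt else - p_pt) \<and> (m = 0 \<longrightarrow> \<not> c)"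
    show "(m = 0 \<longrightarrow> \<not> c) \<and> x \<in> S_cup m (A, Dt)"
      using iffD2[OF 2[OF conjunct2[OF *]] conjunct1[OF *]] conjunct2[OF *] by (rule conjI[rotated])
  qed
qed

lemma dotted_ray_rightmost:
  assumes "good_diagram m A D" "Ray i \<in> D"
  shows "rightmost_ray A i"
  using assms by (fastforce simp: good_diagram_def outer_def rightmost_ray_def)

subsection \<open>The hermitian form\<close>

type_synonym 'd hspace = "complex ^ ('d + 'd)"

lemma herm_add_left: "herm (u + v) w = herm u w + herm v w"
  by (simp add: herm_def algebra_simps sum.distrib)

lemma herm_add_right: "herm u (v + w) = herm u v + herm u w"
  by (simp add: herm_def algebra_simps sum.distrib)

lemma herm_scale_left: "herm (c *s v) w = c * herm v w"
  by (simp add: herm_def sum_distrib_left mult.assoc)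

lemma herm_scale_right: "herm v (c *s w) = cnj c * herm v w"
  by (simp add: herm_def sum_distrib_left mult.assoc mult.left_commute)

lemma herm_diff_left: "herm (u - v) w = herm u w - herm v w"
  by (simp add: herm_def algebra_simps sum_subtractf)

lemma herm_diff_right: "herm u (v - w) = herm u v - herm u w"
  by (simp add: herm_def algebra_simps sum_subtractf)

lemma herm_zero [simp]: "herm 0 w = 0" "herm w 0 = 0"
  by (simp_all add: herm_def)

lemma herm_minus [simp]: "herm (- v) w = - herm v w" "herm w (- v) = - herm w v"
  by (simp_all add: herm_def sum_negf)

lemmas herm_simps = herm_add_left herm_add_right herm_diff_left herm_diff_right herm_scale_left herm_scale_right

lemma herm_commute: "herm w v = cnj (herm v w)"
  by (simp add: herm_def cnj_sum mult.commute)

lemma cnj_herm: "cnj (herm v w) = herm w v"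
  using herm_commute[of w v] by simp

lemma Re_herm: "Re (herm v w) = inner v w"
  by (simp add: herm_def inner_vec_def inner_complex_def Re_sum)

lemma herm_self: "herm v v = of_real ((norm v)\<^sup>2)"
proof (rule complex_eqI)
  show "Im (herm v v) = Im (complex_of_real ((norm v)\<^sup>2))"
    by (simp add: herm_def Im_sum mult.commute)
qed (simp add: Re_herm power2_norm_eq_inner)

lemma herm_self_eq_0 [simp]: "herm v v = 0 \<longleftrightarrow> v = 0"
  by (simp add: herm_self)

lemma herm_2: "herm u (v :: complex ^ 2) = u $ 1 * cnj (v $ 1) + u $ 2 * cnj (v $ 2)"
  by (simp add: herm_def sum_2)

lemma herm_eq_0_commute: "herm v w = 0 \<longleftrightarrow> herm w v = 0"
  by (metis complex_cnj_zero_iff herm_commute)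

lemma herm_axis: "herm v (axis b 1) = v $ b"
proof -
  have "herm v (axis b 1) = (\<Sum>i\<in>UNIV. if i = b then v $ i else 0)"
    unfolding herm_def axis_def by (intro sum.cong) auto
  then show ?thesis by simp
qed

lemma herm_span:
  assumes "\<And>w. w \<in> S \<Longrightarrow> herm v w = 0" "w \<in> vec.span S"
  shows "herm v w = 0"
proof -
  have "vec.subspace {w. herm v w = 0}" by (auto simp: vec.subspace_def herm_simps)
  then have "vec.span S \<subseteq> {w. herm v w = 0}" using assms(1) by (intro vec.span_minimal) auto
  then show ?thesis using assms(2) by blast
qed

lemma normalize_vec:
  fixes u :: "complex ^ 'n"
  assumes "u \<noteq> 0"
  obtains c a where "c \<noteq> 0" "u = c *s a" "herm a a = 1"
proof
  define r where "r = complex_of_real (norm u)"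
  have r: "r \<noteq> 0" using assms by (simp add: r_def)
  show "r \<noteq> 0" by (rule r)
  show "u = r *s (inverse r *s u)" using r by simp
  have "herm u u = r * cnj r" by (simp add: herm_self r_def power2_eq_square)
  then have "herm (inverse r *s u) (inverse r *s u) = (inverse r * r) * (cnj (inverse r) * cnj r)"
    by (simp add: herm_simps)
  then show "herm (inverse r *s u) (inverse r *s u) = 1" using r by (simp add: herm_simps)
qed

subsection \<open>Coordinates\<close>

lemma idx_bij: "bij_betw (idx :: nat \<Rightarrow> 'd::finite) {1..CARD('d)} UNIV"
proof -
  have "bij_betw (from_nat_into (UNIV :: 'd set)) {..<CARD('d)} UNIV"
    by (rule bij_betw_from_nat_into_finite) simp
  moreover have "bij_betw (\<lambda>i. i - 1) {1..CARD('d)} {..<CARD('d)}"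
    by (rule bij_betwI[where g = Suc]) auto
  ultimately have "bij_betw (from_nat_into (UNIV :: 'd set) \<circ> (\<lambda>i. i - 1)) {1..CARD('d)} UNIV"
    by (rule bij_betw_trans[rotated])
  then show ?thesis by (simp add: idx_def[abs_def] comp_def)
qed

definition pos :: "'d::finite \<Rightarrow> nat" where "pos = inv_into {1..CARD('d)} idx"

lemma idx_pos [simp]: "idx (pos d) = d"
  unfolding pos_def using idx_bij by (metis UNIV_I bij_betw_def f_inv_into_f)

lemma pos_range: "1 \<le> pos (d :: 'd::finite)" "pos d \<le> CARD('d)"
proof -
  have "pos d \<in> {1..CARD('d)}"
    unfolding pos_def using idx_bij by (metis UNIV_I bij_betw_def inv_into_into)
  then show "1 \<le> pos d" "pos d \<le> CARD('d)" by auto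
qed

lemma pos_idx [simp]: "1 \<le> i \<Longrightarrow> i \<le> CARD('d) \<Longrightarrow> pos (idx i :: 'd::finite) = i"
  unfolding pos_def using idx_bij by (metis atLeastAtMost_iff bij_betw_def inv_into_f_f)

lemma idx_eq_iff: "1 \<le> i \<Longrightarrow> i \<le> CARD('d) \<Longrightarrow> 1 \<le> j \<Longrightarrow> j \<le> CARD('d) \<Longrightarrow>
    (idx i :: 'd::finite) = idx j \<longleftrightarrow> i = j"
  by (metis pos_idx)

lemma idx_eq_first:
  assumes "Suc 0 \<le> i" "i \<le> CARD('d)"
  shows "(idx i :: 'd::finite) = idx (Suc 0) \<longleftrightarrow> i = Suc 0"
  using assms by (intro idx_eq_iff) auto

definition labels :: "nat \<Rightarrow> nat \<Rightarrow> (nat + nat) set" where "labels r s = {1..r} <+> {1..s}"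

definition height :: "nat + nat \<Rightarrow> nat" where "height a = case_sum id id a"

definition next_label :: "nat + nat \<Rightarrow> nat + nat" where "next_label = map_sum Suc Suc"

lemma label_simps [simp]:
  "height (Inl i) = i" "height (Inr i) = i"
  "next_label (Inl i) = Inl (Suc i)" "next_label (Inr i) = Inr (Suc i)"
  "Inl i \<in> labels r s \<longleftrightarrow> 1 \<le> i \<and> i \<le> r" "Inr i \<in> labels r s \<longleftrightarrow> 1 \<le> i \<and> i \<le> s"
  by (auto simp: height_def next_label_def labels_def)

lemma finite_labels [simp]: "finite (labels r s)"
  by (simp add: labels_def)

lemma coordinate_simps [simp]:
  "coordinate v (Inl i) = v $ Inl (idx i)" "coordinate v (Inr i) = v $ Inr (idx i)"
  by (simp_all add: coordinate_def)

lemma vec_eqI_coordinate: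
  fixes v w :: "('d::finite) hspace"
  assumes "\<And>i. 1 \<le> i \<Longrightarrow> i \<le> CARD('d) \<Longrightarrow> v $ Inl (idx i) = w $ Inl (idx i)"
    and "\<And>i. 1 \<le> i \<Longrightarrow> i \<le> CARD('d) \<Longrightarrow> v $ Inr (idx i) = w $ Inr (idx i)"
  shows "v = w"
proof (rule vec_eq_iff[THEN iffD2, rule_format])
  fix a :: "'d + 'd"
  show "v $ a = w $ a"
    using assms[of "pos (projl a)"] assms[of "pos (projr a)"]
      pos_range[of "projl a"] pos_range[of "projr a"] by (cases a) auto
qed

lemma sum_UNIV_labels:
  "(\<Sum>a\<in>(UNIV :: ('d::finite + 'd) set). f a) = (\<Sum>i=1..CARD('d). f (Inl (idx i))) + (\<Sum>i=1..CARD('d). f (Inr (idx i)))"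
proof -
  have "(\<Sum>a\<in>(UNIV :: ('d + 'd) set). f a) = (\<Sum>d\<in>UNIV. f (Inl d)) + (\<Sum>d\<in>UNIV. f (Inr d))"
    by (simp add: UNIV_Plus_UNIV[symmetric] sum.Plus del: UNIV_Plus_UNIV)
  also have "(\<Sum>d\<in>UNIV. f (Inl d)) = (\<Sum>i=1..CARD('d). f (Inl (idx i)))"
    using sum.reindex_bij_betw[OF idx_bij, of "\<lambda>d. f (Inl d)"] by simp
  also have "(\<Sum>d\<in>UNIV. f (Inr d)) = (\<Sum>i=1..CARD('d). f (Inr (idx i)))"
    using sum.reindex_bij_betw[OF idx_bij, of "\<lambda>d. f (Inr d)"] by simp
  finally show ?thesis .
qed

lemma herm_coordinates:
  fixes v w :: "('d::finite) hspace"
  shows "herm v w = (\<Sum>i=1..CARD('d). v $ Inl (idx i) * cnj (w $ Inl (idx i))) +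
    (\<Sum>i=1..CARD('d). v $ Inr (idx i) * cnj (w $ Inr (idx i)))"
  unfolding herm_def by (rule sum_UNIV_labels)

text \<open>The shift \<open>e_vec i\<close> to \<open>e_vec (i + 1)\<close> and
  \<open>f_vec i\<close> to \<open>f_vec (i + 1)\<close>, killing the topmost pair. It is the
  adjoint of \<open>nilp\<close>, and a right inverse of it away from the top.\<close>

definition up :: "('d::finite) hspace \<Rightarrow> 'd hspace" where
  "up v = (\<chi> a. case a of
     Inl d \<Rightarrow> if 2 \<le> pos d then v $ Inl (idx (pos d - 1)) else 0
   | Inr d \<Rightarrow> if 2 \<le> pos d then v $ Inr (idx (pos d - 1)) else 0)"

lemma up_nth [simp]:
  fixes v :: "('d::finite) hspace"
  assumes "1 \<le> i" "i \<le> CARD('d)"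
  shows "up v $ Inl (idx i) = (if 2 \<le> i then v $ Inl (idx (i - 1)) else 0)"
    "up v $ Inr (idx i) = (if 2 \<le> i then v $ Inr (idx (i - 1)) else 0)"
  using assms by (simp_all add: up_def)

lemma e_vec_nth:
  fixes d :: "'d::finite"
  shows "(e_vec j :: 'd hspace) $ Inl d = (if d = idx j then 1 else 0)" "(e_vec j :: 'd hspace) $ Inr d = 0"
    "(f_vec j :: 'd hspace) $ Inr d = (if d = idx j then 1 else 0)" "(f_vec j :: 'd hspace) $ Inl d = 0"
  by (auto simp: e_vec_def f_vec_def axis_def)

lemma e_vec_other [simp]:
  "(e_vec j :: ('d::finite) hspace) $ Inr d = 0" "(f_vec j :: 'd hspace) $ Inl d = 0"
  by (simp_all add: e_vec_nth)

lemma e_vec_idx [simp]: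
  assumes "1 \<le> i" "i \<le> CARD('d)"
  shows "(e_vec (Suc 0) :: ('d::finite) hspace) $ Inl (idx i) = (if i = 1 then 1 else 0)"
    "(f_vec (Suc 0) :: 'd hspace) $ Inr (idx i) = (if i = 1 then 1 else 0)"
  using assms idx_eq_first[of i] by (auto simp: e_vec_nth)

lemma nilp_nth [simp]:
  fixes v :: "('d::finite) hspace"
  assumes "1 \<le> i" "i \<le> CARD('d)"
  shows "nilp v $ Inl (idx i) = (if i < CARD('d) then v $ Inl (idx (Suc i)) else 0)" (is ?l)
    "nilp v $ Inr (idx i) = (if i < CARD('d) then v $ Inr (idx (Suc i)) else 0)" (is ?r)
proof -
  have eq: "idx i = (idx (j - 1) :: 'd) \<longleftrightarrow> j = Suc i" if "j \<in> {2..CARD('d)}" for j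
  proof -
    have "1 \<le> j - 1" "j - 1 \<le> CARD('d)" "i = j - 1 \<longleftrightarrow> j = Suc i" using that by auto
    then show ?thesis using idx_eq_iff[where 'd = 'd, of i "j - 1"] assms by blast
  qed
  have "nilp v $ Inl (idx i) = (\<Sum>j=2..CARD('d). if j = Suc i then v $ Inl (idx (Suc i)) else 0)"
    unfolding nilp_def sum_component by (intro sum.cong refl) (simp add: eq e_vec_nth del: One_nat_def)
  then show ?l using assms by simp
  have "nilp v $ Inr (idx i) = (\<Sum>j=2..CARD('d). if j = Suc i then v $ Inr (idx (Suc i)) else 0)"
    unfolding nilp_def sum_component by (intro sum.cong refl) (simp add: eq e_vec_nth del: One_nat_def)
  then show ?r using assms by simp
qed

lemma nilp_add: "nilp (v + w) = nilp v + nilp w"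
  and nilp_scale: "nilp (c *s v) = c *s nilp v"
  and nilp_diff: "nilp (v - w) = nilp v - nilp w"
  and up_add: "up (v + w) = up v + up w"
  and up_scale: "up (c *s v) = c *s up v"
  by (rule vec_eqI_coordinate; simp)+

lemma nilp_0 [simp]: "nilp 0 = 0" and up_0 [simp]: "up 0 = 0"
  by (rule vec_eqI_coordinate; simp)+

lemma herm_up: "herm (up v) w = herm v (nilp w)"
proof -
  have shift: "(\<Sum>i=1..n. (if 2 \<le> i then f (i - 1) else 0) * cnj (g i)) =
      (\<Sum>i=1..n. f i * cnj (if i < n then g (Suc i) else 0))" for f g :: "nat \<Rightarrow> complex" and n
  proof -
    have "(\<Sum>i=1..n. (if 2 \<le> i then f (i - 1) else 0) * cnj (g i)) = (\<Sum>i\<in>{2..n}. f (i - 1) * cnj (g i))"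
      by (rule sum.mono_neutral_cong_right) auto
    also have "\<dots> = (\<Sum>i\<in>{1..<n}. f i * cnj (g (Suc i)))"
      by (rule sum.reindex_bij_witness[where i = Suc and j = "\<lambda>i. i - 1"]) auto
    also have "\<dots> = (\<Sum>i=1..n. f i * cnj (if i < n then g (Suc i) else 0))"
      by (rule sum.mono_neutral_cong_left) auto
    finally show ?thesis .
  qed
  have "herm (up v) w = (\<Sum>i=1..CARD('a). (if 2 \<le> i then v $ Inl (idx (i - 1)) else 0) * cnj (w $ Inl (idx i))) +
    (\<Sum>i=1..CARD('a). (if 2 \<le> i then v $ Inr (idx (i - 1)) else 0) * cnj (w $ Inr (idx i)))"
    unfolding herm_coordinates by (intro arg_cong2[of _ _ _ _ "(+)"] sum.cong refl) auto
  also have "\<dots> = (\<Sum>i=1..CARD('a). v $ Inl (idx i) * cnj (if i < CARD('a) then w $ Inl (idx (Suc i)) else 0)) +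
    (\<Sum>i=1..CARD('a). v $ Inr (idx i) * cnj (if i < CARD('a) then w $ Inr (idx (Suc i)) else 0))"
    unfolding shift[of "\<lambda>i. v $ Inl (idx i)"] shift[of "\<lambda>i. v $ Inr (idx i)"] ..
  also have "\<dots> = herm v (nilp w)"
    unfolding herm_coordinates by (intro arg_cong2[of _ _ _ _ "(+)"] sum.cong refl) auto
  finally show ?thesis .
qed

text \<open>Membership in the span of the first \<open>j\<close> vectors of each kind. For
  \<open>j < CARD('d)\<close> nothing is lost by \<open>up\<close>; this is where the large
  dimension of the space is needed.\<close>

definition low :: "nat \<Rightarrow> ('d::finite) hspace \<Rightarrow> bool" where
  "low j v \<longleftrightarrow> (\<forall>i. j < i \<longrightarrow> i \<le> CARD('d) \<longrightarrow> v $ Inl (idx i) = 0 \<and> v $ Inr (idx i) = 0)"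

lemma low_simps: "low j v \<Longrightarrow> low j w \<Longrightarrow> low j (v + w)" "low j v \<Longrightarrow> low j (c *s v)" "low j 0"
  by (auto simp: low_def)

lemma low_mono: "low i v \<Longrightarrow> i \<le> j \<Longrightarrow> low j v"
  by (auto simp: low_def)

lemma low_up: "low j v \<Longrightarrow> low (Suc j) (up v)"
  by (auto simp: low_def)

lemma nilp_up:
  assumes "low j (v :: ('d::finite) hspace)" "j < CARD('d)"
  shows "nilp (up v) = v"
  by (rule vec_eqI_coordinate) (use assms in \<open>auto simp: low_def\<close>)

lemma nilp_eq_0:
  fixes v :: "('d::finite) hspace"
  assumes "nilp v = 0"
  shows "v = (v $ Inl (idx 1)) *s e_vec 1 + (v $ Inr (idx 1)) *s f_vec 1"
proof (rule vec_eqI_coordinate)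
  fix i assume i: "1 \<le> i" "i \<le> CARD('d)"
  have 2: "v $ Inl (idx i) = 0" "v $ Inr (idx i) = 0" if "i \<noteq> 1"
  proof -
    obtain j where j: "i = Suc j" using i by (cases i) auto
    then show "v $ Inl (idx i) = 0" "v $ Inr (idx i) = 0" using nilp_nth[of j v] i that assms by auto
  qed
  have "v $ Inl (idx i) = (v $ Inl (idx 1) *s e_vec 1 + v $ Inr (idx 1) *s f_vec 1 :: 'd hspace) $ Inl (idx i) \<and>
    v $ Inr (idx i) = (v $ Inl (idx 1) *s e_vec 1 + v $ Inr (idx 1) *s f_vec 1 :: 'd hspace) $ Inr (idx i)"
    using 2 i by (cases "i = 1") simp_all
  then show "v $ Inl (idx i) = (v $ Inl (idx 1) *s e_vec 1 + v $ Inr (idx 1) *s f_vec 1 :: 'd hspace) $ Inl (idx i)"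
    "v $ Inr (idx i) = (v $ Inl (idx 1) *s e_vec 1 + v $ Inr (idx 1) *s f_vec 1 :: 'd hspace) $ Inr (idx i)" by blast+
qed

lemma nilp_first [simp]: "nilp (e_vec 1 :: ('d::finite) hspace) = 0" "nilp (f_vec 1 :: ('d::finite) hspace) = 0"
  by (rule vec_eqI_coordinate; simp add: idx_eq_iff)+

lemma C_map_nth:
  fixes v :: "('d::finite) hspace"
  shows "C_map v $ 1 = (\<Sum>i=1..CARD('d). v $ Inl (idx i))" "C_map v $ 2 = (\<Sum>i=1..CARD('d). v $ Inr (idx i))"
  unfolding C_map_def sum_component by (simp_all add: e2_def f2_def axis_def)

lemma vec2_eqI: "u $ 1 = v $ 1 \<Longrightarrow> u $ 2 = v $ 2 \<Longrightarrow> u = (v :: complex ^ 2)"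
  by (simp add: vec_eq_iff forall_2)

lemma C_map_add: "C_map (v + w) = C_map v + C_map w"
  and C_map_scale: "C_map (c *s v) = c *s C_map v"
  by (rule vec2_eqI; simp add: C_map_nth sum.distrib sum_distrib_left)+

lemma C_map_up:
  assumes "low j (v :: ('d::finite) hspace)" "j < CARD('d)"
  shows "C_map (up v) = C_map v"
proof -
  have shift: "(\<Sum>i=1..n. (if 2 \<le> i then f (i - 1) else 0)) = (\<Sum>i=1..n. f i)"
    if "f n = 0" "n > 0" for f :: "nat \<Rightarrow> complex" and n
  proof -
    have "(\<Sum>i=1..n. (if 2 \<le> i then f (i - 1) else 0)) = (\<Sum>i\<in>{2..n}. f (i - 1))"
      by (rule sum.mono_neutral_cong_right) auto
    also have "\<dots> = (\<Sum>i\<in>{1..<n}. f i)"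
      by (rule sum.reindex_bij_witness[where i = Suc and j = "\<lambda>i. i - 1"]) auto
    also have "\<dots> = (\<Sum>i=1..n. f i)"
      using that by (intro sum.mono_neutral_left) (auto simp: le_less)
    finally show ?thesis .
  qed
  have "v $ Inl (idx CARD('d)) = 0" "v $ Inr (idx CARD('d)) = 0" using assms by (auto simp: low_def)
  then have "(\<Sum>i=1..CARD('d). if 2 \<le> i then v $ Inl (idx (i - 1)) else 0) = C_map v $ 1"
    "(\<Sum>i=1..CARD('d). if 2 \<le> i then v $ Inr (idx (i - 1)) else 0) = C_map v $ 2"
    unfolding C_map_nth by (intro shift; simp)+
  moreover have "C_map (up v) $ 1 = (\<Sum>i=1..CARD('d). if 2 \<le> i then v $ Inl (idx (i - 1)) else 0)"
    "C_map (up v) $ 2 = (\<Sum>i=1..CARD('d). if 2 \<le> i then v $ Inr (idx (i - 1)) else 0)"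
    unfolding C_map_nth by (intro sum.cong refl; simp)+
  ultimately show ?thesis by (intro vec2_eqI) simp_all
qed

subsection \<open>Flags from sequences of unit vectors in the plane\<close>

text \<open>For a unit vector \<open>a\<close> this is the orthogonal projection onto its line. So
  \<open>pj a = pj b\<close> says that two unit vectors span the same line, whatever their
  phases.\<close>

definition pj :: "complex ^ 2 \<Rightarrow> complex ^ 2 \<Rightarrow> complex ^ 2" where "pj a u = herm u a *s a"

lemma pj_add: "pj a (u + v) = pj a u + pj a v"
  and pj_scale: "pj a (c *s u) = c *s pj a u"
  and pj_diff: "pj a (u - v) = pj a u - pj a v"
  by (simp_all add: pj_def herm_simps vec.scale_left_distrib vec.scale_left_diff_distrib)

lemma pj_self: "herm a a = 1 \<Longrightarrow> pj a a = a" and pj_idem: "herm a a = 1 \<Longrightarrow> pj a (pj a u) = pj a u"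
  by (simp_all add: pj_def herm_simps)

text \<open>The coordinates of the next step of a flag: \<open>Bm a i\<close> embeds the plane as
  the orthogonal complement of \<open>Fs a i\<close> in its preimage under \<open>nilp\<close>, and
  \<open>C_map\<close> inverts it. At stage \<open>Suc i\<close> the direction
  \<open>a (Suc i)\<close> has been used up by the flag, so its component moves one level up; the
  orthogonal component is still free and stays.\<close>

primrec Bm :: "(nat \<Rightarrow> complex ^ 2) \<Rightarrow> nat \<Rightarrow> complex ^ 2 \<Rightarrow> ('d::finite) hspace" where
  "Bm a 0 u = u $ 1 *s e_vec 1 + u $ 2 *s f_vec 1"
| "Bm a (Suc i) u = up (Bm a i (pj (a (Suc i)) u)) + Bm a i (u - pj (a (Suc i)) u)"

text \<open>The unit vector spanning the part of the \<open>j\<close>-th subspace orthogonal to the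
  previous one; \<open>C_map\<close> sends it to \<open>a j\<close>.\<close>

definition wv :: "(nat \<Rightarrow> complex ^ 2) \<Rightarrow> nat \<Rightarrow> ('d::finite) hspace" where
  "wv a j = Bm a (j - 1) (a j)"

definition Fs :: "(nat \<Rightarrow> complex ^ 2) \<Rightarrow> nat \<Rightarrow> ('d::finite) hspace set" where
  "Fs a i = vec.span (wv a ` {1..i})"

definition units :: "(nat \<Rightarrow> complex ^ 2) \<Rightarrow> nat \<Rightarrow> bool" where
  "units a n \<longleftrightarrow> (\<forall>i\<in>{1..n}. herm (a i) (a i) = 1)"

lemma units_mono: "units a n \<Longrightarrow> i \<le> n \<Longrightarrow> units a i"
  by (auto simp: units_def)

lemma units_nth: "units a n \<Longrightarrow> 1 \<le> i \<Longrightarrow> i \<le> n \<Longrightarrow> herm (a i) (a i) = 1"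
  by (auto simp: units_def)

lemma Bm_add: "Bm a i (u + v) = (Bm a i u + Bm a i v :: ('d::finite) hspace)"
proof (induction i arbitrary: u v)
  case 0
  then show ?case by (simp add: vec.scale_left_distrib)
next
  case (Suc i)
  have "u + v - pj (a (Suc i)) (u + v) = (u - pj (a (Suc i)) u) + (v - pj (a (Suc i)) v)"
    by (simp add: pj_add)
  then have "Bm a i (u + v - pj (a (Suc i)) (u + v)) = Bm a i (u - pj (a (Suc i)) u) + (Bm a i (v - pj (a (Suc i)) v) :: 'd hspace)"
    by (simp only: Suc.IH)
  moreover have "up (Bm a i (pj (a (Suc i)) (u + v))) = up (Bm a i (pj (a (Suc i)) u)) + (up (Bm a i (pj (a (Suc i)) v)) :: 'd hspace)"
    by (simp only: pj_add Suc.IH up_add)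
  ultimately show ?case by (simp only: Bm.simps) (simp add: algebra_simps)
qed

lemma Bm_scale: "Bm a i (c *s u) = (c *s Bm a i u :: ('d::finite) hspace)"
proof (induction i arbitrary: u)
  case 0
  then show ?case by (simp add: vec.scale_right_distrib)
next
  case (Suc i)
  have "c *s u - pj (a (Suc i)) (c *s u) = c *s (u - pj (a (Suc i)) u)"
    by (simp add: pj_scale vec.scale_right_diff_distrib)
  then have "Bm a i (c *s u - pj (a (Suc i)) (c *s u)) = (c *s Bm a i (u - pj (a (Suc i)) u) :: 'd hspace)"
    by (simp only: Suc.IH)
  moreover have "up (Bm a i (pj (a (Suc i)) (c *s u))) = (c *s up (Bm a i (pj (a (Suc i)) u)) :: 'd hspace)"
    by (simp only: pj_scale Suc.IH up_scale)
  ultimately show ?case by (simp only: Bm.simps) (simp add: vec.scale_right_distrib)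
qed

lemma Bm_0 [simp]: "Bm a i 0 = (0 :: ('d::finite) hspace)"
  using Bm_scale[where 'd = 'd, of a i 0 0] by simp

lemma Bm_diff: "Bm a i (u - v) = (Bm a i u - Bm a i v :: ('d::finite) hspace)"
  using Bm_add[where 'd = 'd, of a i "u - v" v] by (simp add: algebra_simps)

lemma low_Bm: "low (Suc i) (Bm a i u :: ('d::finite) hspace)"
proof (induction i arbitrary: u)
  case 0
  then show ?case by (auto simp: low_def idx_eq_iff)
next
  case (Suc i)
  show ?case
    unfolding Bm.simps(2) using low_mono[OF Suc[of "u - pj (a (Suc i)) u"], of "Suc (Suc i)"]
    by (intro low_simps(1) low_up Suc) simp
qed

lemma Fs_0 [simp]: "Fs a 0 = {0}"
  by (simp add: Fs_def)

lemma subspace_Fs [simp]: "vec.subspace (Fs a i)"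
  by (simp add: Fs_def)

lemma Fs_mono: "i \<le> j \<Longrightarrow> Fs a i \<subseteq> Fs a j"
  unfolding Fs_def by (intro vec.span_mono) auto

lemma Fs_add: "v \<in> Fs a i \<Longrightarrow> w \<in> Fs a i \<Longrightarrow> v + w \<in> Fs a i"
  and Fs_diff: "v \<in> Fs a i \<Longrightarrow> w \<in> Fs a i \<Longrightarrow> v - w \<in> Fs a i"
  and Fs_scale: "v \<in> Fs a i \<Longrightarrow> c *s v \<in> Fs a i"
  and Fs_zero [simp]: "0 \<in> Fs a i"
  by (simp_all add: vec.subspace_add vec.subspace_diff vec.subspace_scale vec.subspace_0)

lemma wv_in_Fs: "1 \<le> j \<Longrightarrow> j \<le> i \<Longrightarrow> wv a j \<in> Fs a i"
  unfolding Fs_def by (intro vec.span_base) auto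

lemma wv_Suc: "wv a (Suc i) = Bm a i (a (Suc i))"
  by (simp add: wv_def)

lemma Fs_Suc: "Fs a (Suc i) = {v :: ('d::finite) hspace. \<exists>c. v - c *s wv a (Suc i) \<in> Fs a i}"
proof -
  have "wv a ` {1..Suc i} = insert (wv a (Suc i) :: 'd hspace) (wv a ` {1..i})"
    by (simp add: atLeastAtMostSuc_conv)
  then show ?thesis unfolding Fs_def by (simp add: vec.span_insert)
qed

lemma Fs_Suc_cases:
  assumes "v \<in> Fs a (Suc i)"
  obtains c f where "f \<in> Fs a i" "v = f + c *s wv a (Suc i)"
proof -
  obtain c where "v - c *s wv a (Suc i) \<in> Fs a i" using assms unfolding Fs_Suc by blast
  then show ?thesis using that[of "v - c *s wv a (Suc i)" c] by simp
qed

lemma Fs_Suc_ex: "v \<in> Fs a (Suc i) \<Longrightarrow> \<exists>f\<in>Fs a i. \<exists>c. v = f + c *s wv a (Suc i)"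
  by (metis Fs_Suc_cases)

lemma Fs_SucI: "f \<in> Fs a i \<Longrightarrow> f + c *s wv a (Suc i) \<in> Fs a (Suc i)"
  unfolding Fs_Suc by (auto intro: exI[of _ c])

lemma herm_Fs:
  assumes "\<And>j. 1 \<le> j \<Longrightarrow> j \<le> i \<Longrightarrow> herm v (wv a j) = 0" "w \<in> Fs a i"
  shows "herm v w = 0"
  by (rule herm_span[of "wv a ` {1..i}"]) (use assms in \<open>auto simp: Fs_def\<close>)

lemma nilp_Bm:
  fixes a :: "nat \<Rightarrow> complex ^ 2"
  assumes "i < CARD('d)"
  shows "nilp (Bm a i u :: ('d::finite) hspace) \<in> Fs a i"
  using assms
proof (induction i arbitrary: u)
  case 0
  show ?case using nilp_first[where 'd = 'd] by (simp add: nilp_add nilp_scale)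
next
  case (Suc i)
  let ?a = "a (Suc i)"
  have "nilp (up (Bm a i (pj ?a u) :: 'd hspace)) = Bm a i (pj ?a u)"
    by (rule nilp_up[OF low_Bm]) (use Suc in simp)
  also have "\<dots> = herm u ?a *s wv a (Suc i)" by (simp add: pj_def Bm_scale wv_Suc)
  finally have "nilp (Bm a (Suc i) u :: 'd hspace) = nilp (Bm a i (u - pj ?a u)) + herm u ?a *s wv a (Suc i)"
    by (simp add: nilp_add)
  then show ?case using Suc by (simp add: Fs_SucI)
qed

lemma nilp_Fs:
  assumes "v \<in> Fs a (Suc i)" "i < CARD('d)"
  shows "nilp (v :: ('d::finite) hspace) \<in> Fs a i"
proof -
  have sub: "vec.subspace {v :: 'd hspace. nilp v \<in> Fs a i}"
    by (auto simp: vec.subspace_def nilp_add nilp_scale Fs_add Fs_scale)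
  have "nilp (wv a j :: 'd hspace) \<in> Fs a i" if "1 \<le> j" "j \<le> Suc i" for j
  proof -
    have "nilp (Bm a (j - 1) (a j) :: 'd hspace) \<in> Fs a (j - 1)"
      using that assms(2) by (intro nilp_Bm) auto
    moreover have "Fs a (j - 1) \<subseteq> (Fs a i :: 'd hspace set)" using that by (intro Fs_mono) auto
    ultimately show ?thesis unfolding wv_def by blast
  qed
  then have "Fs a (Suc i) \<subseteq> {v :: 'd hspace. nilp v \<in> Fs a i}"
    unfolding Fs_def[of a "Suc i"] by (intro vec.span_minimal sub) auto
  then show ?thesis using assms(1) by blast
qed

text \<open>The two claims feed each other: orthogonality to the newest vector
  \<open>wv a (Suc i)\<close> is the isometry of level \<open>i\<close>, and the mixed terms in the
  isometry vanish by orthogonality. Shifted components are handled by moving \<open>up\<close>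
  across the form as \<open>nilp\<close>.\<close>

lemma Bm_orth_isometry:
  fixes a :: "nat \<Rightarrow> complex ^ 2"
  assumes "i < CARD('d)" "units a i"
  shows "(\<forall>u. \<forall>w\<in>Fs a i. herm (Bm a i u :: ('d::finite) hspace) w = 0) \<and>
    (\<forall>u v. herm (Bm a i u :: 'd hspace) (Bm a i v) = herm u v)"
  using assms
proof (induction i)
  case 0
  have "herm (e_vec 1 :: 'd hspace) (e_vec 1) = 1" "herm (f_vec 1 :: 'd hspace) (f_vec 1) = 1"
    "herm (e_vec 1 :: 'd hspace) (f_vec 1) = 0" "herm (f_vec 1 :: 'd hspace) (e_vec 1) = 0"
    by (simp_all add: e_vec_def f_vec_def herm_axis) (simp_all add: axis_def)
  then show ?case by (simp add: herm_simps herm_2 algebra_simps)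
next
  case (Suc i)
  let ?a = "a (Suc i)"
  have aa: "herm ?a ?a = 1" using Suc.prems by (simp add: units_def)
  have "i < CARD('d)" "units a i" using Suc.prems by (auto intro: units_mono)
  note IH = Suc.IH[OF this]
  have orth: "herm (Bm a i u :: 'd hspace) w = 0" if "w \<in> Fs a i" for u w
    using IH that by blast
  have iso: "herm (Bm a i u :: 'd hspace) (Bm a i v) = herm u v" for u v
    using IH by blast
  have nu: "nilp (up (Bm a i u :: 'd hspace)) = Bm a i u" for u
    by (rule nilp_up[OF low_Bm]) (use Suc.prems in simp)
  have perp: "herm (pj ?a u) (v - pj ?a v) = 0" "herm (u - pj ?a u) (pj ?a v) = 0" for u v
    using aa by (simp_all add: pj_def herm_simps cnj_herm)
  have ub: "herm (up (Bm a i u) :: 'd hspace) (Bm a i v) = 0" for u v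
    using orth[OF nilp_Bm] \<open>i < CARD('d)\<close> by (simp add: herm_up)
  have bu: "herm (Bm a i v) (up (Bm a i u) :: 'd hspace) = 0" for u v
    using ub by (simp add: herm_eq_0_commute[of "Bm a i v"])
  have uu: "herm (up (Bm a i u) :: 'd hspace) (up (Bm a i v)) = herm u v" for u v
    by (simp add: herm_up nu iso)
  have "herm (Bm a (Suc i) u :: 'd hspace) (wv a j) = 0" if j: "1 \<le> j" "j \<le> Suc i" for u j
  proof -
    have "wv a j \<in> (Fs a (Suc i) :: 'd hspace set)" using j by (rule wv_in_Fs)
    then have 1: "herm (up (Bm a i (pj ?a u)) :: 'd hspace) (wv a j) = 0"
      using orth[OF nilp_Fs] \<open>i < CARD('d)\<close> by (simp add: herm_up)
    have 2: "herm (Bm a i (u - pj ?a u) :: 'd hspace) (wv a j) = 0"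
    proof (cases "j = Suc i")
      case True
      then show ?thesis using perp(2)[of u ?a] aa by (simp add: wv_Suc iso pj_self)
    next
      case False
      then show ?thesis using orth wv_in_Fs[of j i a] j by auto
    qed
    show ?thesis using 1 2 by (simp add: herm_add_left)
  qed
  then have "\<forall>u. \<forall>w\<in>Fs a (Suc i). herm (Bm a (Suc i) u :: 'd hspace) w = 0"
    using herm_Fs by blast
  moreover have "herm (Bm a (Suc i) u :: 'd hspace) (Bm a (Suc i) v) = herm u v" for u v
  proof -
    have "herm (Bm a (Suc i) u :: 'd hspace) (Bm a (Suc i) v) =
      herm (pj ?a u) (pj ?a v) + herm (u - pj ?a u) (v - pj ?a v)"
      by (simp add: herm_add_left herm_add_right uu ub bu iso)
    also have "\<dots> = herm (pj ?a u + (u - pj ?a u)) (pj ?a v + (v - pj ?a v))"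
      by (simp only: herm_add_left herm_add_right perp) simp
    finally show ?thesis by simp
  qed
  ultimately show ?case by blast
qed

lemma herm_Bm_Fs:
  fixes a :: "nat \<Rightarrow> complex ^ 2"
  assumes "i < CARD('d)" "units a i" "w \<in> Fs a i"
  shows "herm (Bm a i u :: ('d::finite) hspace) w = 0" "herm w (Bm a i u) = 0"
  using Bm_orth_isometry[OF assms(1,2)] assms(3) herm_eq_0_commute by blast+

lemma herm_Bm:
  fixes a :: "nat \<Rightarrow> complex ^ 2"
  assumes "i < CARD('d)" "units a i"
  shows "herm (Bm a i u :: ('d::finite) hspace) (Bm a i v) = herm u v"
  using Bm_orth_isometry[OF assms] by blast

text \<open>Subtracting a multiple of the shifted newest vector brings the image under
  \<open>nilp\<close> into \<open>Fs a i\<close>. Of the direction \<open>u\<close> found there, the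
  component along \<open>a (Suc i)\<close> already lies in the flag, and the orthogonal one is the
  same at level \<open>Suc i\<close>.\<close>

lemma nilp_preimage_Fs:
  fixes v :: "('d::finite) hspace"
  assumes "i < CARD('d)" "units a i" "nilp v \<in> Fs a i"
  obtains u f where "f \<in> Fs a i" "v = f + Bm a i u"
  using assms
proof (induction i arbitrary: v thesis)
  case 0
  define u :: "complex ^ 2" where "u = vector [v $ Inl (idx 1), v $ Inr (idx 1)]"
  have "v = 0 + Bm a 0 u" using nilp_eq_0[of v] 0 by (simp add: u_def vector_2)
  then show ?case using 0 by simp
next
  case (Suc i)
  let ?a = "a (Suc i)"
  let ?w = "wv a (Suc i) :: 'd hspace"
  have aa: "herm ?a ?a = 1" using Suc.prems by (simp add: units_def)
  have i: "i < CARD('d)" "units a i" using Suc.prems by (auto intro: units_mono)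
  obtain c g where g: "g \<in> Fs a i" "nilp v = g + c *s ?w" using Fs_Suc_cases[OF Suc.prems(4)] by metis
  have "nilp (up ?w) = ?w" unfolding wv_Suc by (rule nilp_up[OF low_Bm]) (use Suc.prems in simp)
  then have "nilp (v - c *s up ?w) \<in> Fs a i" using g by (simp add: nilp_diff nilp_scale)
  then obtain f u where f: "f \<in> Fs a i" "v - c *s up ?w = f + Bm a i u"
    using Suc.IH[OF _ i] by metis
  have 1: "Bm a (Suc i) ?a = up ?w" using aa by (simp add: pj_self wv_Suc)
  have 2: "Bm a (Suc i) (u - pj ?a u) = (Bm a i (u - pj ?a u) :: 'd hspace)"
    using aa by (simp add: pj_diff pj_idem)
  have 3: "Bm a i u = Bm a i (u - pj ?a u) + herm u ?a *s ?w"
    by (simp add: Bm_diff pj_def Bm_scale wv_Suc)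
  have "v = (f + herm u ?a *s ?w) + Bm a (Suc i) (c *s ?a + (u - pj ?a u))"
    using f(2) unfolding Bm_add Bm_scale[of a "Suc i"] 1 2 3 by (simp add: algebra_simps)
  moreover have "f + herm u ?a *s ?w \<in> Fs a (Suc i)" using f(1) by (rule Fs_SucI)
  ultimately show ?case using Suc.prems(1) by blast
qed

lemma nilp_preimage_Fs_ex:
  fixes v :: "('d::finite) hspace"
  assumes "i < CARD('d)" "units a i" "nilp v \<in> Fs a i"
  shows "\<exists>f\<in>Fs a i. \<exists>u. v = f + Bm a i u"
  using nilp_preimage_Fs[OF assms] by metis

lemma C_map_Bm:
  fixes a :: "nat \<Rightarrow> complex ^ 2"
  assumes "i < CARD('d)"
  shows "C_map (Bm a i u :: ('d::finite) hspace) = u"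
  using assms
proof (induction i arbitrary: u)
  case 0
  have "(\<Sum>i=1..CARD('d). (e_vec 1 :: 'd hspace) $ Inl (idx i)) = (\<Sum>i=1..CARD('d). if i = 1 then 1 else 0)"
    "(\<Sum>i=1..CARD('d). (f_vec 1 :: 'd hspace) $ Inr (idx i)) = (\<Sum>i=1..CARD('d). if i = 1 then 1 else 0)"
    by (intro sum.cong refl; simp)+
  moreover have "(\<Sum>i=1..CARD('d). if i = 1 then 1 else 0) = (1 :: complex)" by simp
  ultimately have "C_map (e_vec 1 :: 'd hspace) = e2" "C_map (f_vec 1 :: 'd hspace) = f2"
    by (intro vec2_eqI; simp add: C_map_nth e2_def f2_def axis_def)+
  then show ?case
    by (intro vec2_eqI) (simp_all add: C_map_add C_map_scale e2_def f2_def axis_def)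
next
  case (Suc i)
  have "C_map (up (Bm a i v) :: 'd hspace) = C_map (Bm a i v :: 'd hspace)" for v
    by (rule C_map_up[OF low_Bm]) (use Suc.prems in simp)
  then show ?case using Suc by (simp add: C_map_add)
qed

lemma herm_wv_self:
  assumes "1 \<le> i" "i \<le> CARD('d)" "units a i"
  shows "herm (wv a i :: ('d::finite) hspace) (wv a i) = 1"
  using herm_Bm[where 'd = 'd, of "i - 1" a "a i" "a i"] assms units_mono[of a i "i - 1"] units_nth[of a i i]
  by (simp add: wv_def)

lemma herm_wv_Fs:
  assumes "Suc i \<le> CARD('d)" "units a (Suc i)" "w \<in> Fs a i"
  shows "herm (wv a (Suc i) :: ('d::finite) hspace) w = 0"
  using herm_Bm_Fs(1)[where 'd = 'd, of i a w] assms units_mono[of a "Suc i" i] by (simp add: wv_Suc)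

lemma wv_notin_Fs:
  assumes "Suc i \<le> CARD('d)" "units a (Suc i)"
  shows "(wv a (Suc i) :: ('d::finite) hspace) \<notin> Fs a i"
  using herm_wv_Fs[OF assms] herm_wv_self[of "Suc i" a] assms by fastforce

lemma dim_Fs:
  assumes "i \<le> CARD('d)" "units a i"
  shows "vec.dim (Fs a i :: ('d::finite) hspace set) = i"
  using assms
proof (induction i)
  case 0
  then show ?case by simp
next
  case (Suc i)
  have "vec.dim (wv a ` {1..i} :: 'd hspace set) = i"
    using Suc units_mono[of a "Suc i" i] unfolding Fs_def by simp
  moreover have "(wv a (Suc i) :: 'd hspace) \<notin> vec.span (wv a ` {1..i})"
    using wv_notin_Fs[OF Suc.prems] unfolding Fs_def .
  moreover have "wv a ` {1..Suc i} = insert (wv a (Suc i) :: 'd hspace) (wv a ` {1..i})"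
    by (simp add: atLeastAtMostSuc_conv)
  ultimately show ?case unfolding Fs_def vec.dim_span by (simp add: vec.dim_insert)
qed

section \<open>The flags in \<open>Y\<close> and their sequences of lines\<close>

definition flag :: "nat \<Rightarrow> (nat \<Rightarrow> complex ^ 2) \<Rightarrow> ('d::finite + 'd) flag" where
  "flag m a = (\<lambda>i\<in>{1..m}. Fs a i)"

lemma flag_at_flag: "i \<le> m \<Longrightarrow> flag_at (flag m a) i = Fs a i"
  by (auto simp: flag_at_def flag_def)

lemma flag_in_Y:
  assumes "m \<le> CARD('d)" "units a m"
  shows "(flag m a :: ('d::finite + 'd) flag) \<in> Y m"
proof -
  have "nilp ` Fs a i \<subseteq> (Fs a (i - 1) :: 'd hspace set)" if "1 \<le> i" "i \<le> m" for i
    using nilp_Fs[where 'd = 'd, of _ a "i - 1"] that assms by auto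
  moreover have "Fs a (i - 1) \<subseteq> (Fs a i :: 'd hspace set)" for i by (rule Fs_mono) simp
  moreover have "vec.dim (Fs a i :: 'd hspace set) = i" if "i \<le> m" for i
    using that assms by (intro dim_Fs) (auto intro: units_mono)
  ultimately show ?thesis
    by (auto simp: Y_def flag_at_flag) (auto simp: flag_def)
qed

lemma Fs_perp:
  assumes "1 \<le> i" "i \<le> CARD('d)" "units a i"
  shows "Fs a i \<inter> herm_comp (Fs a (i - 1)) = vec.span {wv a i :: ('d::finite) hspace}"
proof -
  obtain j where j: "i = Suc j" using assms by (cases i) auto
  have orth: "herm (wv a i :: 'd hspace) w = 0" if "w \<in> Fs a j" for w
    using herm_wv_Fs[of j a w] that assms j by simp
  have "v \<in> vec.span {wv a i}" if vF: "v \<in> Fs a i" "v \<in> herm_comp (Fs a j)" for v :: "'d hspace"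
  proof -
    obtain c f where f: "f \<in> Fs a j" "v = f + c *s wv a (Suc j)"
      using Fs_Suc_ex[of v a j] vF(1) unfolding j by blast
    have "herm f f = herm v f - c * herm (wv a i) f" by (simp add: f(2) j herm_simps)
    also have "\<dots> = 0" using orth[OF f(1)] vF(2) f(1) by (simp add: herm_comp_def)
    finally show ?thesis using f(2) j by (auto simp: vec.span_singleton)
  qed
  moreover have "wv a i \<in> herm_comp (Fs a j :: 'd hspace set)" using orth by (simp add: herm_comp_def)
  moreover have "vec.subspace (herm_comp (Fs a j :: 'd hspace set))"
    by (auto simp: herm_comp_def vec.subspace_def herm_simps)
  moreover have "wv a i \<in> (Fs a i :: 'd hspace set)" using assms by (intro wv_in_Fs) auto
  ultimately show ?thesis
    using j by (auto simp: vec.span_singleton vec.subspace_scale)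
qed

lemma phi_flag:
  assumes "m \<le> CARD('d)" "units a m" "i \<in> {1..m}"
  shows "phi m (flag m a :: ('d::finite + 'd) flag) i = vec.span {a i}"
proof -
  have "phi m (flag m a :: ('d + 'd) flag) i = C_map ` vec.span {wv a i :: 'd hspace}"
  proof -
    have "flag_at (flag m a :: ('d + 'd) flag) (i - 1) = Fs a (i - 1)" using assms by (intro flag_at_flag) auto
    moreover have "(flag m a :: ('d + 'd) flag) i = Fs a i" using assms by (simp add: flag_def)
    ultimately have "phi m (flag m a :: ('d + 'd) flag) i = C_map ` (Fs a i \<inter> herm_comp (Fs a (i - 1)) :: 'd hspace set)"
      using assms by (simp add: phi_def)
    also have "Fs a i \<inter> herm_comp (Fs a (i - 1)) = vec.span {wv a i :: 'd hspace}"
      using assms by (intro Fs_perp) (auto intro: units_mono)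
    finally show ?thesis .
  qed
  also have "\<dots> = vec.span {C_map (wv a i :: 'd hspace)}"
    unfolding vec.span_singleton image_image C_map_scale ..
  also have "C_map (wv a i :: 'd hspace) = a i"
    unfolding wv_def using assms by (intro C_map_Bm) auto
  finally show ?thesis .
qed

lemma Bm_cong:
  assumes "\<And>j. 1 \<le> j \<Longrightarrow> j \<le> i \<Longrightarrow> pj (a j) = pj (b j)"
  shows "Bm a i u = (Bm b i u :: ('d::finite) hspace)"
  using assms
proof (induction i arbitrary: u)
  case (Suc i)
  then show ?case by (metis Bm.simps(2) Suc_eq_plus1 le_add2 le_SucI order_refl)
qed simp

lemma Fs_cong_subset:
  fixes a b :: "nat \<Rightarrow> complex ^ 2"
  assumes "\<And>j. 1 \<le> j \<Longrightarrow> j \<le> i \<Longrightarrow> pj (a j) = pj (b j)" "units a i"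
  shows "Fs a i \<subseteq> (Fs b i :: (complex ^ ('c::finite + 'c)) set)"
  unfolding Fs_def[of a]
proof (rule vec.span_minimal)
  show "wv a ` {1..i} \<subseteq> (Fs b i :: (complex ^ ('c + 'c)) set)"
  proof (clarsimp)
    fix j assume j: "Suc 0 \<le> j" "j \<le> i"
    have "a j = pj (b j) (a j)" using assms j pj_self[of "a j"] units_nth[of a i j] by (metis One_nat_def)
    then have "a j = herm (a j) (b j) *s b j" by (simp add: pj_def)
    then have "wv a j = (herm (a j) (b j) *s Bm a (j - 1) (b j) :: complex ^ ('c + 'c))"
      unfolding wv_def by (metis Bm_scale)
    also have "Bm a (j - 1) (b j) = (Bm b (j - 1) (b j) :: complex ^ ('c + 'c))" using assms j by (intro Bm_cong) auto
    also have "\<dots> = wv b j" by (simp only: wv_def)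
    finally have w: "wv a j = herm (a j) (b j) *s (wv b j :: complex ^ ('c + 'c))" .
    show "(wv a j :: complex ^ ('c + 'c)) \<in> Fs b i"
      unfolding w using j by (intro Fs_scale wv_in_Fs) auto
  qed
qed simp

lemma Fs_cong:
  assumes "\<And>j. 1 \<le> j \<Longrightarrow> j \<le> i \<Longrightarrow> pj (a j) = pj (b j)" "units a i" "units b i"
  shows "Fs a i = Fs b i"
  using Fs_cong_subset[of i a b] Fs_cong_subset[of i b a] assms by (metis subset_antisym)

lemma flag_cong:
  assumes "\<And>j. 1 \<le> j \<Longrightarrow> j \<le> m \<Longrightarrow> pj (a j) = pj (b j)" "units a m" "units b m"
  shows "flag m a = flag m b"
proof -
  have "Fs a i = Fs b i" if "i \<in> {1..m}" for i
    using assms that units_mono by (intro Fs_cong) auto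
  then show ?thesis unfolding flag_def by (rule restrict_ext)
qed

text \<open>A vector of \<open>G\<close> outside \<open>Fs a i\<close> differs from some
  \<open>Bm a i u\<close> by an element of \<open>Fs a i\<close>; normalizing \<open>u\<close> gives
  the new line, and equality follows by dimension.\<close>

lemma next_line:
  assumes i: "Suc i \<le> CARD('d)" "units a i"
    and G: "vec.subspace G" "Fs a i \<subseteq> G" "vec.dim G = Suc i" "\<And>v. v \<in> G \<Longrightarrow> nilp v \<in> Fs a i"
  obtains b where "herm b b = 1" "G = Fs (a(Suc i := b)) (Suc i)" "Bm a i b \<in> (G :: ('d::finite) hspace set)"
proof -
  have "vec.dim (Fs a i :: 'd hspace set) = i" using i by (intro dim_Fs) auto
  then obtain v where v: "v \<in> G" "v \<notin> Fs a i" using G by (metis Suc_n_not_le_n vec.dim_subset subsetI)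
  obtain u f where f: "f \<in> Fs a i" "v = f + Bm a i u"
    using nilp_preimage_Fs_ex[of i a v] i G(4)[OF v(1)] by (auto simp: Suc_le_eq)
  have u: "u \<noteq> 0" using v f by auto
  then obtain c b where b: "c \<noteq> 0" "u = c *s b" "herm b b = 1" by (rule normalize_vec)
  have "Bm a i u = v - f" using f(2) by simp
  then have "Bm a i u \<in> G" using vec.subspace_diff[OF G(1) v(1) subsetD[OF G(2) f(1)]] by simp
  then have "inverse c *s Bm a i u \<in> G" using vec.subspace_scale[OF G(1)] by simp
  then have bG: "Bm a i b \<in> G" using b by (simp add: Bm_scale)
  define a' where "a' = a(Suc i := b)"
  have un: "units a' (Suc i)" using i(2) b by (auto simp: units_def a'_def)
  have Beq: "Bm a' i x = (Bm a i x :: 'd hspace)" for x by (rule Bm_cong) (simp add: a'_def)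
  have Feq: "Fs a' i = Fs a i" using i(2) units_mono[OF un, of i] by (intro Fs_cong) (auto simp: a'_def)
  have "wv a' (Suc i) = (Bm a i b :: 'd hspace)" by (simp add: wv_Suc Beq) (simp add: a'_def)
  then have "Fs a' (Suc i) \<subseteq> G"
    using bG G(1,2) Feq by (auto elim!: Fs_Suc_cases intro!: vec.subspace_add vec.subspace_scale)
  moreover have "vec.dim (Fs a' (Suc i) :: 'd hspace set) = Suc i" using i un by (intro dim_Fs) auto
  ultimately have "Fs a' (Suc i) = G" using G by (intro vec.subspace_dim_equal) auto
  then show ?thesis using that[of b] b bG unfolding a'_def by simp
qed

lemma Y_flag:
  assumes F: "F \<in> (Y m :: ('d::finite + 'd) flag set)" and m: "m \<le> CARD('d)"
  obtains a where "units a m" "F = flag m a"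
proof -
  have "\<exists>a. units a i \<and> (\<forall>j\<in>{1..i}. F j = Fs a j)" if "i \<le> m" for i
    using that
  proof (induction i)
    case 0
    then show ?case by (simp add: units_def)
  next
    case (Suc i)
    then obtain a where a: "units a i" "\<forall>j\<in>{1..i}. F j = Fs a j" by auto
    have at: "flag_at F i = Fs a i" using a by (cases "i = 0") (auto simp: flag_at_def)
    have "Suc i \<in> {1..m}" using Suc.prems by simp
    then have "vec.subspace (F (Suc i)) \<and> vec.dim (F (Suc i)) = Suc i \<and> flag_at F i \<subseteq> F (Suc i) \<and> nilp ` F (Suc i) \<subseteq> flag_at F i"
      using F unfolding Y_def by force
    then obtain b where b: "herm b b = 1" "F (Suc i) = Fs (a(Suc i := b)) (Suc i)"
      using next_line[of i a "F (Suc i)"] Suc.prems m a(1) unfolding at by (metis image_subset_iff le_trans)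
    define a' where "a' = a(Suc i := b)"
    have un: "units a' (Suc i)" using a(1) b by (auto simp: units_def a'_def)
    have "Fs a' j = (Fs a j :: 'd hspace set)" if "j \<le> i" for j
      using that units_mono[OF a(1), of j] units_mono[OF un, of j] by (intro Fs_cong) (auto simp: a'_def)
    then have "\<forall>j\<in>{1..Suc i}. F j = Fs a' j" using a(2) b(2) by (auto simp: le_Suc_eq a'_def[symmetric])
    then show ?case using un by blast
  qed
  then obtain a where a: "units a m" "\<forall>j\<in>{1..m}. F j = Fs a j" by blast
  have "F = flag m a"
    using F a(2) unfolding Y_def flag_def by (auto simp: extensional_def fun_eq_iff)
  then show ?thesis using that a(1) by blast
qed

subsection \<open>Removing an orthogonal pair\<close>

definition del_seq :: "nat \<Rightarrow> (nat \<Rightarrow> 'p) \<Rightarrow> nat \<Rightarrow> 'p" where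
  "del_seq i a j = (if j < i then a j else a (Suc (Suc j)))"

lemma perp_decomp:
  fixes a b u :: "complex ^ 2"
  assumes "herm a a = 1" "herm b b = 1" "herm a b = 0"
  shows "pj a u + pj b u = u"
proof -
  have ba: "herm b a = 0" using assms(3) herm_eq_0_commute by blast
  define r where "r = u - pj a u - pj b u"
  have ra: "herm r a = 0" and rb: "herm r b = 0"
    using assms ba by (simp_all add: r_def pj_def herm_simps)
  have "r $ 1 * cnj (a $ 1) + r $ 2 * cnj (a $ 2) = 0" "r $ 1 * cnj (b $ 1) + r $ 2 * cnj (b $ 2) = 0"
    using ra rb by (simp_all add: herm_2)
  moreover have "cnj (a $ 1) * cnj (b $ 2) - cnj (a $ 2) * cnj (b $ 1) \<noteq> 0"
  proof
    assume d: "cnj (a $ 1) * cnj (b $ 2) - cnj (a $ 2) * cnj (b $ 1) = 0"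
    have "a $ 1 * (cnj (a $ 1) * cnj (b $ 2) - cnj (a $ 2) * cnj (b $ 1)) =
      cnj (b $ 2) * herm a a - cnj (a $ 2) * herm a b" by (simp add: herm_2 algebra_simps)
    then have 1: "b $ 2 = 0" using d assms by simp
    have "a $ 2 * (cnj (a $ 1) * cnj (b $ 2) - cnj (a $ 2) * cnj (b $ 1)) =
      cnj (a $ 1) * herm a b - cnj (b $ 1) * herm a a" by (simp add: herm_2 algebra_simps)
    then have "b $ 1 = 0" using d assms by simp
    with 1 show False using assms(2) by (simp add: herm_2)
  qed
  ultimately have "r $ 1 = 0 \<and> r $ 2 = 0"
  proof -
    let ?a1 = "cnj (a $ 1)" and ?a2 = "cnj (a $ 2)" and ?b1 = "cnj (b $ 1)" and ?b2 = "cnj (b $ 2)"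
    assume e: "r $ 1 * ?a1 + r $ 2 * ?a2 = 0" "r $ 1 * ?b1 + r $ 2 * ?b2 = 0" and d: "?a1 * ?b2 - ?a2 * ?b1 \<noteq> 0"
    have "r $ 1 * (?a1 * ?b2 - ?a2 * ?b1) = (r $ 1 * ?a1 + r $ 2 * ?a2) * ?b2 - (r $ 1 * ?b1 + r $ 2 * ?b2) * ?a2"
      "r $ 2 * (?a1 * ?b2 - ?a2 * ?b1) = (r $ 1 * ?b1 + r $ 2 * ?b2) * ?a1 - (r $ 1 * ?a1 + r $ 2 * ?a2) * ?b1"
      by (simp_all add: algebra_simps)
    then show ?thesis unfolding e using d by simp
  qed
  then have "r = 0" by (intro vec2_eqI) simp_all
  then show ?thesis by (simp add: r_def algebra_simps)
qed

lemma perp_unit_exists: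
  fixes a :: "complex ^ 2"
  assumes "herm a a = 1"
  obtains b where "herm b b = 1" "herm a b = 0"
proof
  let ?b = "vector [- cnj (a $ 2), cnj (a $ 1)] :: complex ^ 2"
  show "herm ?b ?b = 1" using assms by (simp add: herm_2 vector_2 algebra_simps)
  show "herm a ?b = 0" by (simp add: herm_2 vector_2 algebra_simps)
qed

text \<open>Two orthogonal directions exhaust the plane: the component along the first is shifted at
  the first step, the one along the second at the second step. Altogether every vector is shifted
  exactly once.\<close>

lemma Bm_del:
  fixes a :: "nat \<Rightarrow> complex ^ 2"
  assumes i: "1 \<le> i" and u: "herm (a i) (a i) = 1" "herm (a (Suc i)) (a (Suc i)) = 1" and perp: "herm (a i) (a (Suc i)) = 0"
    and j: "i - 1 \<le> j"
  shows "Bm a (Suc (Suc j)) u = (up (Bm (del_seq i a) j u) :: ('d::finite) hspace)"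
  using j
proof (induction j arbitrary: u rule: dec_induct)
  case base
  obtain l where l: "i = Suc l" using i by (cases i) auto
  let ?a = "a i" and ?b = "a (Suc i)"
  have D: "?a = a (Suc l)" "?b = a (Suc (Suc l))" using l by simp_all
  have p: "herm ?b ?a = 0" using perp herm_eq_0_commute by blast
  have 1: "pj ?a (pj ?b u) = 0" "u - pj ?b u = pj ?a u" "pj ?a (pj ?a u) = pj ?a u" for u
    using perp_decomp[OF assms(2,3,4), of u] p u(1) by (auto simp: pj_def herm_simps algebra_simps)
  have "Bm (del_seq i a) l v = (Bm a l v :: 'd hspace)" for v by (rule Bm_cong) (simp add: del_seq_def l)
  then have eq: "Bm (del_seq i a) (i - 1) u = (Bm a l u :: 'd hspace)" using l by simp
  have "Bm a (Suc (Suc (i - 1))) u = (Bm a (Suc (Suc l)) u :: 'd hspace)" using l by simp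
  also have "\<dots> = up (Bm a (Suc l) (pj ?b u)) + Bm a (Suc l) (u - pj ?b u)"
    unfolding Bm.simps(2)[of a "Suc l"] D ..
  also have "\<dots> = up (Bm a l (pj ?b u)) + up (Bm a l (pj ?a u))"
    unfolding Bm.simps(2)[of a l] D[symmetric] using 1 by simp
  also have "\<dots> = up (Bm a l u)"
    using perp_decomp[OF assms(2,3,4), of u] by (simp flip: up_add Bm_add add: add.commute)
  finally show ?case unfolding eq .
next
  case (step j)
  have d: "del_seq i a (Suc j) = a (Suc (Suc (Suc j)))" using step by (auto simp: del_seq_def)
  show ?case
    unfolding Bm.simps(2)[of a "Suc (Suc j)"] step.IH Bm.simps(2)[of "del_seq i a"] d
    by (simp add: up_add)
qed

text \<open>At the pair itself both directions of the plane are added, which yields the full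
  preimage of the subspace before the pair. Later vectors are the shifts of those of the shortened
  sequence, so the description persists.\<close>

lemma Fs_del:
  fixes a :: "nat \<Rightarrow> complex ^ 2"
  assumes i: "1 \<le> i" and un: "units a (Suc (Suc j))" and perp: "herm (a i) (a (Suc i)) = 0"
    and j: "i - 1 \<le> j" "Suc (Suc j) \<le> CARD('d)"
  shows "Fs a (Suc (Suc j)) = {v :: ('d::finite) hspace. nilp v \<in> Fs (del_seq i a) j}"
  using j un
proof (induction j rule: dec_induct)
  case base
  obtain l where l: "i = Suc l" using i by (cases i) auto
  have u: "herm (a i) (a i) = 1" "herm (a (Suc i)) (a (Suc i)) = 1" using base.prems i by (auto simp: units_def)
  have unl: "units a l" using base.prems l by (auto intro: units_mono)
  have "units (del_seq i a) l" using unl l by (auto simp: units_def del_seq_def)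
  then have eq: "Fs (del_seq i a) (i - 1) = (Fs a l :: 'd hspace set)"
    using unl l by (simp, intro Fs_cong) (auto simp: del_seq_def)
  have p: "herm (a (Suc i)) (a i) = 0" using perp herm_eq_0_commute by blast
  have w: "wv a (Suc (Suc l)) = (Bm a l (a (Suc i)) :: 'd hspace)"
    using p l by (simp add: wv_def pj_def)
  have w1: "wv a (Suc l) = (Bm a l (a i) :: 'd hspace)" using l by (simp add: wv_def)
  show ?case
  proof (rule equalityI; rule subsetI)
    fix v :: "'d hspace"
    assume v: "v \<in> Fs a (Suc (Suc (i - 1)))"
    then have "v \<in> Fs a (Suc (Suc l))" using l by simp
    then obtain c f where f: "f \<in> Fs a (Suc l)" "v = f + c *s Bm a l (a (Suc i))"
      using Fs_Suc_ex[of v a "Suc l"] unfolding w by blast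
    have "nilp f \<in> Fs a l" using f(1) base.prems l by (intro nilp_Fs) auto
    moreover have "nilp (Bm a l (a (Suc i)) :: 'd hspace) \<in> Fs a l"
      using base.prems l by (intro nilp_Bm) auto
    ultimately show "v \<in> {v. nilp v \<in> Fs (del_seq i a) (i - 1)}"
      unfolding eq f(2) by (simp add: nilp_add nilp_scale Fs_add Fs_scale)
  next
    fix v :: "'d hspace"
    assume "v \<in> {v. nilp v \<in> Fs (del_seq i a) (i - 1)}"
    then have "nilp v \<in> Fs a l" using eq by simp
    moreover have "l < CARD('d)" using base.prems l by simp
    ultimately obtain f x where f: "f \<in> Fs a l" "v = f + Bm a l x"
      using nilp_preimage_Fs_ex[of l a v] unl by blast
    have "x = herm x (a i) *s a i + herm x (a (Suc i)) *s a (Suc i)"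
      using perp_decomp[OF u perp, of x] by (simp add: pj_def)
    then have "Bm a l x = (herm x (a i) *s Bm a l (a i) + herm x (a (Suc i)) *s Bm a l (a (Suc i)) :: 'd hspace)"
      by (metis Bm_add Bm_scale)
    then have "v = (f + herm x (a i) *s wv a (Suc l)) + herm x (a (Suc i)) *s wv a (Suc (Suc l))"
      using f(2) w w1 by (simp add: add.assoc)
    then show "v \<in> Fs a (Suc (Suc (i - 1)))" using f(1) l by (simp add: Fs_SucI)
  qed
next
  case (step j)
  have un': "units a (Suc (Suc j))" using step.prems by (auto intro: units_mono)
  have IH: "Fs a (Suc (Suc j)) = {v :: 'd hspace. nilp v \<in> Fs (del_seq i a) j}"
    using step un' by auto
  have u: "herm (a i) (a i) = 1" "herm (a (Suc i)) (a (Suc i)) = 1"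
    using step.prems step.hyps i by (auto simp: units_def)
  have d: "del_seq i a (Suc j) = a (Suc (Suc (Suc j)))" using step by (auto simp: del_seq_def)
  have w: "wv a (Suc (Suc (Suc j))) = (up (wv (del_seq i a) (Suc j)) :: 'd hspace)"
    unfolding wv_Suc d[symmetric] using step.hyps by (intro Bm_del i u perp) auto
  have nu: "nilp (up (wv (del_seq i a) (Suc j) :: 'd hspace)) = wv (del_seq i a) (Suc j)"
    unfolding wv_Suc using step.prems by (intro nilp_up[OF low_Bm]) auto
  have "v \<in> Fs a (Suc (Suc (Suc j))) \<longleftrightarrow> nilp v \<in> Fs (del_seq i a) (Suc j)" for v :: "'d hspace"
    unfolding Fs_Suc[of a "Suc (Suc j)"] Fs_Suc[of "del_seq i a"] w IH
    by (simp add: nilp_diff nilp_scale nu)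
  then show ?case by blast
qed

subsection \<open>Real and complex dimension\<close>

lemma scaleR_eq_smult: "r *\<^sub>R v = complex_of_real r *s (v :: complex ^ 'n)"
  unfolding vec_eq_iff by (simp add: complex_eq_iff)

lemma vec_subspace_imp_subspace:
  assumes "vec.subspace (W :: (complex ^ 'n) set)"
  shows "subspace W"
  using assms by (auto simp: subspace_def vec.subspace_def scaleR_eq_smult)

lemma real_dim_insert:
  fixes W :: "(complex ^ 'n) set"
  assumes W: "vec.subspace W" and b: "b \<notin> W"
  shows "dim (vec.span (insert b W)) = dim W + 2"
proof -
  have sW: "span W = W" using vec_subspace_imp_subspace[OF W] by (simp add: span_eq_iff)
  have spb: "x \<in> span (insert b W) \<longleftrightarrow> (\<exists>r. x - r *\<^sub>R b \<in> W)" for x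
    by (simp add: span_insert sW)
  have ib: "\<i> *s b \<notin> span (insert b W)"
  proof
    assume "\<i> *s b \<in> span (insert b W)"
    then obtain r where "\<i> *s b - r *\<^sub>R b \<in> W" using spb by blast
    then have r: "(\<i> - of_real r) *s b \<in> W" by (simp add: scaleR_eq_smult vec.scale_left_diff_distrib)
    have nz: "\<i> - of_real r \<noteq> 0" by (auto simp: complex_eq_iff)
    then have "b = inverse (\<i> - of_real r) *s ((\<i> - of_real r) *s b)"
      unfolding vec.scale_scale using left_inverse[OF nz] by simp
    also have "\<dots> \<in> W" using W r by (rule vec.subspace_scale)
    finally show False using b by blast
  qed
  have "vec.span (insert b W) = span (insert (\<i> *s b) (insert b W))"
  proof (rule equalityI; rule subsetI)
    fix x assume "x \<in> vec.span (insert b W)"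
    then obtain c where "x - c *s b \<in> vec.span W" by (auto simp: vec.span_insert)
    then have c: "x - c *s b \<in> W" using vec.span_minimal[OF order_refl W] by blast
    have "c *s b = (of_real (Im c) * \<i>) *s b + of_real (Re c) *s b"
      unfolding vec.scale_left_distrib[symmetric] by (simp add: complex_eq_iff vec_eq_iff)
    then have "x - c *s b = (x - Im c *\<^sub>R (\<i> *s b)) - Re c *\<^sub>R b"
      by (simp add: scaleR_eq_smult algebra_simps)
    then have "x - Im c *\<^sub>R (\<i> *s b) \<in> span (insert b W)"
      using c spb by metis
    then show "x \<in> span (insert (\<i> *s b) (insert b W))" using span_insert by blast
  next
    fix x assume x: "x \<in> span (insert (\<i> *s b) (insert b W))"
    have "subspace (vec.span (insert b W))" by (simp add: vec_subspace_imp_subspace)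
    moreover have "insert (\<i> *s b) (insert b W) \<subseteq> vec.span (insert b W)"
      by (auto intro: vec.span_base vec.span_scale)
    ultimately show "x \<in> vec.span (insert b W)" using x span_minimal by blast
  qed
  then have "dim (vec.span (insert b W)) = dim (insert (\<i> *s b) (insert b W))" by simp
  also have "\<dots> = dim (insert b W) + 1" using ib by (simp add: dim_insert)
  also have "dim (insert b W) = dim W + 1" unfolding dim_insert sW using b by simp
  finally show ?thesis by simp
qed

text \<open>This turns counts of real dimensions, such as that of an orthogonal complement, into
  complex ones.\<close>

lemma real_dim:
  fixes W :: "(complex ^ 'n) set"
  assumes "vec.subspace W"
  shows "dim W = 2 * vec.dim W"
proof -
  obtain B where B: "B \<subseteq> W" "vec.independent B" "W \<subseteq> vec.span B" "card B = vec.dim W"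
    using vec.basis_exists by blast
  have "finite B" using B(2) by (rule vec.finiteI_independent)
  then have "vec.independent B \<Longrightarrow> dim (vec.span B) = 2 * card B"
  proof (induction B)
    case (insert b B)
    have ind: "vec.independent B" "b \<notin> vec.span B"
      using insert.prems insert.hyps by (auto simp: vec.independent_insert)
    have "vec.span (insert b B) = vec.span (insert b (vec.span B))"
      unfolding vec.span_insert vec.span_span ..
    then show ?case
      using real_dim_insert[of "vec.span B" b] ind insert by simp
  qed simp
  moreover have "vec.span B = W" using B(1,3) assms by (metis vec.span_minimal subset_antisym)
  ultimately show ?thesis using B by simp
qed

lemma dim_rank_nullity:
  fixes W :: "(complex ^ 'n) set" and f :: "complex ^ 'n \<Rightarrow> complex ^ 'k"
  assumes W: "vec.subspace W"
    and f: "\<And>u v. f (u + v) = f u + f v" "\<And>c u. f (c *s u) = c *s f u"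
  shows "vec.dim W = vec.dim (f ` W) + vec.dim (W \<inter> {v. f v = 0})"
proof -
  have f0: "f 0 = 0" using f(2)[of 0 0] by simp
  have fm: "f (u - v) = f u - f v" for u v using f(1)[of "u - v" v] by (simp add: algebra_simps)
  have lin: "linear f" using f by (intro linearI) (simp_all add: scaleR_eq_smult)
  define K where "K = W \<inter> {v. f v = 0}"
  have sK: "vec.subspace K" using W f f0 by (auto simp: K_def vec.subspace_def)
  have sfW: "vec.subspace (f ` W)"
    unfolding vec.subspace_def
  proof (intro conjI ballI allI)
    show "0 \<in> f ` W" using f0 vec.subspace_0[OF W] by (metis image_eqI)
    show "x + y \<in> f ` W" if "x \<in> f ` W" "y \<in> f ` W" for x y
      using that vec.subspace_add[OF W] by (auto simp flip: f(1))
    show "c *s x \<in> f ` W" if "x \<in> f ` W" for c x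
      using that vec.subspace_scale[OF W] by (auto simp flip: f(2))
  qed
  have rW: "subspace W" and rK: "subspace K" using W sK by (auto intro: vec_subspace_imp_subspace)
  \<comment> \<open>The orthogonal complement of the kernel in \<open>W\<close>: \<open>f\<close> is
    injective on it and has the same image there.\<close>
  define U where "U = {y \<in> W. \<forall>x\<in>K. orthogonal x y}"
  have dU: "dim U + dim K = dim W"
    unfolding U_def using rK rW by (intro dim_subspace_orthogonal_to_vectors) (auto simp: K_def)
  have sU: "subspace U"
    using rW by (auto simp: U_def subspace_def orthogonal_def inner_right_distrib)
  have "f ` U = f ` W"
  proof (rule equalityI)
    show "f ` W \<subseteq> f ` U"
    proof
      fix y assume "y \<in> f ` W"
      then obtain w where w: "w \<in> W" "y = f w" by blast
      obtain k u where ku: "w = k + u" "k \<in> span K" "\<And>x. x \<in> span K \<Longrightarrow> orthogonal u x"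
        using orthogonal_subspace_decomp_exists[of K w] by metis
      have k: "k \<in> K" using span_minimal[OF order_refl rK] ku(2) by blast
      have u: "u = w - k" using ku by simp
      have "u \<in> W" unfolding u using w k rW by (auto simp: K_def intro: subspace_diff)
      then have "u \<in> U" using ku(3) by (auto simp: U_def span_base orthogonal_commute)
      moreover have "f w = f u" using k unfolding u fm by (simp add: K_def)
      ultimately show "y \<in> f ` U" using w by blast
    qed
  qed (auto simp: U_def)
  moreover have "dim (f ` U) = dim U"
  proof (rule dim_image_eq[OF lin])
    have "span U = U" using sU by (simp add: span_eq_iff)
    moreover have "u = v" if uv: "u \<in> U" "v \<in> U" "f u = f v" for u v
    proof -
      have "u - v \<in> U" using uv sU subspace_diff by blast
      moreover have "f (u - v) = 0" using uv by (simp add: fm)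
      ultimately have "u - v \<in> K" "u - v \<in> U" by (auto simp: K_def U_def)
      then have "orthogonal (u - v) (u - v)" by (auto simp: U_def)
      then show ?thesis by (simp add: orthogonal_def)
    qed
    ultimately have "inj_on f U" by (auto simp: inj_on_def)
    then show "inj_on f (span U)" unfolding \<open>span U = U\<close> .
  qed
  ultimately have "dim (f ` W) + dim K = dim W" using dU by simp
  then show ?thesis
    using real_dim[OF sfW] real_dim[OF sK] real_dim[OF W] by (simp add: K_def)
qed

subsection \<open>Coordinate subspaces and bilinear forms\<close>

definition bv :: "nat + nat \<Rightarrow> ('d::finite) hspace" where
  "bv a = axis (map_sum idx idx a) 1"

lemma bv_simps: "bv (Inl i) = e_vec i" "bv (Inr i) = f_vec i"
  by (simp_all add: bv_def e_vec_def f_vec_def)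

lemma bv_inj:
  assumes "a \<in> labels CARD('d) CARD('d)" "b \<in> labels CARD('d) CARD('d)" "(bv a :: ('d::finite) hspace) = bv b"
  shows "a = b"
  using assms idx_eq_iff[where 'd = 'd] unfolding bv_def
  by (cases a; cases b) (auto simp: axis_eq_axis)

lemma labels_mono: "r \<le> r' \<Longrightarrow> s \<le> s' \<Longrightarrow> labels r s \<subseteq> labels r' s'"
  by (auto simp: labels_def)

lemma E_space_eq: "E_space r s = vec.span (bv ` labels r s)"
  unfolding E_space_def labels_def Plus_def by (simp add: image_Un image_image bv_simps)

lemma subspace_E [simp]: "vec.subspace (E_space r s)"
  by (simp add: E_space_eq)

lemma e_vec_idx2:
  assumes "1 \<le> i" "i \<le> CARD('d)" "1 \<le> j" "j \<le> CARD('d)"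
  shows "(e_vec j :: ('d::finite) hspace) $ Inl (idx i) = (if i = j then 1 else 0)"
    "(f_vec j :: ('d::finite) hspace) $ Inr (idx i) = (if i = j then 1 else 0)"
  using assms by (auto simp: e_vec_nth idx_eq_iff)

lemma mem_E_space:
  fixes v :: "('d::finite) hspace"
  assumes "r \<le> CARD('d)" "s \<le> CARD('d)"
  shows "v \<in> E_space r s \<longleftrightarrow> (\<forall>i. 1 \<le> i \<longrightarrow> i \<le> CARD('d) \<longrightarrow>
    (r < i \<longrightarrow> v $ Inl (idx i) = 0) \<and> (s < i \<longrightarrow> v $ Inr (idx i) = 0))" (is "_ \<longleftrightarrow> ?R v")
proof
  assume v: "v \<in> E_space r s"
  have "vec.subspace {v. ?R v}" by (auto simp: vec.subspace_def)
  moreover have "bv ` labels r s \<subseteq> {v. ?R v}"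
    using assms by (auto simp: labels_def bv_simps e_vec_idx2)
  ultimately have "E_space r s \<subseteq> {v. ?R v}" unfolding E_space_eq by (intro vec.span_minimal)
  then show "?R v" using v by blast
next
  assume R: "?R v"
  define x where "x = (\<Sum>i=1..r. v $ Inl (idx i) *s e_vec i) + (\<Sum>i=1..s. v $ Inr (idx i) *s (f_vec i :: 'd hspace))"
  have "v = x"
  proof (rule vec_eqI_coordinate)
    fix i assume i: "1 \<le> i" "i \<le> CARD('d)"
    have "x $ Inl (idx i) = (\<Sum>j=1..r. (v $ Inl (idx j) *s (e_vec j :: 'd hspace)) $ Inl (idx i))"
      unfolding x_def vector_add_component sum_component by simp
    also have "\<dots> = (\<Sum>j=1..r. if j = i then v $ Inl (idx i) else 0)"
      using i assms by (intro sum.cong refl) (auto simp: e_vec_idx2)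
    finally have "x $ Inl (idx i) = (\<Sum>j=1..r. if j = i then v $ Inl (idx i) else 0)" .
    then show "v $ Inl (idx i) = x $ Inl (idx i)" using R i by simp
    have "x $ Inr (idx i) = (\<Sum>j=1..s. (v $ Inr (idx j) *s (f_vec j :: 'd hspace)) $ Inr (idx i))"
      unfolding x_def vector_add_component sum_component by simp
    also have "\<dots> = (\<Sum>j=1..s. if j = i then v $ Inr (idx i) else 0)"
      using i assms by (intro sum.cong refl) (auto simp: e_vec_idx2)
    finally have "x $ Inr (idx i) = (\<Sum>j=1..s. if j = i then v $ Inr (idx i) else 0)" .
    then show "v $ Inr (idx i) = x $ Inr (idx i)" using R i by simp
  qed
  moreover have "x \<in> E_space r s"
    unfolding x_def E_space_def
    by (intro vec.span_add vec.span_sum vec.span_scale vec.span_base) auto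
  ultimately show "v \<in> E_space r s" by simp
qed

lemma dim_E_space:
  assumes "r \<le> CARD('d)" "s \<le> CARD('d)"
  shows "vec.dim (E_space r s :: ('d::finite) hspace set) = r + s"
proof -
  have "(bv ` labels r s :: 'd hspace set) \<subseteq> cart_basis"
    by (auto simp: bv_def cart_basis_def)
  then have "vec.independent (bv ` labels r s :: 'd hspace set)"
    using independent_cart_basis by (rule vec.independent_mono[rotated])
  moreover have "inj_on (bv :: _ \<Rightarrow> 'd hspace) (labels r s)"
    using bv_inj[where 'd = 'd] labels_mono[OF assms] by (auto simp: inj_on_def)
  moreover have "card (labels r s) = r + s"
    by (simp add: labels_def card_Plus)
  ultimately show ?thesis
    unfolding E_space_eq vec.dim_span by (metis vec.dim_eq_card_independent card_image)
qed

lemma E_space_mono: "r \<le> r' \<Longrightarrow> s \<le> s' \<Longrightarrow> E_space r s \<subseteq> E_space r' s'"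
  unfolding E_space_eq by (intro vec.span_mono image_mono labels_mono)

lemma nilp_E_iff:
  fixes v :: "('d::finite) hspace"
  assumes "Suc r \<le> CARD('d)" "Suc s \<le> CARD('d)"
  shows "nilp v \<in> E_space r s \<longleftrightarrow> v \<in> E_space (Suc r) (Suc s)"
proof -
  have "(\<forall>i. 1 \<le> i \<longrightarrow> i \<le> CARD('d) \<longrightarrow> (r < i \<longrightarrow> nilp v $ Inl (idx i) = 0) \<and> (s < i \<longrightarrow> nilp v $ Inr (idx i) = 0)) \<longleftrightarrow>
    (\<forall>i. 1 \<le> i \<longrightarrow> i \<le> CARD('d) \<longrightarrow> (Suc r < i \<longrightarrow> v $ Inl (idx i) = 0) \<and> (Suc s < i \<longrightarrow> v $ Inr (idx i) = 0))" (is "?L \<longleftrightarrow> ?R")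
  proof
    assume L: ?L
    show ?R
    proof (intro allI impI)
      fix i assume i: "1 \<le> i" "i \<le> CARD('d)"
      show "(Suc r < i \<longrightarrow> v $ Inl (idx i) = 0) \<and> (Suc s < i \<longrightarrow> v $ Inr (idx i) = 0)"
      proof (cases "i = 1")
        case False
        then obtain j where j: "i = Suc j" "1 \<le> j" using i by (cases i) auto
        then show ?thesis using L[rule_format, of j] i by auto
      qed simp
    qed
  next
    assume R: ?R
    show ?L
    proof (intro allI impI)
      fix i assume i: "1 \<le> i" "i \<le> CARD('d)"
      show "(r < i \<longrightarrow> nilp v $ Inl (idx i) = 0) \<and> (s < i \<longrightarrow> nilp v $ Inr (idx i) = 0)"
        using R[rule_format, of "Suc i"] i by auto
    qed
  qed
  then show ?thesis using assms by (simp add: mem_E_space)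
qed

section \<open>Bilinear forms and their Gram matrices\<close>

definition bilinear_form :: "(complex ^ 'n \<Rightarrow> complex ^ 'n \<Rightarrow> complex) \<Rightarrow> bool" where
  "bilinear_form f \<longleftrightarrow> (\<forall>u v w. f (u + v) w = f u w + f v w) \<and> (\<forall>u v w. f w (u + v) = f w u + f w v) \<and>
     (\<forall>c u w. f (c *s u) w = c * f u w) \<and> (\<forall>c u w. f w (c *s u) = c * f w u)"

lemma bilinear_formD:
  assumes "bilinear_form f"
  shows "f (u + v) w = f u w + f v w" "f w (u + v) = f w u + f w v"
    "f (c *s u) w = c * f u w" "f w (c *s u) = c * f w u"
  using assms unfolding bilinear_form_def by blast+

lemma bilinear_form_zero:
  assumes "bilinear_form f"
  shows "f 0 w = 0" "f w 0 = 0"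
  using bilinear_formD(3,4)[OF assms, of 0 0 w] bilinear_formD(4)[OF assms, of w 0 0] by simp_all

lemma bilinear_form_diff:
  assumes "bilinear_form f"
  shows "f (u - v) w = f u w - f v w" "f w (u - v) = f w u - f w v"
  using bilinear_formD(1)[OF assms, of "u - v" v w] bilinear_formD(2)[OF assms, of w "u - v" v]
  by simp_all

lemma bilinear_form_eq:
  assumes f: "bilinear_form f" and g: "bilinear_form g"
    and eq: "\<And>a b. a \<in> A \<Longrightarrow> b \<in> B \<Longrightarrow> f a b = g a b"
    and v: "v \<in> vec.span A" and w: "w \<in> vec.span B"
  shows "f v w = g v w"
proof -
  have "f v b = g v b" if b: "b \<in> B" for b
  proof -
    have "vec.subspace {v. f v b = g v b}"
      using f g by (auto simp: vec.subspace_def bilinear_formD bilinear_form_zero)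
    then have "vec.span A \<subseteq> {v. f v b = g v b}" using eq b by (intro vec.span_minimal) auto
    then show ?thesis using v by blast
  qed
  moreover have "vec.subspace {w. f v w = g v w}"
    using f g by (auto simp: vec.subspace_def bilinear_formD bilinear_form_zero)
  ultimately have "vec.span B \<subseteq> {w. f v w = g v w}" by (intro vec.span_minimal) auto
  then show ?thesis using w by blast
qed

lemma bilinear_form_nilp: "bilinear_form f \<Longrightarrow> bilinear_form (\<lambda>v w. f (nilp v) w)"
  "bilinear_form f \<Longrightarrow> bilinear_form (\<lambda>v w. f v (nilp w))"
  "bilinear_form f \<Longrightarrow> bilinear_form (\<lambda>v w. - f v w)"
  "bilinear_form f \<Longrightarrow> bilinear_form (\<lambda>v w. f w v)"
  by (simp_all add: bilinear_form_def nilp_add nilp_scale)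

lemma coordinate_add: "coordinate (u + v) a = coordinate u a + coordinate v a"
  and coordinate_scale: "coordinate (c *s u) a = c * coordinate u a"
  by (simp_all add: coordinate_def)

lemma bilinear_bilin: "bilinear_form (bilin r s G)"
  unfolding bilinear_form_def bilin_def coordinate_add coordinate_scale
  by (simp add: algebra_simps sum.distrib sum_distrib_left)

lemma coordinate_bv:
  assumes "a \<in> labels CARD('d) CARD('d)" "b \<in> labels CARD('d) CARD('d)"
  shows "coordinate (bv a :: ('d::finite) hspace) b = (if a = b then 1 else 0)"
  using assms by (cases a; cases b) (auto simp: bv_simps e_vec_idx2)

lemma bilin_labels: "bilin r s G v w = (\<Sum>a\<in>labels r s. \<Sum>b\<in>labels r s. coordinate v a * coordinate w b * G a b)"
  by (simp add: bilin_def labels_def)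

lemma bilin_bv:
  assumes "r \<le> CARD('d)" "s \<le> CARD('d)" "a \<in> labels r s" "b \<in> labels r s"
  shows "bilin r s G (bv a :: ('d::finite) hspace) (bv b) = G a b"
proof -
  have sub: "x \<in> labels CARD('d) CARD('d)" if "x \<in> labels r s" for x using labels_mono[OF assms(1,2)] that by blast
  have "bilin r s G (bv a :: 'd hspace) (bv b) =
    (\<Sum>x\<in>labels r s. \<Sum>y\<in>labels r s. if y = b then (if x = a then G a b else 0) else 0)"
    unfolding bilin_labels using sub assms by (intro sum.cong refl) (auto simp: coordinate_bv)
  also have "\<dots> = (\<Sum>x\<in>labels r s. if x = a then G a b else 0)"
    using assms by (simp only: sum.delta finite_labels if_True)
  also have "\<dots> = G a b" using assms by simp
  finally show ?thesis .
qed

lemma nilp_bv: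
  assumes "a \<in> labels CARD('d) CARD('d)"
  shows "height a = 1 \<Longrightarrow> nilp (bv a :: ('d::finite) hspace) = 0"
    and "a = next_label b \<Longrightarrow> b \<in> labels CARD('d) CARD('d) \<Longrightarrow> nilp (bv a :: 'd hspace) = bv b"
proof -
  show "nilp (bv a :: 'd hspace) = 0" if "height a = 1"
    using that nilp_first[where 'd = 'd] by (cases a) (auto simp: bv_simps)
  show "nilp (bv a :: 'd hspace) = bv b" if "a = next_label b" "b \<in> labels CARD('d) CARD('d)"
    using that assms by (intro vec_eqI_coordinate; cases b) (auto simp: bv_simps e_vec_idx2)
qed

text \<open>The hypotheses of the theorem without \<open>1 \<le> k\<close>, so that they survive the
  step to \<open>(m - 2, k - 2)\<close>. With \<open>k = 0\<close> they force \<open>m = 0\<close>,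
  the empty flag.\<close>

definition adm :: "'d::finite itself \<Rightarrow> nat \<Rightarrow> nat \<Rightarrow> bool" where
  "adm T m k \<longleftrightarrow> k \<le> m \<and> (k = m \<or> odd k) \<and> 2 * m \<le> CARD('d)"

lemma adm_bounds:
  assumes "adm TYPE('d::finite) m k"
  shows "2 * m - k \<le> CARD('d)" "k \<le> CARD('d)" "m \<le> CARD('d)" "k \<le> m" "k \<le> 2 * m - k"
  using assms by (auto simp: adm_def)

lemma adm_less: "adm TYPE('d::finite) m k \<Longrightarrow> 1 \<le> m \<Longrightarrow> m < CARD('d)"
  by (auto simp: adm_def)

lemma adm_reduce:
  assumes "adm TYPE('d::finite) m k" "2 \<le> k"
  shows "adm TYPE('d) (m - 2) (k - 2)" "2 \<le> m" "2 * (m - 2) - (k - 2) = 2 * m - k - 2"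
  using assms by (auto simp: adm_def)

lemma label_cases:
  assumes "a \<in> labels r s"
  obtains "height a = 1" | b where "a = next_label b" "b \<in> labels (r - 1) (s - 1)"
proof (cases "height a = 1")
  case False
  show ?thesis
  proof (cases a)
    case (Inl i)
    then have "i = Suc (i - 1)" "1 \<le> i - 1" "i - 1 \<le> r - 1" using False assms by auto
    then show ?thesis using that(2)[of "Inl (i - 1)"] Inl by simp
  next
    case (Inr i)
    then have "i = Suc (i - 1)" "1 \<le> i - 1" "i - 1 \<le> s - 1" using False assms by auto
    then show ?thesis using that(2)[of "Inr (i - 1)"] Inr by simp
  qed
qed (use that in blast)

lemma minus_one_pred: "1 \<le> i \<Longrightarrow> (- 1 :: complex) ^ i = - ((- 1) ^ (i - 1))"
  by (cases i) auto

text \<open>The numerical source of the relation between the two forms: \<open>gram_C\<close> pairs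
  labels whose sum is one less than for \<open>gram_D\<close>.\<close>

lemma gram_C_next: "a \<in> labels r s \<Longrightarrow> b \<in> labels r s \<Longrightarrow> gram_C m k a b = gram_D m k a (next_label b)"
  using minus_one_pred by (cases a; cases b) auto

lemma gram_D_next_next:
  assumes "2 \<le> k" "k \<le> m" "a \<in> labels r s" "b \<in> labels r s"
  shows "gram_D m k (next_label a) (next_label b) = - gram_D (m - 2) (k - 2) a b"
  using assms minus_one_pred by (cases a; cases b) auto

lemma gram_D_skew:
  assumes "k \<le> m" "a \<in> labels r s" "b \<in> labels r s"
  shows "gram_D m k (next_label a) b = - gram_D m k a (next_label b)"
  using assms minus_one_pred by (cases a; cases b) auto

lemma gram_D_first:
  assumes "k \<le> m" "height a = 1" "b \<in> labels (2 * m - k - 1) (k - 1)"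
  shows "gram_D m k a b = 0" "gram_D m k b a = 0"
  using assms by (cases a; cases b; auto)+

text \<open>For \<open>k < m\<close> the oddness of \<open>k\<close> makes both index sums
  \<open>2 * m - k + 1\<close> and \<open>k + 1\<close> even, so paired indices have the same parity
  and the same sign.\<close>

lemma gram_D_sym:
  assumes "k \<le> m" "k = m \<or> odd k" "a \<in> labels (2 * m - k) k" "b \<in> labels (2 * m - k) k"
  shows "gram_D m k a b = gram_D m k b a"
proof (cases "k = m")
  case True
  then show ?thesis by (cases a; cases b) (auto simp: add.commute)
next
  case False
  then have k: "odd k" using assms by blast
  have p: "(- 1 :: complex) ^ i = (- 1) ^ j" if "even (i + j)" for i j
    using that by (metis even_add uminus_power_if power_one)
  have q: "(- 1 :: complex) ^ (i - 1) = (- 1) ^ (j - 1)" if "1 \<le> i" "1 \<le> j" "even (i + j)" for i j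
    using that by (intro p) auto
  show ?thesis
  proof (cases a; cases b)
    fix i j assume "a = Inl i" "b = Inl j"
    then show ?thesis
    proof (cases "i + j = 2 * m - k + 1")
      case True
      then have "even (i + j)" using k assms(1) by simp
      then show ?thesis using \<open>a = Inl i\<close> \<open>b = Inl j\<close> assms q[of i j] True False by (simp add: add.commute)
    qed (simp add: add.commute)
  next
    fix i j assume "a = Inr i" "b = Inr j"
    then show ?thesis
    proof (cases "i + j = k + 1")
      case True
      then have "even (i + j)" using k by simp
      then show ?thesis using \<open>a = Inr i\<close> \<open>b = Inr j\<close> p[of i j] True False by (simp add: add.commute)
    qed (simp add: add.commute)
  qed (use False in auto)
qed

text \<open>The Gram matrix is a signed permutation matrix: each label has exactly one partner.
  Hence \<open>theta\<close> permutes the basis up to signs.\<close>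

lemma gram_D_partner:
  assumes "k \<le> m" "k = m \<or> odd k" "a \<in> labels (2 * m - k) k"
  obtains c e where "c \<in> labels (2 * m - k) k" "e * e = 1" "cnj e = e"
    "\<And>d. d \<in> labels (2 * m - k) k \<Longrightarrow> gram_D m k d a = (if d = c then e else 0)"
    "\<And>d. d \<in> labels (2 * m - k) k \<Longrightarrow> gram_D m k d c = (if d = a then e else 0)"
proof -
  define c where "c = (if k = m then (case a of Inl i \<Rightarrow> Inr (k + 1 - i) | Inr j \<Rightarrow> Inl (k + 1 - j))
    else (case a of Inl i \<Rightarrow> Inl (2 * m - k + 1 - i) | Inr j \<Rightarrow> Inr (k + 1 - j)))"
  have c: "c \<in> labels (2 * m - k) k"
    using assms by (cases a) (auto simp: c_def)
  have 1: "gram_D m k d a = 0" if "d \<in> labels (2 * m - k) k" "d \<noteq> c" for d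
    using that assms by (cases a; cases d) (auto simp: c_def split: if_splits)
  have 2: "gram_D m k d c = 0" if "d \<in> labels (2 * m - k) k" "d \<noteq> a" for d
    using that assms by (cases a; cases d) (auto simp: c_def split: if_splits)
  define e where "e = gram_D m k c a"
  have e': "gram_D m k a c = e" unfolding e_def by (rule gram_D_sym[OF assms c])
  have pw: "(- 1 :: complex) ^ i = 1 \<or> (- 1 :: complex) ^ i = - 1" for i by (cases "even i") auto
  have "e = 1 \<or> e = - 1"
  proof (cases "k = m")
    case True
    then show ?thesis using assms(3) pw by (cases a) (auto simp: c_def e_def)
  next
    case False
    then have "k < m" using assms(1) by simp
    then show ?thesis using assms(3) pw by (cases a) (auto simp: c_def e_def)
  qed
  then have "e * e = 1" "cnj e = e" by auto
  moreover have "gram_D m k d a = (if d = c then e else 0)" if "d \<in> labels (2 * m - k) k" for d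
    using 1[OF that] by (cases "d = c") (simp_all add: e_def)
  moreover have "gram_D m k d c = (if d = a then e else 0)" if "d \<in> labels (2 * m - k) k" for d
    using 2[OF that] e' by (cases "d = a") simp_all
  ultimately show ?thesis by (rule that[OF c])
qed

lemma bilinear_beta_D: "bilinear_form (beta_D m k)" and bilinear_beta_C: "bilinear_form (beta_C m k)"
  unfolding beta_D_def beta_C_def by (rule bilinear_bilin)+

lemmas beta_add = bilinear_formD(1,2)[OF bilinear_beta_D] bilinear_formD(1,2)[OF bilinear_beta_C]
lemmas beta_scale = bilinear_formD(3,4)[OF bilinear_beta_D] bilinear_formD(3,4)[OF bilinear_beta_C]
lemmas beta_diff = bilinear_form_diff[OF bilinear_beta_D] bilinear_form_diff[OF bilinear_beta_C]
lemmas beta_zero [simp] = bilinear_form_zero[OF bilinear_beta_D] bilinear_form_zero[OF bilinear_beta_C]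

definition ED :: "nat \<Rightarrow> nat \<Rightarrow> ('d::finite) hspace set" where
  "ED m k = E_space (2 * m - k) k"

definition EC :: "nat \<Rightarrow> nat \<Rightarrow> ('d::finite) hspace set" where
  "EC m k = E_space (2 * m - k - 1) (k - 1)"

lemma subspace_ED [simp]: "vec.subspace (ED m k)" and subspace_EC [simp]: "vec.subspace (EC m k)"
  by (simp_all add: ED_def EC_def)

lemma EC_subset_ED: "EC m k \<subseteq> ED m k"
  unfolding EC_def ED_def by (rule E_space_mono) auto

lemma nilp_ED_iff:
  assumes "adm TYPE('d::finite) m k" "1 \<le> k"
  shows "nilp (v :: 'd hspace) \<in> EC m k \<longleftrightarrow> v \<in> ED m k"
proof -
  have "Suc (2 * m - k - 1) = 2 * m - k" "Suc (k - 1) = k" using assms by (auto simp: adm_def)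
  then show ?thesis
    using nilp_E_iff[of "2 * m - k - 1" "k - 1" v] adm_bounds[OF assms(1)] unfolding EC_def ED_def by simp
qed

lemma nilp_EC_iff:
  assumes "adm TYPE('d::finite) m k" "2 \<le> k"
  shows "nilp (v :: 'd hspace) \<in> ED (m - 2) (k - 2) \<longleftrightarrow> v \<in> EC m k"
proof -
  have "Suc (2 * m - k - 2) = 2 * m - k - 1" "Suc (k - 2) = k - 1" using assms by (auto simp: adm_def)
  then show ?thesis
    using nilp_E_iff[of "2 * m - k - 2" "k - 2" v] adm_bounds[OF assms(1)]
    unfolding EC_def ED_def adm_reduce(3)[OF assms] by auto
qed

text \<open>The link between the two types: a condition on \<open>F\<^sub>m\<^sub>-\<^sub>1\<close>
  in terms of \<open>beta_C\<close> becomes one in terms of \<open>beta_D\<close> and the preimage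
  of \<open>F\<^sub>m\<^sub>-\<^sub>1\<close> under \<open>nilp\<close>.\<close>

lemma beta_C_nilp:
  assumes a: "adm TYPE('d::finite) m k" "1 \<le> k" and v: "v \<in> EC m k" and w: "w \<in> ED m k"
  shows "beta_C m k v (nilp (w :: 'd hspace)) = beta_D m k v w"
proof (rule bilinear_form_eq[OF bilinear_form_nilp(2)[OF bilinear_beta_C] bilinear_beta_D _ v[unfolded EC_def E_space_eq] w[unfolded ED_def E_space_eq]])
  let ?r = "2 * m - k"
  fix x y :: "'d hspace"
  assume "x \<in> bv ` labels (?r - 1) (k - 1)" "y \<in> bv ` labels ?r k"
  then obtain b c where bc: "b \<in> labels (?r - 1) (k - 1)" "x = bv b" "c \<in> labels ?r k" "y = bv c" by blast
  have bd: "?r \<le> CARD('d)" "k \<le> CARD('d)" "?r - 1 \<le> CARD('d)" "k - 1 \<le> CARD('d)"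
    using adm_bounds[OF a(1)] by auto
  have bl: "b \<in> labels ?r k" using bc labels_mono[OF diff_le_self[of ?r 1] diff_le_self[of k 1]] by blast
  have D: "beta_D m k (bv b :: 'd hspace) (bv c) = gram_D m k b c"
    unfolding beta_D_def by (rule bilin_bv) (use bd bl bc in auto)
  have cN: "c \<in> labels CARD('d) CARD('d)" using bc labels_mono bd by blast
  from bc(3) show "beta_C m k x (nilp y) = beta_D m k x y"
  proof (cases rule: label_cases)
    case 1
    then show ?thesis unfolding bc D nilp_bv(1)[OF cN 1] using gram_D_first(2)[of k m c b] bc(1) a by (simp add: adm_def)
  next
    case (2 c')
    have c'N: "c' \<in> labels CARD('d) CARD('d)" using 2 labels_mono bd by blast
    have "beta_C m k (bv b :: 'd hspace) (bv c') = gram_C m k b c'"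
      unfolding beta_C_def using bc(1) 2(2) bd by (intro bilin_bv) auto
    then show ?thesis
      unfolding bc D nilp_bv(2)[OF cN 2(1) c'N] using gram_C_next[OF bc(1) 2(2)] 2 by simp
  qed
qed

lemma beta_D_skew:
  assumes a: "adm TYPE('d::finite) m k" and v: "v \<in> ED m k" and w: "w \<in> ED m k"
  shows "beta_D m k (nilp v) (w :: 'd hspace) = - beta_D m k v (nilp w)"
proof (rule bilinear_form_eq[OF bilinear_form_nilp(1)[OF bilinear_beta_D] bilinear_form_nilp(3)[OF bilinear_form_nilp(2)[OF bilinear_beta_D]] _
      v[unfolded ED_def E_space_eq] w[unfolded ED_def E_space_eq]])
  let ?r = "2 * m - k"
  fix x y :: "'d hspace"
  assume "x \<in> bv ` labels ?r k" "y \<in> bv ` labels ?r k"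
  then obtain b c where bc: "b \<in> labels ?r k" "x = bv b" "c \<in> labels ?r k" "y = bv c" by blast
  have km: "k \<le> m" using a by (simp add: adm_def)
  have bd: "?r \<le> CARD('d)" "k \<le> CARD('d)" using adm_bounds[OF a] by auto
  have N: "d \<in> labels CARD('d) CARD('d)" if "d \<in> labels ?r k" for d using labels_mono[OF bd] that by blast
  have sub: "d \<in> labels ?r k" if "d \<in> labels (?r - 1) (k - 1)" for d
    using that labels_mono[OF diff_le_self[of ?r 1] diff_le_self[of k 1]] by blast
  have D: "beta_D m k (bv b' :: 'd hspace) (bv c') = gram_D m k b' c'"
    if "b' \<in> labels ?r k" "c' \<in> labels ?r k" for b' c'
    unfolding beta_D_def by (rule bilin_bv) (use bd that in auto)
  from bc(1) show "beta_D m k (nilp x) y = - beta_D m k x (nilp y)"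
  proof (cases rule: label_cases)
    case 1
    from bc(3) show ?thesis
    proof (cases rule: label_cases)
      case one: 1
      show ?thesis unfolding bc nilp_bv(1)[OF N[OF bc(1)] 1] nilp_bv(1)[OF N[OF bc(3)] one] by simp
    next
      case (2 c')
      show ?thesis
        unfolding bc nilp_bv(1)[OF N[OF bc(1)] 1] nilp_bv(2)[OF N[OF bc(3)] 2(1) N[OF sub[OF 2(2)]]] D[OF bc(1) sub[OF 2(2)]]
        using gram_D_first(1)[OF km 1 2(2)] by simp
    qed
  next
    case (2 b')
    note nb = nilp_bv(2)[OF N[OF bc(1)] 2(1) N[OF sub[OF 2(2)]]]
    from bc(3) show ?thesis
    proof (cases rule: label_cases)
      case 1
      show ?thesis
        unfolding bc nb nilp_bv(1)[OF N[OF bc(3)] 1] D[OF sub[OF 2(2)] bc(3)]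
        using gram_D_first(2)[OF km 1 2(2)] by simp
    next
      case c: (2 c')
      show ?thesis
        unfolding bc nb nilp_bv(2)[OF N[OF bc(3)] c(1) N[OF sub[OF c(2)]]] D[OF sub[OF 2(2)] bc(3)] D[OF bc(1) sub[OF c(2)]]
        using gram_D_skew[OF km 2(2) c(2)] 2(1) c(1) by simp
    qed
  qed
qed

lemma beta_D_nilp_nilp:
  assumes a: "adm TYPE('d::finite) m k" "2 \<le> k" and v: "v \<in> EC m k" and w: "w \<in> EC m k"
  shows "beta_D (m - 2) (k - 2) (nilp v) (nilp (w :: 'd hspace)) = - beta_D m k v w"
proof (rule bilinear_form_eq[OF bilinear_form_nilp(1)[OF bilinear_form_nilp(2)[OF bilinear_beta_D]] bilinear_form_nilp(3)[OF bilinear_beta_D] _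
      v[unfolded EC_def E_space_eq] w[unfolded EC_def E_space_eq]])
  let ?r = "2 * m - k - 1" and ?s = "k - 1"
  fix x y :: "'d hspace"
  assume "x \<in> bv ` labels ?r ?s" "y \<in> bv ` labels ?r ?s"
  then obtain b c where bc: "b \<in> labels ?r ?s" "x = bv b" "c \<in> labels ?r ?s" "y = bv c" by blast
  have km: "k \<le> m" using a by (simp add: adm_def)
  have bd: "2 * m - k \<le> CARD('d)" "k \<le> CARD('d)" using adm_bounds[OF a(1)] by auto
  have L: "d \<in> labels (2 * m - k) k" if "d \<in> labels ?r ?s" for d
    using that labels_mono[OF diff_le_self[of "2 * m - k" 1] diff_le_self[of k 1]] by blast
  have N: "d \<in> labels CARD('d) CARD('d)" if "d \<in> labels ?r ?s" for d using labels_mono[OF bd] L[OF that] by blast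
  have sub: "d \<in> labels ?r ?s" if "d \<in> labels (?r - 1) (?s - 1)" for d
    using that labels_mono[OF diff_le_self[of ?r 1] diff_le_self[of ?s 1]] by blast
  have r: "2 * (m - 2) - (k - 2) = ?r - 1" "k - 2 = ?s - 1" using adm_reduce(3)[OF a] by auto
  have D: "beta_D m k (bv b :: 'd hspace) (bv c) = gram_D m k b c"
    unfolding beta_D_def by (rule bilin_bv) (use bd bc L in auto)
  from bc(1) show "beta_D (m - 2) (k - 2) (nilp x) (nilp y) = - beta_D m k x y"
  proof (cases rule: label_cases)
    case 1
    show ?thesis unfolding bc D nilp_bv(1)[OF N[OF bc(1)] 1] using gram_D_first(1)[OF km 1 bc(3)] by simp
  next
    case (2 b')
    note nb = nilp_bv(2)[OF N[OF bc(1)] 2(1) N[OF sub[OF 2(2)]]]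
    from bc(3) show ?thesis
    proof (cases rule: label_cases)
      case 1
      show ?thesis unfolding bc D nilp_bv(1)[OF N[OF bc(3)] 1] using gram_D_first(2)[OF km 1 bc(1)] by simp
    next
      case c: (2 c')
      have "beta_D (m - 2) (k - 2) (bv b' :: 'd hspace) (bv c') = gram_D (m - 2) (k - 2) b' c'"
        unfolding beta_D_def by (rule bilin_bv) (use bd 2 c r in auto)
      then show ?thesis
        unfolding bc D nb nilp_bv(2)[OF N[OF bc(3)] c(1) N[OF sub[OF c(2)]]]
        using gram_D_next_next[OF a(2) km 2(2) c(2)] 2(1) c(1) bc by simp
    qed
  qed
qed

lemma beta_D_sym:
  assumes a: "adm TYPE('d::finite) m k"
  shows "beta_D m k v (w :: 'd hspace) = beta_D m k w v"
proof -
  have "beta_D m k v w = (\<Sum>a\<in>labels (2 * m - k) k. \<Sum>b\<in>labels (2 * m - k) k. coordinate w b * coordinate v a * gram_D m k b a)"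
    unfolding beta_D_def bilin_labels
    using gram_D_sym[of k m] a by (intro sum.cong refl) (simp add: adm_def)
  also have "\<dots> = beta_D m k w v" unfolding beta_D_def bilin_labels by (rule sum.swap)
  finally show ?thesis .
qed

subsection \<open>The real structure\<close>

text \<open>The antilinear map representing \<open>beta_D\<close> through the hermitian form. On
  \<open>ED\<close> it is an involution, because the Gram matrix is a symmetric signed permutation;
  it turns complements for \<open>beta_D\<close> into hermitian ones.\<close>

definition theta :: "nat \<Rightarrow> nat \<Rightarrow> ('d::finite) hspace \<Rightarrow> 'd hspace" where
  "theta m k w = (\<chi> c. cnj (beta_D m k (axis c 1) w))"

lemma herm_theta: "herm v (theta m k w) = beta_D m k v w"
proof -
  have "beta_D m k (\<Sum>i\<in>S. v $ i *s axis i 1) w = (\<Sum>i\<in>S. v $ i * beta_D m k (axis i 1) w)" for S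
    by (induction S rule: infinite_finite_induct) (simp_all add: beta_add beta_scale)
  from this[of UNIV] have "beta_D m k v w = (\<Sum>i\<in>UNIV. v $ i * beta_D m k (axis i 1) w)"
    by (simp add: basis_expansion)
  then show ?thesis by (simp add: herm_def theta_def)
qed

lemma theta_add: "theta m k (v + w) = theta m k v + theta m k w"
  and theta_scale: "theta m k (c *s v) = cnj c *s theta m k v"
  by (simp_all add: theta_def vec_eq_iff beta_add beta_scale)

lemma theta_zero [simp]: "theta m k 0 = 0"
  by (simp add: theta_def vec_eq_iff)

lemma theta_bv:
  assumes a: "adm TYPE('d::finite) m k" and b: "b \<in> labels (2 * m - k) k"
  obtains c e where "c \<in> labels (2 * m - k) k" "e * e = 1" "cnj e = e"
    "theta m k (bv b) = e *s (bv c :: 'd hspace)" "theta m k (bv c) = e *s (bv b :: 'd hspace)"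
proof -
  let ?r = "2 * m - k"
  have bd: "?r \<le> CARD('d)" "k \<le> CARD('d)" using adm_bounds[OF a] by auto
  have km: "k \<le> m" "k = m \<or> odd k" using a by (auto simp: adm_def)
  obtain c e where c: "c \<in> labels ?r k" "e * e = 1" "cnj e = e"
    "\<And>d. d \<in> labels ?r k \<Longrightarrow> gram_D m k d b = (if d = c then e else 0)"
    "\<And>d. d \<in> labels ?r k \<Longrightarrow> gram_D m k d c = (if d = b then e else 0)"
    by (rule gram_D_partner[OF km b]) blast
  have N: "d \<in> labels CARD('d) CARD('d)" if "d \<in> labels ?r k" for d using labels_mono[OF bd] that by blast
  have key: "theta m k (bv x) = e *s (bv y :: 'd hspace)"
    if x: "x \<in> labels ?r k" and y: "y \<in> labels ?r k"
      and xy: "\<And>d. d \<in> labels ?r k \<Longrightarrow> gram_D m k d x = (if d = y then e else 0)" for x y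
  proof -
    have co: "coordinate (theta m k (bv x) :: 'd hspace) d = (if d = y then e else 0)"
      if d: "d \<in> labels CARD('d) CARD('d)" for d
    proof -
      have eq: "coordinate (theta m k (bv x) :: 'd hspace) d = cnj (beta_D m k (bv d :: 'd hspace) (bv x))"
        by (simp add: coordinate_def theta_def bv_def)
      show ?thesis
      proof (cases "d \<in> labels ?r k")
        case True
        have "beta_D m k (bv d :: 'd hspace) (bv x) = gram_D m k d x"
          unfolding beta_D_def by (rule bilin_bv) (use bd True x in auto)
        then show ?thesis using eq xy[OF True] c(3) by simp
      next
        case False
        have "coordinate (bv d :: 'd hspace) l = 0" if "l \<in> labels ?r k" for l
          using coordinate_bv[where 'd = 'd, OF d N[OF that]] that False by auto
        then have "beta_D m k (bv d :: 'd hspace) (bv x) = 0"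
          unfolding beta_D_def bilin_labels by simp
        then show ?thesis using eq False y by auto
      qed
    qed
    have co2: "coordinate (e *s (bv y :: 'd hspace)) d = (if d = y then e else 0)"
      if d: "d \<in> labels CARD('d) CARD('d)" for d
      using coordinate_bv[where 'd = 'd, OF N[OF y] d] by (auto simp: coordinate_scale)
    show ?thesis
    proof (rule vec_eqI_coordinate)
      fix i assume i: "1 \<le> i" "i \<le> CARD('d)"
      show "(theta m k (bv x) :: 'd hspace) $ Inl (idx i) = (e *s (bv y :: 'd hspace)) $ Inl (idx i)"
        using trans[OF co[of "Inl i"] co2[of "Inl i", symmetric]] unfolding coordinate_simps label_simps using i by blast
      show "(theta m k (bv x) :: 'd hspace) $ Inr (idx i) = (e *s (bv y :: 'd hspace)) $ Inr (idx i)"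
        using trans[OF co[of "Inr i"] co2[of "Inr i", symmetric]] unfolding coordinate_simps label_simps using i by blast
    qed
  qed
  show ?thesis using that[OF c(1-3) key[OF b c(1,4)] key[OF c(1) b c(5)]] .
qed

lemma theta_ED:
  assumes a: "adm TYPE('d::finite) m k" and v: "v \<in> (ED m k :: 'd hspace set)"
  shows "theta m k v \<in> ED m k" "theta m k (theta m k v) = v"
proof -
  have "vec.subspace {v :: 'd hspace. theta m k v \<in> ED m k \<and> theta m k (theta m k v) = v}"
  proof -
    have s: "vec.subspace (ED m k :: 'd hspace set)" by simp
    show ?thesis
      using vec.subspace_add[OF s] vec.subspace_scale[OF s] vec.subspace_0[OF s]
      unfolding vec.subspace_def by (simp add: theta_add theta_scale)
  qed
  moreover have "bv b \<in> {v :: 'd hspace. theta m k v \<in> ED m k \<and> theta m k (theta m k v) = v}"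
    if b: "b \<in> labels (2 * m - k) k" for b
  proof -
    obtain c e where c: "c \<in> labels (2 * m - k) k" "e * e = 1" "cnj e = e"
      "theta m k (bv b) = e *s (bv c :: 'd hspace)" "theta m k (bv c) = e *s (bv b :: 'd hspace)"
      using theta_bv[OF a b] by metis
    have "e *s (bv c :: 'd hspace) \<in> ED m k"
      unfolding ED_def E_space_eq using c(1) by (intro vec.span_scale vec.span_base) auto
    then show ?thesis using c by (simp add: theta_scale)
  qed
  ultimately have "ED m k \<subseteq> {v :: 'd hspace. theta m k v \<in> ED m k \<and> theta m k (theta m k v) = v}"
    unfolding ED_def E_space_eq by (intro vec.span_minimal) auto
  then show "theta m k v \<in> ED m k" "theta m k (theta m k v) = v" using v by auto
qed

lemma herm_theta_theta:
  assumes a: "adm TYPE('d::finite) m k" and v: "v \<in> (ED m k :: 'd hspace set)"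
  shows "herm (theta m k w) (theta m k v) = herm v w"
proof -
  have "herm (theta m k v) (theta m k w) = beta_D m k w (theta m k v)"
    unfolding herm_theta by (rule beta_D_sym[OF a])
  also have "\<dots> = herm w v" unfolding herm_theta[symmetric] theta_ED(2)[OF a v] ..
  finally show ?thesis using cnj_herm by metis
qed

definition perp :: "nat \<Rightarrow> nat \<Rightarrow> ('d::finite) hspace set \<Rightarrow> 'd hspace set" where
  "perp m k W = {v \<in> ED m k. \<forall>w\<in>W. beta_D m k v w = 0}"

lemma subspace_perp [simp]: "vec.subspace (perp m k W)"
  using vec.subspace_add[OF subspace_ED] vec.subspace_scale[OF subspace_ED] vec.subspace_0[OF subspace_ED]
  by (auto simp: perp_def vec.subspace_def beta_add beta_scale)

lemma dim_ED:
  assumes "adm TYPE('d::finite) m k"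
  shows "vec.dim (ED m k :: 'd hspace set) = 2 * m"
  using dim_E_space[where 'd = 'd, of "2 * m - k" k] adm_bounds[OF assms] unfolding ED_def by simp

lemma dim_EC:
  assumes "adm TYPE('d::finite) m k" "1 \<le> k"
  shows "vec.dim (EC m k :: 'd hspace set) = 2 * m - 2"
  using dim_E_space[where 'd = 'd, of "2 * m - k - 1" "k - 1"] adm_bounds[OF assms(1)] assms unfolding EC_def
  by (auto simp: adm_def)

lemma dim_perp:
  assumes a: "adm TYPE('d::finite) m k" and W: "vec.subspace W" "W \<subseteq> (ED m k :: 'd hspace set)"
  shows "vec.dim (perp m k W) + vec.dim W = 2 * m"
proof -
  have lin: "linear (theta m k :: 'd hspace \<Rightarrow> _)"
    by (intro linearI) (simp_all add: theta_add scaleR_eq_smult theta_scale)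
  have rW: "subspace W" using W(1) by (rule vec_subspace_imp_subspace)
  have "dim (theta m k ` W) = dim W"
  proof (rule dim_image_eq[OF lin])
    have "span W = W" using rW by (simp add: span_eq_iff)
    then show "inj_on (theta m k) (span W)"
      using theta_ED(2)[OF a] W(2) by (metis inj_on_inverseI subsetD)
  qed
  moreover have "dim {y \<in> ED m k. \<forall>x\<in>theta m k ` W. orthogonal x y} + dim (theta m k ` W) = dim (ED m k :: 'd hspace set)"
    using theta_ED(1)[OF a] W(2) linear_subspace_image[OF lin rW]
    by (intro dim_subspace_orthogonal_to_vectors) (auto intro: vec_subspace_imp_subspace)
  moreover have "{y \<in> ED m k. \<forall>x\<in>theta m k ` W. orthogonal x y} = perp m k W"
  proof -
    have re: "orthogonal (theta m k w) y \<longleftrightarrow> Re (beta_D m k y w) = 0" for w y :: "'d hspace"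
      unfolding orthogonal_def by (metis Re_herm herm_theta inner_commute)
    have "(\<forall>w\<in>W. orthogonal (theta m k w) y) \<longleftrightarrow> (\<forall>w\<in>W. beta_D m k y w = 0)" for y
    proof
      assume o: "\<forall>w\<in>W. orthogonal (theta m k w) y"
      show "\<forall>w\<in>W. beta_D m k y w = 0"
      proof
        fix w assume w: "w \<in> W"
        \<comment> \<open>Real orthogonality only controls the real part; testing a second time with
          the vector multiplied by the imaginary unit gives the imaginary part.\<close>
        then have "\<i> *s w \<in> W" by (rule vec.subspace_scale[OF W(1)])
        then have "Re (beta_D m k y w) = 0" "Re (beta_D m k y (\<i> *s w)) = 0" using o w unfolding re by blast+
        then show "beta_D m k y w = 0" by (simp add: beta_scale complex_eq_iff)
      qed
    qed (simp add: re)
    then show ?thesis unfolding perp_def by auto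
  qed
  ultimately have "dim (perp m k W) + dim W = dim (ED m k :: 'd hspace set)" by simp
  then show ?thesis
    using real_dim[OF subspace_perp[of m k W]] real_dim[OF W(1)] real_dim[of "ED m k :: 'd hspace set"] dim_ED[OF a] by simp
qed

subsection \<open>Lagrangian flags\<close>

lemma ker_nilp: "{v :: ('d::finite) hspace. nilp v = 0} = E_space 1 1"
proof (rule equalityI; rule subsetI)
  fix v :: "'d hspace" assume "v \<in> {v. nilp v = 0}"
  then have "v = v $ Inl (idx 1) *s e_vec 1 + v $ Inr (idx 1) *s f_vec 1" using nilp_eq_0[of v] by simp
  also have "\<dots> \<in> E_space 1 1"
    unfolding E_space_def by (intro vec.span_add vec.span_scale vec.span_base) auto
  finally show "v \<in> E_space 1 1" .
next
  fix v :: "'d hspace" assume v: "v \<in> E_space 1 1"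
  have "vec.subspace {v :: 'd hspace. nilp v = 0}"
    by (simp add: vec.subspace_def nilp_add nilp_scale)
  moreover have "e_vec ` {1..1} \<union> f_vec ` {1..1} \<subseteq> {v :: 'd hspace. nilp v = 0}"
    using nilp_first[where 'd = 'd] by simp
  ultimately show "v \<in> {v. nilp v = 0}"
    using v vec.span_minimal unfolding E_space_def by blast
qed

lemma nilp_preimage:
  fixes W :: "('d::finite) hspace set"
  assumes W: "vec.subspace W" "\<And>w. w \<in> W \<Longrightarrow> low j w" "j < CARD('d)"
  shows "vec.subspace {v. nilp v \<in> W}" "vec.dim {v. nilp v \<in> W} = vec.dim W + 2"
proof -
  show s: "vec.subspace {v. nilp v \<in> W}"
    using vec.subspace_add[OF W(1)] vec.subspace_scale[OF W(1)] vec.subspace_0[OF W(1)]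
    by (auto simp: vec.subspace_def nilp_add nilp_scale)
  have "nilp (up w) = w" if "w \<in> W" for w using nilp_up[OF W(2)[OF that] W(3)] .
  then have "nilp ` {v. nilp v \<in> W} = W" by (auto simp: image_iff) metis
  moreover have "{v. nilp v \<in> W} \<inter> {v. nilp v = 0} = E_space 1 1"
    unfolding ker_nilp[symmetric] using vec.subspace_0[OF W(1)] by auto
  moreover have "vec.dim (E_space 1 1 :: 'd hspace set) = 2"
    using dim_E_space[where 'd = 'd, of 1 1] by (simp add: Suc_le_eq)
  ultimately show "vec.dim {v. nilp v \<in> W} = vec.dim W + 2"
    using dim_rank_nullity[OF s nilp_add nilp_scale] by simp
qed

lemma nilp_zero_ED:
  assumes "adm TYPE('d::finite) m k" "1 \<le> k" "nilp (u :: 'd hspace) = 0"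
  shows "u \<in> ED m k"
  using nilp_ED_iff[OF assms(1,2), of u] assms(3) vec.subspace_0[OF subspace_EC] by metis

lemma nilp_zero_EC:
  assumes "adm TYPE('d::finite) m k" "2 \<le> k" "nilp (u :: 'd hspace) = 0"
  shows "u \<in> EC m k"
  using nilp_EC_iff[OF assms(1,2), of u] assms(3) vec.subspace_0[OF subspace_ED] by metis

text \<open>One inclusion is \<open>beta_C_nilp\<close> with a kernel vector, the other a dimension
  count. It reduces membership in \<open>EC\<close> to orthogonality to the kernel of
  \<open>nilp\<close>.\<close>

lemma EC_eq_perp:
  assumes a: "adm TYPE('d::finite) m k" "1 \<le> k"
  shows "EC m k = perp m k {u :: 'd hspace. nilp u = 0}"
proof (rule vec.subspace_dim_equal)
  let ?K = "{u :: 'd hspace. nilp u = 0}"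
  show "EC m k \<subseteq> perp m k ?K"
  proof
    fix v :: "'d hspace" assume v: "v \<in> EC m k"
    have "beta_D m k v u = 0" if "nilp u = 0" for u
      using beta_C_nilp[OF a v nilp_zero_ED[OF a that]] that by simp
    then show "v \<in> perp m k ?K" using v EC_subset_ED by (auto simp: perp_def)
  qed
  have "?K \<subseteq> ED m k" using nilp_zero_ED[OF a] by auto
  moreover have "vec.subspace ?K" unfolding ker_nilp by simp
  ultimately have "vec.dim (perp m k ?K) + vec.dim ?K = 2 * m" by (intro dim_perp a)
  moreover have "vec.dim ?K = 2"
    unfolding ker_nilp using dim_E_space[where 'd = 'd, of 1 1] by (simp add: Suc_le_eq)
  ultimately show "vec.dim (perp m k ?K) \<le> vec.dim (EC m k :: 'd hspace set)"
    using dim_EC[OF a] by simp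
qed simp_all

text \<open>The isotropy condition of the fiber, read off the sequence of lines. The type argument
  fixes the ambient space, which \<open>a\<close> does not mention.\<close>

definition FD :: "'d::finite itself \<Rightarrow> nat \<Rightarrow> nat \<Rightarrow> (nat \<Rightarrow> complex ^ 2) \<Rightarrow> bool" where
  "FD T m k a \<longleftrightarrow> Fs a m \<subseteq> (ED m k :: 'd hspace set) \<and> isotropic (beta_D m k) (Fs a m :: 'd hspace set)"

definition FC :: "'d::finite itself \<Rightarrow> nat \<Rightarrow> nat \<Rightarrow> (nat \<Rightarrow> complex ^ 2) \<Rightarrow> bool" where
  "FC T m k a \<longleftrightarrow> Fs a (m - 1) \<subseteq> (EC m k :: 'd hspace set) \<and> isotropic (beta_C m k) (Fs a (m - 1) :: 'd hspace set)"

definition lagrangian :: "nat \<Rightarrow> nat \<Rightarrow> ('d::finite) hspace set \<Rightarrow> bool" where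
  "lagrangian m k N \<longleftrightarrow> vec.subspace N \<and> N \<subseteq> ED m k \<and> isotropic (beta_D m k) N \<and> vec.dim N = m"

lemma isotropicD: "isotropic b W \<Longrightarrow> v \<in> W \<Longrightarrow> w \<in> W \<Longrightarrow> b v w = 0"
  by (simp add: isotropic_def)

lemma FD_lagrangian:
  assumes "adm TYPE('d::finite) m k" "units a m" "FD TYPE('d) m k a"
  shows "lagrangian m k (Fs a m :: 'd hspace set)"
  using assms dim_Fs[of m a] adm_bounds(3)[OF assms(1)] by (simp add: lagrangian_def FD_def)

lemma perp_lagrangian:
  assumes a: "adm TYPE('d::finite) m k" and N: "lagrangian m k (N :: 'd hspace set)"
  shows "perp m k N = N"
proof (rule vec.subspace_dim_equal[symmetric])
  show "N \<subseteq> perp m k N" using N by (auto simp: lagrangian_def perp_def isotropic_def)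
  have "vec.dim (perp m k N) + vec.dim N = 2 * m" using N by (intro dim_perp a) (auto simp: lagrangian_def)
  then show "vec.dim (perp m k N) \<le> vec.dim N" using N by (simp add: lagrangian_def)
qed (use N in \<open>simp_all add: lagrangian_def\<close>)

lemma low_Fs: "v \<in> Fs a i \<Longrightarrow> low i (v :: ('d::finite) hspace)"
proof -
  assume v: "v \<in> Fs a i"
  have "low i (wv a j :: 'd hspace)" if "1 \<le> j" "j \<le> i" for j
    using low_mono[OF low_Bm[where 'd = 'd, of "j - 1" a "a j"], of i] that by (simp add: wv_def)
  moreover have "vec.subspace {v :: 'd hspace. low i v}"
    by (auto simp: vec.subspace_def intro: low_simps)
  ultimately have "Fs a i \<subseteq> {v :: 'd hspace. low i v}"
    unfolding Fs_def by (intro vec.span_minimal) auto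
  then show ?thesis using v by blast
qed

lemma nilp_Fs_self:
  assumes "i \<le> CARD('d)" "v \<in> Fs a i"
  shows "nilp (v :: ('d::finite) hspace) \<in> Fs a i"
proof (cases i)
  case 0
  then show ?thesis using assms by simp
next
  case (Suc l)
  then show ?thesis using nilp_Fs[of v a l] assms Fs_mono[of l i a] by auto
qed

text \<open>Let \<open>W\<close> be \<open>Fs a l\<close> and \<open>L\<close> the Lagrangian
  \<open>Fs a (Suc l)\<close>. By skewness \<open>nilp\<close> acts on the quadratic plane given by
  the complement of \<open>W\<close> modulo \<open>W\<close>, and it kills the isotropic line of
  \<open>L\<close>. A skew map of a nondegenerate quadratic plane that kills an isotropic line is
  zero, so \<open>nilp\<close> sends the complement into \<open>W\<close>; the dimensions
  agree.\<close>

lemma FD_imp_perp: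
  fixes a :: "nat \<Rightarrow> complex ^ 2"
  assumes ad: "adm TYPE('d::finite) (Suc l) k" and un: "units a (Suc l)" and FD: "FD TYPE('d) (Suc l) k a"
  shows "perp (Suc l) k (Fs a l) = {v :: 'd hspace. nilp v \<in> Fs a l}"
proof (rule vec.subspace_dim_equal)
  let ?m = "Suc l" and ?b = "beta_D (Suc l) k :: 'd hspace \<Rightarrow> 'd hspace \<Rightarrow> complex"
  define W where "W = (Fs a l :: 'd hspace set)"
  define L where "L = (Fs a ?m :: 'd hspace set)"
  define w where "w = (wv a ?m :: 'd hspace)"
  have lN: "?m \<le> CARD('d)" "l < CARD('d)" using adm_bounds(3)[OF ad] by auto
  have WL: "W \<subseteq> L" unfolding W_def L_def by (rule Fs_mono) simp
  have wL: "w \<in> L" unfolding w_def L_def by (rule wv_in_Fs) auto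
  have lag: "lagrangian ?m k L" unfolding L_def by (rule FD_lagrangian[OF ad un FD])
  have LE: "L \<subseteq> ED ?m k" and iso: "isotropic ?b L" and sL: "vec.subspace L" using lag by (auto simp: lagrangian_def)
  have dW: "vec.dim W = l" unfolding W_def using lN un units_mono by (intro dim_Fs) auto
  have sW: "vec.subspace W" by (simp add: W_def)
  have dM: "vec.dim (perp ?m k W) = Suc ?m"
    using dim_perp[OF ad sW] WL LE dW by simp
  have dZ: "vec.dim {v. nilp v \<in> W} = Suc ?m"
    using nilp_preimage(2)[OF sW _ lN(2)] low_Fs dW unfolding W_def by auto
  have LM: "L \<subseteq> perp ?m k W" using LE iso WL by (auto simp: perp_def isotropic_def)
  have "\<not> perp ?m k W \<subseteq> L" using dM lag vec.dim_subset[of "perp ?m k W" L] by (auto simp: lagrangian_def)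
  then obtain u where u: "u \<in> perp ?m k W" "u \<notin> L" by blast
  have uE: "u \<in> ED ?m k" using u by (simp add: perp_def)
  have "vec.span (insert u L) = perp ?m k W"
  proof (rule vec.subspace_dim_equal)
    show "vec.span (insert u L) \<subseteq> perp ?m k W" using u LM by (intro vec.span_minimal) auto
    have "vec.span L = L" using vec.span_minimal[OF order_refl sL] vec.span_superset by blast
    then have "vec.dim (vec.span (insert u L)) = Suc ?m"
      unfolding vec.dim_span vec.dim_insert \<open>vec.span L = L\<close> using u(2) lag by (simp add: lagrangian_def)
    then show "vec.dim (perp ?m k W) \<le> vec.dim (vec.span (insert u L))" using dM by simp
  qed simp_all
  then have dec: "\<exists>c. v - c *s u \<in> L" if "v \<in> perp ?m k W" for v
    using that vec.span_minimal[OF order_refl sL] unfolding vec.span_insert by blast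
  have Lcases: "\<exists>f\<in>W. \<exists>c. v = f + c *s w" if "v \<in> L" for v
    using Fs_Suc_ex[of v a l] that unfolding L_def W_def w_def by blast
  \<comment> \<open>Otherwise \<open>u\<close> would be orthogonal to all of \<open>L\<close>, hence
    lie in \<open>L\<close>, which is its own complement.\<close>
  have uw: "?b u w \<noteq> 0"
  proof
    assume z: "?b u w = 0"
    have "?b u v = 0" if vL: "v \<in> L" for v
    proof -
      obtain f c where "f \<in> W" "v = f + c *s w" using Lcases[OF vL] by blast
      then show ?thesis using u z by (auto simp: perp_def beta_add beta_scale)
    qed
    then have "u \<in> perp ?m k L" using uE by (simp add: perp_def)
    then show False using perp_lagrangian[OF ad lag] u by simp
  qed
  have nL: "nilp v \<in> W" if "v \<in> L" for v
    using nilp_Fs[of v a l] that lN unfolding L_def W_def by blast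
  have nW: "nilp v \<in> W" if "v \<in> W" for v using nL WL that by blast
  have nE: "nilp v \<in> ED ?m k" if "v \<in> ED ?m k" for v :: "'d hspace"
  proof (cases "1 \<le> k")
    case True
    then show ?thesis using nilp_ED_iff[OF ad True] that EC_subset_ED by blast
  next
    case False
    then have "k = 0" by simp
    then show ?thesis using ad by (simp add: adm_def)
  qed
  have nu: "nilp u \<in> perp ?m k W"
  proof -
    have "?b (nilp u) v = 0" if v: "v \<in> W" for v
    proof -
      have "?b (nilp u) v = - ?b u (nilp v)" using uE v WL LE by (intro beta_D_skew ad) auto
      also have "\<dots> = 0" using u nW[OF v] by (simp add: perp_def)
      finally show ?thesis .
    qed
    then show ?thesis using nE[OF uE] by (simp add: perp_def)
  qed
  obtain b where "nilp u - b *s u \<in> L" using dec[OF nu] by blast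
  then obtain f c where f: "f \<in> W" "nilp u - b *s u = f + c *s w" using Lcases by blast
  have nueq: "nilp u = f + c *s w + b *s u" using f(2) by (simp add: algebra_simps)
  \<comment> \<open>Pairing with \<open>w\<close> isolates the coefficient \<open>b\<close> of
    \<open>u\<close>, since \<open>f\<close> and \<open>w\<close> lie in the isotropic space
    \<open>L\<close>.\<close>
  have "?b (nilp u) w = - ?b u (nilp w)" using uE wL LE by (intro beta_D_skew ad) auto
  also have "\<dots> = 0" using u nL[OF wL] by (simp add: perp_def)
  finally have "b * ?b u w = 0"
    using isotropicD[OF iso, of f w] isotropicD[OF iso, of w w] f(1) WL wL
    by (auto simp: nueq beta_add beta_scale)
  then have b: "b = 0" using uw by simp
  \<comment> \<open>By skewness and symmetry this value is its own negative; pairing with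
    \<open>u\<close> then isolates the coefficient \<open>c\<close> of \<open>w\<close>.\<close>
  have "?b (nilp u) u = - ?b u (nilp u)" using uE by (intro beta_D_skew ad) auto
  then have "?b (nilp u) u = 0" using beta_D_sym[OF ad, of u "nilp u"] by simp
  moreover have "?b f u = 0" using u f(1) beta_D_sym[OF ad, of f u] by (simp add: perp_def)
  ultimately have "c * ?b w u = 0" by (simp add: nueq b beta_add beta_scale)
  then have c: "c = 0" using uw beta_D_sym[OF ad, of u w] by simp
  have nuW: "nilp u \<in> W" using nueq b c f(1) by simp
  have "perp ?m k W \<subseteq> {v. nilp v \<in> W}"
  proof
    fix v assume "v \<in> perp ?m k W"
    then obtain e where e: "v - e *s u \<in> L" using dec by blast
    have "nilp v = nilp (v - e *s u) + e *s nilp u" by (simp add: nilp_diff nilp_scale)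
    then show "v \<in> {v. nilp v \<in> W}"
      using nL[OF e] nuW vec.subspace_add[OF sW] vec.subspace_scale[OF sW] by simp
  qed
  then show "perp ?m k (Fs a l) \<subseteq> {v :: 'd hspace. nilp v \<in> Fs a l}" unfolding W_def .
  show "vec.dim {v :: 'd hspace. nilp v \<in> Fs a l} \<le> vec.dim (perp ?m k (Fs a l) :: 'd hspace set)"
    using dM dZ unfolding W_def by simp
  show "vec.subspace {v :: 'd hspace. nilp v \<in> Fs a l}"
    using nilp_preimage(1)[OF sW _ lN(2)] low_Fs unfolding W_def by blast
qed simp

text \<open>The complement of \<open>Fs a l\<close> is its preimage under \<open>nilp\<close>, so it
  contains the kernel of \<open>nilp\<close> and all \<open>up v'\<close> with \<open>v'\<close> in
  \<open>Fs a l\<close>. Orthogonality to the kernel puts \<open>Fs a l\<close> into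
  \<open>EC\<close>; orthogonality to \<open>up v'\<close> is isotropy for
  \<open>beta_C\<close>.\<close>

lemma FD_imp_FC:
  fixes a :: "nat \<Rightarrow> complex ^ 2"
  assumes ad: "adm TYPE('d::finite) (Suc l) k" "1 \<le> k" and un: "units a (Suc l)" and FD: "FD TYPE('d) (Suc l) k a"
  shows "FC TYPE('d) (Suc l) k a"
proof -
  let ?W = "Fs a l :: 'd hspace set"
  note P = FD_imp_perp[OF ad(1) un FD]
  have lN: "l < CARD('d)" using adm_bounds(3)[OF ad(1)] by auto
  have WE: "?W \<subseteq> ED (Suc l) k" using FD Fs_mono[of l "Suc l" a] unfolding FD_def by auto
  have WC: "?W \<subseteq> EC (Suc l) k"
  proof
    fix v assume v: "v \<in> ?W"
    have "beta_D (Suc l) k v u = 0" if "nilp u = 0" for u :: "'d hspace"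
    proof -
      have "u \<in> perp (Suc l) k ?W" unfolding P using that by simp
      then show ?thesis using v beta_D_sym[OF ad(1), of v u] by (simp add: perp_def)
    qed
    then show "v \<in> EC (Suc l) k" unfolding EC_eq_perp[OF ad] using v WE by (auto simp: perp_def)
  qed
  moreover have "beta_C (Suc l) k v v' = 0" if v: "v \<in> ?W" "v' \<in> ?W" for v v'
  proof -
    have n: "nilp (up v') = v'" using nilp_up[OF low_Fs[OF v(2)] lN] .
    then have "up v' \<in> perp (Suc l) k ?W" unfolding P using v by simp
    then have "up v' \<in> ED (Suc l) k" "beta_D (Suc l) k (up v') v = 0" using v by (auto simp: perp_def)
    then show ?thesis
      using beta_C_nilp[OF ad, of v "up v'"] WC v(1) n beta_D_sym[OF ad(1), of v "up v'"] by auto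
  qed
  ultimately show ?thesis by (simp add: FC_def isotropic_def)
qed

text \<open>Here \<open>beta_C_nilp\<close> gives that the preimage lies in the complement, and both
  have dimension \<open>l + 2\<close>.\<close>

lemma FC_imp_perp:
  fixes a :: "nat \<Rightarrow> complex ^ 2"
  assumes ad: "adm TYPE('d::finite) (Suc l) k" "1 \<le> k" and un: "units a l" and FC: "FC TYPE('d) (Suc l) k a"
  shows "perp (Suc l) k (Fs a l) = {v :: 'd hspace. nilp v \<in> Fs a l}"
proof (rule vec.subspace_dim_equal[symmetric])
  let ?W = "Fs a l :: 'd hspace set"
  have lN: "l < CARD('d)" using adm_bounds(3)[OF ad(1)] by auto
  have WC: "?W \<subseteq> EC (Suc l) k" and iso: "isotropic (beta_C (Suc l) k) ?W" using FC by (simp_all add: FC_def)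
  show "{v. nilp v \<in> ?W} \<subseteq> perp (Suc l) k ?W"
  proof
    fix v assume "v \<in> {v. nilp v \<in> ?W}"
    then have nv: "nilp v \<in> ?W" by simp
    then have vE: "v \<in> ED (Suc l) k" using WC nilp_ED_iff[OF ad] by blast
    have "beta_D (Suc l) k v w = 0" if w: "w \<in> ?W" for w
      using beta_C_nilp[OF ad _ vE, of w] w WC isotropicD[OF iso w nv] beta_D_sym[OF ad(1), of v w] by auto
    then show "v \<in> perp (Suc l) k ?W" using vE by (simp add: perp_def)
  qed
  have dW: "vec.dim ?W = l" using lN un by (intro dim_Fs) auto
  have WE: "?W \<subseteq> ED (Suc l) k" using WC EC_subset_ED by blast
  have "vec.dim (perp (Suc l) k ?W) + l = 2 * Suc l" using dim_perp[OF ad(1) _ WE] dW by simp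
  moreover have "vec.dim {v. nilp v \<in> ?W} = l + 2"
    using nilp_preimage(2)[of ?W l] low_Fs lN dW by auto
  ultimately show "vec.dim (perp (Suc l) k ?W) \<le> vec.dim {v. nilp v \<in> ?W}" by simp
  show "vec.subspace {v. nilp v \<in> ?W}" using nilp_preimage(1)[of ?W l] low_Fs lN by auto
qed simp

section \<open>Isotropic extensions by one line\<close>

lemma Fs_update:
  assumes "units a l" "herm b b = 1"
  shows "Fs (a(Suc l := b)) l = (Fs a l :: ('d::finite) hspace set)"
    "Bm (a(Suc l := b)) l u = (Bm a l u :: 'd hspace)"
    "wv (a(Suc l := b)) (Suc l) = (Bm a l b :: 'd hspace)"
    "units (a(Suc l := b)) (Suc l)"
proof -
  show u: "units (a(Suc l := b)) (Suc l)" using assms by (auto simp: units_def)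
  show "Fs (a(Suc l := b)) l = (Fs a l :: ('d::finite) hspace set)"
    using assms units_mono[OF u, of l] by (intro Fs_cong) auto
  show B: "Bm (a(Suc l := b)) l v = (Bm a l v :: 'd hspace)" for v by (rule Bm_cong) simp
  show "wv (a(Suc l := b)) (Suc l) = (Bm a l b :: 'd hspace)"
    unfolding wv_Suc B by simp
qed

text \<open>The new vector lies in the complement of \<open>Fs a l\<close>, so its pairing with
  itself is the only one that can fail to vanish.\<close>

lemma lift_iff:
  fixes a :: "nat \<Rightarrow> complex ^ 2"
  assumes ad: "adm TYPE('d::finite) (Suc l) k" "1 \<le> k" and un: "units a l" and FC: "FC TYPE('d) (Suc l) k a"
    and b: "herm b b = 1"
  shows "FD TYPE('d) (Suc l) k (a(Suc l := b)) \<longleftrightarrow> beta_D (Suc l) k (Bm a l b) (Bm a l b :: 'd hspace) = 0"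
proof -
  let ?W = "Fs a l :: 'd hspace set" and ?L = "Fs (a(Suc l := b)) (Suc l) :: 'd hspace set"
  let ?w = "Bm a l b :: 'd hspace"
  note P = FC_imp_perp[OF ad un FC]
  have lN: "l < CARD('d)" using adm_bounds(3)[OF ad(1)] by auto
  have WM: "?W \<subseteq> perp (Suc l) k ?W" unfolding P using nilp_Fs_self[where 'd = 'd, of l _ a] lN by auto
  have wM: "?w \<in> perp (Suc l) k ?W" unfolding P using nilp_Bm[OF lN] by simp
  have L: "v \<in> ?L \<longleftrightarrow> (\<exists>c. v - c *s ?w \<in> ?W)" for v
    unfolding Fs_Suc Fs_update(1,3)[OF un b] by simp
  have wL: "?w \<in> ?L" unfolding L by (auto intro: exI[of _ 1])
  show ?thesis
  proof
    assume "FD TYPE('d) (Suc l) k (a(Suc l := b))"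
    then show "beta_D (Suc l) k ?w ?w = 0" using wL by (simp add: FD_def isotropic_def)
  next
    assume q: "beta_D (Suc l) k ?w ?w = 0"
    have sE: "vec.subspace (ED (Suc l) k :: 'd hspace set)" by simp
    have rep: "\<exists>f\<in>?W. \<exists>c. v = f + c *s ?w" if "v \<in> ?L" for v
      using that unfolding L by (metis diff_add_cancel)
    have "?L \<subseteq> ED (Suc l) k"
    proof
      fix v assume "v \<in> ?L"
      then obtain f c where "f \<in> ?W" "v = f + c *s ?w" using rep by blast
      then show "v \<in> ED (Suc l) k"
        using WM wM vec.subspace_add[OF sE] vec.subspace_scale[OF sE] by (auto simp: perp_def)
    qed
    moreover have "beta_D (Suc l) k v v' = 0" if v: "v \<in> ?L" "v' \<in> ?L" for v v'
    proof -
      obtain f c f' c' where f: "f \<in> ?W" "v = f + c *s ?w" "f' \<in> ?W" "v' = f' + c' *s ?w" using rep v by meson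
      have "beta_D (Suc l) k f f' = 0" "beta_D (Suc l) k ?w f' = 0" "beta_D (Suc l) k ?w f = 0"
        using WM wM f by (auto simp: perp_def)
      then show ?thesis
        using q beta_D_sym[OF ad(1), of f ?w] by (simp add: f beta_add beta_scale)
    qed
    ultimately show "FD TYPE('d) (Suc l) k (a(Suc l := b))" by (simp add: FD_def isotropic_def)
  qed
qed

lemma unit_plane_cases:
  fixes a b v :: "complex ^ 2"
  assumes "herm a a = 1" "herm b b = 1" "herm a b = 0"
  shows "v = herm v a *s a + herm v b *s b"
  using perp_decomp[OF assms, of v] by (simp add: pj_def)

text \<open>The real structure commutes with the orthogonal complement, so it acts on the plane
  \<open>range (Bm a l)\<close>; hence the two isotropic lines of that plane are orthogonal to each other.\<close>

lemma isotropic_line_perp: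
  fixes a :: "nat \<Rightarrow> complex ^ 2"
  assumes ad: "adm TYPE('d::finite) (Suc l) k" "1 \<le> k" and un: "units a l" and FC: "FC TYPE('d) (Suc l) k a"
    and b: "herm b b = 1" and c: "herm c c = 1" and bc: "herm b c = 0"
    and q: "beta_D (Suc l) k (Bm a l b) (Bm a l b :: 'd hspace) = 0"
  shows "beta_D (Suc l) k (Bm a l c) (Bm a l c :: 'd hspace) = 0"
    "beta_D (Suc l) k (Bm a l b) (Bm a l c :: 'd hspace) \<noteq> 0"
proof -
  let ?W = "Fs a l :: 'd hspace set"
  let ?w = "Bm a l b :: 'd hspace" and ?t = "theta (Suc l) k :: 'd hspace \<Rightarrow> _"
  note P = FC_imp_perp[OF ad un FC]
  have lN: "l < CARD('d)" using adm_bounds(3)[OF ad(1)] by auto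
  have WE: "?W \<subseteq> ED (Suc l) k" using FC EC_subset_ED by (auto simp: FC_def)
  have wM: "?w \<in> perp (Suc l) k ?W" unfolding P using nilp_Bm[OF lN] by simp
  have wE: "?w \<in> ED (Suc l) k" using wM by (simp add: perp_def)
  have "beta_D (Suc l) k (?t ?w) v = 0" if v: "v \<in> ?W" for v
  proof -
    have "beta_D (Suc l) k (?t ?w) v = herm v (?t (?t ?w))"
      unfolding herm_theta by (rule beta_D_sym[OF ad(1)])
    also have "\<dots> = 0" unfolding theta_ED(2)[OF ad(1) wE] using herm_Bm_Fs(2)[OF lN un v] .
    finally show ?thesis .
  qed
  then have "?t ?w \<in> perp (Suc l) k ?W" using theta_ED(1)[OF ad(1) wE] by (simp add: perp_def)
  then have "nilp (?t ?w) \<in> ?W" unfolding P by simp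
  then obtain f y where f: "f \<in> ?W" "?t ?w = f + Bm a l y" using nilp_preimage_Fs_ex[OF lN un] by blast
  have "herm f (?t ?w) = 0" unfolding herm_theta using wM f(1) beta_D_sym[OF ad(1), of f ?w] by (simp add: perp_def)
  then have "f = 0" using f herm_Bm_Fs(2)[OF lN un f(1)] by (simp add: herm_add_right)
  then have t: "?t ?w = Bm a l y" using f by simp
  have "herm b y = herm ?w (?t ?w)" unfolding t using herm_Bm[OF lN un] by simp
  also have "\<dots> = 0" unfolding herm_theta using q .
  finally have "herm y b = 0" using herm_eq_0_commute by blast
  then have y: "y = herm y c *s c" using unit_plane_cases[OF b c bc, of y] by simp
  define s where "s = herm y c"
  have ts: "?t ?w = s *s Bm a l c" unfolding t s_def by (metis y Bm_scale)
  have "herm (?t ?w) (?t ?w) = 1"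
    unfolding herm_theta_theta[OF ad(1) wE] using herm_Bm[OF lN un, of b b] b by simp
  then have s: "s \<noteq> 0" using ts by auto
  have cw: "herm (Bm a l c :: 'd hspace) (Bm a l c) = 1" using herm_Bm[OF lN un, of c c] c by simp
  have "beta_D (Suc l) k ?w (Bm a l c) = herm (Bm a l c) (?t ?w)"
    unfolding herm_theta by (rule beta_D_sym[OF ad(1)])
  also have "\<dots> = cnj s" unfolding ts using cw by (simp add: herm_scale_right)
  finally show "beta_D (Suc l) k ?w (Bm a l c) \<noteq> 0" using s by simp
  have "beta_D (Suc l) k (?t ?w) (?t ?w) = herm (?t ?w) (?t (?t ?w))" unfolding herm_theta ..
  also have "\<dots> = herm (?t ?w) ?w" unfolding theta_ED(2)[OF ad(1) wE] ..
  also have "\<dots> = 0" using q herm_theta[of ?w "Suc l" k ?w] herm_eq_0_commute by metis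
  finally have "s * (s * beta_D (Suc l) k (Bm a l c) (Bm a l c :: 'd hspace)) = 0"
    unfolding ts by (simp add: beta_scale)
  then show "beta_D (Suc l) k (Bm a l c) (Bm a l c :: 'd hspace) = 0" using s by simp
qed

text \<open>In a basis of two isotropic vectors a quadratic form is a multiple of the product of the
  coordinates, and here the factor is nonzero. So there are no further isotropic lines.\<close>

lemma isotropic_line_cases:
  fixes a :: "nat \<Rightarrow> complex ^ 2"
  assumes ad: "adm TYPE('d::finite) (Suc l) k" "1 \<le> k" and un: "units a l" and FC: "FC TYPE('d) (Suc l) k a"
    and b: "herm b b = 1" and c: "herm c c = 1" and bc: "herm b c = 0"
    and q: "beta_D (Suc l) k (Bm a l b) (Bm a l b :: 'd hspace) = 0"
    and y: "beta_D (Suc l) k (Bm a l y) (Bm a l y :: 'd hspace) = 0"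
  shows "herm y b = 0 \<or> herm y c = 0"
proof -
  note I = isotropic_line_perp[OF ad un FC b c bc q]
  have "Bm a l y = herm y b *s Bm a l b + herm y c *s (Bm a l c :: 'd hspace)"
    by (metis unit_plane_cases[OF b c bc, of y] Bm_add Bm_scale)
  then have "2 * (herm y b * herm y c) * beta_D (Suc l) k (Bm a l b) (Bm a l c :: 'd hspace) = 0"
    using y q I(1) beta_D_sym[OF ad(1), of "Bm a l c" "Bm a l b :: 'd hspace"]
    by (simp add: beta_add beta_scale algebra_simps)
  then show ?thesis using I(2) by simp
qed

lemma FD_swap:
  assumes ad: "adm TYPE('d::finite) (Suc l) k" "1 \<le> k" and un: "units a (Suc l)" and FD: "FD TYPE('d) (Suc l) k a"
    and c: "herm c c = 1" "herm (a (Suc l)) c = 0"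
  shows "FD TYPE('d) (Suc l) k (a(Suc l := c))"
    "beta_D (Suc l) k (Bm a l (a (Suc l))) (Bm a l c :: 'd hspace) \<noteq> 0"
proof -
  have unl: "units a l" using un by (rule units_mono) simp
  have b: "herm (a (Suc l)) (a (Suc l)) = 1" using un by (simp add: units_def)
  note FC = FD_imp_FC[OF ad un FD]
  have "FD TYPE('d) (Suc l) k (a(Suc l := a (Suc l)))" using FD by simp
  then have q: "beta_D (Suc l) k (Bm a l (a (Suc l))) (Bm a l (a (Suc l)) :: 'd hspace) = 0"
    using lift_iff[OF ad unl FC b] by blast
  note I = isotropic_line_perp[OF ad unl FC b c q]
  show "FD TYPE('d) (Suc l) k (a(Suc l := c))" using lift_iff[OF ad unl FC c(1)] I(1) by blast
  show "beta_D (Suc l) k (Bm a l (a (Suc l))) (Bm a l c :: 'd hspace) \<noteq> 0" by (rule I(2))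
qed

lemma pj_eqI:
  fixes a b c :: "complex ^ 2"
  assumes "herm a a = 1" "herm b b = 1" "herm c c = 1" "herm a c = 0" "herm b c = 0"
  shows "pj a = pj b"
proof
  fix u
  have "pj a u + pj c u = u" "pj b u + pj c u = u" using perp_decomp assms by blast+
  then show "pj a u = pj b u" by (metis add_right_cancel)
qed

lemma FD_lift_unique:
  assumes ad: "adm TYPE('d::finite) (Suc l) k" "1 \<le> k" and un: "units a (Suc l)" and FD: "FD TYPE('d) (Suc l) k a"
    and y: "herm y y = 1" and FDy: "FD TYPE('d) (Suc l) k (a(Suc l := y))"
  shows "herm (a (Suc l)) y = 0 \<or> pj y = pj (a (Suc l))"
proof -
  have unl: "units a l" using un by (rule units_mono) simp
  have b: "herm (a (Suc l)) (a (Suc l)) = 1" using un by (simp add: units_def)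
  note FC = FD_imp_FC[OF ad un FD]
  obtain c where c: "herm c c = 1" "herm (a (Suc l)) c = 0" using perp_unit_exists[OF b] .
  have "FD TYPE('d) (Suc l) k (a(Suc l := a (Suc l)))" using FD by simp
  then have q: "beta_D (Suc l) k (Bm a l (a (Suc l))) (Bm a l (a (Suc l)) :: 'd hspace) = 0"
    using lift_iff[OF ad unl FC b] by blast
  have qy: "beta_D (Suc l) k (Bm a l y) (Bm a l y :: 'd hspace) = 0"
    using lift_iff[OF ad unl FC y] FDy by blast
  have "herm y (a (Suc l)) = 0 \<or> herm y c = 0" by (rule isotropic_line_cases[OF ad unl FC b c q qy])
  then show ?thesis using pj_eqI[OF y b c(1)] c(2) herm_eq_0_commute by blast
qed

text \<open>A binary quadratic form over the complex numbers has a nontrivial zero; \<open>D\<close>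
  is a square root of its discriminant.\<close>

lemma lift_exists:
  fixes a :: "nat \<Rightarrow> complex ^ 2"
  assumes ad: "adm TYPE('d::finite) (Suc l) k" "1 \<le> k" and un: "units a l" and FC: "FC TYPE('d) (Suc l) k a"
  obtains b where "herm b b = 1" "FD TYPE('d) (Suc l) k (a(Suc l := b))"
proof -
  let ?B = "\<lambda>u v. beta_D (Suc l) k (Bm a l u) (Bm a l v :: 'd hspace)"
  have bil: "?B (u + v) w = ?B u w + ?B v w" "?B w (u + v) = ?B w u + ?B w v"
    "?B (c *s u) w = c * ?B u w" "?B w (c *s u) = c * ?B w u" for u v w c
    by (simp_all add: Bm_add Bm_scale beta_add beta_scale)
  have sym: "?B u v = ?B v u" for u v by (rule beta_D_sym[OF ad(1)])
  have "\<exists>u. u \<noteq> 0 \<and> ?B u u = 0"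
  proof (cases "?B e2 e2 = 0")
    case True
    have "e2 \<noteq> 0" by (simp add: e2_def axis_def vec_eq_iff)
    then show ?thesis using True by blast
  next
    case False
    define D where "D = csqrt ((?B e2 f2)\<^sup>2 - ?B e2 e2 * ?B f2 f2)"
    have D: "D * D = ?B e2 f2 * ?B e2 f2 - ?B e2 e2 * ?B f2 f2"
      using power2_csqrt[of "(?B e2 f2)\<^sup>2 - ?B e2 e2 * ?B f2 f2"] by (simp add: D_def power2_eq_square)
    define u where "u = (D - ?B e2 f2) *s e2 + ?B e2 e2 *s f2"
    have "u $ 2 = ?B e2 e2" by (simp add: u_def e2_def f2_def axis_def)
    then have "u \<noteq> 0" using False by auto
    moreover have "?B u u = ?B e2 e2 * (D * D - (?B e2 f2 * ?B e2 f2 - ?B e2 e2 * ?B f2 f2))"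
      unfolding u_def bil sym[of f2 e2] by (simp add: algebra_simps)
    ultimately show ?thesis using D by auto
  qed
  then obtain u where u: "u \<noteq> 0" "?B u u = 0" by blast
  obtain c b where c: "c \<noteq> 0" "u = c *s b" "herm b b = 1" using normalize_vec[OF u(1)] .
  have "?B b b = 0" using u(2) c(1) unfolding c(2) bil by simp
  then show ?thesis using that[OF c(3)] lift_iff[OF ad un FC c(3)] by blast
qed

text \<open>The component of \<open>b\<close> along \<open>a (Suc l)\<close> sits one level up, so
  \<open>nilp\<close> turns it into a multiple of \<open>wv a (Suc l)\<close>, which is not in
  \<open>Fs a l\<close>.\<close>

lemma perp_of_nilp:
  fixes a :: "nat \<Rightarrow> complex ^ 2"
  assumes un: "units a (Suc l)" and N: "Suc l < CARD('d)"
    and n: "nilp (Bm a (Suc l) b :: ('d::finite) hspace) \<in> Fs a l"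
  shows "herm b (a (Suc l)) = 0"
proof (rule ccontr)
  assume nz: "herm b (a (Suc l)) \<noteq> 0"
  let ?a = "a (Suc l)" and ?w = "wv a (Suc l) :: 'd hspace"
  have 1: "nilp (up (Bm a l (pj ?a b) :: 'd hspace)) = Bm a l (pj ?a b)"
    using N by (intro nilp_up[OF low_Bm]) simp
  have 2: "Bm a l (pj ?a b) = herm b ?a *s ?w" by (simp add: pj_def Bm_scale wv_Suc)
  have 3: "nilp (Bm a l (b - pj ?a b) :: 'd hspace) \<in> Fs a l" using N by (intro nilp_Bm) simp
  have "nilp (Bm a (Suc l) b) = Bm a l (pj ?a b) + nilp (Bm a l (b - pj ?a b) :: 'd hspace)"
    unfolding Bm.simps(2) nilp_add 1 ..
  then have "herm b ?a *s ?w = nilp (Bm a (Suc l) b) - nilp (Bm a l (b - pj ?a b))"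
    unfolding 2 by simp
  also have "\<dots> \<in> Fs a l" using n 3 by (rule Fs_diff)
  finally have "inverse (herm b ?a) *s (herm b ?a *s ?w) \<in> Fs a l" by (rule Fs_scale)
  then have "?w \<in> Fs a l" using nz by simp
  then show False using wv_notin_Fs[where 'd = 'd, of l a] N un by auto
qed

text \<open>As a preimage, \<open>Fs a m\<close> contains the kernel of \<open>nilp\<close>.
  Isotropy therefore forces it into \<open>EC\<close>, where \<open>beta_D_nilp_nilp\<close>
  compares the form with the one for \<open>(m - 2, k - 2)\<close>; the sign there does not affect
  vanishing.\<close>

lemma FD_delete:
  fixes a :: "nat \<Rightarrow> complex ^ 2"
  assumes ad: "adm TYPE('d::finite) m k" "2 \<le> k" and un: "units a m" and i: "1 \<le> i" "i < m"
    and perp: "herm (a i) (a (Suc i)) = 0"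
  shows "Fs a m = {v :: 'd hspace. nilp v \<in> Fs (del_seq i a) (m - 2)}"
    "FD TYPE('d) m k a \<longleftrightarrow> FD TYPE('d) (m - 2) (k - 2) (del_seq i a)"
proof -
  have m: "2 \<le> m" using adm_reduce(2)[OF ad] .
  then have mm: "Suc (Suc (m - 2)) = m" by simp
  let ?F' = "Fs (del_seq i a) (m - 2) :: 'd hspace set"
  show eq: "Fs a m = {v :: 'd hspace. nilp v \<in> ?F'}"
    using Fs_del[where 'd = 'd, of i a "m - 2"] un perp i mm adm_bounds(3)[OF ad(1)] by simp
  have upF: "nilp (up v) = v" "up v \<in> Fs a m" if "v \<in> ?F'" for v
  proof -
    show "nilp (up v) = v" using nilp_up[OF low_Fs[OF that]] adm_bounds(3)[OF ad(1)] m by simp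
    then show "up v \<in> Fs a m" unfolding eq using that by simp
  qed
  show "FD TYPE('d) m k a \<longleftrightarrow> FD TYPE('d) (m - 2) (k - 2) (del_seq i a)"
  proof
    assume FD: "FD TYPE('d) m k a"
    then have FE: "Fs a m \<subseteq> (ED m k :: 'd hspace set)"
      and iso: "isotropic (beta_D m k) (Fs a m :: 'd hspace set)" by (simp_all add: FD_def)
    have FC: "Fs a m \<subseteq> (EC m k :: 'd hspace set)"
    proof
      fix v :: "'d hspace" assume v: "v \<in> Fs a m"
      have "beta_D m k v u = 0" if "nilp u = 0" for u :: "'d hspace"
        using isotropicD[OF iso v, of u] that unfolding eq by simp
      moreover have "1 \<le> k" using ad by simp
      ultimately show "v \<in> EC m k" using EC_eq_perp[OF ad(1)] v FE by (auto simp: perp_def)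
    qed
    have "?F' \<subseteq> ED (m - 2) (k - 2)"
    proof
      fix v assume v: "v \<in> ?F'"
      have "up v \<in> EC m k" using upF(2)[OF v] FC by blast
      then show "v \<in> ED (m - 2) (k - 2)" using nilp_EC_iff[OF ad, of "up v"] upF(1)[OF v] by simp
    qed
    moreover have "beta_D (m - 2) (k - 2) v w = 0" if vw: "v \<in> ?F'" "w \<in> ?F'" for v w
    proof -
      have "up v \<in> EC m k" "up w \<in> EC m k" using upF(2) vw FC by blast+
      then have "beta_D (m - 2) (k - 2) (nilp (up v)) (nilp (up w)) = - beta_D m k (up v) (up w)"
        by (rule beta_D_nilp_nilp[OF ad])
      also have "\<dots> = 0" using isotropicD[OF iso upF(2)[OF vw(1)] upF(2)[OF vw(2)]] by simp
      finally show ?thesis unfolding upF(1)[OF vw(1)] upF(1)[OF vw(2)] .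
    qed
    ultimately show "FD TYPE('d) (m - 2) (k - 2) (del_seq i a)" by (simp add: FD_def isotropic_def)
  next
    assume "FD TYPE('d) (m - 2) (k - 2) (del_seq i a)"
    then have F': "?F' \<subseteq> ED (m - 2) (k - 2)" and iso: "isotropic (beta_D (m - 2) (k - 2)) ?F'"
      by (simp_all add: FD_def)
    have FC: "Fs a m \<subseteq> (EC m k :: 'd hspace set)"
      unfolding eq using F' nilp_EC_iff[OF ad] by blast
    moreover have "beta_D m k v w = 0" if vw: "v \<in> Fs a m" "w \<in> Fs a m" for v w :: "'d hspace"
      using beta_D_nilp_nilp[OF ad, of v w] vw FC isotropicD[OF iso, of "nilp v" "nilp w"] unfolding eq by auto
    ultimately show "FD TYPE('d) m k a"
      using order_trans[OF FC EC_subset_ED] by (simp add: FD_def isotropic_def)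
  qed
qed

text \<open>If \<open>Fs a m\<close> contains the kernel of \<open>nilp\<close>, the step at which
  the kernel is completed adds a line orthogonal to the preceding one. If not, a kernel vector
  outside \<open>Fs a m\<close> spans with \<open>Fs a (m - 1)\<close> the other isotropic
  extension. Its line is orthogonal to \<open>a m\<close> as the other extension, and to
  \<open>a (m - 1)\<close> because \<open>nilp\<close> kills the vector, so these two span the same
  line.\<close>

lemma FD_reducible:
  fixes a :: "nat \<Rightarrow> complex ^ 2"
  assumes ad: "adm TYPE('d::finite) m k" "2 \<le> k" and un: "units a m" and FD: "FD TYPE('d) m k a"
  shows "(\<exists>i. 1 \<le> i \<and> i < m \<and> herm (a i) (a (Suc i)) = 0) \<or> pj (a m) = pj (a (m - 1))"
proof -
  have m: "2 \<le> m" using adm_reduce(2)[OF ad] .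
  then obtain l where l: "m = Suc (Suc l)" by (metis Suc_le_D numeral_2_eq_2 Suc_le_mono)
  have k1: "1 \<le> k" using ad by simp
  have N: "m < CARD('d)" using adm_less[OF ad(1)] m by simp
  show ?thesis
  proof (cases "\<forall>x :: 'd hspace. nilp x = 0 \<longrightarrow> x \<in> Fs a m")
    case True
    \<comment> \<open>The kernel has dimension two, so \<open>2 \<le> j\<close>. By minimality some
      kernel vector has a nonzero component along the newest vector, whose image under
      \<open>nilp\<close> hence falls two steps back.\<close>
    define j where "j = (LEAST j. \<forall>x :: 'd hspace. nilp x = 0 \<longrightarrow> x \<in> Fs a j)"
    have j: "\<forall>x :: 'd hspace. nilp x = 0 \<longrightarrow> x \<in> Fs a j" unfolding j_def by (rule LeastI[of _ m]) (rule True)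
    have jm: "j \<le> m" unfolding j_def by (rule Least_le) (rule True)
    have "vec.dim {x :: 'd hspace. nilp x = 0} = 2"
      unfolding ker_nilp using dim_E_space[where 'd = 'd, of 1 1] by (simp add: Suc_le_eq)
    moreover have "{x :: 'd hspace. nilp x = 0} \<subseteq> Fs a j" using j by blast
    moreover have "vec.dim (Fs a j :: 'd hspace set) = j"
      using jm N un units_mono by (intro dim_Fs) auto
    ultimately have "2 \<le> j" using vec.dim_subset by metis
    then obtain i where ji: "j = Suc (Suc i)" by (metis Suc_le_D numeral_2_eq_2 Suc_le_mono)
    have "\<not> (\<forall>x :: 'd hspace. nilp x = 0 \<longrightarrow> x \<in> Fs a (Suc i))"
      using not_less_Least[of "Suc i" "\<lambda>j. \<forall>x :: 'd hspace. nilp x = 0 \<longrightarrow> x \<in> Fs a j"] ji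
      unfolding j_def[symmetric] by simp
    then obtain x :: "'d hspace" where x: "nilp x = 0" "x \<notin> Fs a (Suc i)" by blast
    have "x \<in> Fs a (Suc (Suc i))" using j x ji by simp
    then obtain f c where f: "f \<in> Fs a (Suc i)" "x = f + c *s wv a (Suc (Suc i))" using Fs_Suc_ex by blast
    have c: "c \<noteq> 0" using f x by auto
    have "c *s nilp (wv a (Suc (Suc i))) = - nilp f"
      using x(1) unfolding f(2) nilp_add nilp_scale by (simp add: eq_neg_iff_add_eq_0 add.commute)
    then have "nilp (wv a (Suc (Suc i))) = inverse c *s (- nilp f)" using c by (metis vec.scale_one vec.scale_scale left_inverse)
    moreover have "nilp f \<in> Fs a i" using f(1) N jm ji by (intro nilp_Fs) auto
    ultimately have "nilp (wv a (Suc (Suc i)) :: 'd hspace) \<in> Fs a i"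
      using vec.subspace_neg[OF subspace_Fs] Fs_scale by metis
    then have "herm (a (Suc (Suc i))) (a (Suc i)) = 0"
      unfolding wv_Suc[of a "Suc i"] using N jm ji un units_mono by (intro perp_of_nilp[where 'd = 'd]) auto
    then have "herm (a (Suc i)) (a (Suc (Suc i))) = 0" using herm_eq_0_commute by blast
    moreover have "Suc i < m" using ji jm by simp
    ultimately show ?thesis by (intro disjI1 exI[of _ "Suc i"]) simp
  next
    case False
    then obtain x :: "'d hspace" where x: "nilp x = 0" "x \<notin> Fs a m" by blast
    let ?W = "Fs a (Suc l) :: 'd hspace set" and ?b = "beta_D m k :: 'd hspace \<Rightarrow> _"
    have unl: "units a (Suc l)" using un l by (auto intro: units_mono)
    have FC: "FC TYPE('d) m k a" using FD_imp_FC[of "Suc l" k a] ad k1 un FD l by simp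
    note P = FC_imp_perp[of "Suc l" k a, folded l, OF ad(1) k1 unl FC]
    have lN: "Suc l < CARD('d)" using N l by simp
    obtain f y where f: "f \<in> ?W" "x = f + Bm a (Suc l) y"
      using nilp_preimage_Fs_ex[OF lN unl, of x] x(1) by auto
    have WF: "?W \<subseteq> Fs a m" unfolding l by (rule Fs_mono) simp
    have y: "y \<noteq> 0" using x(2) f WF by (metis Bm_0 add_0_right subsetD)
    have iso: "isotropic ?b (Fs a m)" using FD by (simp add: FD_def)
    have xC: "x \<in> EC m k" using nilp_zero_EC[OF ad x(1)] .
    \<comment> \<open>For \<open>2 \<le> k\<close> the kernel lies in \<open>EC\<close>, its own
      complement, and is thus isotropic.\<close>
    have xx: "?b x x = 0" using xC x(1) unfolding EC_eq_perp[OF ad(1) k1] by (simp add: perp_def)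
    have xM: "x \<in> perp m k ?W" unfolding P using x(1) by simp
    have ff: "?b f f = 0" "?b f x = 0" "?b x f = 0"
      using isotropicD[OF iso] f(1) WF xM beta_D_sym[OF ad(1), of f x] by (auto simp: perp_def)
    have By: "Bm a (Suc l) y = x - f" using f(2) by simp
    obtain c b where c: "c \<noteq> 0" "y = c *s b" "herm b b = 1" using normalize_vec[OF y] .
    have "?b (Bm a (Suc l) y) (Bm a (Suc l) y) = 0"
      unfolding By using ff xx by (simp add: beta_diff)
    then have "?b (Bm a (Suc l) b) (Bm a (Suc l) b) = 0" unfolding c(2) Bm_scale using c(1) by (simp add: beta_scale del: Bm.simps)
    then have FDb: "FD TYPE('d) m k (a(m := b))"
      using lift_iff[of "Suc l" k a b, folded l, OF ad(1) k1 unl FC c(3)] by blast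
    have am: "herm (a m) (a m) = 1" using un m by (simp add: units_def)
    have "herm (a m) b = 0 \<or> pj b = pj (a m)"
      using FD_lift_unique[of "Suc l" k a b, folded l, OF ad(1) k1 un FD c(3) FDb] .
    moreover have "pj b \<noteq> pj (a m)"
    proof
      assume "pj b = pj (a m)"
      then have "b = herm b (a m) *s a m" using pj_self[OF c(3)] by (simp add: pj_def)
      then have "Bm a (Suc l) y = (c * herm b (a m)) *s (wv a m :: 'd hspace)"
        unfolding c(2) l wv_Suc by (metis Bm_scale vec.scale_scale)
      then have "x \<in> Fs a m" using f Fs_SucI[of f a "Suc l"] unfolding l by simp
      then show False using x(2) by blast
    qed
    ultimately have 1: "herm (a m) b = 0" by blast
    have "nilp (Bm a (Suc l) y) = - nilp f" unfolding By nilp_diff x(1) by simp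
    moreover have nf: "nilp f \<in> Fs a l" using f(1) lN by (intro nilp_Fs) auto
    ultimately have "nilp (Bm a (Suc l) y :: 'd hspace) \<in> Fs a l"
      using vec.subspace_neg[OF subspace_Fs] by metis
    then have "herm y (a (Suc l)) = 0" by (rule perp_of_nilp[OF unl lN])
    then have "herm b (a (Suc l)) = 0" using c by (simp add: herm_scale_left)
    then have 2: "herm (a (Suc l)) b = 0" using herm_eq_0_commute by blast
    have "herm (a (Suc l)) (a (Suc l)) = 1" using unl by (simp add: units_def)
    then have "pj (a m) = pj (a (Suc l))" using pj_eqI[OF am _ c(3) 1 2] by blast
    then show ?thesis using l by simp
  qed
qed

subsection \<open>Lagrangians and parity\<close>

lemma dim_hyperplane_section:
  fixes N L W :: "(complex ^ 'n) set"
  assumes N: "vec.subspace N" and W: "vec.subspace W" "W \<subseteq> L"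
    and L: "vec.subspace L" "\<And>x. x \<in> L \<Longrightarrow> \<exists>c. x - c *s w \<in> W" and n: "n \<in> N" "n \<in> L" "n \<notin> W"
  shows "vec.dim (N \<inter> L) = Suc (vec.dim (N \<inter> W))"
proof -
  have sNW: "vec.subspace (N \<inter> W)" and sNL: "vec.subspace (N \<inter> L)"
    using vec.subspace_inter[OF N] W(1) L(1) by blast+
  have spNW: "vec.span (N \<inter> W) = N \<inter> W"
    using vec.span_minimal[OF order_refl sNW] vec.span_superset by blast
  have "vec.span (insert n (N \<inter> W)) = N \<inter> L"
  proof (rule equalityI)
    show "vec.span (insert n (N \<inter> W)) \<subseteq> N \<inter> L"
      using n W(2) by (intro vec.span_minimal sNL) auto
    show "N \<inter> L \<subseteq> vec.span (insert n (N \<inter> W))"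
    proof
      fix x assume x: "x \<in> N \<inter> L"
      obtain c d where c: "x - c *s w \<in> W" and d: "n - d *s w \<in> W" using L(2) x n by blast
      have "d \<noteq> 0" using d n by auto
      then have eq: "x - (c / d) *s n = (x - c *s w) - (c / d) *s (n - d *s w)"
        by (simp add: vec.scale_right_diff_distrib)
      have "x - (c / d) *s n \<in> W"
        unfolding eq by (rule vec.subspace_diff[OF W(1) c vec.subspace_scale[OF W(1) d]])
      moreover have "x - (c / d) *s n \<in> N"
        using x by (intro vec.subspace_diff[OF N _ vec.subspace_scale[OF N n(1)]]) auto
      ultimately show "x \<in> vec.span (insert n (N \<inter> W))"
        unfolding vec.span_insert spNW by blast
    qed
  qed
  then have "vec.dim (N \<inter> L) = vec.dim (insert n (N \<inter> W))" by (metis vec.dim_span)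
  also have "\<dots> = Suc (vec.dim (N \<inter> W))" unfolding vec.dim_insert spNW using n by simp
  finally show ?thesis .
qed

text \<open>Since \<open>N\<close> is its own complement, the intersection is the complement of the
  sum of \<open>N\<close> and \<open>W\<close>.\<close>

lemma dim_lagrangian_perp:
  assumes ad: "adm TYPE('d::finite) m k" and N: "lagrangian m k (N :: 'd hspace set)"
    and W: "vec.subspace W" "W \<subseteq> ED m k"
  shows "vec.dim (N \<inter> perp m k W) + vec.dim W = m + vec.dim (N \<inter> W)"
proof -
  have sN: "vec.subspace N" and NE: "N \<subseteq> ED m k" and dN: "vec.dim N = m" using N by (auto simp: lagrangian_def)
  define S where "S = {x + y | x y. x \<in> N \<and> y \<in> W}"
  have sS: "vec.subspace S" unfolding S_def by (rule vec.subspace_sums[OF sN W(1)])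
  have sE: "vec.subspace (ED m k :: 'd hspace set)" by simp
  have SE: "S \<subseteq> ED m k" using NE W(2) vec.subspace_add[OF sE] by (auto simp: S_def)
  have NS: "N \<subseteq> S" "W \<subseteq> S" unfolding S_def using vec.subspace_0[OF W(1)] vec.subspace_0[OF sN] by force+
  have "N \<inter> perp m k W = perp m k S"
  proof (rule equalityI)
    show "perp m k S \<subseteq> N \<inter> perp m k W"
    proof
      fix x assume x: "x \<in> perp m k S"
      then have "x \<in> perp m k N" "x \<in> perp m k W" using NS by (auto simp: perp_def)
      then show "x \<in> N \<inter> perp m k W" using perp_lagrangian[OF ad N] by simp
    qed
    show "N \<inter> perp m k W \<subseteq> perp m k S"
      using N by (auto simp: perp_def S_def lagrangian_def isotropic_def beta_add)
  qed
  moreover have "vec.dim (perp m k S) + vec.dim S = 2 * m" by (rule dim_perp[OF ad sS SE])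
  moreover have "vec.dim S + vec.dim (N \<inter> W) = m + vec.dim W"
    using vec.dim_sums_Int[OF sN W(1)] dN unfolding S_def by simp
  ultimately show ?thesis by simp
qed

text \<open>The intersection of \<open>N\<close> with the complement of \<open>Fs a l\<close> is one
  dimension larger than that with \<open>Fs a l\<close>. The extra vector gives an isotropic vector
  of the plane, hence lies in one of the two extensions. It cannot happen in both, because the two
  isotropic lines pair nontrivially while \<open>N\<close> is isotropic. So exactly one intersection
  grows.\<close>

lemma lagrangian_swap:
  fixes a :: "nat \<Rightarrow> complex ^ 2"
  assumes ad: "adm TYPE('d::finite) (Suc l) k" "1 \<le> k" and un: "units a (Suc l)" and FD: "FD TYPE('d) (Suc l) k a"
    and c: "herm c c = 1" "herm (a (Suc l)) c = 0" and N: "lagrangian (Suc l) k (N :: 'd hspace set)"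
  shows "odd (vec.dim (N \<inter> Fs a (Suc l)) + vec.dim (N \<inter> Fs (a(Suc l := c)) (Suc l)))"
proof -
  let ?m = "Suc l" and ?W = "Fs a l :: 'd hspace set"
  let ?b = "beta_D (Suc l) k :: 'd hspace \<Rightarrow> 'd hspace \<Rightarrow> complex"
  define w1 where "w1 = (Bm a l (a ?m) :: 'd hspace)"
  define w2 where "w2 = (Bm a l c :: 'd hspace)"
  define L1 where "L1 = (Fs a ?m :: 'd hspace set)"
  define L2 where "L2 = (Fs (a(?m := c)) ?m :: 'd hspace set)"
  have unl: "units a l" using un by (rule units_mono) simp
  have b: "herm (a ?m) (a ?m) = 1" using un by (simp add: units_def)
  note FC = FD_imp_FC[OF ad un FD]
  note P = FC_imp_perp[OF ad unl FC]
  have lN: "l < CARD('d)" using adm_bounds(3)[OF ad(1)] by auto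
  have WE: "?W \<subseteq> ED ?m k" using FC EC_subset_ED by (auto simp: FC_def)
  have L1: "v \<in> L1 \<longleftrightarrow> (\<exists>c. v - c *s w1 \<in> ?W)" for v unfolding L1_def Fs_Suc w1_def wv_Suc by simp
  have L2: "v \<in> L2 \<longleftrightarrow> (\<exists>c. v - c *s w2 \<in> ?W)" for v
    unfolding L2_def Fs_Suc w2_def Fs_update(1,3)[OF unl c(1)] by simp
  have sub: "vec.subspace L1" "vec.subspace L2" "vec.subspace ?W" by (simp_all add: L1_def L2_def)
  have WL: "?W \<subseteq> L1" "?W \<subseteq> L2" unfolding L1_def L2_def
    using Fs_mono[of l ?m a] Fs_mono[of l ?m "a(?m := c)"] Fs_update(1)[where 'd = 'd, OF unl c(1)] by auto
  have sN: "vec.subspace N" and iso: "isotropic ?b N" using N by (auto simp: lagrangian_def)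
  have q: "?b w1 w1 = 0"
    using lift_iff[OF ad unl FC b] FD unfolding w1_def by simp
  have w12: "?b w1 w2 \<noteq> 0" using FD_swap(2)[OF ad un FD c] unfolding w1_def w2_def .
  have dW: "vec.dim ?W = l" using lN unl by (intro dim_Fs) auto
  have "vec.dim (N \<inter> perp ?m k ?W) = Suc (vec.dim (N \<inter> ?W))"
    using dim_lagrangian_perp[OF ad(1) N sub(3) WE] dW by simp
  then have "\<not> N \<inter> perp ?m k ?W \<subseteq> N \<inter> ?W" using vec.dim_subset by (metis Suc_n_not_le_n)
  then obtain n where n: "n \<in> N" "n \<in> perp ?m k ?W" "n \<notin> ?W" by blast
  have "nilp n \<in> ?W" using n(2) unfolding P by simp
  then obtain f y where f: "f \<in> ?W" "n = f + Bm a l y" using nilp_preimage_Fs_ex[OF lN unl] by blast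
  have WM: "?W \<subseteq> perp ?m k ?W" unfolding P using nilp_Fs_self[where 'd = 'd, of l _ a] lN by auto
  have "?b n n = 0" "?b n f = 0" "?b f f = 0" "?b f n = 0"
    using isotropicD[OF iso n(1) n(1)] n(2) f(1) WM beta_D_sym[OF ad(1), of f n] by (auto simp: perp_def)
  moreover have By: "Bm a l y = n - f" using f(2) by simp
  ultimately have "?b (Bm a l y) (Bm a l y) = 0" unfolding By by (simp add: beta_diff)
  then have yc: "herm y (a ?m) = 0 \<or> herm y c = 0"
    using isotropic_line_cases[OF ad unl FC b c, of y] q unfolding w1_def by blast
  have "Bm a l y = herm y (a ?m) *s w1 + herm y c *s w2"
    unfolding w1_def w2_def by (metis unit_plane_cases[OF b c, of y] Bm_add Bm_scale)
  then have "n \<in> L1 \<or> n \<in> L2" using yc f unfolding L1 L2 by (auto intro: exI[of _ "herm y (a ?m)"] exI[of _ "herm y c"])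
  then have ex: "(N \<inter> L1) - ?W \<noteq> {} \<or> (N \<inter> L2) - ?W \<noteq> {}" using n by blast
  have notboth: "\<not> ((N \<inter> L1) - ?W \<noteq> {} \<and> (N \<inter> L2) - ?W \<noteq> {})"
  proof
    assume "(N \<inter> L1) - ?W \<noteq> {} \<and> (N \<inter> L2) - ?W \<noteq> {}"
    then obtain n1 n2 where n12: "n1 \<in> N" "n1 \<in> L1" "n1 \<notin> ?W" "n2 \<in> N" "n2 \<in> L2" "n2 \<notin> ?W" by blast
    obtain c1 c2 where c12: "n1 - c1 *s w1 \<in> ?W" "n2 - c2 *s w2 \<in> ?W" using n12 unfolding L1 L2 by blast
    define f1 where "f1 = n1 - c1 *s w1"
    define f2 where "f2 = n2 - c2 *s w2"
    have nz: "c1 \<noteq> 0" "c2 \<noteq> 0" using c12 n12 by auto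
    have fW: "f1 \<in> ?W" "f2 \<in> ?W" using c12 by (simp_all add: f1_def f2_def)
    have w12M: "w1 \<in> perp ?m k ?W" "w2 \<in> perp ?m k ?W" unfolding P w1_def w2_def using nilp_Bm[OF lN] by simp_all
    have z: "?b f1 f2 = 0" "?b w1 f2 = 0" "?b f1 w2 = 0"
      using fW w12M WM beta_D_sym[OF ad(1), of f1 w2] by (auto simp: perp_def)
    have n1: "n1 = f1 + c1 *s w1" and n2: "n2 = f2 + c2 *s w2" by (simp_all add: f1_def f2_def)
    have "?b n1 n2 = c1 * c2 * ?b w1 w2" unfolding n1 n2 using z by (simp add: beta_add beta_scale)
    then show False using isotropicD[OF iso n12(1,4)] nz w12 by simp
  qed
  have D: "vec.dim (N \<inter> L) = (if (N \<inter> L) - ?W \<noteq> {} then Suc (vec.dim (N \<inter> ?W)) else vec.dim (N \<inter> ?W))"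
    if "vec.subspace L" "?W \<subseteq> L" "\<And>x. x \<in> L \<Longrightarrow> \<exists>c. x - c *s w \<in> ?W" for L w
  proof (cases "(N \<inter> L) - ?W = {}")
    case True
    then have "N \<inter> L = N \<inter> ?W" using that(2) by blast
    then show ?thesis using True by simp
  next
    case False
    then obtain n where "n \<in> N" "n \<in> L" "n \<notin> ?W" by blast
    then have "vec.dim (N \<inter> L) = Suc (vec.dim (N \<inter> ?W))"
      by (intro dim_hyperplane_section[OF sN sub(3) that(2,1,3)]) auto
    then show ?thesis using False by simp
  qed
  have "vec.dim (N \<inter> L1) = (if (N \<inter> L1) - ?W \<noteq> {} then Suc (vec.dim (N \<inter> ?W)) else vec.dim (N \<inter> ?W))"
    using L1 by (intro D[OF sub(1) WL(1)]) blast
  moreover have "vec.dim (N \<inter> L2) = (if (N \<inter> L2) - ?W \<noteq> {} then Suc (vec.dim (N \<inter> ?W)) else vec.dim (N \<inter> ?W))"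
    using L2 by (intro D[OF sub(2) WL(2)]) blast
  ultimately have "odd (vec.dim (N \<inter> L1) + vec.dim (N \<inter> L2))" using ex notboth by auto
  then show ?thesis unfolding L1_def L2_def .
qed

text \<open>Symplectic-style reduction along the kernel of \<open>nilp\<close>: \<open>N'\<close> is
  the image of the part of \<open>N\<close> orthogonal to the kernel. The dimension lost,
  \<open>d\<close>, is that of the intersection of \<open>N\<close> with the kernel, the same for
  every \<open>F'\<close>; only parities will matter, so a constant shift is harmless.\<close>

lemma lagrangian_reduce:
  assumes ad: "adm TYPE('d::finite) m k" "2 \<le> k" and N: "lagrangian m k (N :: 'd hspace set)"
  obtains N' d where "lagrangian (m - 2) (k - 2) (N' :: 'd hspace set)"
    "\<And>F'. lagrangian m k {v. nilp v \<in> F'} \<Longrightarrow> vec.subspace F' \<Longrightarrow> vec.dim (N \<inter> {v. nilp v \<in> F'}) = vec.dim (N' \<inter> F') + d"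
proof -
  let ?K = "{v :: 'd hspace. nilp v = 0}"
  have k1: "1 \<le> k" using ad by simp
  have sN: "vec.subspace N" and NE: "N \<subseteq> ED m k" and iso: "isotropic (beta_D m k) N" using N by (auto simp: lagrangian_def)
  have sK: "vec.subspace ?K" unfolding ker_nilp by simp
  have dK: "vec.dim ?K = 2"
    unfolding ker_nilp using dim_E_space[where 'd = 'd, of 1 1] by (simp add: Suc_le_eq)
  have KC: "?K \<subseteq> EC m k" using nilp_zero_EC[OF ad] by blast
  have KE: "?K \<subseteq> ED m k" using KC EC_subset_ED by blast
  define d where "d = vec.dim (N \<inter> ?K)"
  define N' where "N' = nilp ` (N \<inter> EC m k)"
  have sNC: "vec.subspace (N \<inter> EC m k)" by (intro vec.subspace_inter sN subspace_EC)
  have "vec.dim (N \<inter> EC m k) + 2 = m + d"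
    using dim_lagrangian_perp[OF ad(1) N sK KE] dK unfolding EC_eq_perp[OF ad(1) k1] d_def by simp
  moreover have "vec.dim (N \<inter> EC m k) = vec.dim N' + vec.dim ((N \<inter> EC m k) \<inter> ?K)"
    unfolding N'_def by (rule dim_rank_nullity[OF sNC nilp_add nilp_scale])
  moreover have "(N \<inter> EC m k) \<inter> ?K = N \<inter> ?K" using KC by blast
  ultimately have dN': "vec.dim N' = m - 2" unfolding d_def by simp
  have "vec.subspace N'"
    unfolding N'_def vec.subspace_def
  proof (intro conjI ballI allI)
    show "0 \<in> nilp ` (N \<inter> EC m k)" using vec.subspace_0[OF sNC] nilp_0 by (metis image_eqI)
    show "x + y \<in> nilp ` (N \<inter> EC m k)" if "x \<in> nilp ` (N \<inter> EC m k)" "y \<in> nilp ` (N \<inter> EC m k)" for x y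
      using that vec.subspace_add[OF sNC] by (auto simp flip: nilp_add)
    show "c *s x \<in> nilp ` (N \<inter> EC m k)" if "x \<in> nilp ` (N \<inter> EC m k)" for c x
      using that vec.subspace_scale[OF sNC] by (auto simp flip: nilp_scale)
  qed
  moreover have "N' \<subseteq> ED (m - 2) (k - 2)" unfolding N'_def using nilp_EC_iff[OF ad] by blast
  moreover have "isotropic (beta_D (m - 2) (k - 2)) N'"
    unfolding N'_def isotropic_def using beta_D_nilp_nilp[OF ad] isotropicD[OF iso] by auto
  ultimately have lag: "lagrangian (m - 2) (k - 2) N'" using dN' by (simp add: lagrangian_def)
  have "vec.dim (N \<inter> {v. nilp v \<in> F'}) = vec.dim (N' \<inter> F') + d"
    if F: "lagrangian m k {v. nilp v \<in> F'}" and F': "vec.subspace F'" for F'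
  proof -
    let ?F = "{v. nilp v \<in> F'}"
    have sF: "vec.subspace ?F" and FE: "?F \<subseteq> ED m k" and isoF: "isotropic (beta_D m k) ?F" using F by (auto simp: lagrangian_def)
    have KF: "?K \<subseteq> ?F" using vec.subspace_0[OF F'] by auto
    have FC: "?F \<subseteq> EC m k"
      unfolding EC_eq_perp[OF ad(1) k1] using KF FE isotropicD[OF isoF] by (auto simp: perp_def)
    have "nilp ` (N \<inter> ?F) = N' \<inter> F'" unfolding N'_def using FC by auto
    moreover have "(N \<inter> ?F) \<inter> ?K = N \<inter> ?K" using KF by blast
    ultimately show ?thesis
      using dim_rank_nullity[OF vec.subspace_inter[OF sN sF] nilp_add nilp_scale] unfolding d_def by simp
  qed
  then show ?thesis using that lag by blast
qed

subsection \<open>The case of a single row of rays\<close>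

text \<open>For \<open>k = 1\<close> the space \<open>EC\<close> contains only vectors in the span
  of the \<open>e_vec\<close>, so \<open>C_map\<close> sends them into the line of
  \<open>e2\<close>.\<close>

lemma FC_first:
  fixes a :: "nat \<Rightarrow> complex ^ 2"
  assumes ad: "adm TYPE('d::finite) (Suc l) 1" and un: "units a l" and FC: "FC TYPE('d) (Suc l) 1 a"
    and i: "1 \<le> i" "i \<le> l"
  shows "pj (a i) = pj e2"
proof -
  have lN: "l < CARD('d)" using adm_bounds(3)[OF ad] by auto
  have "wv a i \<in> (Fs a l :: 'd hspace set)" using i by (rule wv_in_Fs)
  then have w: "wv a i \<in> (EC (Suc l) 1 :: 'd hspace set)" using FC by (auto simp: FC_def)
  have "2 * Suc l - 1 - 1 \<le> CARD('d)" using ad by (simp add: adm_def)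
  then have z: "(wv a i :: 'd hspace) $ Inr (idx j) = 0" if "1 \<le> j" "j \<le> CARD('d)" for j
    using w that unfolding EC_def by (simp add: mem_E_space)
  have "C_map (wv a i :: 'd hspace) = a i"
    unfolding wv_def using i lN by (intro C_map_Bm) auto
  then have "a i $ 2 = (\<Sum>j=1..CARD('d). (wv a i :: 'd hspace) $ Inr (idx j))"
    by (metis C_map_nth(2))
  also have "\<dots> = 0" using z by (intro sum.neutral) auto
  finally have a2: "a i $ 2 = 0" .
  have aa: "herm (a i) (a i) = 1" using un i by (simp add: units_def)
  show ?thesis
  proof (rule pj_eqI[of _ _ f2])
    show "herm e2 e2 = 1" "herm f2 f2 = 1" "herm e2 f2 = 0" by (simp_all add: herm_2 e2_def f2_def axis_def)
    show "herm (a i) f2 = 0" using a2 by (simp add: herm_2 f2_def axis_def)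
  qed (rule aa)
qed

lemma Bm_const:
  assumes "\<And>j. 1 \<le> j \<Longrightarrow> j \<le> i \<Longrightarrow> pj (a j) = pj e2" "Suc i \<le> CARD('d)"
  shows "Bm a i u = u $ 1 *s e_vec (Suc i) + u $ 2 *s (f_vec 1 :: ('d::finite) hspace)"
  using assms
proof (induction i arbitrary: u)
  case 0
  then show ?case by simp
next
  case (Suc i)
  have IH: "Bm a i v = v $ 1 *s e_vec (Suc i) + v $ 2 *s (f_vec 1 :: 'd hspace)" for v using Suc by simp
  have p1: "pj (a (Suc i)) = pj e2" using Suc.prems(1)[of "Suc i"] by simp
  have p: "pj (a (Suc i)) u = u $ 1 *s e2"
    unfolding p1 by (simp add: pj_def herm_2 e2_def axis_def)
  have up: "up (e_vec (Suc i)) = (e_vec (Suc (Suc i)) :: 'd hspace)"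
    by (rule vec_eqI_coordinate) (use Suc.prems in \<open>auto simp: e_vec_idx2\<close>)
  show ?case
    unfolding Bm.simps(2) IH p by (simp add: e2_def axis_def up_scale up_add up)
qed

text \<open>The last vector is \<open>u e_vec (Suc l) + v f_vec 1\<close>, and the condition is its
  isotropy. The first basis vector is the middle one of its row and pairs with itself with sign
  \<open>(- 1) ^ l\<close>, the second with sign \<open>- 1\<close>; for \<open>l = 0\<close> the
  two pair with each other instead.\<close>

lemma FD_first:
  fixes a :: "nat \<Rightarrow> complex ^ 2"
  assumes ad: "adm TYPE('d::finite) (Suc l) 1" and un: "units a (Suc l)"
    and e: "\<And>j. 1 \<le> j \<Longrightarrow> j \<le> l \<Longrightarrow> pj (a j) = pj e2"
    and q: "if l = 0 then a 1 $ 1 * a 1 $ 2 = 0 else (- 1) ^ l * (a (Suc l) $ 1)\<^sup>2 = (a (Suc l) $ 2)\<^sup>2"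
  shows "FD TYPE('d) (Suc l) 1 a"
proof -
  let ?m = "Suc l"
  have lN: "?m \<le> CARD('d)" using adm_bounds(3)[OF ad] by auto
  have bd: "2 * ?m - 1 \<le> CARD('d)" "1 \<le> CARD('d)" using ad by (auto simp: adm_def)
  have unl: "units a l" using un by (rule units_mono) simp
  have b: "herm (a ?m) (a ?m) = 1" using un by (simp add: units_def)
  have sub: "Fs a l \<subseteq> vec.span (bv ` labels l 0 :: 'd hspace set)"
    unfolding Fs_def
  proof (rule vec.span_minimal)
    show "wv a ` {1..l} \<subseteq> vec.span (bv ` labels l 0 :: 'd hspace set)"
    proof (rule image_subsetI)
      fix i assume i: "i \<in> {1..l}"
      then obtain j where j: "i = Suc j" by (cases i) auto
      have ai: "herm (a i) (a i) = 1" using unl i by (simp add: units_def)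
      have "a i = pj e2 (a i)" using e[of i] i pj_self[OF ai] by simp
      moreover have "pj e2 (a i) $ 2 = 0" by (simp add: pj_def e2_def axis_def)
      ultimately have "a i $ 2 = 0" by simp
      moreover have "wv a i = a i $ 1 *s e_vec i + a i $ 2 *s (f_vec 1 :: 'd hspace)"
        unfolding wv_def using Bm_const[where 'd = 'd, of j a "a i"] e i j lN by simp
      ultimately have "wv a i = a i $ 1 *s (bv (Inl i) :: 'd hspace)" by (simp add: bv_simps)
      moreover have "bv (Inl i) \<in> (bv ` labels l 0 :: 'd hspace set)" using i by auto
      ultimately show "wv a i \<in> vec.span (bv ` labels l 0 :: 'd hspace set)"
        by (simp add: vec.span_base vec.span_scale)
    qed
  qed simp
  have FC: "FC TYPE('d) ?m 1 a"
    unfolding FC_def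
  proof
    have "labels l 0 \<subseteq> labels (2 * ?m - 1 - 1) (1 - 1)" by (rule labels_mono) auto
    then have "vec.span (bv ` labels l 0 :: 'd hspace set) \<subseteq> EC ?m 1"
      unfolding EC_def E_space_eq by (intro vec.span_mono image_mono)
    then show "Fs a (?m - 1) \<subseteq> (EC ?m 1 :: 'd hspace set)" using sub by simp
    have zero: "bilinear_form (\<lambda>v w :: 'd hspace. 0)" by (simp add: bilinear_form_def)
    have "beta_C ?m 1 v w = 0" if "v \<in> Fs a l" "w \<in> Fs a l" for v w :: "'d hspace"
    proof (rule bilinear_form_eq[OF bilinear_beta_C zero])
      show "v \<in> vec.span (bv ` labels l 0)" "w \<in> vec.span (bv ` labels l 0)" using that sub by auto
      fix x y :: "'d hspace" assume "x \<in> bv ` labels l 0" "y \<in> bv ` labels l 0"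
      then obtain i j where ij: "x = bv (Inl i)" "y = bv (Inl j)" "1 \<le> i" "i \<le> l" "1 \<le> j" "j \<le> l"
        by (auto simp: labels_def)
      have "beta_C ?m 1 x y = gram_C ?m 1 (Inl i) (Inl j)"
        unfolding beta_C_def ij by (rule bilin_bv) (use bd ij in auto)
      then show "beta_C ?m 1 x y = 0" using ij by simp
    qed
    then show "isotropic (beta_C ?m 1) (Fs a (?m - 1) :: 'd hspace set)" by (simp add: isotropic_def)
  qed
  let ?u = "a ?m $ 1" and ?v = "a ?m $ 2"
  have B: "Bm a l (a ?m) = ?u *s bv (Inl ?m) + ?v *s (bv (Inr 1) :: 'd hspace)"
    using Bm_const[where 'd = 'd, of l a "a ?m"] e lN by (simp add: bv_simps)
  have G: "beta_D ?m 1 (bv x :: 'd hspace) (bv y) = gram_D ?m 1 x y"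
    if "x \<in> labels (2 * ?m - 1) 1" "y \<in> labels (2 * ?m - 1) 1" for x y
    unfolding beta_D_def by (rule bilin_bv) (use bd that in auto)
  have "beta_D ?m 1 (Bm a l (a ?m)) (Bm a l (a ?m) :: 'd hspace) =
    ?u * ?u * gram_D ?m 1 (Inl ?m) (Inl ?m) + ?u * ?v * gram_D ?m 1 (Inl ?m) (Inr 1)
    + ?v * ?u * gram_D ?m 1 (Inr 1) (Inl ?m) + ?v * ?v * gram_D ?m 1 (Inr 1) (Inr 1)"
    unfolding B by (simp add: beta_add beta_scale G algebra_simps del: gram_D.simps One_nat_def)
  also have "\<dots> = 0"
    using q by (cases "l = 0") (auto simp: power2_eq_square algebra_simps)
  finally show ?thesis using lift_iff[OF ad _ unl FC b] by simp
qed

subsection \<open>The projective line as a sphere\<close>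

text \<open>The first entry is the axis through the lines of \<open>e2\<close> and
  \<open>f2\<close>, the other two are real and imaginary part of the off-diagonal entry. The order
  is chosen for \<open>c = m - k\<close>, so that \<open>p_pt\<close> and \<open>- p_pt\<close>
  become the lines prescribed for dotted and undotted rightmost rays. For \<open>c > 0\<close> the
  point \<open>q_pt\<close> becomes the line of \<open>e2\<close>.\<close>

definition axes :: "nat \<Rightarrow> real ^ 3 \<Rightarrow> real \<times> real \<times> real" where
  "axes c y = (if c = 0 then (y $ 3, y $ 1, y $ 2) else if even c then (y $ 1, y $ 3, y $ 2) else (y $ 1, y $ 2, y $ 3))"

text \<open>The rank one projection attached to a point of the sphere, half of the identity plus a
  combination of Pauli matrices. Antipodal points give complementary projections.\<close>

definition prm :: "nat \<Rightarrow> real ^ 3 \<Rightarrow> complex ^ 2 \<Rightarrow> complex ^ 2" where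
  "prm c y u = (case axes c y of (s, t, r) \<Rightarrow>
     vector [of_real ((1 + s) / 2) * u $ 1 + Complex (t / 2) (r / 2) * u $ 2,
       cnj (Complex (t / 2) (r / 2)) * u $ 1 + of_real ((1 - s) / 2) * u $ 2])"

lemma axes_sphere:
  assumes "axes c y = (s, t, r)"
  shows "y \<in> sphere 0 1 \<longleftrightarrow> s\<^sup>2 + t\<^sup>2 + r\<^sup>2 = 1"
proof -
  have "y \<in> sphere 0 1 \<longleftrightarrow> (y $ 1)\<^sup>2 + (y $ 2)\<^sup>2 + (y $ 3)\<^sup>2 = 1"
    by (simp add: norm_eq_1 inner_vec_def sum_3 power2_eq_square)
  then show ?thesis using assms by (auto simp: axes_def split: if_splits)
qed

lemma axes_minus: "axes c y = (s, t, r) \<Longrightarrow> axes c (- y) = (- s, - t, - r)"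
  by (auto simp: axes_def split: if_splits)

lemma axes_inj: "axes c y = axes c y' \<Longrightarrow> y = y'"
  by (auto simp: axes_def vec_eq_iff forall_3 split: if_splits)

lemma axes_surj: obtains y where "axes c y = (s, t, r)"
proof (cases "c = 0")
  case True
  then show ?thesis using that[of "vector [t, r, s]"] by (simp add: axes_def)
next
  case False
  then show ?thesis
    using that[of "if even c then vector [s, r, t] else vector [s, t, r]"] by (simp add: axes_def)
qed

lemma pj_nth: "pj a u $ i = a $ i * cnj (a $ 1) * u $ 1 + a $ i * cnj (a $ 2) * u $ 2"
  by (simp add: pj_def herm_2 algebra_simps)

lemma pj_eq_prm_iff:
  assumes "axes c y = (s, t, r)"
  shows "pj a = prm c y \<longleftrightarrow> a $ 1 * cnj (a $ 1) = of_real ((1 + s) / 2) \<and> a $ 1 * cnj (a $ 2) = Complex (t / 2) (r / 2)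
    \<and> a $ 2 * cnj (a $ 2) = of_real ((1 - s) / 2)" (is "_ \<longleftrightarrow> ?R")
proof
  assume eq: "pj a = prm c y"
  have "pj a (axis 1 1) $ 1 = prm c y (axis 1 1) $ 1" "pj a (axis 2 1) $ 1 = prm c y (axis 2 1) $ 1"
    "pj a (axis 2 1) $ 2 = prm c y (axis 2 1) $ 2" using eq by simp_all
  then show ?R using assms by (simp add: pj_nth prm_def axis_def vector_2)
next
  assume R: ?R
  then have "cnj (a $ 1 * cnj (a $ 2)) = cnj (Complex (t / 2) (r / 2))" by simp
  then have R21: "a $ 2 * cnj (a $ 1) = cnj (Complex (t / 2) (r / 2))" by (simp add: mult.commute)
  have R': "a $ 1 * cnj (a $ 1) = of_real ((1 + s) / 2)" "a $ 1 * cnj (a $ 2) = Complex (t / 2) (r / 2)"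
    "a $ 2 * cnj (a $ 2) = of_real ((1 - s) / 2)" using R by blast+
  show "pj a = prm c y"
    by (intro ext vec2_eqI) (simp_all only: pj_nth prm_def assms prod.case vector_2 R' R21)
qed

lemma prm_inj:
  assumes "prm c y = prm c y'"
  shows "y = y'"
proof -
  obtain s t r s' t' r' where a: "axes c y = (s, t, r)" "axes c y' = (s', t', r')" by (metis prod_cases3)
  have "prm c y (axis 1 1) $ 1 = prm c y' (axis 1 1) $ 1" "prm c y (axis 2 1) $ 1 = prm c y' (axis 2 1) $ 1"
    using assms by simp_all
  then have "s = s'" "t = t'" "r = r'"
    using a by (simp_all add: prm_def axis_def vector_2 complex_eq_iff)
  then show ?thesis using a axes_inj by metis
qed

lemma prm_minus: "prm c (- y) u = u - prm c y u"
proof -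
  obtain s t r where a: "axes c y = (s, t, r)" by (metis prod_cases3)
  have C: "Complex (- (t / 2)) (- (r / 2)) = - Complex (t / 2) (r / 2)" by (simp add: complex_eq_iff)
  show ?thesis
    using axes_minus[OF a] a C
    by (intro vec2_eqI) (simp_all add: prm_def vector_2 field_simps)
qed

lemma prm_unit_exists:
  assumes "y \<in> sphere 0 1"
  shows "\<exists>a. herm a a = 1 \<and> pj a = prm c y"
proof -
  obtain s t r where a: "axes c y = (s, t, r)" by (metis prod_cases3)
  have q: "s\<^sup>2 + t\<^sup>2 + r\<^sup>2 = 1" using axes_sphere[OF a] assms by blast
  show ?thesis
  \<comment> \<open>The unit vector is normalized to have a positive first coordinate, which fails
    only for the line of \<open>f2\<close>.\<close>
  proof (cases "s = - 1")
    case True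
    then have "t\<^sup>2 + r\<^sup>2 = 0" using q by simp
    then have "t = 0" "r = 0" by (simp_all add: sum_power2_eq_zero_iff)
    then have "pj (vector [0, 1]) = prm c y"
      unfolding pj_eq_prm_iff[OF a] using True by (simp add: vector_2 complex_eq_iff)
    moreover have "herm (vector [0, 1] :: complex ^ 2) (vector [0, 1]) = 1" by (simp add: herm_2 vector_2)
    ultimately show ?thesis by blast
  next
    case False
    have "s\<^sup>2 \<le> 1" using q by (metis add_increasing2 le_add_same_cancel1 sum_power2_ge_zero add.assoc)
    then have s1: "1 + s > 0" using False by (simp add: abs_square_le_1 abs_le_iff)
    define w where "w = sqrt ((1 + s) / 2)"
    have w: "w > 0" "w * w = (1 + s) / 2" using s1 by (simp_all add: w_def)
    define z where "z = Complex (t / 2) (r / 2)"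
    have zz: "z * cnj z = of_real ((1 + s) / 2 * ((1 - s) / 2))"
    proof -
      have "z * cnj z = of_real ((t\<^sup>2 + r\<^sup>2) / 4)"
        by (simp add: z_def complex_eq_iff power2_eq_square field_simps)
      also have "(t\<^sup>2 + r\<^sup>2) / 4 = (1 + s) / 2 * ((1 - s) / 2)" using q by (simp add: power2_eq_square field_simps)
      finally show ?thesis .
    qed
    define b where "b = (vector [of_real w, cnj z / of_real w] :: complex ^ 2)"
    have b: "b $ 1 = of_real w" "b $ 2 = cnj z / of_real w" by (simp_all add: b_def vector_2)
    have b11: "b $ 1 * cnj (b $ 1) = of_real ((1 + s) / 2)"
    proof -
      have "b $ 1 * cnj (b $ 1) = of_real (w * w)" unfolding b by simp
      then show ?thesis unfolding w(2) .
    qed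
    have b12: "b $ 1 * cnj (b $ 2) = z" unfolding b using w(1) by simp
    have "b $ 2 * cnj (b $ 2) = (z * cnj z) / of_real (w * w)" unfolding b by (simp add: mult.commute)
    also have "\<dots> = of_real ((1 + s) / 2 * ((1 - s) / 2) / ((1 + s) / 2))"
      unfolding zz w(2) by (simp only: of_real_divide)
    also have "(1 + s) / 2 * ((1 - s) / 2) / ((1 + s) / 2) = (1 - s) / 2"
      using s1 by (intro nonzero_mult_div_cancel_left) simp
    finally have b22: "b $ 2 * cnj (b $ 2) = of_real ((1 - s) / 2)" .
    have "pj b = prm c y" unfolding pj_eq_prm_iff[OF a] using b11 b12 b22 by (simp add: z_def)
    moreover have "herm b b = 1"
    proof -
      have h: "(1 + s) / 2 + (1 - s) / 2 = 1" by (simp add: field_simps)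
      show ?thesis unfolding herm_2 b11 b22 of_real_add[symmetric] h by simp
    qed
    ultimately show ?thesis by blast
  qed
qed

lemma unit_prm_exists:
  assumes "herm a a = 1"
  obtains y where "y \<in> sphere 0 1" "pj a = prm c y"
proof -
  \<comment> \<open>These are the coordinates of the Hopf map.\<close>
  define s where "s = (cmod (a $ 1))\<^sup>2 - (cmod (a $ 2))\<^sup>2"
  define z where "z = 2 * (a $ 1 * cnj (a $ 2))"
  obtain y where y: "axes c y = (s, Re z, Im z)" using axes_surj by blast
  have n: "(cmod (a $ 1))\<^sup>2 + (cmod (a $ 2))\<^sup>2 = 1"
    using assms unfolding herm_2 complex_norm_square[symmetric]
    by (metis of_real_add of_real_eq_1_iff)
  have "(Re z)\<^sup>2 + (Im z)\<^sup>2 = (cmod z)\<^sup>2" by (simp add: cmod_power2)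
  also have "\<dots> = 4 * (cmod (a $ 1))\<^sup>2 * (cmod (a $ 2))\<^sup>2" by (simp add: z_def norm_mult power_mult_distrib)
  finally have "s\<^sup>2 + (Re z)\<^sup>2 + (Im z)\<^sup>2 = ((cmod (a $ 1))\<^sup>2 + (cmod (a $ 2))\<^sup>2)\<^sup>2"
    by (simp add: s_def power2_eq_square algebra_simps)
  then have "y \<in> sphere 0 1" using axes_sphere[OF y] n by (simp add: add.assoc)
  moreover have "pj a = prm c y"
  proof -
    have "a $ 1 * cnj (a $ 1) = of_real ((1 + s) / 2)" "a $ 2 * cnj (a $ 2) = of_real ((1 - s) / 2)"
    proof -
      have "(1 + s) / 2 = (cmod (a $ 1))\<^sup>2" "(1 - s) / 2 = (cmod (a $ 2))\<^sup>2" using n by (simp_all add: s_def field_simps)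
      then show "a $ 1 * cnj (a $ 1) = of_real ((1 + s) / 2)" "a $ 2 * cnj (a $ 2) = of_real ((1 - s) / 2)"
        by (simp_all only: complex_norm_square)
    qed
    moreover have "a $ 1 * cnj (a $ 2) = Complex (Re z / 2) (Im z / 2)" by (simp add: z_def complex_eq_iff)
    ultimately show ?thesis unfolding pj_eq_prm_iff[OF y] by blast
  qed
  ultimately show ?thesis using that by blast
qed

text \<open>The phase is arbitrary: the Hopf fibration has no section, so a continuous choice is
  impossible. Later continuity proofs use only \<open>pj (uv c y) = prm c y\<close>.\<close>

definition uv :: "nat \<Rightarrow> real ^ 3 \<Rightarrow> complex ^ 2" where
  "uv c y = (SOME a. herm a a = 1 \<and> pj a = prm c y)"

lemma uv:
  assumes "y \<in> sphere 0 1"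
  shows "herm (uv c y) (uv c y) = 1" "pj (uv c y) = prm c y"
  using someI_ex[OF prm_unit_exists[OF assms, of c]] unfolding uv_def by blast+

lemma uv_perp_iff:
  assumes "y \<in> sphere 0 1" "y' \<in> sphere 0 1"
  shows "herm (uv c y) (uv c y') = 0 \<longleftrightarrow> y' = - y"
proof
  assume h: "herm (uv c y) (uv c y') = 0"
  have "prm c y u + prm c y' u = u" for u
    using perp_decomp[OF uv(1)[OF assms(1)] uv(1)[OF assms(2)] h, of u] uv(2)[OF assms(1)] uv(2)[OF assms(2)] by simp
  then have "prm c y' = prm c (- y)" by (intro ext) (metis prm_minus add_diff_cancel_left')
  then show "y' = - y" by (rule prm_inj)
next
  assume y': "y' = - y"
  let ?a = "uv c y" and ?b = "uv c y'"
  have "pj ?b ?b = ?b - pj ?a ?b"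
    unfolding uv(2)[OF assms(1)] uv(2)[OF assms(2)] unfolding y' by (rule prm_minus)
  then have "pj ?a ?b = 0" using pj_self[OF uv(1)[OF assms(2)]] by simp
  then have "herm ?b ?a = 0" using uv(1)[OF assms(1), of c] by (auto simp: pj_def)
  then show "herm ?a ?b = 0" using herm_eq_0_commute by blast
qed

lemma uv_eqI:
  assumes "y \<in> sphere 0 1" "y' \<in> sphere 0 1" "pj (uv c y) = pj (uv c y')"
  shows "y = y'"
  using assms uv(2) prm_inj by metis

lemma pq_sphere: "p_pt \<in> sphere 0 1" "q_pt \<in> sphere 0 1"
  by (simp_all add: p_pt_def q_pt_def norm_eq_1 inner_vec_def sum_3)

lemma herm_ef [simp]: "herm e2 e2 = 1" "herm f2 f2 = 1" "herm e2 f2 = 0" "herm f2 e2 = 0"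
  by (simp_all add: herm_2 e2_def f2_def axis_def)

lemma pj_uv_q:
  assumes "c \<noteq> 0"
  shows "pj (uv c q_pt) = pj e2"
proof -
  have "axes c q_pt = (1, 0, 0)" using assms by (simp add: axes_def q_pt_def)
  then have "pj e2 = prm c q_pt" by (simp add: pj_eq_prm_iff e2_def axis_def complex_eq_iff)
  then show ?thesis using uv(2)[OF pq_sphere(2)] by simp
qed

subsection \<open>Diagrams and isotropic flags\<close>

text \<open>For the fibers \<open>c\<close> is \<open>m - k\<close>, which the step to
  \<open>(m - 2, k - 2)\<close> leaves unchanged.\<close>

definition seq :: "nat \<Rightarrow> (nat \<Rightarrow> real ^ 3) \<Rightarrow> nat \<Rightarrow> complex ^ 2" where
  "seq c x = (\<lambda>i. uv c (x i))"

abbreviation spheres :: "nat \<Rightarrow> (nat \<Rightarrow> real ^ 3) set" where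
  "spheres m \<equiv> {1..m} \<rightarrow>\<^sub>E sphere 0 1"

lemma spheres_nth: "x \<in> spheres m \<Longrightarrow> 1 \<le> i \<Longrightarrow> i \<le> m \<Longrightarrow> x i \<in> sphere 0 1"
  by (auto simp: PiE_iff)

lemma units_seq: "x \<in> spheres m \<Longrightarrow> units (seq c x) m"
  using uv(1) spheres_nth unfolding units_def seq_def by (metis atLeastAtMost_iff)

lemma FD_cong:
  assumes "\<And>j. 1 \<le> j \<Longrightarrow> j \<le> m \<Longrightarrow> pj (a j) = pj (b j)" "units a m" "units b m"
  shows "FD TYPE('d::finite) m k a \<longleftrightarrow> FD TYPE('d) m k b"
proof -
  have "Fs a m = (Fs b m :: 'd hspace set)" using assms by (rule Fs_cong)
  then show ?thesis by (simp add: FD_def)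
qed

lemma delete_pair_spheres:
  assumes "1 \<le> i" "i < m" "x \<in> spheres m"
  shows "delete_pair m i x \<in> spheres (m - 2)"
proof -
  have "skip i j \<in> {1..m}" if "j \<in> {1..m - 2}" for j using that assms by simp
  then show ?thesis using assms(3) by (auto simp: delete_pair_def PiE_iff)
qed

lemma seq_delete:
  assumes "1 \<le> j" "j \<le> m - 2"
  shows "seq c (delete_pair m i x) j = del_seq i (seq c x) j"
  using assms by (auto simp: seq_def delete_pair_def del_seq_def skip_def)

lemma units_del:
  assumes "1 \<le> i" "i < m" "x \<in> spheres m"
  shows "units (del_seq i (seq c x)) (m - 2)"
proof -
  have "units (seq c (delete_pair m i x)) (m - 2)" by (rule units_seq[OF delete_pair_spheres[OF assms]])
  then show ?thesis by (auto simp: units_def seq_delete)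
qed

lemma Fs_delete_pair:
  assumes "1 \<le> i" "i < m" "x \<in> spheres m"
  shows "Fs (del_seq i (seq c x)) (m - 2) = (Fs (seq c (delete_pair m i x)) (m - 2) :: ('d::finite) hspace set)"
  using units_del[OF assms] units_seq[OF delete_pair_spheres[OF assms]]
  by (intro Fs_cong) (auto simp: seq_delete)

lemma FD_delete_pair:
  assumes ad: "adm TYPE('d::finite) m k" "2 \<le> k" and x: "x \<in> spheres m" and i: "1 \<le> i" "i < m" "x (Suc i) = - x i"
  shows "FD TYPE('d) m k (seq (m - k) x) \<longleftrightarrow> FD TYPE('d) (m - 2) (k - 2) (seq (m - 2 - (k - 2)) (delete_pair m i x))"
    "Fs (seq (m - k) x) m = {v :: 'd hspace. nilp v \<in> Fs (seq (m - 2 - (k - 2)) (delete_pair m i x)) (m - 2)}"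
proof -
  have c: "m - 2 - (k - 2) = m - k" using ad by (auto simp: adm_def)
  have "herm (seq (m - k) x i) (seq (m - k) x (Suc i)) = 0"
    unfolding seq_def using i x spheres_nth[OF x] by (subst uv_perp_iff) auto
  note D = FD_delete[OF ad units_seq[OF x] i(1,2) this]
  show "Fs (seq (m - k) x) m = {v :: 'd hspace. nilp v \<in> Fs (seq (m - 2 - (k - 2)) (delete_pair m i x)) (m - 2)}"
    unfolding c D(1) Fs_delete_pair[OF i(1,2) x] ..
  show "FD TYPE('d) m k (seq (m - k) x) \<longleftrightarrow> FD TYPE('d) (m - 2) (k - 2) (seq (m - 2 - (k - 2)) (delete_pair m i x))"
    unfolding c D(2) unfolding FD_def Fs_delete_pair[OF i(1,2) x] ..
qed

definition flip :: "nat \<Rightarrow> (nat \<Rightarrow> real ^ 3) \<Rightarrow> nat \<Rightarrow> real ^ 3" where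
  "flip m x = x(m := - x m)"

lemma flip_spheres: "1 \<le> m \<Longrightarrow> x \<in> spheres m \<Longrightarrow> flip m x \<in> spheres m"
  by (auto simp: flip_def PiE_iff extensional_def)

lemma flip_flip [simp]: "flip m (flip m x) = x"
  by (simp add: flip_def)

lemma seq_flip: "seq c (flip m x) = (seq c x)(m := uv c (- x m))"
  by (auto simp: seq_def flip_def)

lemma FD_flip:
  assumes ad: "adm TYPE('d::finite) m k" "1 \<le> k" and x: "x \<in> spheres m" and FD: "FD TYPE('d) m k (seq c x)"
  shows "FD TYPE('d) m k (seq c (flip m x))"
    "lagrangian m k (N :: 'd hspace set) \<Longrightarrow>
     odd (vec.dim (N \<inter> Fs (seq c x) m) + vec.dim (N \<inter> Fs (seq c (flip m x)) m))"
proof -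
  obtain l where l: "m = Suc l" using ad by (cases m) (auto simp: adm_def)
  have xm: "x m \<in> sphere 0 1" "- x m \<in> sphere 0 1" using spheres_nth[OF x, of m] l by auto
  have p: "herm (seq c x (Suc l)) (uv c (- x m)) = 0" unfolding seq_def l[symmetric] by (subst uv_perp_iff) (use xm in auto)
  note a = ad[unfolded l] units_seq[OF x, unfolded l] FD[unfolded l] uv(1)[OF xm(2), of c] p
  show "FD TYPE('d) m k (seq c (flip m x))" unfolding seq_flip using FD_swap(1)[OF a] l by simp
  show "odd (vec.dim (N \<inter> Fs (seq c x) m) + vec.dim (N \<inter> Fs (seq c (flip m x)) m))" if "lagrangian m k N"
    unfolding seq_flip using lagrangian_swap[OF a] that l by simp
qed

lemma delete_pair_flip: "delete_pair m (m - 1) (flip m x) = delete_pair m (m - 1) x"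
  by (auto simp: delete_pair_def flip_def skip_def fun_eq_iff restrict_def)

text \<open>This is the isotropy condition of \<open>FD_first\<close> for the two lines allowed on
  the last ray, and it explains why \<open>axes\<close> depends on the parity of
  \<open>c\<close>.\<close>

lemma seq_ray_condition:
  assumes "y = p_pt \<or> y = - p_pt"
  shows "if l = 0 then uv l y $ 1 * uv l y $ 2 = 0 else (- 1) ^ l * (uv l y $ 1)\<^sup>2 = (uv l y $ 2)\<^sup>2"
proof -
  let ?a = "uv l y"
  have ys: "y \<in> sphere 0 1" using assms pq_sphere by auto
  obtain s t r where ax: "axes l y = (s, t, r)" by (metis prod_cases3)
  have R: "?a $ 1 * cnj (?a $ 1) = of_real ((1 + s) / 2)" "?a $ 1 * cnj (?a $ 2) = Complex (t / 2) (r / 2)"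
    "?a $ 2 * cnj (?a $ 2) = of_real ((1 - s) / 2)"
    using uv(2)[OF ys, of l] unfolding pj_eq_prm_iff[OF ax] by blast+
  show ?thesis
  proof (cases "l = 0")
    case True
    then have "t = 0" "r = 0" using ax assms by (auto simp: axes_def p_pt_def)
    then have "?a $ 1 * cnj (?a $ 2) = 0" using R(2) by (simp add: complex_eq_iff)
    then show ?thesis using True by simp
  next
    case False
    define z where "z = Complex t r"
    have s0: "s = 0" and zz: "(- 1) ^ l * z\<^sup>2 = 1"
      using ax assms False
      by (auto simp: axes_def p_pt_def z_def power2_eq_square complex_eq_iff uminus_power_if split: if_splits)
    have a2: "?a $ 2 * cnj (?a $ 2) = 1 / 2" using R(3) s0 by simp
    have "?a $ 1 = 2 * (?a $ 1 * cnj (?a $ 2)) * ?a $ 2" using a2 by (simp add: mult.commute mult.left_commute)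
    also have "\<dots> = z * ?a $ 2" unfolding R(2) by (simp add: z_def complex_eq_iff)
    finally have "(?a $ 1)\<^sup>2 = z\<^sup>2 * (?a $ 2)\<^sup>2" by (metis power_mult_distrib)
    then have "(- 1) ^ l * (?a $ 1)\<^sup>2 = ((- 1) ^ l * z\<^sup>2) * (?a $ 2)\<^sup>2" by (simp add: mult.assoc)
    then show ?thesis using zz False by simp
  qed
qed

lemma FD_iff_S_par_1:
  assumes ad: "adm TYPE('d::finite) m 1" and x: "x \<in> spheres m"
  shows "FD TYPE('d) m 1 (seq (m - 1) x) \<longleftrightarrow> (\<exists>b. x \<in> S_par b m 1)"
proof -
  obtain l where l: "m = Suc l" using ad by (cases m) (auto simp: adm_def)
  have ml: "m - 1 = l" using l by simp
  define z where "z b = (\<lambda>i\<in>{1..m}. if i < m then q_pt else if b then p_pt else - p_pt)" for b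
  have S: "x \<in> S_par b m 1 \<longleftrightarrow> x = z b" for x b using S_par_few[of 1 x b m] l by (simp add: z_def)
  have zs: "z b \<in> spheres m" for b using pq_sphere by (auto simp: z_def)
  have zq: "pj (seq l (z b) j) = pj e2" if "1 \<le> j" "j \<le> l" for j b
    using that pj_uv_q[of l] l by (simp add: seq_def z_def)
  have zm: "z b m = (if b then p_pt else - p_pt)" for b using l by (simp add: z_def)
  have FDz: "FD TYPE('d) m 1 (seq l (z b))" for b
  proof -
    have "FD TYPE('d) (Suc l) 1 (seq l (z b))"
    proof (rule FD_first)
      show "adm TYPE('d) (Suc l) 1" using ad l by simp
      show "units (seq l (z b)) (Suc l)" using units_seq[OF zs] l by simp
      show "if l = 0 then seq l (z b) 1 $ 1 * seq l (z b) 1 $ 2 = 0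
        else (- 1) ^ l * (seq l (z b) (Suc l) $ 1)\<^sup>2 = (seq l (z b) (Suc l) $ 2)\<^sup>2"
        using seq_ray_condition[of "z b m" l] zm[of b] l by (auto simp: seq_def)
    qed (rule zq)
    then show ?thesis using l by simp
  qed
  show ?thesis
  proof
    assume FD: "FD TYPE('d) m 1 (seq (m - 1) x)"
    have a: "adm TYPE('d) (Suc l) 1" "(1::nat) \<le> 1" "units (seq l x) (Suc l)" "FD TYPE('d) (Suc l) 1 (seq l x)"
      using ad units_seq[OF x] FD ml l by auto
    have FC: "FC TYPE('d) (Suc l) 1 (seq l x)" by (rule FD_imp_FC[OF a])
    have q: "x j = q_pt" if j: "1 \<le> j" "j \<le> l" for j
    proof -
      have "units (seq l x) l" using a(3) by (rule units_mono) simp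
      then have "pj (seq l x j) = pj e2" using FC_first[OF a(1) _ FC j] by blast
      then have "pj (uv l (x j)) = pj (uv l q_pt)" using pj_uv_q[of l] j by (simp add: seq_def)
      then show ?thesis using uv_eqI spheres_nth[OF x, of j] j l pq_sphere by simp
    qed
    \<comment> \<open>The point \<open>p_pt\<close> in last position is known to give an isotropic
      flag, so by uniqueness of the extension up to orthogonality the last coordinate of
      \<open>x\<close> is \<open>p_pt\<close> or its antipode.\<close>
    define b where "b = uv l p_pt"
    have FDp: "FD TYPE('d) (Suc l) 1 ((seq l x)(Suc l := b))"
    proof -
      have "((seq l x)(Suc l := b)) j = seq l (z True) j" if "1 \<le> j" "j \<le> Suc l" for j
        using q that l by (auto simp: seq_def z_def b_def le_Suc_eq)
      moreover have "units ((seq l x)(Suc l := b)) (Suc l)"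
        using a(3) uv(1)[OF pq_sphere(1)] by (auto simp: units_def b_def)
      moreover have "units (seq l (z True)) (Suc l)" using units_seq[OF zs] l by simp
      ultimately have "FD TYPE('d) (Suc l) 1 ((seq l x)(Suc l := b)) \<longleftrightarrow> FD TYPE('d) (Suc l) 1 (seq l (z True))"
        by (intro FD_cong) auto
      then show ?thesis using FDz[of True] l by simp
    qed
    have "herm (seq l x (Suc l)) b = 0 \<or> pj b = pj (seq l x (Suc l))"
      using FD_lift_unique[OF a _ FDp] uv(1)[OF pq_sphere(1)] by (simp add: b_def)
    moreover have xm: "x m \<in> sphere 0 1" using spheres_nth[OF x, of m] l by simp
    ultimately have "p_pt = - x m \<or> p_pt = x m"
      unfolding b_def seq_def l[symmetric] using uv_perp_iff[OF xm pq_sphere(1)] uv_eqI[OF pq_sphere(1) xm] by blast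
    then have "x m = z True m \<or> x m = z False m" unfolding zm by (metis minus_minus)
    then obtain b where b: "x m = z b m" by blast
    have "x = z b"
    proof (rule extensionalityI[of _ "{1..m}"])
      show "x i = z b i" if "i \<in> {1..m}" for i
        using q[of i] b that l by (cases "i = m") (auto simp: z_def)
    qed (use x zs in \<open>auto simp: PiE_def\<close>)
    then show "\<exists>b. x \<in> S_par b m 1" using S by blast
  next
    assume "\<exists>b. x \<in> S_par b m 1"
    then show "FD TYPE('d) m 1 (seq (m - 1) x)" using S FDz ml by auto
  qed
qed

theorem FD_iff_S_par:
  assumes "adm TYPE('d::finite) m k" "x \<in> spheres m"
  shows "FD TYPE('d) m k (seq (m - k) x) \<longleftrightarrow> (\<exists>b. x \<in> S_par b m k)"
  using assms
proof (induction k arbitrary: m x rule: less_induct)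
  case (less k)
  note ad = less.prems(1) and x = less.prems(2)
  consider "k = 0" | "k = 1" | "2 \<le> k" by linarith
  then show ?case
  proof cases
    case 1
    then have m: "m = 0" using ad by (auto simp: adm_def)
    have "x \<in> S_par False 0 0" using x m S_par_few[of 0 x False 0] by (auto simp: restrict_def)
    moreover have "FD TYPE('d) 0 0 (seq 0 x)"
      by (simp add: FD_def isotropic_def vec.subspace_0)
    ultimately show ?thesis using m 1 by auto
  next
    case 2
    then show ?thesis using FD_iff_S_par_1[of m x] ad x by simp
  next
    case 3
    have m2: "2 \<le> m" using adm_reduce(2)[OF ad 3] .
    have k1: "1 \<le> k" using 3 by simp
    have IH: "FD TYPE('d) (m - 2) (k - 2) (seq (m - 2 - (k - 2)) x') \<longleftrightarrow> (\<exists>b. x' \<in> S_par b (m - 2) (k - 2))"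
      if "x' \<in> spheres (m - 2)" for x'
      using less.IH[OF _ adm_reduce(1)[OF ad 3] that] 3 by simp
    have red: "FD TYPE('d) m k (seq (m - k) x) \<longleftrightarrow> (\<exists>b. delete_pair m i x \<in> S_par b (m - 2) (k - 2))"
      if "x \<in> spheres m" "1 \<le> i" "i < m" "x (Suc i) = - x i" for x i
      using FD_delete_pair(1)[OF ad 3 that] IH[OF delete_pair_spheres[OF that(2,3,1)]] by simp
    have m1: "1 \<le> m - 1" "m - 1 < m" "Suc (m - 1) = m" using m2 by auto
    have xs: "x i \<in> sphere 0 1" if "1 \<le> i" "i \<le> m" for i using spheres_nth[OF x that] .
    have fl: "flip m x \<in> spheres m" using m2 x by (intro flip_spheres) auto
    have last: "flip m x (Suc (m - 1)) = - flip m x (m - 1)" if "x m = x (m - 1)"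
    proof -
      have "m - 1 \<noteq> m" using m2 by simp
      then show ?thesis unfolding flip_def m1(3) using that by simp
    qed
    have ext: "x \<in> extensional {1..m}" using x by (simp add: PiE_def)
    show ?thesis
    proof
      assume FD: "FD TYPE('d) m k (seq (m - k) x)"
      from FD_reducible[OF ad 3 units_seq[OF x] FD] show "\<exists>b. x \<in> S_par b m k"
      proof (elim disjE exE conjE)
        fix i assume i: "1 \<le> i" "i < m" and h: "herm (seq (m - k) x i) (seq (m - k) x (Suc i)) = 0"
        have xi: "x (Suc i) = - x i"
          using h uv_perp_iff[OF xs xs, of i "Suc i"] i unfolding seq_def by simp
        obtain b where b: "delete_pair m i x \<in> S_par b (m - 2) (k - 2)" using red[OF x i xi] FD by blast
        have "insert_pair m i True (x i) (delete_pair m i x) \<in> S_par b m k"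
          using S_par_insert[OF i 3, of True _ b "x i"] b xs[of i] i by simp
        then show ?thesis using insert_delete_pair[OF i ext, of True] xi by auto
      next
        assume "pj (seq (m - k) x m) = pj (seq (m - k) x (m - 1))"
        then have xm: "x m = x (m - 1)" using uv_eqI xs[of m] xs[of "m - 1"] m2 unfolding seq_def by simp
        have "FD TYPE('d) m k (seq (m - k) (flip m x))" by (rule FD_flip(1)[OF ad k1 x FD])
        then obtain b where "delete_pair m (m - 1) (flip m x) \<in> S_par b (m - 2) (k - 2)"
          using red[OF fl m1(1,2) last[OF xm]] by blast
        then have b: "delete_pair m (m - 1) x \<in> S_par b (m - 2) (k - 2)" unfolding delete_pair_flip .
        have "insert_pair m (m - 1) False (x (m - 1)) (delete_pair m (m - 1) x) \<in> S_par (\<not> b) m k"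
          using S_par_insert[OF m1(1,2) 3, of False _ "\<not> b" "x (m - 1)"] b xs[of "m - 1"] m1 by simp
        then show ?thesis using insert_delete_pair[OF m1(1,2) ext, of False] xm m1(3) by auto
      qed
    next
      assume "\<exists>b. x \<in> S_par b m k"
      then obtain b where b: "x \<in> S_par b m k" by blast
      from S_par_cases[OF 3 b] show "FD TYPE('d) m k (seq (m - k) x)"
      proof (elim disjE exE conjE)
        fix i assume "1 \<le> i" "i < m" "x (Suc i) = - x i" "delete_pair m i x \<in> S_par b (m - 2) (k - 2)"
        then show ?thesis using red[OF x] by blast
      next
        assume xm: "x m = x (m - 1)" and d: "delete_pair m (m - 1) x \<in> S_par (\<not> b) (m - 2) (k - 2)"
        have "FD TYPE('d) m k (seq (m - k) (flip m x))"
          using red[OF fl m1(1,2) last[OF xm]] d delete_pair_flip by metis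
        then show ?thesis using FD_flip(1)[OF ad k1 fl] by simp
      qed
    qed
  qed
qed

text \<open>The constant \<open>n\<close> depends on \<open>N\<close> only. A neighbouring undotted
  pair is removed by \<open>lagrangian_reduce\<close>; a dotted last pair becomes an undotted one
  under \<open>flip\<close>, which changes both the number of dots and the dimension by an odd
  amount modulo two.\<close>

lemma S_par_parity:
  assumes "adm TYPE('d::finite) m k" "lagrangian m k (N :: 'd hspace set)"
  shows "\<exists>n. \<forall>b. \<forall>x\<in>S_par b m k. even (vec.dim (N \<inter> Fs (seq (m - k) x) m) + n) = b"
  using assms
proof (induction k arbitrary: m N rule: less_induct)
  case (less k)
  note ad = less.prems(1) and N = less.prems(2)
  consider "k = 0" | "k = 1" | "2 \<le> k" by linarith
  then show ?case
  proof cases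
    case 1
    then have m: "m = 0" using ad by (auto simp: adm_def)
    have "\<not> b" if "x \<in> S_par b 0 0" for b x using S_par_few[of 0 x b 0] that by simp
    \<comment> \<open>The empty diagram has even parity, so \<open>n\<close> is chosen to make the
      sum odd.\<close>
    then show ?thesis using m 1 by (intro exI[of _ "Suc (vec.dim (N \<inter> {0}))"]) auto
  next
    case 2
    have m: "1 \<le> m" using ad 2 by (simp add: adm_def)
    define z where "z b = (\<lambda>i\<in>{1..m}. if i < m then q_pt else if b then p_pt else - p_pt)" for b
    have S: "x \<in> S_par b m 1 \<longleftrightarrow> x = z b" for x b using S_par_few[of 1 x b m] m by (simp add: z_def)
    have zs: "z b \<in> spheres m" for b using pq_sphere by (auto simp: z_def)
    have zf: "z False = flip m (z True)" using m by (auto simp: z_def flip_def fun_eq_iff)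
    have FD: "FD TYPE('d) m 1 (seq (m - 1) (z True))" using FD_iff_S_par_1[OF _ zs] ad S 2 by blast
    have o: "odd (vec.dim (N \<inter> Fs (seq (m - 1) (z True)) m) + vec.dim (N \<inter> Fs (seq (m - 1) (z False)) m))"
      unfolding zf using FD_flip(2)[OF _ _ zs FD] ad N 2 by simp
    have "even (vec.dim (N \<inter> Fs (seq (m - 1) (z b)) m) + vec.dim (N \<inter> Fs (seq (m - 1) (z True)) m)) = b" for b
      using o by (cases b) (simp_all add: add.commute)
    then show ?thesis
      unfolding 2 by (intro exI[of _ "vec.dim (N \<inter> Fs (seq (m - 1) (z True)) m)"] allI ballI) (simp only: S)
  next
    case 3
    have m2: "2 \<le> m" using adm_reduce(2)[OF ad 3] .
    have k1: "1 \<le> k" using 3 by simp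
    obtain N' d where N': "lagrangian (m - 2) (k - 2) (N' :: 'd hspace set)"
      and red: "\<And>F'. lagrangian m k {v. nilp v \<in> F'} \<Longrightarrow> vec.subspace F' \<Longrightarrow>
        vec.dim (N \<inter> {v. nilp v \<in> F'}) = vec.dim (N' \<inter> F') + d"
      using lagrangian_reduce[OF ad 3 N] by blast
    obtain n where n: "\<And>b x. x \<in> S_par b (m - 2) (k - 2) \<Longrightarrow>
      even (vec.dim (N' \<inter> Fs (seq (m - 2 - (k - 2)) x) (m - 2)) + n) = b"
      using less.IH[OF _ adm_reduce(1)[OF ad 3] N'] 3 by auto
    have S: "x \<in> spheres m" "FD TYPE('d) m k (seq (m - k) x)" if "x \<in> S_par b m k" for x b
      using S_par_sphere that FD_iff_S_par[OF ad] by blast+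
    have step: "even (vec.dim (N \<inter> Fs (seq (m - k) x) m) + (n + d)) = b"
      if x: "x \<in> spheres m" "FD TYPE('d) m k (seq (m - k) x)" and i: "1 \<le> i" "i < m" "x (Suc i) = - x i"
        and d: "delete_pair m i x \<in> S_par b (m - 2) (k - 2)" for x i b
    proof -
      have eq: "Fs (seq (m - k) x) m = {v :: 'd hspace. nilp v \<in> Fs (seq (m - 2 - (k - 2)) (delete_pair m i x)) (m - 2)}"
        by (rule FD_delete_pair(2)[OF ad 3 x(1) i])
      have "lagrangian m k (Fs (seq (m - k) x) m :: 'd hspace set)"
        by (rule FD_lagrangian[OF ad units_seq[OF x(1)] x(2)])
      then have "vec.dim (N \<inter> Fs (seq (m - k) x) m) = vec.dim (N' \<inter> Fs (seq (m - 2 - (k - 2)) (delete_pair m i x)) (m - 2)) + d"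
        unfolding eq by (intro red) simp_all
      \<comment> \<open>The shift \<open>d\<close> occurs once in the dimension and once in the new
        constant, and cancels modulo two.\<close>
      moreover have "even (y + d + (n + d)) = even (y + n)" for y by presburger
      ultimately show ?thesis using n[OF d] by (simp only:)
    qed
    have "even (vec.dim (N \<inter> Fs (seq (m - k) x) m) + (n + d)) = b" if x: "x \<in> S_par b m k" for b x
    proof -
      from S_par_cases[OF 3 x] show ?thesis
      proof (elim disjE exE conjE)
        fix i assume "1 \<le> i" "i < m" "x (Suc i) = - x i" "delete_pair m i x \<in> S_par b (m - 2) (k - 2)"
        then show ?thesis by (rule step[OF S[OF x]])
      next
        assume xm: "x m = x (m - 1)" and d: "delete_pair m (m - 1) x \<in> S_par (\<not> b) (m - 2) (k - 2)"
        have fl: "flip m x \<in> spheres m" "FD TYPE('d) m k (seq (m - k) (flip m x))"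
          using flip_spheres[OF _ S(1)[OF x]] m2 FD_flip(1)[OF ad k1 S[OF x]] by simp_all
        have "even (vec.dim (N \<inter> Fs (seq (m - k) (flip m x)) m) + (n + d)) = (\<not> b)"
        proof (rule step[OF fl])
          show m1: "1 \<le> m - 1" "m - 1 < m" using m2 by auto
          have "Suc (m - 1) = m" "m - 1 \<noteq> m" using m2 by auto
          then show "flip m x (Suc (m - 1)) = - flip m x (m - 1)" using xm by (simp add: flip_def)
          show "delete_pair m (m - 1) (flip m x) \<in> S_par (\<not> b) (m - 2) (k - 2)" unfolding delete_pair_flip by (rule d)
        qed
        moreover have "odd (vec.dim (N \<inter> Fs (seq (m - k) x) m) + vec.dim (N \<inter> Fs (seq (m - k) (flip m x)) m))"
          by (rule FD_flip(2)[OF ad k1 S[OF x] N])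
        ultimately show ?thesis by auto
      qed
    qed
    then show ?thesis by blast
  qed
qed

text \<open>Any Lagrangian distinguishes the parities, for instance the last subspace of the flag of
  \<open>x\<close> itself.\<close>

lemma S_par_disjoint:
  assumes ad: "adm TYPE('d::finite) m k" and "x \<in> S_par b m k" "x \<in> S_par b' m k"
  shows "b = b'"
proof -
  have xs: "x \<in> spheres m" using assms(2) S_par_sphere by blast
  have "FD TYPE('d) m k (seq (m - k) x)" using FD_iff_S_par[OF ad xs] assms by blast
  then have "lagrangian m k (Fs (seq (m - k) x) m :: 'd hspace set)"
    by (rule FD_lagrangian[OF ad units_seq[OF xs]])
  from S_par_parity[OF ad this] show ?thesis using assms by blast
qed

lemma flip_S_par:
  assumes ad: "adm TYPE('d::finite) m k" "1 \<le> k" and x: "x \<in> S_par b m k"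
  shows "flip m x \<in> S_par (\<not> b) m k"
proof -
  have m: "1 \<le> m" using ad by (simp add: adm_def)
  have xs: "x \<in> spheres m" using x S_par_sphere by blast
  have FD: "FD TYPE('d) m k (seq (m - k) x)" using FD_iff_S_par[OF ad(1) xs] x by blast
  obtain b' where b': "flip m x \<in> S_par b' m k"
    using FD_iff_S_par[OF ad(1) flip_spheres[OF m xs]] FD_flip(1)[OF ad xs FD] by blast
  let ?N = "Fs (seq (m - k) x) m :: 'd hspace set"
  have N: "lagrangian m k ?N" by (rule FD_lagrangian[OF ad(1) units_seq[OF xs] FD])
  obtain n where n: "\<And>b x. x \<in> S_par b m k \<Longrightarrow> even (vec.dim (?N \<inter> Fs (seq (m - k) x) m) + n) = b"
    using S_par_parity[OF ad(1) N] by blast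
  have "b' \<noteq> b" using n[OF x] n[OF b'] FD_flip(2)[OF ad xs FD N] by auto
  then show ?thesis using b' by (cases b; cases b') auto
qed

lemma S_par_nonempty:
  assumes "adm TYPE('d::finite) m k" "1 \<le> k"
  shows "S_par b m k \<noteq> {}"
  using assms
proof (induction k arbitrary: m b rule: less_induct)
  case (less k)
  show ?case
  proof (cases "k = 1")
    case True
    then have "m \<noteq> 0" using less.prems by (simp add: adm_def)
    then show ?thesis using S_par_few[of k _ b m] True by auto
  next
    case False
    then have k: "2 \<le> k" using less.prems by simp
    have m: "2 \<le> m" using adm_reduce(2)[OF less.prems(1) k] .
    have ex: "\<exists>c. (c \<or> Suc (m - 1) = m) \<and> S_par (b = c) (m - 2) (k - 2) \<noteq> {}"
    proof (cases "1 \<le> k - 2")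
      case True
      then show ?thesis using less.IH[of "k - 2" "m - 2"] adm_reduce(1)[OF less.prems(1) k] k by auto
    next
      case False
      \<comment> \<open>Then \<open>m = 2\<close>, and removing the only cup leaves the empty
        diagram, which is even. So the cup is dotted exactly for the odd parity.\<close>
      then have "k = 2" using k by simp
      then have "m = 2" using less.prems(1) by (auto simp: adm_def)
      have "(\<lambda>i\<in>{1..0}. if i < 0 then q_pt else if False then p_pt else - p_pt) \<in> S_par False 0 0"
        by (simp add: S_par_few)
      then show ?thesis using \<open>k = 2\<close> \<open>m = 2\<close> by (intro exI[of _ "\<not> b"]) auto
    qed
    then obtain c x where c: "c \<or> Suc (m - 1) = m" "x \<in> S_par (b = c) (m - 2) (k - 2)" by blast
    have "insert_pair m (m - 1) c q_pt x \<in> S_par b m k"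
      using m pq_sphere by (intro S_par_insert[OF _ _ k c]) auto
    then show ?thesis by blast
  qed
qed

subsection \<open>Continuity of the parametrization\<close>

lemma continuous_map_tendsto:
  "continuous_map X euclidean f \<longleftrightarrow> (\<forall>x\<in>topspace X. (f \<longlongrightarrow> f x) (atin X x))"
  by (simp add: continuous_map_atin)

lemma cm_mult:
  fixes f g :: "'a \<Rightarrow> complex"
  assumes "continuous_map X euclidean f" "continuous_map X euclidean g"
  shows "continuous_map X euclidean (\<lambda>x. f x * g x)"
  using assms by (simp add: continuous_map_tendsto tendsto_mult)

lemma cm_cnj: "continuous_map X euclidean f \<Longrightarrow> continuous_map X euclidean (\<lambda>x. cnj (f x))"
  by (simp add: continuous_map_tendsto tendsto_cnj)

lemma cm_of_real: "continuous_map X euclidean f \<Longrightarrow> continuous_map X euclidean (\<lambda>x. complex_of_real (f x))"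
  by (simp add: continuous_map_tendsto tendsto_of_real)

lemma cm_Complex:
  assumes "continuous_map X euclidean f" "continuous_map X euclidean g"
  shows "continuous_map X euclidean (\<lambda>x. Complex (f x) (g x))"
  using assms by (simp add: continuous_map_tendsto tendsto_Complex)

lemma cm_nth: "continuous_map X euclidean f \<Longrightarrow> continuous_map X euclidean (\<lambda>x. f x $ i)"
  by (simp add: continuous_map_tendsto tendsto_vec_nth)

lemma cm_vec:
  assumes "\<And>i. continuous_map X euclidean (\<lambda>x. f x $ i)"
  shows "continuous_map X euclidean f"
  unfolding continuous_map_tendsto
  by (intro ballI vec_tendstoI) (use assms in \<open>simp add: continuous_map_tendsto\<close>)

lemma cm_const: "continuous_map X euclidean (\<lambda>x. c)"
  by simp

lemma cm_smult:
  fixes f :: "'a \<Rightarrow> complex" and g :: "'a \<Rightarrow> complex ^ 'n"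
  assumes "continuous_map X euclidean f" "continuous_map X euclidean g"
  shows "continuous_map X euclidean (\<lambda>x. f x *s g x)"
  using assms by (intro cm_vec) (simp add: cm_mult cm_nth)

lemma cm_herm:
  assumes "continuous_map X euclidean f"
  shows "continuous_map X euclidean (\<lambda>x. herm v (f x))"
  unfolding herm_def using assms by (intro continuous_map_sum cm_mult cm_cnj cm_nth cm_const) auto

lemma cm_up:
  fixes f :: "'a \<Rightarrow> ('d::finite) hspace"
  assumes "continuous_map X euclidean f"
  shows "continuous_map X euclidean (\<lambda>x. up (f x))"
proof (rule cm_vec)
  fix i
  show "continuous_map X euclidean (\<lambda>x. up (f x) $ i)"
    using assms by (cases i) (auto simp: up_def intro: cm_nth)
qed

lemma cm_axes:
  assumes "continuous_map X euclidean y"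
  shows "continuous_map X euclidean (\<lambda>x. fst (axes c (y x)))" "continuous_map X euclidean (\<lambda>x. fst (snd (axes c (y x))))"
    "continuous_map X euclidean (\<lambda>x. snd (snd (axes c (y x))))"
  using cm_nth[OF assms] by (cases "c = 0"; cases "even c"; simp add: axes_def)+

lemma cm_prm:
  assumes y: "continuous_map X euclidean y" and u: "continuous_map X euclidean u"
  shows "continuous_map X euclidean (\<lambda>x. prm c (y x) (u x))"
proof (rule cm_vec)
  fix i :: 2
  let ?s = "\<lambda>x. fst (axes c (y x))" and ?t = "\<lambda>x. fst (snd (axes c (y x)))" and ?r = "\<lambda>x. snd (snd (axes c (y x)))"
  have half: "continuous_map X euclidean (\<lambda>x. f x / 2)" if "continuous_map X euclidean f" for f :: "'a \<Rightarrow> real"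
    using that by (simp add: continuous_map_tendsto tendsto_divide)
  have plus: "continuous_map X euclidean (\<lambda>x. (1 + f x) / 2)" "continuous_map X euclidean (\<lambda>x. (1 - f x) / 2)"
    if "continuous_map X euclidean f" for f :: "'a \<Rightarrow> real"
    using that by (simp_all add: continuous_map_tendsto tendsto_divide tendsto_add tendsto_diff)
  note ax = cm_axes[OF y, of c]
  have "prm c (y x) (u x) $ 1 = of_real ((1 + ?s x) / 2) * u x $ 1 + Complex (?t x / 2) (?r x / 2) * u x $ 2"
    "prm c (y x) (u x) $ 2 = cnj (Complex (?t x / 2) (?r x / 2)) * u x $ 1 + of_real ((1 - ?s x) / 2) * u x $ 2" for x
    by (simp_all add: prm_def case_prod_beta vector_2)
  moreover have "i = 1 \<or> i = 2" by (rule exhaust_2)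
  moreover have "continuous_map X euclidean (\<lambda>x. of_real ((1 + ?s x) / 2) * u x $ 1 + Complex (?t x / 2) (?r x / 2) * u x $ 2)"
    by (intro continuous_map_add cm_mult cm_of_real plus(1) cm_Complex half cm_nth ax u)
  moreover have "continuous_map X euclidean (\<lambda>x. cnj (Complex (?t x / 2) (?r x / 2)) * u x $ 1 + of_real ((1 - ?s x) / 2) * u x $ 2)"
    by (intro continuous_map_add cm_mult cm_cnj cm_of_real plus(2) cm_Complex half cm_nth ax u)
  ultimately show "continuous_map X euclidean (\<lambda>x. prm c (y x) (u x) $ i)" by auto
qed

lemma topspace_S [simp]: "topspace (S_topology m) = spheres m"
  by (simp add: S_topology_def)

lemma cm_coordinate:
  assumes "1 \<le> j" "j \<le> m"
  shows "continuous_map (S_topology m) euclidean (\<lambda>x. x j)"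
proof -
  have "continuous_map (S_topology m) (top_of_set (sphere 0 1)) (\<lambda>x. x j)"
    unfolding S_topology_def using assms continuous_map_product_projection[of j "{1..m}" "\<lambda>_. top_of_set (sphere 0 1 :: (real ^ 3) set)"] by simp
  then show ?thesis by (simp add: continuous_map_in_subtopology)
qed

text \<open>The recursion for \<open>Bm\<close> sees the vectors of \<open>seq c x\<close> only
  through their projections, which are continuous in \<open>x\<close> although the vectors need not
  be.\<close>

lemma cm_Bm:
  fixes g :: "(nat \<Rightarrow> real ^ 3) \<Rightarrow> complex ^ 2"
  assumes "i \<le> m" "continuous_map (S_topology m) euclidean g"
  shows "continuous_map (S_topology m) euclidean (\<lambda>x. Bm (seq c x) i (g x) :: ('d::finite) hspace)"
  using assms
proof (induction i arbitrary: g)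
  case 0
  then show ?case by (auto intro!: continuous_map_add cm_smult cm_nth)
next
  case (Suc i)
  let ?p = "\<lambda>x. prm c (x (Suc i)) (g x)"
  have p: "continuous_map (S_topology m) euclidean ?p"
    using Suc.prems by (intro cm_prm cm_coordinate) auto
  have d: "continuous_map (S_topology m) euclidean (\<lambda>x. g x - ?p x)"
    using Suc.prems(2) p by (simp add: continuous_map_tendsto tendsto_diff)
  have "continuous_map (S_topology m) euclidean
    (\<lambda>x. up (Bm (seq c x) i (?p x) :: 'd hspace) + Bm (seq c x) i (g x - ?p x))"
    using Suc.prems(1) by (intro continuous_map_add cm_up Suc.IH p d) auto
  moreover have "up (Bm (seq c x) i (?p x) :: 'd hspace) + Bm (seq c x) i (g x - ?p x) = Bm (seq c x) (Suc i) (g x)"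
    if "x \<in> topspace (S_topology m)" for x
    using uv(2)[OF spheres_nth[of x m "Suc i"], of c] that Suc.prems(1) by (simp add: seq_def)
  ultimately show ?case by (rule continuous_map_eq)
qed

lemma wv_orthonormal:
  assumes "units a n" "n \<le> CARD('d)" "1 \<le> i" "i \<le> n" "1 \<le> j" "j \<le> n"
  shows "herm (wv a i :: ('d::finite) hspace) (wv a j) = (if i = j then 1 else 0)"
proof -
  have lt: "herm (wv a i :: 'd hspace) (wv a j) = 0" if ij: "1 \<le> j" "j < i" "i \<le> n" for i j
  proof -
    obtain l where l: "i = Suc l" using ij by (cases i) auto
    show ?thesis unfolding l
      using ij l assms(1,2) units_mono wv_in_Fs[of j l a] by (intro herm_wv_Fs) auto
  qed
  consider "i = j" | "j < i" | "i < j" by linarith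
  then show ?thesis
  proof cases
    case 1
    then show ?thesis using herm_wv_self[where 'd = 'd, of i a] assms units_mono[OF assms(1)] by simp
  next
    case 2
    then show ?thesis using lt assms by simp
  next
    case 3
    then show ?thesis using lt[of i j] assms herm_eq_0_commute by (metis nat_neq_iff)
  qed
qed

lemma closed_vec_subspace: "vec.subspace (W :: (complex ^ 'n) set) \<Longrightarrow> closed W \<and> convex W \<and> W \<noteq> {}"
  using vec_subspace_imp_subspace closed_subspace subspace_imp_convex vec.subspace_0 by blast

lemma closest_point_Fs:
  assumes un: "units a n" and n: "n \<le> CARD('d)" and i: "i \<le> n"
  shows "closest_point (Fs a i) v = (\<Sum>j=1..i. herm v (wv a j) *s (wv a j :: ('d::finite) hspace))" (is "_ = ?p")
proof (rule closest_point_unique[symmetric])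
  have cc: "closed (Fs a i :: 'd hspace set) \<and> convex (Fs a i :: 'd hspace set) \<and> Fs a i \<noteq> ({} :: 'd hspace set)"
    by (rule closed_vec_subspace) simp
  show "closed (Fs a i :: 'd hspace set)" "convex (Fs a i :: 'd hspace set)" using cc by blast+
  have S: "(\<Sum>j\<in>J. herm v (wv a j) *s (wv a j :: 'd hspace)) \<in> Fs a i" if "J \<subseteq> {1..i}" for J
    using that by (intro vec.subspace_sum subspace_Fs Fs_scale wv_in_Fs) auto
  show pF: "?p \<in> Fs a i" by (rule S) simp
  have sumr: "herm (\<Sum>j\<in>J. f j) w = (\<Sum>j\<in>J. herm (f j) w)" for f :: "nat \<Rightarrow> 'd hspace" and J w
    by (induction J rule: infinite_finite_induct) (simp_all add: herm_add_left)
  have "herm (v - ?p) (wv a l :: 'd hspace) = 0" if l: "1 \<le> l" "l \<le> i" for l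
  proof -
    have "herm ?p (wv a l) = (\<Sum>j=1..i. if j = l then herm v (wv a l) else 0)"
      unfolding sumr herm_scale_left using l i
      by (intro sum.cong refl) (auto simp: wv_orthonormal[OF un n])
    then show ?thesis using l by (simp add: herm_diff_left)
  qed
  then have orth: "herm (v - ?p) w = 0" if "w \<in> Fs a i" for w using herm_Fs that by blast
  show "\<forall>z\<in>Fs a i. dist v ?p \<le> dist v z"
  proof
    fix z :: "'d hspace" assume z: "z \<in> (Fs a i :: 'd hspace set)"
    have "inner (v - ?p) (?p - z) = 0"
      unfolding Re_herm[symmetric] using orth[OF Fs_diff[OF pF z]] by simp
    then have "(norm ((v - ?p) + (?p - z)))\<^sup>2 = (norm (v - ?p))\<^sup>2 + (norm (?p - z))\<^sup>2"
      by (intro norm_add_Pythagorean) (simp add: orthogonal_def)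
    then have "(norm (v - ?p))\<^sup>2 \<le> (norm (v - z))\<^sup>2" by simp
    then show "dist v ?p \<le> dist v z" unfolding dist_norm by (rule power2_le_imp_le) simp
  qed
qed

definition Psi :: "nat \<Rightarrow> nat \<Rightarrow> (nat \<Rightarrow> real ^ 3) \<Rightarrow> ('d::finite + 'd) flag" where
  "Psi c m x = flag m (seq c x)"

lemma continuous_Psi:
  assumes m: "m \<le> CARD('d)"
  shows "continuous_map (S_topology m) (flag_topology m) (Psi c m :: _ \<Rightarrow> ('d::finite + 'd) flag)"
  unfolding flag_topology_def continuous_map_componentwise
proof (intro conjI ballI)
  show "(Psi c m :: _ \<Rightarrow> ('d + 'd) flag) ` topspace (S_topology m) \<subseteq> extensional {1..m}"
    by (auto simp: Psi_def flag_def)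
  fix i assume i: "i \<in> {1..m}"
  have comp: "continuous_map (S_topology m) euclidean (\<lambda>x. closest_point (Psi c m x i) (v :: 'd hspace))" for v
  proof -
    \<comment> \<open>The adjoint of \<open>Bm (seq c x) (j - 1)\<close> applied to
      \<open>v\<close>. It allows the projection of \<open>v\<close> to the line of
      \<open>wv (seq c x) j\<close> to be written with \<open>prm\<close> in place of the vector,
      hence without phases.\<close>
    let ?b = "\<lambda>j x. vector [herm v (Bm (seq c x) (j - 1) e2), herm v (Bm (seq c x) (j - 1) f2)] :: complex ^ 2"
    have "continuous_map (S_topology m) euclidean (\<lambda>x. Bm (seq c x) (j - 1) (prm c (x j) (?b j x)) :: 'd hspace)"
      if j: "j \<in> {1..i}" for j
    proof (rule cm_Bm)
      show "continuous_map (S_topology m) euclidean (\<lambda>x. prm c (x j) (?b j x))"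
      proof (rule cm_prm)
        show "continuous_map (S_topology m) euclidean (\<lambda>x. x j)" using i j by (intro cm_coordinate) auto
        have h: "continuous_map (S_topology m) euclidean (\<lambda>x. herm v (Bm (seq c x) (j - 1) u))" for u
          using i j by (intro cm_herm cm_Bm) auto
        show "continuous_map (S_topology m) euclidean (?b j)"
        proof (rule cm_vec)
          fix l :: 2
          show "continuous_map (S_topology m) euclidean (\<lambda>x. ?b j x $ l)"
            using exhaust_2[of l] h by (auto simp: vector_2)
        qed
      qed
    qed (use i j in auto)
    then have "continuous_map (S_topology m) euclidean (\<lambda>x. \<Sum>j=1..i. Bm (seq c x) (j - 1) (prm c (x j) (?b j x)) :: 'd hspace)"
      by (intro continuous_map_sum) auto
    moreover have "(\<Sum>j=1..i. Bm (seq c x) (j - 1) (prm c (x j) (?b j x))) = closest_point (Psi c m x i) v"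
      if x: "x \<in> topspace (S_topology m)" for x
    proof -
      have xs: "x \<in> spheres m" using x by simp
      have "closest_point (Psi c m x i) v = (\<Sum>j=1..i. herm v (wv (seq c x) j) *s wv (seq c x) j)"
        using closest_point_Fs[OF units_seq[OF xs] m, of i c v] i by (simp add: Psi_def flag_def)
      also have "\<dots> = (\<Sum>j=1..i. Bm (seq c x) (j - 1) (prm c (x j) (?b j x)))"
      proof (intro sum.cong refl)
        fix j assume j: "j \<in> {1..i}"
        let ?a = "seq c x j"
        have xj: "x j \<in> sphere 0 1" using spheres_nth[OF xs, of j] i j by auto
        have "?a = ?a $ 1 *s e2 + ?a $ 2 *s f2" by (intro vec2_eqI) (simp_all add: e2_def f2_def axis_def)
        then have "Bm (seq c x) (j - 1) ?a = ?a $ 1 *s Bm (seq c x) (j - 1) e2 + ?a $ 2 *s (Bm (seq c x) (j - 1) f2 :: 'd hspace)"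
          by (metis Bm_add Bm_scale)
        then have "herm v (wv (seq c x) j) = herm (?b j x) ?a"
          unfolding wv_def by (simp add: herm_simps herm_2 vector_2 mult.commute)
        then have "herm v (wv (seq c x) j) *s wv (seq c x) j = Bm (seq c x) (j - 1) (pj ?a (?b j x))"
          by (simp add: pj_def Bm_scale wv_def)
        then show "herm v (wv (seq c x) j) *s wv (seq c x) j = Bm (seq c x) (j - 1) (prm c (x j) (?b j x))"
          using uv(2)[OF xj, of c] by (simp add: seq_def)
      qed
      finally show ?thesis ..
    qed
    ultimately show ?thesis by (rule continuous_map_eq)
  qed
  show "continuous_map (S_topology m) subspace_topology (\<lambda>x. (Psi c m x :: ('d + 'd) flag) i)"
    unfolding subspace_topology_def
  proof (rule continuous_map_pullback')
    show "continuous_map (S_topology m) euclidean (closest_point \<circ> (\<lambda>x. (Psi c m x :: ('d + 'd) flag) i))"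
      unfolding euclidean_product_topology[symmetric] continuous_map_componentwise_UNIV comp_def using comp by simp
    show "topspace (S_topology m) \<subseteq> (\<lambda>x. (Psi c m x :: ('d + 'd) flag) i) -` {F. vec.subspace F}"
      using i by (auto simp: Psi_def flag_def)
  qed
qed

lemma topspace_flag: "topspace (flag_topology m) = ({1..m} \<rightarrow>\<^sub>E {F :: (complex ^ 'b::finite) set. vec.subspace F})"
  by (simp add: flag_topology_def subspace_topology_def topspace_pullback_topology)

text \<open>A subspace is the fixed point set of its closest point map, so subspaces inject
  continuously into a Hausdorff space of functions.\<close>

lemma Hausdorff_flag: "Hausdorff_space (flag_topology m :: 'b::finite flag topology)"
proof -
  have "Hausdorff_space (subspace_topology :: (complex ^ 'b) set topology)"
  proof (rule Hausdorff_space_injective_preimage)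
    show "Hausdorff_space (product_topology (\<lambda>_. euclidean :: (complex ^ 'b) topology) (UNIV :: (complex ^ 'b) set))"
      unfolding Hausdorff_space_product_topology by simp
    have "continuous_map (subspace_topology :: (complex ^ 'b) set topology) euclidean closest_point"
      unfolding subspace_topology_def using continuous_map_pullback[OF continuous_map_id] by simp
    then show "continuous_map (subspace_topology :: (complex ^ 'b) set topology) (product_topology (\<lambda>_. euclidean) UNIV) closest_point"
      unfolding euclidean_product_topology .
    have sub: "F \<subseteq> G" if "vec.subspace F" "vec.subspace G" "closest_point F = closest_point G" for F G :: "(complex ^ 'b) set"
    proof
      fix v assume "v \<in> F"
      then have "closest_point G v = v" using closest_point_self[of v F] that(3) by simp
      then show "v \<in> G" using closest_point_in_set[of G v] closed_vec_subspace[OF that(2)] by simp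
    qed
    show "inj_on closest_point (topspace (subspace_topology :: (complex ^ 'b) set topology))"
    proof (rule inj_onI)
      fix F G :: "(complex ^ 'b) set"
      assume "F \<in> topspace subspace_topology" "G \<in> topspace subspace_topology" "closest_point F = closest_point G"
      then show "F = G" using sub[of F G] sub[of G F] by (simp add: subspace_topology_def topspace_pullback_topology)
    qed
  qed
  then show ?thesis unfolding flag_topology_def Hausdorff_space_product_topology by blast
qed

subsection \<open>Surjectivity and injectivity\<close>

lemma span_unit_eq_iff:
  fixes a b :: "complex ^ 2"
  assumes a: "herm a a = 1" and b: "herm b b = 1"
  shows "vec.span {a} = vec.span {b} \<longleftrightarrow> pj a = pj b"
proof
  assume "vec.span {a} = vec.span {b}"
  then have "a \<in> vec.span {b}" using vec.span_base by blast
  then obtain t where t: "a = t *s b" by (auto simp: vec.span_singleton)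
  have "t * cnj t = 1" using a b unfolding t by (simp add: herm_simps mult.commute)
  then show "pj a = pj b" unfolding t by (intro ext) (simp add: pj_def herm_simps mult.commute)
next
  assume p: "pj a = pj b"
  have "a = herm a b *s b" using pj_self[OF a] unfolding p by (simp add: pj_def)
  moreover have "b = herm b a *s a" using pj_self[OF b] unfolding p[symmetric] by (simp add: pj_def)
  ultimately have "a \<in> vec.span {b}" "b \<in> vec.span {a}" by (metis vec.span_base vec.span_scale singletonI)+
  then show "vec.span {a} = vec.span {b}" by (simp add: vec.span_minimal subset_antisym)
qed

lemma phi_Psi:
  assumes "m \<le> CARD('d)" "x \<in> spheres m" "i \<in> {1..m}"
  shows "phi m (Psi c m x :: ('d::finite + 'd) flag) i = vec.span {uv c (x i)}"
  unfolding Psi_def using phi_flag[where 'd = 'd, OF assms(1) units_seq[OF assms(2)] assms(3), of c] by (simp add: seq_def)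

lemma span_uv_eq_iff:
  assumes "y \<in> sphere 0 1" "y' \<in> sphere 0 1"
  shows "vec.span {uv c y} = vec.span {uv c y'} \<longleftrightarrow> y = y'"
  using span_unit_eq_iff[OF uv(1)[OF assms(1)] uv(1)[OF assms(2)]] uv_eqI[OF assms] by blast

lemma inj_Psi:
  assumes m: "m \<le> CARD('d)"
  shows "inj_on (Psi c m :: _ \<Rightarrow> ('d::finite + 'd) flag) (spheres m)"
proof (rule inj_onI)
  fix x y assume x: "x \<in> spheres m" and y: "y \<in> spheres m" and eq: "(Psi c m x :: ('d + 'd) flag) = Psi c m y"
  show "x = y"
  proof (rule extensionalityI[of _ "{1..m}"])
    fix i assume i: "i \<in> {1..m}"
    then have "vec.span {uv c (x i)} = vec.span {uv c (y i)}"
      using phi_Psi[OF m x i, of c] phi_Psi[OF m y i, of c] eq by simp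
    then show "x i = y i" using span_uv_eq_iff spheres_nth[OF x, of i] spheres_nth[OF y, of i] i by simp
  qed (use x y in \<open>auto simp: PiE_def\<close>)
qed

lemma flag_eq_Psi:
  assumes "units a m"
  obtains x where "x \<in> spheres m" "(flag m a :: ('d::finite + 'd) flag) = Psi c m x" "\<And>i. i \<in> {1..m} \<Longrightarrow> pj (a i) = pj (seq c x i)"
proof -
  have "\<forall>i\<in>{1..m}. \<exists>y. y \<in> sphere 0 1 \<and> pj (a i) = prm c y"
    using assms unit_prm_exists unfolding units_def by metis
  then obtain f where f: "\<forall>i\<in>{1..m}. f i \<in> sphere 0 1 \<and> pj (a i) = prm c (f i)" by metis
  define x where "x = restrict f {1..m}"
  have x: "x \<in> spheres m" using f by (auto simp: x_def)
  have p: "pj (a i) = pj (seq c x i)" if "i \<in> {1..m}" for i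
    using f that uv(2)[of "f i" c] by (simp add: x_def seq_def)
  have "(flag m a :: ('d + 'd) flag) = Psi c m x"
    unfolding Psi_def using p assms units_seq[OF x] by (intro flag_cong) auto
  then show ?thesis using that x p by blast
qed

lemma Psi_in_Y: "m \<le> CARD('d) \<Longrightarrow> x \<in> spheres m \<Longrightarrow> (Psi c m x :: ('d::finite + 'd) flag) \<in> Y m"
  unfolding Psi_def by (intro flag_in_Y units_seq)

lemma Y_Psi:
  assumes "F \<in> (Y m :: ('d::finite + 'd) flag set)" "m \<le> CARD('d)"
  obtains x where "x \<in> spheres m" "F = Psi c m x"
proof -
  obtain a where "units a m" "F = flag m a" using Y_flag[OF assms] .
  then show ?thesis using flag_eq_Psi[of a m] that by metis
qed

subsection \<open>The union of the products of spheres\<close>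

lemma continuous_insert_pair:
  assumes i: "1 \<le> i" "i < m"
  shows "continuous_map (prod_topology (top_of_set (sphere 0 1)) (S_topology (m - 2))) (S_topology m)
    (\<lambda>(y, x). insert_pair m i b y x)"
  unfolding S_topology_def[of m] continuous_map_componentwise
proof (intro conjI ballI)
  let ?P = "prod_topology (top_of_set (sphere 0 1 :: (real ^ 3) set)) (S_topology (m - 2))"
  show "(\<lambda>(y, x). insert_pair m i b y x) ` topspace ?P \<subseteq> extensional {1..m}"
    by (auto simp: insert_pair_def)
  fix j assume j: "j \<in> {1..m}"
  have fst: "continuous_map ?P euclidean fst"
    using continuous_map_fst[of "top_of_set (sphere 0 1 :: (real ^ 3) set)" "S_topology (m - 2)"]
    by (simp add: continuous_map_in_subtopology)
  have snd: "continuous_map ?P euclidean (\<lambda>z. snd z l)" if "1 \<le> l" "l \<le> m - 2" for l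
    using continuous_map_compose[OF continuous_map_snd cm_coordinate[OF that]] by (simp add: comp_def)
  have "continuous_map ?P euclidean (\<lambda>z. insert_pair m i b (fst z) (snd z) j)"
  proof -
    consider "j < i" | "j = i" | "j = Suc i" | "Suc i < j" by linarith
    then show ?thesis
    proof cases
      case 1
      then show ?thesis using j i snd[of j] by (simp add: insert_pair_def)
    next
      case 2
      then show ?thesis using j fst by (simp add: insert_pair_def)
    next
      case 3
      then show ?thesis using j fst by (cases b) (simp_all add: insert_pair_def continuous_map_minus)
    next
      case 4
      then show ?thesis using j i snd[of "j - 2"] by (simp add: insert_pair_def)
    qed
  qed
  moreover have "insert_pair m i b (fst z) (snd z) j \<in> sphere 0 1" if "z \<in> topspace ?P" for z
    using insert_pair_sphere[OF i, of "snd z" "fst z" b] that j by (auto simp: PiE_iff)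
  ultimately show "continuous_map ?P (top_of_set (sphere 0 1)) (\<lambda>z. (case z of (y, x) \<Rightarrow> insert_pair m i b y x) j)"
    by (auto simp: continuous_map_in_subtopology case_prod_beta)
qed

lemma compact_S_par: "compactin (S_topology m) (S_par b m k)"
proof (induction k arbitrary: m b rule: less_induct)
  case (less k)
  show ?case
  proof (cases "k < 2")
    case True
    have "S_par b m k \<subseteq> {\<lambda>i\<in>{1..m}. if i < m then q_pt else if b then p_pt else - p_pt}"
      using S_par_few[OF True] by blast
    then have "finite (S_par b m k)" by (rule finite_subset) simp
    then show ?thesis using S_par_sphere by (intro finite_imp_compactin) auto
  next
    case False
    then have k: "2 \<le> k" by simp
    show ?thesis
    proof (cases "m < 2")
      case True
      have "S_par b m k = {}" proof (rule equals0I)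
        fix x assume "x \<in> S_par b m k"
        from S_par_cases[OF k this] True show False by auto
      qed
      then show ?thesis by simp
    next
      case False
      then have m: "2 \<le> m" by simp
      have cs: "compactin (prod_topology (top_of_set (sphere 0 1)) (S_topology (m - 2))) ((sphere 0 1 :: (real ^ 3) set) \<times> S_par c (m - 2) (k - 2))" for c
        using less.IH[of "k - 2" "m - 2" c] k by (simp add: compactin_Times compactin_subtopology)
      show ?thesis
        unfolding S_par_rec[OF k m]
      proof (intro compactin_Un compactin_Union)
        show "finite ((\<lambda>i. (\<lambda>(y, x). insert_pair m i True y x) ` (sphere 0 1 \<times> S_par b (m - 2) (k - 2))) ` {1..<m})" by simp
        show "compactin (S_topology m) ((\<lambda>(y, x). insert_pair m (m - 1) False y x) ` (sphere 0 1 \<times> S_par (\<not> b) (m - 2) (k - 2)))"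
          using m by (intro image_compactin[OF cs] continuous_insert_pair) auto
        fix A assume "A \<in> (\<lambda>i. (\<lambda>(y, x). insert_pair m i True y x) ` (sphere 0 1 \<times> S_par b (m - 2) (k - 2))) ` {1..<m}"
        then obtain i where i: "1 \<le> i" "i < m" "A = (\<lambda>(y, x). insert_pair m i True y x) ` (sphere 0 1 \<times> S_par b (m - 2) (k - 2))"
          by auto
        show "compactin (S_topology m) A" unfolding i(3) by (rule image_compactin[OF cs continuous_insert_pair[OF i(1,2)]])
      qed
    qed
  qed
qed

section \<open>Connectedness of the two parity parts\<close>

lemma connectedin_chain:
  assumes "\<And>i. 1 \<le> i \<Longrightarrow> i \<le> n \<Longrightarrow> connectedin X (A i)"
    and "\<And>i. 1 \<le> i \<Longrightarrow> i < n \<Longrightarrow> A i \<inter> A (Suc i) \<noteq> {}"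
  shows "connectedin X (\<Union>i\<in>{1..n}. A i)"
  using assms
proof (induction n)
  case 0
  then show ?case by simp
next
  case (Suc n)
  show ?case
  proof (cases "n = 0")
    case True
    then show ?thesis using Suc.prems by simp
  next
    case False
    have "{1..Suc n} = insert (Suc n) {1..n}" by auto
    then have eq: "(\<Union>i\<in>{1..Suc n}. A i) = (\<Union>i\<in>{1..n}. A i) \<union> A (Suc n)"
      by (simp only: UN_insert Un_commute)
    have "A n \<inter> A (Suc n) \<noteq> {}" using Suc.prems(2)[of n] False by simp
    then have "(\<Union>i\<in>{1..n}. A i) \<inter> A (Suc n) \<noteq> {}" using False by force
    then show ?thesis
      unfolding eq using Suc by (intro connectedin_Un) auto
  qed
qed

text \<open>A common point of the pieces for undotted cups at \<open>i\<close> and at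
  \<open>Suc i\<close>: its coordinates from \<open>i\<close> on are \<open>x i\<close>,
  \<open>- x i\<close>, \<open>x i\<close>.\<close>

lemma insert_pair_move:
  assumes "1 \<le> i" "Suc i < m" "x \<in> extensional {1..m - 2}"
  shows "insert_pair m i True (x i) x = insert_pair m (Suc i) True (- x i) x"
proof
  fix j
  consider "j < i" | "j = i" | "j = Suc i" | "j = Suc (Suc i)" | "Suc (Suc i) < j" by linarith
  then show "insert_pair m i True (x i) x j = insert_pair m (Suc i) True (- x i) x j"
    using assms by cases (auto simp: insert_pair_def)
qed

text \<open>A common point of the last undotted piece and the dotted piece. The coordinate left of
  the dotted cup is flipped, which matches the opposite parity required there.\<close>

lemma insert_pair_move_last:
  assumes "3 \<le> m" "x \<in> extensional {1..m - 2}"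
  shows "insert_pair m (m - 2) True (- x (m - 2)) x = insert_pair m (m - 1) False (x (m - 2)) (flip (m - 2) x)"
proof
  fix j
  consider "j < m - 2" | "j = m - 2" | "j = m - 1" | "j = m" | "m < j" using assms by linarith
  then show "insert_pair m (m - 2) True (- x (m - 2)) x j = insert_pair m (m - 1) False (x (m - 2)) (flip (m - 2) x) j"
    using assms by cases (auto simp: insert_pair_def flip_def)
qed

lemma connected_S_par:
  assumes "adm TYPE('d::finite) m k"
  shows "connectedin (S_topology m) (S_par b m k)"
  using assms
proof (induction k arbitrary: m b rule: less_induct)
  case (less k)
  note ad = less.prems
  show ?case
  proof (cases "k < 2")
    case True
    have "S_par b m k = {} \<or> (\<exists>x. S_par b m k = {x})"
      using S_par_few[OF True, of _ b m] by (cases "m = 0 \<longrightarrow> \<not> b") auto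
    then show ?thesis using S_par_sphere[of b m k] by (auto simp: connectedin_sing)
  next
    case False
    then have k: "2 \<le> k" by simp
    have m: "2 \<le> m" using adm_reduce(2)[OF ad k] .
    note ad' = adm_reduce(1)[OF ad k]
    define A where "A i = (\<lambda>(y, x). insert_pair m i True y x) ` (sphere 0 1 \<times> S_par b (m - 2) (k - 2))" for i
    define B where "B = (\<lambda>(y, x). insert_pair m (m - 1) False y x) ` (sphere 0 1 \<times> S_par (\<not> b) (m - 2) (k - 2))"
    have sph: "connected (sphere 0 1 :: (real ^ 3) set)" by (rule connected_sphere) simp
    have cs: "connectedin (prod_topology (top_of_set (sphere 0 1)) (S_topology (m - 2))) ((sphere 0 1 :: (real ^ 3) set) \<times> S_par c (m - 2) (k - 2))" for c
      using less.IH[OF _ ad', of c] k sph by (simp add: connectedin_Times connectedin_subtopology)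
    have cA: "connectedin (S_topology m) (A i)" if "1 \<le> i" "i < m" for i
      unfolding A_def by (rule connectedin_continuous_map_image[OF continuous_insert_pair[OF that] cs])
    have cB: "connectedin (S_topology m) B"
      unfolding B_def using m by (intro connectedin_continuous_map_image[OF continuous_insert_pair cs]) auto
    have rec: "S_par b m k = (\<Union>i\<in>{1..<m}. A i) \<union> B" unfolding A_def B_def by (rule S_par_rec[OF k m])
    have idx: "{1..<m} = {1..m - 1}" using m by auto
    show ?thesis
    proof (cases "m = 2")
      case True
      then have "k - 2 = 0" "m - 2 = 0" using ad k by (auto simp: adm_def)
      then have z: "S_par True (m - 2) (k - 2) = {}" using S_par_few[of "k - 2" _ True "m - 2"] by auto
      have "{1..<m} = {1}" using True by auto
      then have "S_par b m k = A 1 \<union> B" using rec by simp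
      moreover have "A 1 = {} \<or> B = {}" using z by (cases b) (auto simp: A_def B_def)
      ultimately have "S_par b m k = A 1 \<or> S_par b m k = B" by auto
      then show ?thesis using cA[of 1] cB True by auto
    next
      case False
      then have m3: "3 \<le> m" using m by simp
      have k1: "1 \<le> k - 2"
      proof (rule ccontr)
        assume "\<not> 1 \<le> k - 2"
        then have "k = 2" using k by simp
        then show False using ad m3 by (auto simp: adm_def)
      qed
      obtain x where x: "x \<in> S_par b (m - 2) (k - 2)" using S_par_nonempty[OF ad' k1] by blast
      have xs: "x \<in> spheres (m - 2)" using x S_par_sphere by blast
      have ext: "x \<in> extensional {1..m - 2}" using xs by (simp add: PiE_def)
      have inA: "insert_pair m i True y x \<in> A i" if "y \<in> sphere 0 1" for y i
        unfolding A_def using that x by (auto intro!: image_eqI[of _ _ "(y, x)"])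
      have "A i \<inter> A (Suc i) \<noteq> {}" if i: "1 \<le> i" "i < m - 1" for i
      proof -
        have xi: "x i \<in> sphere 0 1" "- x i \<in> sphere 0 1" using spheres_nth[OF xs, of i] i by auto
        have "insert_pair m i True (x i) x = insert_pair m (Suc i) True (- x i) x"
          using i ext by (intro insert_pair_move) auto
        then show ?thesis using inA[OF xi(1), of i] inA[OF xi(2), of "Suc i"] by auto
      qed
      then have cU: "connectedin (S_topology m) (\<Union>i\<in>{1..m - 1}. A i)"
        using cA by (intro connectedin_chain) auto
      have xm: "x (m - 2) \<in> sphere 0 1" "- x (m - 2) \<in> sphere 0 1" using spheres_nth[OF xs, of "m - 2"] m3 by auto
      have "flip (m - 2) x \<in> S_par (\<not> b) (m - 2) (k - 2)" by (rule flip_S_par[OF ad' k1 x])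
      then have "insert_pair m (m - 1) False (x (m - 2)) (flip (m - 2) x) \<in> B"
        unfolding B_def using xm by (auto intro!: image_eqI[of _ _ "(x (m - 2), flip (m - 2) x)"])
      then have "insert_pair m (m - 2) True (- x (m - 2)) x \<in> A (m - 2) \<inter> B"
        using inA[OF xm(2), of "m - 2"] insert_pair_move_last[OF m3 ext] by simp
      then have "(\<Union>i\<in>{1..m - 1}. A i) \<inter> B \<noteq> {}" using m3 by force
      then show ?thesis unfolding rec idx using cU cB by (intro connectedin_Un)
    qed
  qed
qed

subsection \<open>The two components of the type D fiber\<close>

text \<open>The cups use up all vertices except at most one. So for \<open>k = m\<close> every ray
  is the rightmost one and \<open>q_pt\<close> never occurs, in accordance with the two-valued ray
  condition of \<open>T_cup\<close>.\<close>

lemma at_most_one_ray: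
  assumes g: "good_diagram m A D" and c: "card {a \<in> A. is_cup a} = m div 2"
    and i: "Ray i \<in> A" and j: "Ray j \<in> A"
  shows "i = j"
proof (rule ccontr)
  assume ij: "i \<noteq> j"
  have wf: "\<forall>a\<in>A. wf_arc m a" and cov: "\<forall>v\<in>{1..m}. \<exists>a\<in>A. v \<in> ends a" and nc: "noncrossing A"
    using g by (auto simp: good_diagram_def)
  have fin: "finite A" using good_diagram_finite[OF g] by simp
  have ends: "ends a \<subseteq> {1..m}" "finite (ends a)" if "a \<in> A" for a
    using wf that by (cases a; force)+
  have uniq: "\<forall>v\<in>{1..m}. \<exists>!a. a \<in> A \<and> v \<in> ends a" using unique_arc_iff[OF wf nc] cov by blast
  have disj: "ends a \<inter> ends b = {}" if "a \<in> A" "b \<in> A" "a \<noteq> b" for a b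
    using uniq ends(1)[OF that(1)] that by blast
  have "(\<Union>a\<in>A. ends a) = {1..m}" using ends cov by blast
  then have "m = (\<Sum>a\<in>A. card (ends a))"
    using card_UN_disjoint[of A ends] fin ends disj by (metis card_atLeastAtMost diff_Suc_1)
  also have "\<dots> = (\<Sum>a\<in>{a \<in> A. is_cup a}. card (ends a)) + (\<Sum>a\<in>A - {a \<in> A. is_cup a}. card (ends a))"
    using fin by (subst sum.subset_diff[of "{a \<in> A. is_cup a}" A]) (auto simp: add.commute)
  also have "(\<Sum>a\<in>{a \<in> A. is_cup a}. card (ends a)) = (\<Sum>a\<in>{a \<in> A. is_cup a}. 2)"
    using wf by (intro sum.cong) (auto simp: is_cup_def)
  finally have m: "m = 2 * (m div 2) + (\<Sum>a\<in>A - {a \<in> A. is_cup a}. card (ends a))" using c by simp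
  have "(\<Sum>a\<in>{Ray i, Ray j}. card (ends a)) \<le> (\<Sum>a\<in>A - {a \<in> A. is_cup a}. card (ends a))"
    using fin i j by (intro sum_mono2) auto
  moreover have "(\<Sum>a\<in>{Ray i, Ray j}. card (ends a)) = 2" using ij by simp
  ultimately show False using m by linarith
qed

lemma herm_comp_span_uv:
  assumes y: "y \<in> sphere 0 1"
  shows "herm_comp (vec.span {uv c y}) = vec.span {uv c (- y)}"
proof -
  let ?a = "uv c y" and ?b = "uv c (- y)"
  have y': "- y \<in> sphere 0 1" using y by simp
  note u = uv(1)[OF y, of c] uv(1)[OF y', of c]
  have ab: "herm ?a ?b = 0" using uv_perp_iff[OF y y'] by simp
  show ?thesis
  proof
    show "herm_comp (vec.span {?a}) \<subseteq> vec.span {?b}"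
    proof
      fix v assume "v \<in> herm_comp (vec.span {?a})"
      then have "herm v ?a = 0" by (simp add: herm_comp_def vec.span_base)
      then have "v = herm v ?b *s ?b" using unit_plane_cases[OF u ab, of v] by simp
      then show "v \<in> vec.span {?b}" by (auto simp: vec.span_singleton)
    qed
    have "herm ?b ?a = 0" using ab herm_eq_0_commute by blast
    then show "vec.span {?b} \<subseteq> herm_comp (vec.span {?a})"
      by (auto simp: vec.span_singleton herm_comp_def herm_simps)
  qed
qed

lemma span_uvI:
  assumes y: "y \<in> sphere 0 1" and v: "v \<noteq> 0" "prm c y v = v"
  shows "vec.span {uv c y} = vec.span {v}"
proof -
  let ?a = "uv c y"
  have va: "v = herm v ?a *s ?a" using v(2) uv(2)[OF y, of c] by (metis pj_def)
  then have "herm v ?a \<noteq> 0" using v(1) by (metis vec.scale_zero_left)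
  then have "?a = (1 / herm v ?a) *s v" using va by (metis divide_self_if times_divide_eq_left mult_1 vector_smult_assoc vec.scale_one)
  then have "?a \<in> vec.span {v}" by (metis vec.span_base vec.span_scale singletonI)
  moreover have "v \<in> vec.span {?a}" using va by (metis vec.span_base vec.span_scale singletonI)
  ultimately show ?thesis by (simp add: vec.span_minimal subset_antisym)
qed

lemma mp_sphere: "- p_pt \<in> sphere 0 1"
  using pq_sphere(1) by simp

text \<open>Each case is checked by exhibiting a vector fixed by the projection \<open>prm\<close>
  of the point; the choice of \<open>axes\<close> is made for this.\<close>

lemma ray_line_eq:
  assumes g: "good_diagram m A D" and c: "card {a \<in> A. is_cup a} = k div 2" and i: "Ray i \<in> A" and k: "k \<le> m"
  shows "ray_line m k (A, D) i = vec.span {uv (m - k) (if Ray i \<in> D then p_pt else if rightmost_ray A i then - p_pt else q_pt)}"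
proof (cases "k = m")
  case True
  have "rightmost_ray A i" using at_most_one_ray[OF g] c i True unfolding rightmost_ray_def by blast
  moreover have "vec.span {uv 0 p_pt} = vec.span {e2}"
    by (rule span_uvI[OF pq_sphere(1)]) (auto simp: prm_def axes_def p_pt_def e2_def axis_def vec_eq_iff forall_2 complex_eq_iff)
  moreover have "vec.span {uv 0 (- p_pt)} = vec.span {f2}"
    by (rule span_uvI[OF mp_sphere]) (auto simp: prm_def axes_def p_pt_def f2_def axis_def vec_eq_iff forall_2 complex_eq_iff)
  ultimately show ?thesis using True by (simp add: ray_line_def)
next
  case False
  let ?c = "m - k"
  have c0: "?c \<noteq> 0" using False k by simp
  have q: "vec.span {uv ?c q_pt} = vec.span {e2}"
    using span_unit_eq_iff[OF uv(1)[OF pq_sphere(2)] herm_ef(1)] pj_uv_q[OF c0] by blast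
  have p: "vec.span {uv ?c p_pt} = vec.span {(if even ?c then 1 else \<i>) *s e2 + f2}"
    by (rule span_uvI[OF pq_sphere(1)]) (use c0 in \<open>auto simp: prm_def axes_def p_pt_def e2_def f2_def axis_def vec_eq_iff forall_2 complex_eq_iff\<close>)
  have mp: "vec.span {uv ?c (- p_pt)} = vec.span {(if even ?c then 1 else \<i>) *s e2 - f2}"
    by (rule span_uvI[OF mp_sphere]) (use c0 in \<open>auto simp: prm_def axes_def p_pt_def e2_def f2_def axis_def vec_eq_iff forall_2 complex_eq_iff\<close>)
  have "Ray i \<in> D \<Longrightarrow> rightmost_ray A i" by (rule dotted_ray_rightmost[OF g])
  then show ?thesis using False p mp q by (auto simp: ray_line_def Let_def)
qed

lemma phi_in_T_cup_iff:
  assumes m: "m \<le> CARD('d)" and x: "x \<in> spheres m" and g: "good_diagram m A D"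
    and c: "card {a \<in> A. is_cup a} = k div 2" and k: "k \<le> m"
  shows "phi m (Psi (m - k) m x :: ('d::finite + 'd) flag) \<in> T_cup m k (A, D) \<longleftrightarrow> x \<in> S_cup m (A, D)"
proof -
  let ?l = "phi m (Psi (m - k) m x :: ('d + 'd) flag)"
  note l = phi_Psi[where 'd = 'd, OF m x, of _ "m - k"]
  have xs: "x i \<in> sphere 0 1" if "i \<in> {1..m}" for i using spheres_nth[OF x, of i] that by simp
  have wf: "wf_arc m a" if "a \<in> A" for a using g that by (auto simp: good_diagram_def)
  have "?l i \<in> P1" if i: "i \<in> {1..m}" for i
  proof -
    have "uv (m - k) (x i) \<noteq> 0" using uv(1)[OF xs[OF i], of "m - k"] by auto
    then show ?thesis unfolding l[OF i] P1_def by (simp add: vec.dim_insert)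
  qed
  then have P1: "?l \<in> {1..m} \<rightarrow>\<^sub>E P1" by (auto simp: phi_def)
  have cup: "(?l j = (if Cup i j \<in> D then ?l i else herm_comp (?l i))) \<longleftrightarrow> (x i = (if Cup i j \<in> D then x j else - x j))"
    if "Cup i j \<in> A" for i j
  proof -
    have ij: "i \<in> {1..m}" "j \<in> {1..m}" using wf[OF that] by auto
    have mi: "- x i \<in> sphere 0 1" using xs[OF ij(1)] by simp
    have e: "x j = - x i \<longleftrightarrow> x i = - x j" by auto
    show ?thesis
    proof (cases "Cup i j \<in> D")
      case True
      show ?thesis
        unfolding l[OF ij(1)] l[OF ij(2)] if_P[OF True] span_uv_eq_iff[OF xs[OF ij(2)] xs[OF ij(1)]] by (rule eq_commute)
    next
      case False
      show ?thesis
        unfolding l[OF ij(1)] l[OF ij(2)] if_not_P[OF False] herm_comp_span_uv[OF xs[OF ij(1)]] span_uv_eq_iff[OF xs[OF ij(2)] mi]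
        by (rule e)
    qed
  qed
  have ray: "(?l i = ray_line m k (A, D) i) \<longleftrightarrow> (x i = (if Ray i \<in> D then p_pt else if rightmost_ray A i then - p_pt else q_pt))"
    if "Ray i \<in> A" for i
  proof -
    have i: "i \<in> {1..m}" using wf[OF that] by auto
    show ?thesis
      unfolding l[OF i] ray_line_eq[OF g c that k] by (rule span_uv_eq_iff) (use xs[OF i] pq_sphere in auto)
  qed
  have "?l \<in> T_cup m k (A, D) \<longleftrightarrow> (\<forall>i j. Cup i j \<in> A \<longrightarrow> ?l j = (if Cup i j \<in> D then ?l i else herm_comp (?l i))) \<and>
      (\<forall>i. Ray i \<in> A \<longrightarrow> ?l i = ray_line m k (A, D) i)"
    unfolding T_cup_def using P1 by blast
  also have "\<dots> \<longleftrightarrow> (\<forall>i j. Cup i j \<in> A \<longrightarrow> x i = (if Cup i j \<in> D then x j else - x j)) \<and>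
      (\<forall>i. Ray i \<in> A \<longrightarrow> x i = (if Ray i \<in> D then p_pt else if rightmost_ray A i then - p_pt else q_pt))"
  proof (intro conj_cong iff_allI)
    fix i j
    show "(Cup i j \<in> A \<longrightarrow> ?l j = (if Cup i j \<in> D then ?l i else herm_comp (?l i))) \<longleftrightarrow>
        (Cup i j \<in> A \<longrightarrow> x i = (if Cup i j \<in> D then x j else - x j))"
      using cup[of i j] by (rule imp_cong[OF refl])
    show "(Ray i \<in> A \<longrightarrow> ?l i = ray_line m k (A, D) i) \<longleftrightarrow>
        (Ray i \<in> A \<longrightarrow> x i = (if Ray i \<in> D then p_pt else if rightmost_ray A i then - p_pt else q_pt))"
      using ray[of i] by (rule imp_cong[OF refl])
  qed
  also have "\<dots> \<longleftrightarrow> x \<in> S_cup m (A, D)" unfolding S_cup_def using x by blast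
  finally show ?thesis .
qed

definition comp_D :: "bool \<Rightarrow> nat \<Rightarrow> nat \<Rightarrow> ('d::finite + 'd) flag set" where
  "comp_D b m k = Psi (m - k) m ` S_par b m k"

lemma cup_diagrams_odd_iff:
  "(A, D) \<in> cup_diagrams_odd m k \<longleftrightarrow> good_diagram m A D \<and> card {a \<in> A. is_cup a} = k div 2 \<and> odd (card D)"
  by (simp add: cup_diagrams_odd_def cup_diagrams_def cup_diagram_iff_good is_cup_def)

lemma Fl_D_odd_eq:
  assumes m: "m \<le> CARD('d)" and k: "k \<le> m"
  shows "(Fl_D_odd m k :: ('d::finite + 'd) flag set) = comp_D True m k"
proof (intro set_eqI iffI)
  fix F :: "('d + 'd) flag"
  assume "F \<in> Fl_D_odd m k"
  then obtain a where a: "a \<in> cup_diagrams_odd m k" "F \<in> Y m" "phi m F \<in> T_cup m k a"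
    unfolding Fl_D_odd_def by blast
  obtain A D where AD: "a = (A, D)" by (rule prod.exhaust)
  note g = a(1)[unfolded AD cup_diagrams_odd_iff]
  obtain x where x: "x \<in> spheres m" "F = Psi (m - k) m x" using Y_Psi[OF a(2) m] .
  have "x \<in> S_cup m (A, D)" using phi_in_T_cup_iff[where 'd = 'd, OF m x(1) _ _ k, of A D] g a(3) x(2) AD by simp
  then have "x \<in> S_par True m k" using g S_par_iff[of x True m k] by blast
  then show "F \<in> comp_D True m k" unfolding comp_D_def x(2) by (rule imageI)
next
  fix F :: "('d + 'd) flag"
  assume "F \<in> comp_D True m k"
  then obtain x where x: "x \<in> S_par True m k" "F = Psi (m - k) m x" by (auto simp: comp_D_def)
  obtain A D where g: "good_diagram m A D" "card {a \<in> A. is_cup a} = k div 2" "odd (card D)" "x \<in> S_cup m (A, D)"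
    using x(1) S_par_iff[of x True m k] by blast
  have xs: "x \<in> spheres m" using x(1) S_par_sphere by blast
  have "phi m F \<in> T_cup m k (A, D)" "F \<in> Y m"
    using phi_in_T_cup_iff[where 'd = 'd, OF m xs g(1,2) k] g(4) Psi_in_Y[OF m xs] x(2) by simp_all
  moreover have "(A, D) \<in> cup_diagrams_odd m k" unfolding cup_diagrams_odd_iff using g(1-3) by (intro conjI)
  ultimately show "F \<in> Fl_D_odd m k" unfolding Fl_D_odd_def by blast
qed

lemma flag_in_Fl_D:
  assumes "m \<le> CARD('d)" "units a m"
  shows "(flag m a :: ('d::finite + 'd) flag) \<in> Fl_D m k \<longleftrightarrow> FD TYPE('d) m k a"
proof -
  have "flag_at (flag m a :: ('d + 'd) flag) m = Fs a m" by (rule flag_at_flag) simp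
  then show ?thesis using flag_in_Y[where 'd = 'd, OF assms] by (simp add: Fl_D_def FD_def ED_def)
qed

lemma flag_in_Fl_C:
  assumes "m \<le> CARD('d)" "units a (m - 1)"
  shows "(flag (m - 1) a :: ('d::finite + 'd) flag) \<in> Fl_C m k \<longleftrightarrow> FC TYPE('d) m k a"
proof -
  have "flag_at (flag (m - 1) a :: ('d + 'd) flag) (m - 1) = Fs a (m - 1)" by (rule flag_at_flag) simp
  moreover have "(flag (m - 1) a :: ('d + 'd) flag) \<in> Y (m - 1)" using assms by (intro flag_in_Y) auto
  ultimately show ?thesis by (simp add: Fl_C_def FC_def EC_def)
qed

lemma Fl_D_eq:
  assumes ad: "adm TYPE('d::finite) m k"
  shows "(Fl_D m k :: ('d + 'd) flag set) = comp_D True m k \<union> comp_D False m k"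
proof -
  have m: "m \<le> CARD('d)" using adm_bounds[OF ad] by simp
  have iff: "(Psi (m - k) m x :: ('d + 'd) flag) \<in> Fl_D m k \<longleftrightarrow> (\<exists>b. x \<in> S_par b m k)" if x: "x \<in> spheres m" for x
    unfolding Psi_def flag_in_Fl_D[where 'd = 'd, OF m units_seq[OF x]] by (rule FD_iff_S_par[OF ad x])
  show ?thesis
  proof (intro set_eqI iffI)
    fix F :: "('d + 'd) flag"
    assume F: "F \<in> Fl_D m k"
    then obtain x where x: "x \<in> spheres m" "F = Psi (m - k) m x" using Y_Psi[of F m] m by (auto simp: Fl_D_def)
    then obtain b where "x \<in> S_par b m k" using F iff by blast
    then show "F \<in> comp_D True m k \<union> comp_D False m k" using x(2) by (cases b) (auto simp: comp_D_def)
  next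
    fix F :: "('d + 'd) flag"
    assume "F \<in> comp_D True m k \<union> comp_D False m k"
    then obtain b x where x: "x \<in> S_par b m k" "F = Psi (m - k) m x" by (auto simp: comp_D_def)
    then show "F \<in> Fl_D m k" using iff[of x] S_par_sphere[of b m k] by auto
  qed
qed

lemma flag_proj_flag: "flag_proj m (flag m a) = flag (m - 1) a"
  by (auto simp: flag_proj_def flag_def fun_eq_iff)

lemma flag_proj_Psi: "flag_proj m (Psi c m x) = Psi c (m - 1) x"
  unfolding Psi_def by (rule flag_proj_flag)

lemma Psi_restrict: "Psi c n (restrict x {1..n}) = (Psi c n x :: ('d::finite + 'd) flag)"
proof -
  have "Bm (seq c (restrict x {1..n})) i u = (Bm (seq c x) i u :: 'd hspace)" if "i \<le> n" for i u
    using that by (intro Bm_cong) (auto simp: seq_def)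
  moreover have "seq c (restrict x {1..n}) i = seq c x i" if "i \<in> {1..n}" for i using that by (auto simp: seq_def)
  ultimately have "(wv (seq c (restrict x {1..n})) i :: 'd hspace) = wv (seq c x) i" if "i \<in> {1..n}" for i
    using that unfolding wv_def by (metis One_nat_def atLeastAtMost_iff diff_le_self le_trans)
  then have "Fs (seq c (restrict x {1..n})) i = (Fs (seq c x) i :: 'd hspace set)" if "i \<in> {1..n}" for i
    unfolding Fs_def using that by (intro arg_cong[of _ _ vec.span] image_cong) auto
  then show ?thesis unfolding Psi_def flag_def by (intro restrict_ext)
qed

text \<open>Two points with the same projection can only differ by \<open>flip\<close>, which
  changes the parity. Conversely some extension exists, and \<open>flip\<close> corrects its parity
  without touching the first \<open>m - 1\<close> subspaces.\<close>

lemma bij_flag_proj: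
  assumes ad: "adm TYPE('d::finite) m k" "1 \<le> k"
  shows "bij_betw (flag_proj m) (comp_D b m k :: ('d + 'd) flag set) (Fl_C m k)"
proof -
  have m: "m \<le> CARD('d)" "1 \<le> m" "k \<le> m" using adm_bounds[OF ad(1)] ad(2) by simp_all
  then obtain l where l: "m = Suc l" by (cases m) auto
  let ?c = "m - k"
  have FD: "FD TYPE('d) m k (seq ?c x)" if "x \<in> S_par b' m k" for b' x
    using FD_iff_S_par[OF ad(1)] that S_par_sphere by blast
  have into: "Psi ?c l x \<in> (Fl_C m k :: ('d + 'd) flag set)" if x: "x \<in> S_par b' m k" for b' x
  proof -
    have u: "units (seq ?c x) m" using x S_par_sphere units_seq by blast
    have "FC TYPE('d) m k (seq ?c x)" using FD_imp_FC[of l k] ad u FD[OF x] l by simp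
    then show ?thesis unfolding Psi_def
      using flag_in_Fl_C[where 'd = 'd, OF m(1), of "seq ?c x" k] units_mono[OF u, of l] l by simp
  qed
  have inj: "x = y" if x: "x \<in> S_par b m k" and y: "y \<in> S_par b m k"
    and eq: "(Psi ?c l x :: ('d + 'd) flag) = Psi ?c l y" for x y
  proof -
    have xs: "x \<in> spheres m" and ys: "y \<in> spheres m" using x y S_par_sphere by blast+
    have "restrict x {1..l} \<in> spheres l" "restrict y {1..l} \<in> spheres l" using xs ys l by (auto simp: PiE_iff)
    moreover have "(Psi ?c l (restrict x {1..l}) :: ('d + 'd) flag) = Psi ?c l (restrict y {1..l})"
      unfolding Psi_restrict by (rule eq)
    ultimately have "restrict x {1..l} = restrict y {1..l}" using inj_onD[OF inj_Psi[where 'd = 'd, of l ?c]] m(1) l by simp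
    then have low: "x i = y i" if "i \<in> {1..l}" for i using that by (metis restrict_apply')
    have xm: "x m \<in> sphere 0 1" "y m \<in> sphere 0 1" using spheres_nth[OF xs] spheres_nth[OF ys] m(2) by auto
    have "pj (seq ?c y j) = pj (((seq ?c x)(Suc l := uv ?c (y m))) j)" if "1 \<le> j" "j \<le> m" for j
      using low[of j] that l by (cases "j = m") (auto simp: seq_def)
    moreover have "units ((seq ?c x)(Suc l := uv ?c (y m))) m"
      using units_seq[OF xs, of ?c] uv(1)[OF xm(2), of ?c] l by (auto simp: units_def)
    ultimately have "FD TYPE('d) m k ((seq ?c x)(Suc l := uv ?c (y m)))"
      using FD_cong[where 'd = 'd, of m "seq ?c y" "(seq ?c x)(Suc l := uv ?c (y m))" k] units_seq[OF ys] FD[OF y] by blast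
    then have "herm (uv ?c (x m)) (uv ?c (y m)) = 0 \<or> pj (uv ?c (y m)) = pj (uv ?c (x m))"
      using FD_lift_unique[of l k "seq ?c x" "uv ?c (y m)"] ad units_seq[OF xs, of ?c] FD[OF x] uv(1)[OF xm(2), of ?c] l
      by (simp add: seq_def)
    then have "y m = - x m \<or> y m = x m" using uv_perp_iff[OF xm] uv_eqI[OF xm(2,1)] by blast
    moreover have False if "y m = - x m"
    proof -
      have "y = flip m x"
      proof (rule extensionalityI[of _ "{1..m}"])
        fix i assume "i \<in> {1..m}"
        then show "y i = flip m x i" using that low[of i] l by (auto simp: flip_def)
      qed (use xs ys m in \<open>auto simp: PiE_def extensional_def flip_def\<close>)
      then show False using flip_S_par[OF ad x] y S_par_disjoint[OF ad(1), of y "\<not> b" b] by auto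
    qed
    ultimately have xy: "y m = x m" by blast
    show ?thesis
    proof (rule extensionalityI[of _ "{1..m}"])
      fix i assume "i \<in> {1..m}"
      then show "x i = y i" using xy low[of i] l by (cases "i = m") auto
    qed (use xs ys in \<open>auto simp: PiE_def\<close>)
  qed
  have onto: "\<exists>x\<in>S_par b m k. F = Psi ?c l x" if F: "F \<in> (Fl_C m k :: ('d + 'd) flag set)" for F
  proof -
    obtain a where a: "units a l" "F = flag l a" using Y_flag[of F l] F m l by (auto simp: Fl_C_def)
    have FC: "FC TYPE('d) (Suc l) k a" using flag_in_Fl_C[where 'd = 'd, of m a k] F a m(1) l by simp
    obtain v where v: "herm v v = 1" "FD TYPE('d) (Suc l) k (a(Suc l := v))"
      using lift_exists[of l k a] ad a(1) FC l by blast
    note u = Fs_update(4)[OF a(1) v(1)]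
    obtain x where x: "x \<in> spheres m" "(flag m (a(Suc l := v)) :: ('d + 'd) flag) = Psi ?c m x"
      "\<And>i. i \<in> {1..m} \<Longrightarrow> pj ((a(Suc l := v)) i) = pj (seq ?c x i)"
      using flag_eq_Psi[where 'd = 'd, of "a(Suc l := v)" m ?c] u l by blast
    have "FD TYPE('d) m k (seq ?c x)"
      using FD_cong[where 'd = 'd, of m "a(Suc l := v)" "seq ?c x" k] x(3) u units_seq[OF x(1)] v(2) l by simp
    then obtain b' where b': "x \<in> S_par b' m k" using FD_iff_S_par[OF ad(1) x(1)] by blast
    have "flag_proj m (flag m (a(Suc l := v)) :: ('d + 'd) flag) = F"
    proof -
      have "units (a(Suc l := v)) l" using units_mono[OF u, of l] by simp
      then have "flag l (a(Suc l := v)) = (flag l a :: ('d + 'd) flag)" using a(1) by (intro flag_cong) auto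
      then show ?thesis unfolding flag_proj_flag a(2) using l by simp
    qed
    then have Fx: "F = Psi ?c l x" unfolding x(2) flag_proj_Psi using l by simp
    have "Psi ?c l (flip m x) = (Psi ?c l (restrict (flip m x) {1..l}) :: ('d + 'd) flag)" by (rule Psi_restrict[symmetric])
    also have "restrict (flip m x) {1..l} = restrict x {1..l}" using l by (auto simp: flip_def)
    finally have fl: "Psi ?c l (flip m x) = (Psi ?c l x :: ('d + 'd) flag)" unfolding Psi_restrict .
    show ?thesis
    proof (cases "b' = b")
      case True
      then show ?thesis using b' Fx by blast
    next
      case False
      then have "flip m x \<in> S_par b m k" using flip_S_par[OF ad b'] by (cases b; cases b') auto
      then show ?thesis using Fx fl by metis
    qed
  qed
  show ?thesis
    unfolding bij_betw_def
  proof
    show "inj_on (flag_proj m) (comp_D b m k :: ('d + 'd) flag set)"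
    proof (rule inj_onI)
      fix F G :: "('d + 'd) flag"
      assume "F \<in> comp_D b m k" "G \<in> comp_D b m k" and eq: "flag_proj m F = flag_proj m G"
      then obtain x y where xy: "x \<in> S_par b m k" "y \<in> S_par b m k" "F = Psi ?c m x" "G = Psi ?c m y"
        by (auto simp: comp_D_def)
      have "(Psi ?c l x :: ('d + 'd) flag) = Psi ?c l y" using eq l unfolding xy flag_proj_Psi by simp
      then show "F = G" using inj[OF xy(1,2)] xy(3,4) by simp
    qed
    show "flag_proj m ` comp_D b m k = (Fl_C m k :: ('d + 'd) flag set)"
    proof
      show "flag_proj m ` comp_D b m k \<subseteq> (Fl_C m k :: ('d + 'd) flag set)"
      proof
        fix F :: "('d + 'd) flag" assume "F \<in> flag_proj m ` comp_D b m k"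
        then obtain x where x: "x \<in> S_par b m k" "F = flag_proj m (Psi ?c m x)" by (auto simp: comp_D_def)
        then show "F \<in> Fl_C m k" using into[OF x(1)] l by (simp add: flag_proj_Psi)
      qed
      show "(Fl_C m k :: ('d + 'd) flag set) \<subseteq> flag_proj m ` comp_D b m k"
      proof
        fix F :: "('d + 'd) flag" assume "F \<in> Fl_C m k"
        then obtain x where x: "x \<in> S_par b m k" "F = Psi ?c l x" using onto by blast
        then have "F = flag_proj m (Psi ?c m x)" using l by (simp add: flag_proj_Psi)
        then show "F \<in> flag_proj m ` comp_D b m k" using x(1) unfolding comp_D_def by blast
      qed
    qed
  qed
qed

lemma comp_D_disjoint:
  assumes ad: "adm TYPE('d::finite) m k"
  shows "(comp_D True m k :: ('d + 'd) flag set) \<inter> comp_D False m k = {}"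
proof (rule ccontr)
  assume "(comp_D True m k :: ('d + 'd) flag set) \<inter> comp_D False m k \<noteq> {}"
  then obtain x y where xy: "x \<in> S_par True m k" "y \<in> S_par False m k" "(Psi (m - k) m x :: ('d + 'd) flag) = Psi (m - k) m y"
    by (auto simp: comp_D_def)
  then have "x = y" using inj_onD[OF inj_Psi[where 'd = 'd, OF adm_bounds(3)[OF ad]], OF xy(3)] S_par_sphere by blast
  then show False using S_par_disjoint[OF ad xy(1)] xy(2) by blast
qed

subsection \<open>Topology of the fibers\<close>

lemma comp_D_topology:
  assumes ad: "adm TYPE('d::finite) m k"
  shows "compactin (flag_topology m) (comp_D b m k :: ('d + 'd) flag set)"
    "connectedin (flag_topology m) (comp_D b m k :: ('d + 'd) flag set)"
    "closedin (flag_topology m) (comp_D b m k :: ('d + 'd) flag set)"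
proof -
  note c = continuous_Psi[where 'd = 'd, OF adm_bounds(3)[OF ad], of "m - k"]
  show comp: "compactin (flag_topology m) (comp_D b m k :: ('d + 'd) flag set)"
    unfolding comp_D_def by (rule image_compactin[OF compact_S_par c])
  show "connectedin (flag_topology m) (comp_D b m k :: ('d + 'd) flag set)"
    unfolding comp_D_def by (rule connectedin_continuous_map_image[OF c connected_S_par[OF ad]])
  show "closedin (flag_topology m) (comp_D b m k :: ('d + 'd) flag set)"
    by (rule compactin_imp_closedin[OF Hausdorff_flag comp])
qed

lemma homeomorphic_map_compact:
  assumes X: "compactin X S" and Z: "Hausdorff_space Z" and f: "continuous_map X Z f" and b: "bij_betw f S T"
    and T: "T \<subseteq> topspace Z"
  shows "homeomorphic_map (subtopology X S) (subtopology Z T) f"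
proof (rule continuous_imp_homeomorphic_map)
  have S: "topspace (subtopology X S) = S" using compactin_subset_topspace[OF X] by auto
  have T': "topspace (subtopology Z T) = T" using T by auto
  show "compact_space (subtopology X S)" using X by (simp add: compactin_subspace)
  show "Hausdorff_space (subtopology Z T)" using Z by (rule Hausdorff_space_subtopology)
  have "f ` S = T" "inj_on f S" using b by (auto simp: bij_betw_def)
  then show "continuous_map (subtopology X S) (subtopology Z T) f" "f ` topspace (subtopology X S) = topspace (subtopology Z T)"
    "inj_on f (topspace (subtopology X S))"
    unfolding S T' using f by (auto simp: continuous_map_in_subtopology continuous_map_from_subtopology)
qed

lemma continuous_flag_proj: "continuous_map (flag_topology m) (flag_topology (m - 1)) (flag_proj m)"
  unfolding flag_topology_def[of "m - 1"] continuous_map_componentwise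
proof (intro conjI ballI)
  show "flag_proj m ` topspace (flag_topology m) \<subseteq> extensional {1..m - 1}" by (auto simp: flag_proj_def)
  fix i assume i: "i \<in> {1..m - 1}"
  have "continuous_map (flag_topology m) subspace_topology (\<lambda>F. F i)"
    unfolding flag_topology_def using i by (intro continuous_map_product_projection) auto
  then show "continuous_map (flag_topology m) subspace_topology (\<lambda>F. flag_proj m F i)" using i by (simp add: flag_proj_def)
qed

lemma homeomorphic_flag_proj:
  assumes ad: "adm TYPE('d::finite) m k" "1 \<le> k"
  shows "homeomorphic_map (subtopology (flag_topology m) (comp_D b m k :: ('d + 'd) flag set))
    (subtopology (flag_topology (m - 1)) (Fl_C m k)) (flag_proj m)"
proof (rule homeomorphic_map_compact[OF comp_D_topology(1)[OF ad(1)] Hausdorff_flag continuous_flag_proj bij_flag_proj[OF ad]])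
  show "Fl_C m k \<subseteq> topspace (flag_topology (m - 1) :: ('d + 'd) flag topology)"
  proof
    fix F assume "F \<in> (Fl_C m k :: ('d + 'd) flag set)"
    then have "F \<in> Y (m - 1)" by (simp add: Fl_C_def)
    then show "F \<in> topspace (flag_topology (m - 1))" unfolding topspace_flag by (simp add: Y_def PiE_def)
  qed
qed

lemma homeomorphic_Psi:
  assumes ad: "adm TYPE('d::finite) m k"
  shows "homeomorphic_map (subtopology (S_topology m) (S_par b m k))
    (subtopology (flag_topology m) (comp_D b m k :: ('d + 'd) flag set)) (Psi (m - k) m)"
proof (rule homeomorphic_map_compact[OF compact_S_par Hausdorff_flag continuous_Psi[OF adm_bounds(3)[OF ad]]])
  show "bij_betw (Psi (m - k) m) (S_par b m k) (comp_D b m k :: ('d + 'd) flag set)"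
    unfolding bij_betw_def comp_D_def
    using inj_on_subset[OF inj_Psi[where 'd = 'd, OF adm_bounds(3)[OF ad]] S_par_sphere] by blast
  show "comp_D b m k \<subseteq> topspace (flag_topology m :: ('d + 'd) flag topology)"
    using compactin_subset_topspace[OF comp_D_topology(1)[OF ad]] .
qed

text \<open>The two parts are compact in a Hausdorff space and complementary to each other, hence
  open and closed; being connected and nonempty they are the components.\<close>

lemma connected_components_Fl_D:
  assumes ad: "adm TYPE('d::finite) m k" "1 \<le> k"
  shows "connected_components_of (subtopology (flag_topology m) (Fl_D m k :: ('d + 'd) flag set)) = {comp_D True m k, comp_D False m k}"
proof -
  let ?X = "subtopology (flag_topology m) (Fl_D m k :: ('d + 'd) flag set)"
  have sub: "comp_D b m k \<subseteq> (Fl_D m k :: ('d + 'd) flag set)" for b unfolding Fl_D_eq[OF ad(1)] by (cases b) auto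
  have top: "topspace ?X = comp_D True m k \<union> comp_D False m k"
    using compactin_subset_topspace[OF comp_D_topology(1)[OF ad(1), of True]]
      compactin_subset_topspace[OF comp_D_topology(1)[OF ad(1), of False]] Fl_D_eq[OF ad(1)] by auto
  have cl: "closedin ?X (comp_D b m k)" for b
    using comp_D_topology(3)[OF ad(1)] sub by (simp add: closedin_subset_topspace)
  have "comp_D True m k = topspace ?X - comp_D False m k" "comp_D False m k = topspace ?X - comp_D True m k"
    unfolding top using comp_D_disjoint[OF ad(1)] by auto
  then have op: "openin ?X (comp_D b m k)" for b using cl by (cases b) (metis openin_closedin_eq openin_diff openin_topspace)+
  have ne: "comp_D b m k \<noteq> ({} :: ('d + 'd) flag set)" for b using S_par_nonempty[OF ad] by (simp add: comp_D_def)
  have con: "connectedin ?X (comp_D b m k)" for b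
    using comp_D_topology(2)[OF ad(1)] sub by (simp add: connectedin_subtopology)
  have comp: "comp_D b m k \<in> connected_components_of ?X" for b
  proof -
    obtain F :: "('d + 'd) flag" where F: "F \<in> comp_D b m k" using ne by blast
    have "F \<in> topspace ?X" using F top by (cases b) auto
    then have "F \<in> connected_component_of_set ?X F" by (simp add: connected_component_of_refl)
    then have "\<not> disjnt (connected_component_of_set ?X F) (comp_D b m k)" using F by (auto simp: disjnt_iff)
    then have "connected_component_of_set ?X F \<subseteq> comp_D b m k"
      using connectedin_clopen_cases[OF connectedin_connected_component_of[of ?X F] cl[of b] op[of b]] by blast
    moreover have "comp_D b m k \<subseteq> connected_component_of_set ?X F"
      by (rule connected_component_of_maximal[OF con F])
    ultimately have "comp_D b m k = connected_component_of_set ?X F" by blast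
    then show ?thesis unfolding connected_components_of_def
      using F connectedin_subset_topspace[OF con[of b]] by blast
  qed
  show ?thesis
  proof
    show "{comp_D True m k, comp_D False m k} \<subseteq> connected_components_of ?X" using comp by blast
    show "connected_components_of ?X \<subseteq> {comp_D True m k, comp_D False m k}"
    proof
      fix C assume C: "C \<in> connected_components_of ?X"
      obtain F where F: "F \<in> C" using nonempty_connected_components_of[OF C] by blast
      then obtain b where b: "F \<in> comp_D b m k" using connected_components_of_subset[OF C] top by blast
      have "C = comp_D b m k"
        using connected_components_of_overlap[OF C comp[of b]] F b by blast
      then show "C \<in> {comp_D True m k, comp_D False m k}" by (cases b) auto
    qed
  qed
qed

subsection \<open>Polynomial functions and frames\<close>

lemma polynomial_fun_cong:
  assumes "polynomial_fun n P" "\<And>i. i \<in> {1..n} \<Longrightarrow> w i = w' i"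
  shows "P w = P w'"
  using assms by (induction) auto

lemma polynomial_fun_mono:
  assumes "polynomial_fun n P" "n \<le> n'"
  shows "polynomial_fun n' P"
  using assms by (induction) (auto intro: polynomial_fun.intros)

lemma polynomial_fun_sum:
  assumes "finite I" "\<And>i. i \<in> I \<Longrightarrow> polynomial_fun n (P i)"
  shows "polynomial_fun n (\<lambda>w. \<Sum>i\<in>I. P i w)"
  using assms by (induction I rule: finite_induct) (auto intro: polynomial_fun.intros)

lemma polynomial_fun_prod:
  assumes "finite I" "\<And>i. i \<in> I \<Longrightarrow> polynomial_fun n (P i)"
  shows "polynomial_fun n (\<lambda>w. \<Prod>i\<in>I. P i w)"
  using assms by (induction I rule: finite_induct) (auto intro: polynomial_fun.intros)

lemma polynomial_fun_det:
  fixes A :: "(nat \<Rightarrow> complex ^ 'b::finite) \<Rightarrow> complex ^ 'd ^ 'd"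
  assumes "\<And>i j. polynomial_fun n (\<lambda>w. A w $ i $ j)"
  shows "polynomial_fun n (\<lambda>w. det (A w))"
  unfolding det_def using assms
  by (intro polynomial_fun_sum polynomial_fun.mult polynomial_fun.const polynomial_fun_prod) auto

lemma polynomial_fun_beta_D:
  assumes "i \<in> {1..n}"
  shows "polynomial_fun n (\<lambda>w. beta_D m k (w i) (v :: ('d::finite) hspace))"
  unfolding herm_theta[symmetric] herm_def using assms
  by (intro polynomial_fun_sum polynomial_fun.mult polynomial_fun.const polynomial_fun.coord) auto

lemma beta_D_sum:
  "beta_D m k v (\<Sum>j\<in>J. s j *s h j) = (\<Sum>j\<in>J. s j * beta_D m k v (h j))"
  "beta_D m k (\<Sum>j\<in>J. s j *s h j) v = (\<Sum>j\<in>J. s j * beta_D m k (h j) v)"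
  by (induction J rule: infinite_finite_induct) (simp_all add: beta_add beta_scale)

text \<open>Cramer's rule keeps the solution of a linear system polynomial after multiplication with the
  determinant; the system is padded with an identity block to make the size a type.\<close>

lemma polynomial_solution:
  fixes h :: "nat \<Rightarrow> ('d::finite) hspace" and v :: "'d hspace"
  assumes n: "n \<le> CARD('d)"
  obtains Q u s where "polynomial_fun n Q" "\<forall>c. polynomial_fun n (\<lambda>w. u w $ c)"
    "\<forall>w. u w = Q w *s v + (\<Sum>j=1..n. s w j *s h j)"
    "\<forall>w. Q w \<noteq> 0 \<longrightarrow> (\<forall>i\<in>{1..n}. beta_D m k (w i) (u w) = 0)"
    "\<forall>w t. Q w \<noteq> 0 \<longrightarrow> (\<forall>j\<in>{1..n}. (\<Sum>i=1..n. t i * beta_D m k (w i) (h j)) = 0) \<longrightarrow> (\<forall>i\<in>{1..n}. t i = 0)"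
    "\<forall>w. (\<forall>i\<in>{1..n}. \<forall>j\<in>{1..n}. beta_D m k (w i) (h j) = (if i = j then 1 else 0)) \<longrightarrow> Q w = 1"
proof -
  let ?B = "beta_D m k :: 'd hspace \<Rightarrow> _"
  define M :: "(nat \<Rightarrow> 'd hspace) \<Rightarrow> complex ^ 'd ^ 'd" where
    "M w = (\<chi> i j. if pos i \<le> n \<and> pos j \<le> n then ?B (w (pos i)) (h (pos j)) else if i = j then 1 else 0)" for w
  define b :: "(nat \<Rightarrow> 'd hspace) \<Rightarrow> complex ^ 'd" where
    "b w = (\<chi> i. if pos i \<le> n then - ?B (w (pos i)) v else 0)" for w
  define c where "c w j = det (\<chi> i j'. if j' = j then b w $ i else M w $ i $ j')" for w j
  define s where "s w j = c w (idx j)" for w j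
  define Q where "Q w = det (M w)" for w
  define u where "u w = Q w *s v + (\<Sum>j=1..n. s w j *s h j)" for w
  have sum_pos: "(\<Sum>d\<in>(UNIV :: 'd set). if pos d \<le> n then g (pos d) d else 0) = (\<Sum>j=1..n. g j (idx j))"
    for g :: "nat \<Rightarrow> 'd \<Rightarrow> complex"
  proof -
    have "(\<Sum>d\<in>(UNIV :: 'd set). if pos d \<le> n then g (pos d) d else 0) =
        (\<Sum>j=1..CARD('d). if j \<le> n then g j (idx j) else 0)"
      unfolding sum.reindex_bij_betw[OF idx_bij, symmetric] by (intro sum.cong) auto
    also have "\<dots> = (\<Sum>j=1..n. g j (idx j))"
      using n by (intro sum.mono_neutral_cong_right) auto
    finally show ?thesis .
  qed
  have polM: "polynomial_fun n (\<lambda>w. M w $ i $ j)" for i j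
  proof (cases "pos i \<le> n \<and> pos j \<le> n")
    case True
    then have "pos i \<in> {1..n}" using pos_range(1)[of i] by simp
    then have "polynomial_fun n (\<lambda>w. ?B (w (pos i)) (h (pos j)))" by (rule polynomial_fun_beta_D)
    then show ?thesis using True by (simp add: M_def)
  next
    case False
    then show ?thesis by (auto simp: M_def polynomial_fun.const)
  qed
  have polb: "polynomial_fun n (\<lambda>w. b w $ i)" for i
  proof (cases "pos i \<le> n")
    case True
    then have "pos i \<in> {1..n}" using pos_range(1)[of i] by simp
    then have "polynomial_fun n (\<lambda>w. (- 1) * ?B (w (pos i)) v)"
      by (intro polynomial_fun.mult polynomial_fun.const polynomial_fun_beta_D)
    then show ?thesis using True by (simp add: b_def)
  qed (simp add: b_def polynomial_fun.const)
  have polc: "polynomial_fun n (\<lambda>w. c w j)" for j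
    unfolding c_def
  proof (rule polynomial_fun_det)
    fix i j'
    show "polynomial_fun n (\<lambda>w. (\<chi> i j'. if j' = j then b w $ i else M w $ i $ j') $ i $ j')"
      using polM polb by (cases "j' = j") simp_all
  qed
  have polQ: "polynomial_fun n Q" unfolding Q_def[abs_def] by (rule polynomial_fun_det[OF polM])
  have polu: "polynomial_fun n (\<lambda>w. u w $ e)" for e
    unfolding u_def s_def using polc polQ
    by (auto intro!: polynomial_fun.add polynomial_fun.mult polynomial_fun_sum polynomial_fun.const)
  have orth: "?B (w i) (u w) = 0" if Q: "Q w \<noteq> 0" and i: "i \<in> {1..n}" for w i
  proof -
    let ?i = "idx i :: 'd"
    have pi: "pos ?i = i" using i n by simp
    define y where "y = (\<chi> j. c w j / Q w)"
    have "M w *v y = b w" using cramer[of "M w" y "b w"] Q unfolding Q_def y_def c_def by simp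
    then have "(\<Sum>d\<in>UNIV. M w $ ?i $ d * (c w d / Q w)) = b w $ ?i"
      unfolding y_def matrix_vector_mult_def by (auto simp: vec_eq_iff)
    moreover have "(\<Sum>d\<in>UNIV. M w $ ?i $ d * (c w d / Q w)) =
        (\<Sum>d\<in>UNIV. if pos d \<le> n then ?B (w i) (h (pos d)) * (c w d / Q w) else 0)"
    proof (intro sum.cong refl)
      fix d :: 'd
      have "?i \<noteq> d" if "\<not> pos d \<le> n" using that i pi by auto
      then show "M w $ ?i $ d * (c w d / Q w) = (if pos d \<le> n then ?B (w i) (h (pos d)) * (c w d / Q w) else 0)"
        using i pi by (auto simp: M_def)
    qed
    ultimately have "(\<Sum>j=1..n. ?B (w i) (h j) * (s w j / Q w)) = - ?B (w i) v"
      using sum_pos[of "\<lambda>j d. ?B (w i) (h j) * (c w d / Q w)"] i pi by (simp add: b_def s_def)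
    then have "Q w * (\<Sum>j=1..n. ?B (w i) (h j) * (s w j / Q w)) = - Q w * ?B (w i) v" by simp
    then have "(\<Sum>j=1..n. s w j * ?B (w i) (h j)) = - Q w * ?B (w i) v"
      using Q by (simp add: sum_distrib_left mult.commute)
    then show ?thesis unfolding u_def by (simp add: beta_add beta_scale beta_D_sum)
  qed
  \<comment> \<open>The determinant being nonzero also kills row relations; this will say that a
    Lagrangian containing the \<open>h j\<close> meets the span of the frame trivially.\<close>
  have inj: "\<forall>i\<in>{1..n}. t i = 0"
    if Q: "Q w \<noteq> 0" and t: "\<forall>j\<in>{1..n}. (\<Sum>i=1..n. t i * ?B (w i) (h j)) = 0" for w t
  proof -
    define y :: "complex ^ 'd" where "y = (\<chi> d. if pos d \<le> n then t (pos d) else 0)"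
    have "(transpose (M w) *v y) $ e = 0" for e
    proof -
      have "(transpose (M w) *v y) $ e = (\<Sum>d\<in>UNIV. if pos d \<le> n then M w $ d $ e * t (pos d) else 0)"
        unfolding matrix_vector_mult_def transpose_def y_def by (auto intro: sum.cong)
      also have "\<dots> = (\<Sum>j=1..n. M w $ idx j $ e * t j)" by (rule sum_pos)
      also have "\<dots> = 0"
      proof (cases "pos e \<le> n")
        case True
        then have e: "pos e \<in> {1..n}" using pos_range(1)[of e] by simp
        have "(\<Sum>j=1..n. M w $ idx j $ e * t j) = (\<Sum>j=1..n. t j * ?B (w j) (h (pos e)))"
          using True n by (intro sum.cong) (auto simp: M_def)
        then show ?thesis using bspec[OF t e] by simp
      next
        case False
        have "(idx j :: 'd) \<noteq> e" if "j \<in> {1..n}" for j using that n False by auto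
        then show ?thesis using False by (intro sum.neutral) (auto simp: M_def)
      qed
      finally show ?thesis .
    qed
    then have "transpose (M w) *v y = 0" by (simp add: vec_eq_iff)
    moreover have "invertible (transpose (M w))" using Q by (simp add: Q_def invertible_det_nz det_transpose)
    ultimately have y0: "y = 0" using matrix_left_invertible_ker[of "transpose (M w)"] by (metis invertible_def)
    show ?thesis
    proof
      fix i assume i: "i \<in> {1..n}"
      then have "y $ idx i = t i" using n by (simp add: y_def)
      then show "t i = 0" using y0 by simp
    qed
  qed
  have one: "Q w = 1" if *: "\<forall>i\<in>{1..n}. \<forall>j\<in>{1..n}. ?B (w i) (h j) = (if i = j then 1 else 0)" for w
  proof -
    have "M w $ i $ j = mat 1 $ i $ j" for i j
    proof (cases "pos i \<le> n \<and> pos j \<le> n")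
      case True
      then have "?B (w (pos i)) (h (pos j)) = (if pos i = pos j then 1 else 0)"
        using pos_range(1)[of i] pos_range(1)[of j] by (intro *[rule_format]) auto
      moreover have "pos i = pos j \<longleftrightarrow> i = j" using idx_pos by metis
      ultimately show ?thesis using True by (simp add: M_def mat_def)
    qed (auto simp: M_def mat_def)
    then have "M w = mat 1" by (simp add: vec_eq_iff)
    then show ?thesis by (simp add: Q_def det_I)
  qed
  show ?thesis by (rule that[of Q u s]) (use polQ polu orth inj one u_def in blast)+
qed

lemma is_frame_flag: "is_frame m (flag m a) (wv a)"
  by (auto simp: is_frame_def flag_def Fs_def)

lemma is_frame_proj: "is_frame m F w \<Longrightarrow> is_frame (m - 1) (flag_proj m F) w"
  by (auto simp: is_frame_def flag_proj_def)

lemma variety_morphism_flag_proj: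
  assumes m: "m \<le> CARD('d)" and X: "X \<subseteq> (Y m :: ('d::finite + 'd) flag set)" and im: "flag_proj m ` X \<subseteq> X'"
  shows "variety_morphism m X (m - 1) X' (flag_proj m)"
  unfolding variety_morphism_def
proof (intro conjI ballI)
  fix F assume F: "F \<in> X"
  then obtain a where a: "units a m" "F = flag m a" using Y_flag[of F m] X m by blast
  have "\<forall>i\<in>{1..m - 1}. \<forall>c. polynomial_fun m (\<lambda>w :: nat \<Rightarrow> 'd hspace. w i $ c)"
    by (intro ballI allI polynomial_fun.coord) auto
  moreover have "is_frame m F (wv a)" unfolding a(2) by (rule is_frame_flag)
  ultimately show "\<exists>Q P. polynomial_fun m Q \<and> (\<forall>i\<in>{1..m - 1}. \<forall>c. polynomial_fun m (\<lambda>w. P w i $ c)) \<and>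
      (\<exists>w. is_frame m F w \<and> Q w \<noteq> 0) \<and> (\<forall>y\<in>X. \<forall>w. is_frame m y w \<and> Q w \<noteq> 0 \<longrightarrow> is_frame (m - 1) (flag_proj m y) (P w))"
    by (intro exI[of _ "\<lambda>_. 1"] exI[of _ "\<lambda>w. w"]) (auto simp: is_frame_proj polynomial_fun.const simp del: One_nat_def)
qed (rule im)

lemma flag_proj_Y:
  assumes m: "m \<le> CARD('d)"
  shows "flag_proj m ` (Y m :: ('d::finite + 'd) flag set) \<subseteq> Y (m - 1)"
proof
  fix G assume "G \<in> flag_proj m ` (Y m :: ('d + 'd) flag set)"
  then obtain F where F: "F \<in> (Y m :: ('d + 'd) flag set)" "G = flag_proj m F" by blast
  obtain a where a: "units a m" "F = flag m a" using Y_flag[OF F(1) m] .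
  show "G \<in> Y (m - 1)"
    unfolding F(2) a(2) flag_proj_flag using m units_mono[OF a(1), of "m - 1"] by (intro flag_in_Y) auto
qed

subsection \<open>The inverse morphism\<close>

lemma dim_span_orthonormal:
  assumes "\<And>i j. i \<in> {1..n} \<Longrightarrow> j \<in> {1..n} \<Longrightarrow> herm (g i) (g j) = (if i = j then 1 else (0 :: complex))"
  shows "vec.dim (vec.span (g ` {1..n})) = n"
  using assms
proof (induction n)
  case (Suc n)
  have "g (Suc n) \<notin> vec.span (g ` {1..n})"
  proof
    assume "g (Suc n) \<in> vec.span (g ` {1..n})"
    moreover have "herm (g (Suc n)) w = 0" if w: "w \<in> g ` {1..n}" for w
    proof -
      obtain j where "j \<in> {1..n}" "w = g j" using w by blast
      then show ?thesis using Suc.prems[of "Suc n" j] by simp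
    qed
    ultimately have "herm (g (Suc n)) (g (Suc n)) = 0" using herm_span by blast
    then show False using Suc.prems[of "Suc n" "Suc n"] by simp
  qed
  moreover have "{1..Suc n} = insert (Suc n) {1..n}" by auto
  then have "g ` {1..Suc n} = insert (g (Suc n)) (g ` {1..n})" by (simp only: image_insert)
  moreover have "vec.dim (g ` {1..n}) = n" using Suc.IH[OF Suc.prems] vec.dim_span[of "g ` {1..n}"] by simp
  ultimately show ?case unfolding vec.dim_span by (simp add: vec.dim_insert)
qed simp

lemma dim_inter_line:
  fixes N G :: "(complex ^ 'b) set"
  assumes N: "vec.subspace N" and G: "vec.subspace G" "N \<inter> G = {0}" and u: "u \<in> N" "u \<noteq> 0"
  shows "vec.dim (N \<inter> vec.span (insert u G)) = 1"
proof -
  have "N \<inter> vec.span (insert u G) = vec.span {u}"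
  proof
    show "N \<inter> vec.span (insert u G) \<subseteq> vec.span {u}"
    proof
      fix x assume x: "x \<in> N \<inter> vec.span (insert u G)"
      then obtain t where t: "x - t *s u \<in> vec.span G" by (auto simp: vec.span_insert)
      then have "x - t *s u \<in> G" using vec.span_minimal[OF subset_refl G(1)] by blast
      moreover have "x - t *s u \<in> N" using x u N by (intro vec.subspace_diff vec.subspace_scale) auto
      ultimately have "x - t *s u = 0" using G(2) by blast
      then have xt: "x = t *s u" by simp
      show "x \<in> vec.span {u}" unfolding xt by (rule vec.span_scale[OF vec.span_base]) simp
    qed
    have "vec.span {u} \<subseteq> N" using u N by (intro vec.span_minimal) auto
    moreover have "vec.span {u} \<subseteq> vec.span (insert u G)" by (rule vec.span_mono) simp
    ultimately show "vec.span {u} \<subseteq> N \<inter> vec.span (insert u G)" by blast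
  qed
  then show ?thesis using u(2) by (simp add: vec.dim_insert)
qed

lemma comp_D_flag:
  assumes ad: "adm TYPE('d::finite) m k" and a: "units a m" "FD TYPE('d) m k a"
  shows "\<exists>b. (flag m a :: ('d + 'd) flag) \<in> comp_D b m k"
proof -
  have "(flag m a :: ('d + 'd) flag) \<in> Fl_D m k" using flag_in_Fl_D[where 'd = 'd, OF adm_bounds(3)[OF ad] a(1)] a(2) by blast
  then show ?thesis unfolding Fl_D_eq[OF ad] by blast
qed

lemma comp_D_imp_flag:
  assumes ad: "adm TYPE('d::finite) m k" and F: "F \<in> (comp_D b m k :: ('d + 'd) flag set)"
  obtains a where "units a m" "F = flag m a" "FD TYPE('d) m k a"
proof -
  have "F \<in> Fl_D m k" using F Fl_D_eq[OF ad] by (cases b) auto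
  moreover then obtain a where a: "units a m" "F = flag m a"
    using Y_flag[of F m] adm_bounds(3)[OF ad] by (auto simp: Fl_D_def)
  ultimately show ?thesis using that flag_in_Fl_D[where 'd = 'd, OF adm_bounds(3)[OF ad] a(1)] by blast
qed

lemma comp_D_parity:
  assumes ad: "adm TYPE('d::finite) m k" and N: "lagrangian m k (N :: 'd hspace set)" and m: "1 \<le> m"
    and F: "F \<in> comp_D b m k" "G \<in> comp_D b' m k" and d: "vec.dim (N \<inter> F m) = vec.dim (N \<inter> G m)"
  shows "b = b'"
proof -
  obtain n where n: "\<forall>b. \<forall>x\<in>S_par b m k. even (vec.dim (N \<inter> Fs (seq (m - k) x) m) + n) = b"
    using S_par_parity[OF ad N] by blast
  have "even (vec.dim (N \<inter> F m) + n) = b" if F: "F \<in> comp_D b m k" for F b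
  proof -
    obtain x where x: "x \<in> S_par b m k" "F = Psi (m - k) m x" using F by (auto simp: comp_D_def)
    have "F m = Fs (seq (m - k) x) m" using m unfolding x(2) Psi_def flag_def by simp
    then show ?thesis using n x(1) by simp
  qed
  then show ?thesis using F d by metis
qed

text \<open>This frame spans the Lagrangian \<open>N\<close> of the inverse morphism: it meets \<open>Fs a m\<close> in the line of
  \<open>wv a m\<close>, because isotropy makes \<open>theta\<close> map \<open>Fs a m\<close> to its hermitian complement.\<close>

definition dual_frame :: "nat \<Rightarrow> nat \<Rightarrow> (nat \<Rightarrow> complex ^ 2) \<Rightarrow> nat \<Rightarrow> ('d::finite) hspace" where
  "dual_frame m k a j = (if j = m then wv a m else theta m k (wv a j))"

text \<open>The third claim makes the Gram matrix of the first \<open>m - 1\<close> vectors against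
  the dual frame the identity, so that the determinant \<open>Q\<close> equals one at the flag
  around which the inverse is built.\<close>

lemma lagrangian_dual_frame:
  fixes a :: "nat \<Rightarrow> complex ^ 2"
  assumes ad: "adm TYPE('d::finite) m k" and a: "units a m" "FD TYPE('d) m k a"
  shows "lagrangian m k (vec.span (dual_frame m k a ` {1..m}) :: 'd hspace set)"
    "\<And>i j. i \<in> {1..m} \<Longrightarrow> j \<in> {1..m} \<Longrightarrow>
      herm (dual_frame m k a i :: 'd hspace) (dual_frame m k a j) = (if i = j then 1 else 0)"
    "\<And>i j. i \<in> {1..m} \<Longrightarrow> j \<in> {1..m} \<Longrightarrow> j \<noteq> m \<Longrightarrow>
      beta_D m k (wv a i) (dual_frame m k a j :: 'd hspace) = (if i = j then 1 else 0)"
proof -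
  let ?w = "wv a :: nat \<Rightarrow> 'd hspace" and ?t = "theta m k :: 'd hspace \<Rightarrow> _"
  let ?g = "dual_frame m k a :: nat \<Rightarrow> 'd hspace"
  note lag = FD_lagrangian[OF ad a]
  have mN: "m \<le> CARD('d)" using adm_bounds[OF ad] by simp
  have wF: "?w i \<in> Fs a m" if "i \<in> {1..m}" for i using that by (intro wv_in_Fs) auto
  have ED: "?w i \<in> ED m k" if "i \<in> {1..m}" for i using lag wF[OF that] unfolding lagrangian_def by blast
  have on: "herm (?w i) (?w j) = (if i = j then 1 else 0)" if "i \<in> {1..m}" "j \<in> {1..m}" for i j
    using wv_orthonormal[where 'd = 'd, OF a(1) mN] that by simp
  have iso: "beta_D m k (?w i) (?w j) = 0" if "i \<in> {1..m}" "j \<in> {1..m}" for i j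
    using lag wF[OF that(1)] wF[OF that(2)] unfolding lagrangian_def by (blast dest: isotropicD)
  have wt: "herm (?w i) (?t (?w j)) = 0" "herm (?t (?w j)) (?w i) = 0" if "i \<in> {1..m}" "j \<in> {1..m}" for i j
    using iso[OF that] herm_theta[of "?w i" m k "?w j"] herm_eq_0_commute[of "?t (?w j)" "?w i"] by simp_all
  have bt: "beta_D m k (?w i) (?t (?w j)) = (if i = j then 1 else 0)" if "i \<in> {1..m}" "j \<in> {1..m}" for i j
    using herm_theta[of "?w i" m k "?t (?w j)"] theta_ED(2)[OF ad ED[OF that(2)]] on[OF that] by simp
  then show "beta_D m k (?w i) (?g j) = (if i = j then 1 else 0)" if "i \<in> {1..m}" "j \<in> {1..m}" "j \<noteq> m" for i j
    using that by (simp add: dual_frame_def)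
  have tt: "beta_D m k (?t (?w i)) (?t (?w j)) = 0" if "i \<in> {1..m}" "j \<in> {1..m}" for i j
    using herm_theta[of "?t (?w i)" m k "?t (?w j)"] theta_ED(2)[OF ad ED[OF that(2)]] wt(2)[OF that(2,1)] by simp
  show gon: "herm (?g i) (?g j) = (if i = j then 1 else 0)" if "i \<in> {1..m}" "j \<in> {1..m}" for i j
    using on[OF that] on[OF that(2,1)] wt[of m i] wt[of m j] herm_theta_theta[OF ad ED[OF that(2)], of "?w i"] that
    by (auto simp: dual_frame_def)
  have gED: "?g i \<in> ED m k" if "i \<in> {1..m}" for i
    using ED[of m] theta_ED(1)[OF ad ED[OF that]] that by (auto simp: dual_frame_def)
  have giso: "beta_D m k (?g i) (?g j) = 0" if "i \<in> {1..m}" "j \<in> {1..m}" for i j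
    using iso[of m m] tt[OF that] bt[of m j] bt[of m i] beta_D_sym[OF ad, of "?t (?w i)" "?w m"] that
    by (auto simp: dual_frame_def)
  have "beta_D m k v w = 0" if "v \<in> vec.span (?g ` {1..m})" "w \<in> vec.span (?g ` {1..m})" for v w
  proof (rule bilinear_form_eq[OF bilinear_beta_D _ _ that])
    show "bilinear_form (\<lambda>_ _ :: 'd hspace. 0)" by (simp add: bilinear_form_def)
  qed (use giso in blast)
  moreover have "vec.span (?g ` {1..m}) \<subseteq> ED m k" using gED by (intro vec.span_minimal) auto
  moreover have "vec.dim (vec.span (?g ` {1..m})) = m" by (rule dim_span_orthonormal) (rule gon)
  ultimately show "lagrangian m k (vec.span (?g ` {1..m}))" unfolding lagrangian_def isotropic_def by simp
qed

text \<open>Modulo \<open>Fs a l\<close> the vector \<open>u\<close> lies in the range of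
  \<open>Bm a l\<close>, since its image under \<open>nilp\<close> lies in \<open>Fs a l\<close>;
  normalizing gives the line.\<close>

lemma isotropic_lift:
  fixes a :: "nat \<Rightarrow> complex ^ 2" and u :: "('d::finite) hspace"
  assumes ad: "adm TYPE('d) (Suc l) k" "1 \<le> k" and un: "units a l" and FC: "FC TYPE('d) (Suc l) k a"
    and u: "u \<in> ED (Suc l) k" "\<And>v. v \<in> Fs a l \<Longrightarrow> beta_D (Suc l) k u v = 0" "beta_D (Suc l) k u u = 0" "u \<notin> Fs a l"
  obtains b where "herm b b = 1" "FD TYPE('d) (Suc l) k (a(Suc l := b))"
    "Fs (a(Suc l := b)) (Suc l) = vec.span (insert u (Fs a l))"
proof -
  have lN: "l < CARD('d)" using adm_bounds(3)[OF ad(1)] by simp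
  note P = FC_imp_perp[OF ad un FC]
  have "u \<in> perp (Suc l) k (Fs a l)" using u by (simp add: perp_def)
  then have "nilp u \<in> Fs a l" unfolding P by simp
  then obtain f y where f: "f \<in> Fs a l" "u = f + Bm a l y" using nilp_preimage_Fs_ex[OF lN un] by blast
  have "y \<noteq> 0" using f u(4) by auto
  then obtain c b where b: "c \<noteq> 0" "y = c *s b" "herm b b = 1" by (rule normalize_vec)
  let ?B = "Bm a l b :: 'd hspace"
  have uB: "u = f + c *s ?B" using f(2) b(2) by (simp add: Bm_scale)
  then have cB: "c *s ?B = u - f" by simp
  have "f \<in> perp (Suc l) k (Fs a l)" unfolding P using nilp_Fs_self[of l f a] f(1) lN by simp
  then have ff: "beta_D (Suc l) k f f = 0" using f(1) by (simp add: perp_def)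
  have uf: "beta_D (Suc l) k u f = 0" "beta_D (Suc l) k f u = 0"
    using u(2)[OF f(1)] beta_D_sym[OF ad(1), of u f] by simp_all
  have "beta_D (Suc l) k (c *s ?B) (c *s ?B) = 0" unfolding cB by (simp add: beta_diff uf ff u(3))
  then have "beta_D (Suc l) k ?B ?B = 0" using b(1) by (simp add: beta_scale)
  then have FD: "FD TYPE('d) (Suc l) k (a(Suc l := b))" using lift_iff[OF ad un FC b(3)] by blast
  let ?H = "Fs (a(Suc l := b)) (Suc l) :: 'd hspace set"
  have eqs: "Fs (a(Suc l := b)) l = (Fs a l :: 'd hspace set)" "wv (a(Suc l := b)) (Suc l) = ?B"
    using Fs_update(1,3)[where 'd = 'd, OF un b(3)] by auto
  have "?H = vec.span (insert u (Fs a l))"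
  proof
    have "v \<in> vec.span (insert u (Fs a l))" if v: "v \<in> ?H" for v
    proof -
      obtain f' t where f': "f' \<in> Fs a l" "v = f' + t *s ?B" using Fs_Suc_ex[OF v] eqs by auto
      have "?B = (1 / c) *s (u - f)" unfolding cB[symmetric] using b(1) by (simp add: vector_smult_assoc)
      moreover have "u - f \<in> vec.span (insert u (Fs a l))" using f(1) by (intro vec.span_diff vec.span_base) auto
      ultimately have "?B \<in> vec.span (insert u (Fs a l))" by (metis vec.span_scale)
      then show ?thesis unfolding f'(2) using f'(1) by (intro vec.span_add vec.span_scale) (auto intro: vec.span_base)
    qed
    then show "?H \<subseteq> vec.span (insert u (Fs a l))" by blast
    have "u \<in> ?H" using Fs_SucI[of f "a(Suc l := b)" l c] f(1) eqs uB by simp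
    moreover have "Fs a l \<subseteq> ?H" unfolding eqs(1)[symmetric] by (rule Fs_mono) simp
    ultimately show "vec.span (insert u (Fs a l)) \<subseteq> ?H" by (intro vec.span_minimal) auto
  qed
  then show ?thesis using that b(3) FD by blast
qed

lemma span_image_sum:
  fixes w :: "nat \<Rightarrow> complex ^ 'b"
  assumes "v \<in> vec.span (w ` {1..n})"
  shows "\<exists>t. v = (\<Sum>i=1..n. t i *s w i)"
  using assms
proof (induction n arbitrary: v)
  case (Suc n)
  have "{1..Suc n} = insert (Suc n) {1..n}" by auto
  then have "w ` {1..Suc n} = insert (w (Suc n)) (w ` {1..n})" by (simp only: image_insert)
  then obtain c where "v - c *s w (Suc n) \<in> vec.span (w ` {1..n})" using Suc.prems by (auto simp: vec.span_insert)
  then obtain t where t: "v - c *s w (Suc n) = (\<Sum>i=1..n. t i *s w i)" using Suc.IH by blast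
  have "v = (\<Sum>i=1..n. t i *s w i) + c *s w (Suc n)" unfolding t[symmetric] by simp
  also have "\<dots> = (\<Sum>i=1..Suc n. (t(Suc n := c)) i *s w i)" by simp
  finally show ?case by blast
qed simp

lemma herm_sum_left: "herm (\<Sum>j\<in>J. f j) w = (\<Sum>j\<in>J. herm (f j) w)"
  by (induction J rule: infinite_finite_induct) (simp_all add: herm_add_left)

lemma span_insert_span: "vec.span (insert x (vec.span S)) = vec.span (insert x (S :: (complex ^ 'b) set))"
  by (simp add: vec.span_insert vec.span_span)

lemma Fs_Suc_span: "Fs a (Suc i) = vec.span (insert (wv a (Suc i)) (Fs a i))"
proof -
  have "{1..Suc i} = insert (Suc i) {1..i}" by auto
  then show ?thesis unfolding Fs_def span_insert_span by simp
qed

text \<open>The new frame vector \<open>u w\<close> lies in \<open>N\<close> and is orthogonal to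
  the first \<open>m - 1\<close> vectors, so it yields an isotropic extension. This extension meets
  \<open>N\<close> in a line, as \<open>F0\<close> does. Hence it has the parity \<open>b\<close>,
  and by injectivity of the projection it is the flag sought.\<close>

lemma flag_proj_local_inverse:
  assumes ad: "adm TYPE('d::finite) m k" "1 \<le> k" and F0: "F0 \<in> (comp_D b m k :: ('d + 'd) flag set)"
  shows "\<exists>Q P. polynomial_fun (m - 1) Q \<and> (\<forall>i\<in>{1..m}. \<forall>c. polynomial_fun (m - 1) (\<lambda>w. P w i $ c)) \<and>
    (\<exists>w. is_frame (m - 1) (flag_proj m F0) w \<and> Q w \<noteq> 0) \<and>
    (\<forall>F\<in>comp_D b m k. \<forall>w. is_frame (m - 1) (flag_proj m F) w \<and> Q w \<noteq> 0 \<longrightarrow> is_frame m F (P w))"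
proof -
  have m: "m \<le> CARD('d)" "1 \<le> m" using adm_bounds[OF ad(1)] ad(2) by simp_all
  then obtain l where l: "m = Suc l" by (cases m) auto
  have lN: "l \<le> CARD('d)" using m l by simp
  obtain a0 where a0: "units a0 m" "F0 = flag m a0" "FD TYPE('d) m k a0" by (rule comp_D_imp_flag[OF ad(1) F0])
  define h where "h j = theta m k (wv a0 j :: 'd hspace)" for j
  let ?v = "wv a0 m :: 'd hspace"
  let ?g = "dual_frame m k a0 :: nat \<Rightarrow> 'd hspace"
  define N where "N = vec.span (?g ` {1..m})"
  obtain Q u s where pol: "polynomial_fun l Q" "\<forall>c. polynomial_fun l (\<lambda>w. u w $ c)"
    and u': "\<forall>w. u w = Q w *s ?v + (\<Sum>j=1..l. s w j *s h j)"
    and orth: "\<forall>w. Q w \<noteq> 0 \<longrightarrow> (\<forall>i\<in>{1..l}. beta_D m k (w i) (u w) = 0)"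
    and indep: "\<forall>w t. Q w \<noteq> 0 \<longrightarrow> (\<forall>j\<in>{1..l}. (\<Sum>i=1..l. t i * beta_D m k (w i) (h j)) = 0) \<longrightarrow> (\<forall>i\<in>{1..l}. t i = 0)"
    and one: "\<forall>w. (\<forall>i\<in>{1..l}. \<forall>j\<in>{1..l}. beta_D m k (w i) (h j) = (if i = j then 1 else 0)) \<longrightarrow> Q w = 1"
    by (rule polynomial_solution[OF lN, where h = h and v = ?v and m = m and k = k])
  note u = u'[rule_format]
  define P where "P w = w(m := u w)" for w
  note dual = lagrangian_dual_frame[OF ad(1) a0(1,3)]
  have lagN: "lagrangian m k N" unfolding N_def by (rule dual(1))
  have gh: "?g j = h j" if "j \<in> {1..l}" for j using that l by (simp add: dual_frame_def h_def)
  have gm: "?g m = ?v" by (simp add: dual_frame_def)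
  have gN: "?g j \<in> N" if "j \<in> {1..m}" for j unfolding N_def using that by (intro vec.span_base) simp
  have hN: "h j \<in> N" if "j \<in> {1..l}" for j using gN[of j] gh[OF that] that l by simp
  have vN: "?v \<in> N" using gN[of m] gm m by simp
  have subN: "vec.subspace N" and isoN: "isotropic (beta_D m k) N" and NED: "N \<subseteq> ED m k"
    using lagN by (auto simp: lagrangian_def)
  have uN: "u w \<in> N" for w
    unfolding u using hN vN subN by (intro vec.subspace_add vec.subspace_sum vec.subspace_scale) auto
  \<comment> \<open>The vector \<open>?v\<close> is orthogonal to all \<open>h j\<close>, so the
    hermitian product of \<open>u w\<close> with it is the coefficient \<open>Q w\<close>.\<close>
  have u0: "u w \<noteq> 0" if "Q w \<noteq> 0" for w
  proof -
    have hv: "herm (h j) ?v = 0" if j: "j \<in> {1..l}" for j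
      using dual(2)[of j m] gh[OF j] gm j l by simp
    have vv: "herm ?v ?v = 1" using dual(2)[of m m] gm m by simp
    have "herm (u w) ?v = Q w" unfolding u by (simp add: herm_simps herm_sum_left vv hv)
    then show ?thesis using that by auto
  qed
  \<comment> \<open>A vector of \<open>N\<close> is orthogonal to every \<open>h j\<close>; expanded
    in the frame this is a linear system with invertible matrix.\<close>
  have NG: "N \<inter> vec.span (w ` {1..l}) = {0}" if Q: "Q w \<noteq> 0" for w
  proof -
    have "x = 0" if x: "x \<in> N" "x \<in> vec.span (w ` {1..l})" for x
    proof -
      obtain t where t: "x = (\<Sum>i=1..l. t i *s w i)" using span_image_sum[OF x(2)] by blast
      have "(\<Sum>i=1..l. t i * beta_D m k (w i) (h j)) = 0" if "j \<in> {1..l}" for j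
        using isotropicD[OF isoN x(1) hN[OF that]] unfolding t beta_D_sum .
      then have "\<forall>i\<in>{1..l}. t i = 0" using indep Q by blast
      then show ?thesis unfolding t by simp
    qed
    then show ?thesis using vec.subspace_0[OF subN] vec.span_zero by blast
  qed
  have Q1: "Q (wv a0) = 1"
  proof (intro one[THEN spec, THEN mp] ballI)
    fix i j assume ij: "i \<in> {1..l}" "j \<in> {1..l}"
    then show "beta_D m k (wv a0 i) (h j) = (if i = j then 1 else 0)" using dual(3)[of i j] gh[OF ij(2)] l by simp
  qed
  have d0: "vec.dim (N \<inter> F0 m) = 1"
  proof -
    have "F0 m = vec.span (insert ?v (Fs a0 l))" using m l unfolding a0(2) flag_def by (simp add: Fs_Suc_span)
    moreover have "?v \<noteq> 0" using herm_wv_self[where 'd = 'd, of m a0] m a0(1) by auto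
    ultimately show ?thesis
      using dim_inter_line[OF subN subspace_Fs, of a0 l ?v] NG[of "wv a0"] Q1 vN by (simp add: Fs_def)
  qed
  have frame: "is_frame m F (P w)" if F: "F \<in> comp_D b m k" and w: "is_frame l (flag_proj m F) w" and Q: "Q w \<noteq> 0" for F w
  proof -
    obtain a where a: "units a m" "F = flag m a" "FD TYPE('d) m k a" by (rule comp_D_imp_flag[OF ad(1) F])
    have ul: "units a l" using units_mono[OF a(1)] l by simp
    have FC: "FC TYPE('d) m k a" using FD_imp_FC[of l k a] ad a l by simp
    have low: "Fs a i = vec.span (w ` {1..i})" if "i \<in> {1..l}" for i
      using w that l unfolding a(2) flag_proj_flag by (simp add: is_frame_def flag_def)
    have G: "Fs a l = vec.span (w ` {1..l})"
    proof (cases "l = 0")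
      case False
      then show ?thesis by (intro low) auto
    qed simp
    have "beta_D m k (u w) x = 0" if x: "x \<in> Fs a l" for x
    proof -
      obtain t where t: "x = (\<Sum>i=1..l. t i *s w i)" using span_image_sum[of x w l] x unfolding G by blast
      have "beta_D m k x (u w) = 0" unfolding t beta_D_sum using orth Q by simp
      then show ?thesis using beta_D_sym[OF ad(1), of "u w" x] by simp
    qed
    moreover have "u w \<notin> Fs a l" using NG[OF Q] uN[of w] u0[OF Q] unfolding G by blast
    moreover have "u w \<in> ED m k" "beta_D m k (u w) (u w) = 0" using NED uN isotropicD[OF isoN uN uN] by blast+
    ultimately obtain c where c: "herm c c = 1" "FD TYPE('d) m k (a(m := c))"
      "Fs (a(m := c)) m = vec.span (insert (u w) (Fs a l))"
      using isotropic_lift[of l k a "u w"] ad ul FC unfolding l by blast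
    let ?a = "a(m := c)"
    let ?F = "flag m ?a :: ('d + 'd) flag"
    have ua: "units ?a m" using Fs_update(4)[OF ul c(1)] l by simp
    obtain b' where b': "?F \<in> comp_D b' m k" using comp_D_flag[OF ad(1) ua c(2)] by blast
    have Fm: "?F m = vec.span (insert (u w) (Fs a l))" using m c(3) by (simp add: flag_def)
    \<comment> \<open>The same dimension as for \<open>F0\<close>, so the parities agree: this
      selects the right one of the two extensions.\<close>
    have "vec.dim (N \<inter> ?F m) = 1"
      unfolding Fm using dim_inter_line[OF subN subspace_Fs _ uN u0[OF Q], of a l] NG[OF Q] unfolding G by blast
    then have "b' = b" using comp_D_parity[OF ad(1) lagN m(2) b' F0] d0 by simp
    moreover have "flag_proj m ?F = flag_proj m F"
      unfolding a(2) flag_proj_flag using units_mono[OF ua, of l] ul l by (intro flag_cong) auto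
    ultimately have FF: "?F = F"
      using bij_betw_imp_inj_on[OF bij_flag_proj[where 'd = 'd, OF ad]] b' F by (meson inj_onD)
    show ?thesis
      unfolding is_frame_def
    proof
      fix i assume i: "i \<in> {1..m}"
      show "F i = vec.span (P w ` {1..i})"
      proof (cases "i = m")
        case True
        have "{1..m} = insert m {1..l}" using l by auto
        then have "P w ` {1..m} = insert (u w) (w ` {1..l})" using l by (auto simp: P_def)
        then show ?thesis using True Fm FF unfolding G span_insert_span by simp
      next
        case False
        then have "i \<in> {1..l}" using i l by auto
        moreover have "P w ` {1..i} = w ` {1..i}" using False i by (auto simp: P_def)
        ultimately show ?thesis using low i unfolding a(2) by (simp add: flag_def)
      qed
    qed
  qed
  have "polynomial_fun l (\<lambda>w. P w i $ c)" if "i \<in> {1..m}" for i c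
    using pol(2) that l by (cases "i = m") (auto simp: P_def intro: polynomial_fun.coord)
  moreover have "is_frame l (flag_proj m F0) (wv a0)" unfolding a0(2) flag_proj_flag using is_frame_flag l by simp
  ultimately have "polynomial_fun l Q \<and> (\<forall>i\<in>{1..m}. \<forall>c. polynomial_fun l (\<lambda>w. P w i $ c)) \<and>
    (\<exists>w. is_frame l (flag_proj m F0) w \<and> Q w \<noteq> 0) \<and>
    (\<forall>F\<in>comp_D b m k. \<forall>w. is_frame l (flag_proj m F) w \<and> Q w \<noteq> 0 \<longrightarrow> is_frame m F (P w))"
    using pol(1) Q1 frame by (intro conjI ballI allI impI exI[of _ "wv a0"]) auto
  moreover have "m - 1 = l" using l by simp
  ultimately show ?thesis by (intro exI[of _ Q] exI[of _ P]) simp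
qed

subsection \<open>Isomorphisms\<close>

abbreviation lift :: "bool \<Rightarrow> nat \<Rightarrow> nat \<Rightarrow> ('d::finite + 'd) flag \<Rightarrow> ('d + 'd) flag" where
  "lift b m k \<equiv> the_inv_into (comp_D b m k) (flag_proj m)"

lemma lift:
  assumes ad: "adm TYPE('d::finite) m k" "1 \<le> k"
  shows "F \<in> comp_D b m k \<Longrightarrow> lift b m k (flag_proj m F) = (F :: ('d + 'd) flag)"
    "G \<in> Fl_C m k \<Longrightarrow> lift b m k G \<in> (comp_D b m k :: ('d + 'd) flag set)"
    "G \<in> Fl_C m k \<Longrightarrow> flag_proj m (lift b m k G) = (G :: ('d + 'd) flag)"
proof -
  note b = bij_flag_proj[where 'd = 'd, OF ad, of b, unfolded bij_betw_def]
  show "F \<in> comp_D b m k \<Longrightarrow> lift b m k (flag_proj m F) = F" using b the_inv_into_f_f by metis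
  show "G \<in> Fl_C m k \<Longrightarrow> lift b m k G \<in> comp_D b m k" using b the_inv_into_into[of "flag_proj m" "comp_D b m k" G] by blast
  show "G \<in> Fl_C m k \<Longrightarrow> flag_proj m (lift b m k G) = G" using b f_the_inv_into_f[of "flag_proj m" "comp_D b m k" G] by blast
qed

lemma comp_D_Y:
  assumes "adm TYPE('d::finite) m k"
  shows "comp_D b m k \<subseteq> (Y m :: ('d + 'd) flag set)"
  using Psi_in_Y[OF adm_bounds(3)[OF assms]] S_par_sphere[of b m k] by (auto simp: comp_D_def)

lemma flag_proj_comp_D:
  assumes ad: "adm TYPE('d::finite) m k" "1 \<le> k" and F: "F \<in> (comp_D b m k :: ('d + 'd) flag set)"
  shows "flag_proj m F \<in> Fl_C m k"
  using bij_betwE[OF bij_flag_proj[where 'd = 'd, OF ad]] F by blast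

lemma variety_isomorphism_flag_proj:
  assumes ad: "adm TYPE('d::finite) m k" "1 \<le> k"
  shows "variety_isomorphism m (comp_D b m k :: ('d + 'd) flag set) (m - 1) (Fl_C m k) (flag_proj m)"
  unfolding variety_isomorphism_def
proof (intro conjI)
  show "bij_betw (flag_proj m) (comp_D b m k :: ('d + 'd) flag set) (Fl_C m k)" by (rule bij_flag_proj[OF ad])
  show "variety_morphism m (comp_D b m k :: ('d + 'd) flag set) (m - 1) (Fl_C m k) (flag_proj m)"
    using flag_proj_comp_D[OF ad] by (intro variety_morphism_flag_proj adm_bounds(3)[OF ad(1)] comp_D_Y[OF ad(1)]) auto
  show "variety_morphism (m - 1) (Fl_C m k) m (comp_D b m k :: ('d + 'd) flag set) (lift b m k)"
    unfolding variety_morphism_def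
  proof (intro conjI ballI)
    show "lift b m k ` Fl_C m k \<subseteq> (comp_D b m k :: ('d + 'd) flag set)" using lift(2)[OF ad] by blast
    fix G assume G: "G \<in> (Fl_C m k :: ('d + 'd) flag set)"
    obtain Q P where QP: "polynomial_fun (m - 1) Q" "\<forall>i\<in>{1..m}. \<forall>c. polynomial_fun (m - 1) (\<lambda>w. P w i $ c)"
      "\<exists>w. is_frame (m - 1) (flag_proj m (lift b m k G)) w \<and> Q w \<noteq> 0"
      "\<forall>F\<in>comp_D b m k. \<forall>w. is_frame (m - 1) (flag_proj m F) w \<and> Q w \<noteq> 0 \<longrightarrow> is_frame m F (P w)"
      using flag_proj_local_inverse[OF ad lift(2)[OF ad G]] by blast
    have "is_frame m (lift b m k y) (P w)" if "y \<in> Fl_C m k" "is_frame (m - 1) y w \<and> Q w \<noteq> 0" for y w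
      using QP(4)[rule_format, OF lift(2)[OF ad that(1)], of w] that(2) lift(3)[OF ad that(1)] by simp
    then show "\<exists>Q P. polynomial_fun (m - 1) Q \<and> (\<forall>i\<in>{1..m}. \<forall>c. polynomial_fun (m - 1) (\<lambda>w. P w i $ c)) \<and>
        (\<exists>w. is_frame (m - 1) G w \<and> Q w \<noteq> 0) \<and>
        (\<forall>y\<in>Fl_C m k. \<forall>w. is_frame (m - 1) y w \<and> Q w \<noteq> 0 \<longrightarrow> is_frame m (lift b m k y) (P w))"
      using QP(1,2,3) unfolding lift(3)[OF ad G] by blast
  qed
qed

text \<open>A morphism out of a type D component must be tested on frames of length
  \<open>m\<close>; this supplies one from a frame of length \<open>m - 1\<close>, whose vectors are
  all that the polynomials there depend on.\<close>

lemma frame_extend: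
  assumes "F \<in> (Y m :: ('d::finite + 'd) flag set)" "m \<le> CARD('d)" "1 \<le> m" "is_frame (m - 1) (flag_proj m F) w"
  shows "\<exists>v. is_frame m F (w(m := v))"
proof -
  obtain a where a: "units a m" "F = flag m a" by (rule Y_flag[OF assms(1,2)])
  obtain l where l: "m = Suc l" using assms(3) by (cases m) auto
  have low: "Fs a i = vec.span (w ` {1..i})" if "i \<in> {1..l}" for i
    using assms(4) that l unfolding a(2) flag_proj_flag by (simp add: is_frame_def flag_def)
  have G: "Fs a l = vec.span (w ` {1..l})"
  proof (cases "l = 0")
    case False
    then show ?thesis by (intro low) auto
  qed simp
  let ?w = "w(m := wv a m)"
  have "F i = vec.span (?w ` {1..i})" if i: "i \<in> {1..m}" for i
  proof (cases "i = m")
    case True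
    have "{1..m} = insert m {1..l}" using l by auto
    then have "?w ` {1..m} = insert (wv a m) (w ` {1..l})" using l by auto
    moreover have "F m = vec.span (insert (wv a m) (Fs a l))" using assms(3) l unfolding a(2) flag_def by (simp add: Fs_Suc_span)
    ultimately show ?thesis using True unfolding G span_insert_span by simp
  next
    case False
    then have "i \<in> {1..l}" using i l by auto
    moreover have "?w ` {1..i} = w ` {1..i}" using False i by auto
    ultimately show ?thesis using low i unfolding a(2) by (simp add: flag_def)
  qed
  then show ?thesis unfolding is_frame_def by blast
qed

text \<open>The map factors through the type C fiber, so the local formulas of
  \<open>flag_proj_local_inverse\<close> apply once the last frame vector is ignored. It is
  prescribed on the component alone, so that the statement also fits an inverse known only
  there.\<close>

lemma variety_morphism_comp_D:
  assumes ad: "adm TYPE('d::finite) m k" "1 \<le> k"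
    and \<psi>: "\<And>F. F \<in> comp_D b m k \<Longrightarrow> \<psi> F = lift b' m k (flag_proj m F)"
  shows "variety_morphism m (comp_D b m k :: ('d + 'd) flag set) m (comp_D b' m k :: ('d + 'd) flag set) \<psi>"
  unfolding variety_morphism_def
proof (intro conjI ballI)
  have m: "m \<le> CARD('d)" "1 \<le> m" using adm_bounds[OF ad(1)] ad(2) by simp_all
  have C: "flag_proj m F \<in> Fl_C m k" if "F \<in> comp_D b m k" for F :: "('d + 'd) flag" by (rule flag_proj_comp_D[OF ad that])
  show "\<psi> ` comp_D b m k \<subseteq> (comp_D b' m k :: ('d + 'd) flag set)" using lift(2)[OF ad C] \<psi> by auto
  fix F assume F: "F \<in> (comp_D b m k :: ('d + 'd) flag set)"
  obtain Q P where QP: "polynomial_fun (m - 1) Q" "\<forall>i\<in>{1..m}. \<forall>c. polynomial_fun (m - 1) (\<lambda>w. P w i $ c)"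
    "\<exists>w. is_frame (m - 1) (flag_proj m (lift b' m k (flag_proj m F))) w \<and> Q w \<noteq> 0"
    "\<forall>F\<in>comp_D b' m k. \<forall>w. is_frame (m - 1) (flag_proj m F) w \<and> Q w \<noteq> 0 \<longrightarrow> is_frame m F (P w)"
    using flag_proj_local_inverse[OF ad lift(2)[OF ad C[OF F]]] by blast
  have "is_frame m (\<psi> G) (P w)" if "G \<in> comp_D b m k" "is_frame m G w" "Q w \<noteq> 0" for G w
    using QP(4)[rule_format, OF lift(2)[OF ad C[OF that(1)]], of w] is_frame_proj[OF that(2)] that(3)
    unfolding lift(3)[OF ad C[OF that(1)]] \<psi>[OF that(1)] by simp
  moreover have "\<exists>w. is_frame m F w \<and> Q w \<noteq> 0"
  proof -
    obtain w where w: "is_frame (m - 1) (flag_proj m F) w" "Q w \<noteq> 0" using QP(3) unfolding lift(3)[OF ad C[OF F]] by blast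
    obtain v where v: "is_frame m F (w(m := v))" using frame_extend[of F m w] F comp_D_Y[OF ad(1)] m w(1) by blast
    have "Q (w(m := v)) = Q w" using m(2) by (intro polynomial_fun_cong[OF QP(1)]) auto
    then show ?thesis using v w(2) by metis
  qed
  moreover have "polynomial_fun m Q" by (rule polynomial_fun_mono[OF QP(1)]) simp
  moreover have "polynomial_fun m (\<lambda>w. P w i $ c)" if "i \<in> {1..m}" for i c
    by (rule polynomial_fun_mono[OF QP(2)[rule_format, OF that]]) simp
  ultimately show "\<exists>Q P. polynomial_fun m Q \<and> (\<forall>i\<in>{1..m}. \<forall>c. polynomial_fun m (\<lambda>w. P w i $ c)) \<and>
      (\<exists>w. is_frame m F w \<and> Q w \<noteq> 0) \<and>
      (\<forall>y\<in>comp_D b m k. \<forall>w. is_frame m y w \<and> Q w \<noteq> 0 \<longrightarrow> is_frame m (\<psi> y) (P w))"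
    by blast
qed

text \<open>Projecting and lifting with the other parity exchanges the two isotropic extensions;
  both directions are maps of the same kind.\<close>

lemma variety_isomorphism_comp_D:
  assumes ad: "adm TYPE('d::finite) m k" "1 \<le> k"
  shows "\<exists>\<psi>. variety_isomorphism m (comp_D b m k :: ('d + 'd) flag set) m (comp_D b' m k :: ('d + 'd) flag set) \<psi>"
proof -
  let ?\<psi> = "\<lambda>F. lift b' m k (flag_proj m F) :: ('d + 'd) flag"
  let ?\<psi>' = "\<lambda>F. lift b m k (flag_proj m F) :: ('d + 'd) flag"
  note C = flag_proj_comp_D[OF ad]
  have inv: "?\<psi>' (?\<psi> F) = F" if "F \<in> comp_D b m k" for F
    using lift(3)[OF ad C[OF that]] lift(1)[OF ad that] by simp
  have inv': "?\<psi> (?\<psi>' F) = F" if "F \<in> comp_D b' m k" for F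
    using lift(3)[OF ad C[OF that]] lift(1)[OF ad that] by simp
  have bij: "bij_betw ?\<psi> (comp_D b m k) (comp_D b' m k)"
    using inv inv' lift(2)[OF ad C] by (intro bij_betw_byWitness[of _ ?\<psi>']) auto
  have "the_inv_into (comp_D b m k) ?\<psi> F = ?\<psi>' F" if "F \<in> comp_D b' m k" for F
    by (rule the_inv_into_f_eq[OF bij_betw_imp_inj_on[OF bij] inv'[OF that] lift(2)[OF ad C[OF that]]])
  then have "variety_morphism m (comp_D b' m k :: ('d + 'd) flag set) m (comp_D b m k) (the_inv_into (comp_D b m k) ?\<psi>)"
    by (rule variety_morphism_comp_D[OF ad])
  then have "variety_isomorphism m (comp_D b m k :: ('d + 'd) flag set) m (comp_D b' m k :: ('d + 'd) flag set) ?\<psi>"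
    unfolding variety_isomorphism_def using bij variety_morphism_comp_D[OF ad, of b ?\<psi> b'] by simp
  then show ?thesis by (rule exI[of _ ?\<psi>])
qed

theorem theorem52:
  fixes n m k :: nat
  defines "FlDodd \<equiv> (Fl_D_odd m k :: ('d::finite + 'd) flag set)"
    and "FlC \<equiv> (Fl_C m k :: ('d + 'd) flag set)"
    and "comps \<equiv> connected_components_of
           (subtopology (flag_topology m) (Fl_D m k :: ('d + 'd) flag set))"
  assumes "n = 2 * m" and "1 \<le> k" and "k \<le> m" and "k = m \<or> odd k" and "n \<le> CARD('d)"
  shows "variety_morphism m (Y m :: ('d + 'd) flag set) (m - 1) (Y (m - 1)) (flag_proj m)
    \<and> homeomorphic_map (subtopology (flag_topology m) FlDodd)
         (subtopology (flag_topology (m - 1)) FlC) (flag_proj m)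
    \<and> variety_isomorphism m FlDodd (m - 1) FlC (flag_proj m)
    \<and> FlDodd \<in> comps \<and> card comps = 2
    \<and> (\<forall>X\<in>comps. \<forall>X'\<in>comps. \<exists>\<psi>. variety_isomorphism m X m X' \<psi>)
    \<and> subtopology (S_topology m) (S_D_odd m k) homeomorphic_space
        subtopology (flag_topology (m - 1)) FlC"
proof -
  have ad: "adm TYPE('d) m k" using assms(4-8) by (simp add: adm_def)
  note ad' = ad assms(5)
  have m: "m \<le> CARD('d)" using adm_bounds(3)[OF ad] .
  have odd: "FlDodd = comp_D True m k" unfolding FlDodd_def by (rule Fl_D_odd_eq[OF m assms(6)])
  have comps: "comps = {comp_D True m k, comp_D False m k}" unfolding comps_def by (rule connected_components_Fl_D[OF ad'])
  have "S_par True m k \<noteq> {}" by (rule S_par_nonempty[OF ad'])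
  then have ne: "comp_D True m k \<noteq> ({} :: ('d + 'd) flag set)" by (simp add: comp_D_def)
  then have "comp_D True m k \<noteq> (comp_D False m k :: ('d + 'd) flag set)" using comp_D_disjoint[OF ad] by auto
  then have card: "card comps = 2" unfolding comps by simp
  have "variety_morphism m (Y m :: ('d + 'd) flag set) (m - 1) (Y (m - 1)) (flag_proj m)"
    by (rule variety_morphism_flag_proj[OF m subset_refl flag_proj_Y[OF m]])
  moreover have "homeomorphic_map (subtopology (flag_topology m) FlDodd) (subtopology (flag_topology (m - 1)) FlC) (flag_proj m)"
    unfolding odd FlC_def by (rule homeomorphic_flag_proj[OF ad'])
  moreover have "variety_isomorphism m FlDodd (m - 1) FlC (flag_proj m)"
    unfolding odd FlC_def by (rule variety_isomorphism_flag_proj[OF ad'])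
  moreover have "FlDodd \<in> comps" unfolding odd comps by simp
  moreover have "\<forall>X\<in>comps. \<forall>X'\<in>comps. \<exists>\<psi>. variety_isomorphism m X m X' \<psi>"
    unfolding comps using variety_isomorphism_comp_D[where 'd = 'd, OF ad'] by blast
  moreover have "subtopology (S_topology m) (S_D_odd m k) homeomorphic_space subtopology (flag_topology (m - 1)) FlC"
    unfolding FlC_def S_D_odd_eq
    using homeomorphic_map_imp_homeomorphic_space[OF homeomorphic_map_compose[OF homeomorphic_Psi[where 'd = 'd, OF ad] homeomorphic_flag_proj[OF ad']]] .
  ultimately show ?thesis using card by blast
qed

end
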